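(* Let $X$ be a complex projective manifold of dimension $n$, $E\to X$ a holomorphic vector bundle of rank $r$ such that $\det E$ is ample, $P\in\{N,N^*,G\}$, and $t\in\mathbb{R}$ such that $E\otimes(\det E)^t>_P0$. Fix a smooth positive volume form $\Omega$ on $X$. Then there exist explicit distortion functions $\beta_{P,t,h}\in C^0(X,\mathbb{R}_+)$ (namely those given by the formulas in the context) such that for any smooth hermitian metric $h_t$ on $E$ satisfying $\Theta_{E,h_t}+t\,\Theta_{\det E,\det h_t}\otimes\mathrm{Id}_E>_P0$ and any constant $\beta>\sup_X\beta_{P,t,h_t}$, the system of differential equations $$\omega_t=\Theta_{\det E,\det h_t},\qquad \Phi_P\big(\Theta_{E,h_t}+t\,\omega_t\otimes\mathrm{Id}_E\big)=f_t\Big(\frac{\Omega}{\omega_t^n}\Big)^{\beta}\,\Omega,\qquad \omega_t^{n-1}\wedge\Theta^\circ_{E,h_t}=g_t\,\omega_t^n$$ (with unknown the hermitian metric) possesses an elliptic linearization in a $C^2$ neighborhood of $h_t$, whatever the choice of smooth right-hand sides $f_t=F(t,z,h_t,D_zh_t)>0$ and $g_t=G(t,z,h_t,D_zh_t)\in\mathrm{Herm}^\circ_{h_t(z)}(E_z,E_z)$.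
   Context: For a smooth hermitian metric $h$ on $E$, the Chern curvature tensor is written $\Theta_{E,h}=i\sum_{j,k,\lambda,\mu}c_{jk\lambda\mu}\,dz_j\wedge d\overline z_k\otimes e_\lambda^*\otimes e_\mu$ ($1\le j,k\le n$, $1\le\lambda,\mu\le r$) in holomorphic coordinates and an $h$-orthonormal frame $(e_\lambda)$ of $E$; the same coefficient notation is used for any real $(1,1)$-form $\Theta$ with values in $h$-hermitian endomorphisms of $E$. Such a $\Theta$ is called: - Nakano positive ($>_N0$) if $\sum c_{jk\lambda\mu}\gamma_{j\lambda}\overline\gamma_{k\mu}>0$ for all nonzero $\gamma\in T_X\otimes E$; - dual Nakano positive ($>_{N^*}0$) if $\sum c_{jk\mu\lambda}\gamma_{j\lambda}\overline\gamma_{k\mu}>0$ for all nonzero $\gamma\in T_X\otimes E^*$; - Griffiths positive ($>_G0$) if $\sum c_{jk\lambda\mu}\xi_j\overline\xi_kv_\lambda\overline v_\mu>0$ for all nonzero $\xi\in T_X$, $v\in E$. $E\otimes(\det E)^t>_P0$ means that there is a smooth hermitian metric $h$ on $E$ with $\Theta_{E,h}+t\,\Theta_{\det E,\det h}\otimes\mathrm{Id}_E>_P0$, where $\Theta_{\det E,\det h}=\mathrm{tr}_E\Theta_{E,h}$. Functionals with values in positive $(n,n)$-forms, for $\Theta>_P0$: $\Phi_N(\Theta)=\det(c_{jk\lambda\mu})_{(j,\lambda),(k,\mu)}^{1/r}\,i\,dz_1\wedge d\overline z_1\wedge\dots\wedge i\,dz_n\wedge d\overline z_n$; $\Phi_{N^*}(\Theta)=\det(c_{jk\mu\lambda})_{(j,\lambda),(k,\mu)}^{1/r}\,i\,dz_1\wedge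 d\overline z_1\wedge\dots\wedge i\,dz_n\wedge d\overline z_n$; for $P=G$ one takes $\Phi_P=\Phi_{G,s}$, $\Phi_{G,s}(\Theta)=\Big(\int_{v\in E,|v|_h=1}\big((\langle\Theta\cdot v,v\rangle_h)^n\big)^{-s}d\sigma(v)\Big)^{-1/s}$, where $s>0$ is a fixed sufficiently large finite real number (in particular $s\ge r-1$) and $d\sigma$ is the unitary invariant probability measure on the unit sphere of each fibre (powers of $(n,n)$-forms are computed by comparing with any fixed positive volume form; the result is independent of it). $\Theta^\circ_{E,h}=\Theta_{E,h}-\frac1r\Theta_{\det E,\det h}\otimes\mathrm{Id}_E$; $\mathrm{Herm}^\circ_h(E,E)$ is the bundle of trace free $h$-hermitian endomorphisms of $E$. The right-hand sides $F,G$ are of order at most $1$ in the metric. The linearization of the system is the differential, with respect to the metric (variations being sections of the bundle of hermitian forms on $E$, real rank $r^2$), of the second order nonlinear operator defined by the scalar equation and the trace free equation, with values in sections of $\mathbb{R}\oplus\mathrm{Herm}^\circ_h(E,E)$; it is elliptic if its second order principal symbol is invertible for every nonzero real cotangent vector. "Elliptic linearization in a $C^2$ neighborhood of $h_t$" means that the linearization is elliptic at all metrics sufficiently $C^2$-close to $h_t$. Distortion functions: for $h$ with $\Theta_{E,h}+t\,\Theta_{\det E,\det h}\otimes\mathrm{Id}_E>_P0$, put $\omega_h=\Theta_{\det E,\det h}$ (a Kähler form) and let $\theta_t(h)$ be the $(nr\times nr)$ matrix, in $\omega_h$-orthonormal coordinates and an $h$-orthonormal frame at the given point, of the hermitian form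 on $T_X\otimes E$ defined by $\Theta_{E,h}+t\,\omega_h\otimes\mathrm{Id}_E$; ${}^T\theta_t(h)$ is the matrix of the transposed form on $T_X\otimes E^*$ (coefficients with $\lambda,\mu$ exchanged), and $(\cdot)^{\mathrm{cof}}$ is the cofactor matrix. Pointwise norms are taken with respect to $h$ and $\omega_h$ (Hilbert–Schmidt norms of coefficient arrays). Then at each point $z\in X$ $$\beta_{N,t,h}=\frac{\sqrt{n-1}+1}{r}\,\frac{|\Theta^\circ_{E,h}|\,|\theta_t(h)^{\mathrm{cof}}|}{\det\theta_t(h)},\qquad \beta_{N^*,t,h}=\frac{\sqrt{n-1}+1}{r}\,\frac{|\Theta^\circ_{E,h}|\,|({}^T\theta_t(h))^{\mathrm{cof}}|}{\det({}^T\theta_t(h))},$$ and for $P=G$, $\beta_{P,t,h}=\beta_{G,s,t,h}$ with, integrating over the unit sphere of $E_z$ and writing $\theta_v=\langle\theta_t(h)\cdot v,v\rangle_h$ for the $(1,1)$-form $\langle(\Theta_{E,h}+t\,\omega_h\otimes\mathrm{Id}_E)\cdot v,v\rangle_h$, $$\beta_{G,s,t,h}=(\sqrt{n-1}+1)\,|\Theta^\circ_{E,h}|\Big(\int_{|v|_h=1}\frac{d\sigma(v)}{(\theta_v^n)^s}\Big)^{-1}\int_{|v|_h=1}\frac{n\,\theta_v^{n-1}\wedge\omega_h\,d\sigma(v)}{(\theta_v^n)^{s+1}}.$$ *)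

theory Defs
  imports "HOL-Analysis.Analysis" "HOL-Probability.Probability_Measure"
begin

section \<open>Differentiability in several variables\<close>

text \<open>\<open>Ck_on k S f\<close> is meant for open \<open>S\<close>; all spaces that occur are finite dimensional.\<close>

primrec Ck_on :: "nat \<Rightarrow> 'a::real_normed_vector set \<Rightarrow> ('a \<Rightarrow> 'b::real_normed_vector) \<Rightarrow> bool" where
  "Ck_on 0 S f \<longleftrightarrow> continuous_on S f"
| "Ck_on (Suc k) S f \<longleftrightarrow>
     (\<forall>x\<in>S. f differentiable (at x)) \<and> (\<forall>v. Ck_on k S (\<lambda>x. frechet_derivative f (at x) v))"

text \<open>Smoothness on an arbitrary set means extendability to a smooth function on an open
  neighbourhood. (The set of hermitian matrices is not open in the space of all matrices.)\<close>

definition smooth_on :: "'a::real_normed_vector set \<Rightarrow> ('a \<Rightarrow> 'b::real_normed_vector) \<Rightarrow> bool" where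
  "smooth_on S f \<longleftrightarrow>
     (\<exists>W g. open W \<and> S \<subseteq> W \<and> (\<forall>k. Ck_on k W g) \<and> (\<forall>x\<in>S. g x = f x))"

definition holo_on :: "(complex^'n) set \<Rightarrow> (complex^'n \<Rightarrow> complex) \<Rightarrow> bool" where
  "holo_on S f \<longleftrightarrow>
     (\<forall>z\<in>S. \<exists>f'. (f has_derivative f') (at z) \<and> (\<forall>c v. f' (c *s v) = c * f' v))"

abbreviation deriv_dir :: "'a::real_normed_vector \<Rightarrow> ('a \<Rightarrow> 'b::real_normed_vector) \<Rightarrow> 'a \<Rightarrow> 'b" where
  "deriv_dir v f z \<equiv> frechet_derivative f (at z) v"

definition del :: "'n::finite \<Rightarrow> (complex^'n \<Rightarrow> complex) \<Rightarrow> complex^'n \<Rightarrow> complex" where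
  "del j f z = (deriv_dir (axis j 1) f z - \<i> * deriv_dir (axis j \<i>) f z) / 2"

definition delbar :: "'n::finite \<Rightarrow> (complex^'n \<Rightarrow> complex) \<Rightarrow> complex^'n \<Rightarrow> complex" where
  "delbar j f z = (deriv_dir (axis j 1) f z + \<i> * deriv_dir (axis j \<i>) f z) / 2"

definition del_matrix ::
  "'n::finite \<Rightarrow> (complex^'n \<Rightarrow> complex^'r^'r) \<Rightarrow> complex^'n \<Rightarrow> complex^'r^'r" where
  "del_matrix j H z = (\<chi> a b. del j (\<lambda>w. H w $ a $ b) z)"


section \<open>Complex manifolds and holomorphic vector bundles\<close>

type_synonym ('x, 'n) chart = "'x set \<times> ('x \<Rightarrow> complex^'n)"

text \<open>A local trivialization over an open set \<open>V\<close> is a map defined on the part of the total space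
  over \<open>V\<close> that restricts to a linear isomorphism from each fibre onto \<open>\<complex>\<^sup>r\<close>.\<close>

type_synonym ('e, 'x, 'r) triv = "'x set \<times> ('e \<Rightarrow> complex^'r)"

record ('x, 'n, 'e, 'r) hvb =
  base :: "'x topology"
  atlas :: "('x, 'n) chart set"
  total :: "'e set"
  proj :: "'e \<Rightarrow> 'x"
  trivs :: "('e, 'x, 'r) triv set"

definition complex_manifold :: "'x topology \<Rightarrow> ('x, 'n::finite) chart set \<Rightarrow> bool" where
  "complex_manifold X A \<longleftrightarrow>
     Hausdorff_space X \<and> second_countable X \<and> \<Union>(fst ` A) = topspace X \<and>
     (\<forall>(U, \<phi>)\<in>A. openin X U \<and> open (\<phi> ` U) \<and>
        homeomorphic_map (subtopology X U) (top_of_set (\<phi> ` U)) \<phi>) \<and>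
     (\<forall>(U, \<phi>)\<in>A. \<forall>(V, \<psi>)\<in>A. \<forall>i. holo_on (\<phi> ` (U \<inter> V)) (\<lambda>z. \<psi> (inv_into U \<phi> z) $ i))"

definition holo_fun :: "('x, 'n::finite) chart set \<Rightarrow> 'x set \<Rightarrow> ('x \<Rightarrow> complex) \<Rightarrow> bool" where
  "holo_fun A W f \<longleftrightarrow> (\<forall>(U, \<phi>)\<in>A. holo_on (\<phi> ` (U \<inter> W)) (\<lambda>z. f (inv_into U \<phi> z)))"

text \<open>A point of \<open>\<P>\<^sup>N\<close> is given by homogeneous coordinates \<open>p 0, \<dots>, p N\<close>, not all zero, up to
  proportionality. A map \<open>f\<close> to \<open>\<P>\<^sup>N\<close> is given by an arbitrary choice of homogeneous coordinates at
  each point; it is holomorphic if it has local holomorphic lifts \<open>F\<close> to \<open>\<complex>\<^sup>N\<^sup>+\<^sup>1 - {0}\<close>, and immersive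
  at \<open>x\<close> if \<open>dF v \<in> \<complex> F(x)\<close> implies \<open>v = 0\<close>. On a compact space an injective holomorphic immersion is
  an embedding.\<close>

definition same_point :: "nat \<Rightarrow> (nat \<Rightarrow> complex) \<Rightarrow> (nat \<Rightarrow> complex) \<Rightarrow> bool" where
  "same_point N p q \<longleftrightarrow> (\<exists>c. c \<noteq> 0 \<and> (\<forall>i\<le>N. p i = c * q i))"

definition projective_embedding ::
  "'x topology \<Rightarrow> ('x, 'n::finite) chart set \<Rightarrow> nat \<Rightarrow> ('x \<Rightarrow> nat \<Rightarrow> complex) \<Rightarrow> bool" where
  "projective_embedding X A N f \<longleftrightarrow>
     (\<forall>x\<in>topspace X. \<exists>i\<le>N. f x i \<noteq> 0) \<and>
     (\<forall>x\<in>topspace X. \<forall>y\<in>topspace X. same_point N (f x) (f y) \<longrightarrow> x = y) \<and>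
     (\<forall>x\<in>topspace X. \<exists>W F. openin X W \<and> x \<in> W \<and>
        (\<forall>i\<le>N. holo_fun A W (F i)) \<and>
        (\<forall>y\<in>W. same_point N (\<lambda>i. F i y) (f y)) \<and>
        (\<forall>(U, \<phi>)\<in>A. x \<in> U \<longrightarrow>
           (\<forall>v c. (\<forall>i\<le>N. deriv_dir v (\<lambda>z. F i (inv_into U \<phi> z)) (\<phi> x) = c * F i x) \<longrightarrow> v = 0)))"

definition projective_manifold :: "'x topology \<Rightarrow> ('x, 'n::finite) chart set \<Rightarrow> bool" where
  "projective_manifold X A \<longleftrightarrow>
     complex_manifold X A \<and> compact_space X \<and> (\<exists>N f. projective_embedding X A N f)"

definition fibre :: "('x, 'n::finite, 'e, 'r::finite) hvb \<Rightarrow> 'x \<Rightarrow> 'e set" where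
  "fibre B x = {e \<in> total B. proj B e = x}"

definition frame ::
  "('x, 'n::finite, 'e, 'r::finite) hvb \<Rightarrow> ('e, 'x, 'r) triv \<Rightarrow> 'x \<Rightarrow> 'r \<Rightarrow> 'e" where
  "frame B \<tau> x l = inv_into (fibre B x) (snd \<tau>) (axis l 1)"

definition transition ::
  "('x, 'n::finite, 'e, 'r::finite) hvb \<Rightarrow> ('e, 'x, 'r) triv \<Rightarrow> ('e, 'x, 'r) triv \<Rightarrow> 'x \<Rightarrow> complex^'r^'r"
  where "transition B \<tau> \<tau>' x = (\<chi> m l. snd \<tau>' (frame B \<tau> x l) $ m)"

text \<open>The fibrewise linear structure, the topology and the complex structure of the total space are
  those transported by the local trivializations; they do not depend on the trivialization because
  the transition maps are linear in the fibres with holomorphic coefficients.\<close>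

definition holomorphic_vector_bundle :: "('x, 'n::finite, 'e, 'r::finite) hvb \<Rightarrow> bool" where
  "holomorphic_vector_bundle B \<longleftrightarrow>
     complex_manifold (base B) (atlas B) \<and>
     proj B ` total B \<subseteq> topspace (base B) \<and>
     \<Union>(fst ` trivs B) = topspace (base B) \<and>
     (\<forall>\<tau>\<in>trivs B. openin (base B) (fst \<tau>) \<and>
        (\<forall>x\<in>fst \<tau>. bij_betw (snd \<tau>) (fibre B x) UNIV)) \<and>
     (\<forall>\<tau>\<in>trivs B. \<forall>\<tau>'\<in>trivs B.
        (\<forall>x \<in> fst \<tau> \<inter> fst \<tau>'. \<forall>e\<in>fibre B x. snd \<tau>' e = transition B \<tau> \<tau>' x *v snd \<tau> e) \<and>
        (\<forall>l m. holo_fun (atlas B) (fst \<tau> \<inter> fst \<tau>') (\<lambda>x. transition B \<tau> \<tau>' x $ l $ m)))"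

text \<open>A section of \<open>(det E)\<^sup>m\<close> is given by its components with respect to the local frames
  \<open>(e\<^sub>1 \<and> \<dots> \<and> e\<^sub>r)\<^sup>m\<close> induced by the trivializations of \<open>E\<close>.\<close>

definition holo_section_det_power ::
  "('x, 'n::finite, 'e, 'r::finite) hvb \<Rightarrow> nat \<Rightarrow> (('e, 'x, 'r) triv \<Rightarrow> 'x \<Rightarrow> complex) \<Rightarrow> bool" where
  "holo_section_det_power B m s \<longleftrightarrow>
     (\<forall>\<tau>\<in>trivs B. holo_fun (atlas B) (fst \<tau>) (s \<tau>)) \<and>
     (\<forall>\<tau>\<in>trivs B. \<forall>\<tau>'\<in>trivs B. \<forall>x \<in> fst \<tau> \<inter> fst \<tau>'.
        s \<tau>' x = det (transition B \<tau> \<tau>' x) ^ m * s \<tau> x)"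

text \<open>Ampleness of \<open>det E\<close>: for some \<open>m \<ge> 1\<close> finitely many sections of \<open>(det E)\<^sup>m\<close> have no common
  zero and define an embedding into a projective space.\<close>

definition ample_det :: "('x, 'n::finite, 'e, 'r::finite) hvb \<Rightarrow> bool" where
  "ample_det B \<longleftrightarrow>
     (\<exists>m\<ge>1. \<exists>N s f. (\<forall>i\<le>N. holo_section_det_power B m (s i)) \<and>
        (\<forall>\<tau>\<in>trivs B. \<forall>x\<in>fst \<tau>. same_point N (\<lambda>i. s i \<tau> x) (f x)) \<and>
        projective_embedding (base B) (atlas B) N f)"

text \<open>Coordinate domain on which both the chart \<open>c\<close> and the trivialization \<open>\<tau>\<close> are available.\<close>

definition cdom :: "('x, 'n::finite) chart \<Rightarrow> ('e, 'x, 'r::finite) triv \<Rightarrow> (complex^'n) set" where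
  "cdom c \<tau> = snd c ` (fst c \<inter> fst \<tau>)"

text \<open>\<open>\<Omega> c\<close> is the density of the volume form with respect to
  \<open>i dz\<^sub>1 \<and> d\<bar>z\<^sub>1 \<and> \<dots> \<and> i dz\<^sub>n \<and> d\<bar>z\<^sub>n\<close> in the chart \<open>c\<close>.\<close>

definition volume_form ::
  "('x, 'n::finite, 'e, 'r::finite) hvb \<Rightarrow> (('x, 'n) chart \<Rightarrow> complex^'n \<Rightarrow> real) \<Rightarrow> bool" where
  "volume_form B \<Omega> \<longleftrightarrow>
     (\<forall>c\<in>atlas B. smooth_on (snd c ` fst c) (\<Omega> c) \<and> (\<forall>z\<in>snd c ` fst c. \<Omega> c z > 0)) \<and>
     (\<forall>c\<in>atlas B. \<forall>c'\<in>atlas B. \<forall>x \<in> fst c \<inter> fst c'.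
        \<Omega> c (snd c x) = \<Omega> c' (snd c' x) *
          (norm (det (\<chi> i j. del j (\<lambda>z. snd c' (inv_into (fst c) (snd c) z) $ i) (snd c x))))\<^sup>2)"


section \<open>Hermitian metrics\<close>

definition ctranspose :: "complex^'m^'n \<Rightarrow> complex^'n^'m" where
  "ctranspose M = (\<chi> i j. cnj (M $ j $ i))"

definition hermitian :: "complex^'k^'k \<Rightarrow> bool" where
  "hermitian M \<longleftrightarrow> ctranspose M = M"

definition pos_def :: "complex^'k^'k \<Rightarrow> bool" where
  "pos_def M \<longleftrightarrow> hermitian M \<and>
     (\<forall>v. v \<noteq> 0 \<longrightarrow> Re (\<Sum>l\<in>UNIV. \<Sum>m\<in>UNIV. M $ l $ m * v $ l * cnj (v $ m)) > 0)"

text \<open>A section of the bundle of sesquilinear forms on \<open>E\<close> is a function on pairs of vectors of \<open>E\<close>;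
  only its values on pairs from the same fibre matter. \<open>gram\<close> is its matrix
  \<open>H\<^sub>l\<^sub>m = h(e\<^sub>l, e\<^sub>m)\<close> in the holomorphic frame and the coordinates given by \<open>\<tau>\<close> and \<open>c\<close>.\<close>

type_synonym 'e form = "'e \<Rightarrow> 'e \<Rightarrow> complex"

definition gram ::
  "('x, 'n::finite, 'e, 'r::finite) hvb \<Rightarrow> 'e form \<Rightarrow> ('x, 'n) chart \<Rightarrow> ('e, 'x, 'r) triv
     \<Rightarrow> complex^'n \<Rightarrow> complex^'r^'r" where
  "gram B h c \<tau> z =
     (let x = inv_into (fst c) (snd c) z in \<chi> l m. h (frame B \<tau> x l) (frame B \<tau> x m))"

definition hermitian_form_section ::
  "('x, 'n::finite, 'e, 'r::finite) hvb \<Rightarrow>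
   ((complex^'n) set \<Rightarrow> (complex^'n \<Rightarrow> complex^'r^'r) \<Rightarrow> bool) \<Rightarrow> 'e form \<Rightarrow> bool" where
  "hermitian_form_section B reg h \<longleftrightarrow>
     (\<forall>c\<in>atlas B. \<forall>\<tau>\<in>trivs B. reg (cdom c \<tau>) (gram B h c \<tau>)) \<and>
     (\<forall>x\<in>topspace (base B). \<forall>e\<in>fibre B x. \<forall>e'\<in>fibre B x. h e' e = cnj (h e e')) \<and>
     (\<forall>\<tau>\<in>trivs B. \<forall>x\<in>fst \<tau>. \<forall>e\<in>fibre B x. \<forall>e'\<in>fibre B x.
        h e e' = (\<Sum>l\<in>UNIV. \<Sum>m\<in>UNIV.
          h (frame B \<tau> x l) (frame B \<tau> x m) * snd \<tau> e $ l * cnj (snd \<tau> e' $ m)))"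

definition hermitian_metric ::
  "('x, 'n::finite, 'e, 'r::finite) hvb \<Rightarrow>
   ((complex^'n) set \<Rightarrow> (complex^'n \<Rightarrow> complex^'r^'r) \<Rightarrow> bool) \<Rightarrow> 'e form \<Rightarrow> bool" where
  "hermitian_metric B reg h \<longleftrightarrow> hermitian_form_section B reg h \<and>
     (\<forall>c\<in>atlas B. \<forall>\<tau>\<in>trivs B. \<forall>z\<in>cdom c \<tau>. pos_def (gram B h c \<tau> z))"

abbreviation "smooth_metric B \<equiv> hermitian_metric B smooth_on"
abbreviation "C2_metric B \<equiv> hermitian_metric B (Ck_on 2)"


section \<open>Curvature\<close>

text \<open>Coefficient arrays \<open>c $ j $ k $ l $ m\<close> of (1,1)-forms with values in \<open>End E\<close>, namely
  \<open>i \<Sum> c\<^sub>j\<^sub>k\<^sub>l\<^sub>m dz\<^sub>j \<and> d\<bar>z\<^sub>k \<otimes> e\<^sub>l\<^sup>* \<otimes> e\<^sub>m\<close>. Thus the matrix \<open>c $ j $ k\<close> of an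
  endomorphism acts on row vectors: \<open>e\<^sub>l\<close> is sent to \<open>\<Sum>\<^sub>m c\<^sub>j\<^sub>k\<^sub>l\<^sub>m e\<^sub>m\<close>.\<close>

type_synonym ('n, 'r) curv = "complex^'r^'r^'n^'n"

text \<open>With \<open>H\<^sub>l\<^sub>m = h(e\<^sub>l, e\<^sub>m)\<close> and the row convention the Chern connection form is
  \<open>\<partial>H H\<inverse>\<close> and its curvature is \<open>\<bar>\<partial>(\<partial>H H\<inverse>)\<close>; the sign comes from
  \<open>d\<bar>z\<^sub>k \<and> dz\<^sub>j = - dz\<^sub>j \<and> d\<bar>z\<^sub>k\<close>.\<close>

definition chern :: "(complex^'n \<Rightarrow> complex^'r^'r) \<Rightarrow> complex^'n \<Rightarrow> ('n::finite, 'r::finite) curv" where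
  "chern H z =
     (\<chi> j k. \<chi> l m. - delbar k (\<lambda>w. (del_matrix j H w ** matrix_inv (H w)) $ l $ m) z)"

definition trace_form :: "('n::finite, 'r::finite) curv \<Rightarrow> complex^'n^'n" where
  "trace_form c = (\<chi> j k. trace (c $ j $ k))"

definition otimes_id :: "complex^'n^'n \<Rightarrow> ('n::finite, 'r::finite) curv" where
  "otimes_id a = (\<chi> j k. mat (a $ j $ k))"

definition det_curv :: "(complex^'n \<Rightarrow> complex^'r^'r) \<Rightarrow> complex^'n \<Rightarrow> complex^'n^'n" where
  "det_curv H z = trace_form (chern H z)"

definition twisted_curv ::
  "real \<Rightarrow> (complex^'n \<Rightarrow> complex^'r^'r) \<Rightarrow> complex^'n \<Rightarrow> ('n::finite, 'r::finite) curv" where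
  "twisted_curv t H z = chern H z + t *\<^sub>R otimes_id (det_curv H z)"

definition tracefree_curv ::
  "(complex^'n \<Rightarrow> complex^'r^'r) \<Rightarrow> complex^'n \<Rightarrow> ('n::finite, 'r::finite) curv" where
  "tracefree_curv H z = chern H z - (1 / real CARD('r)) *\<^sub>R otimes_id (det_curv H z)"

text \<open>The rows of \<open>on_basis M\<close> form an orthonormal basis for the hermitian form with matrix \<open>M\<close>.
  Everything below is independent of the choice.\<close>

definition on_basis :: "complex^'k^'k \<Rightarrow> complex^'k^'k" where
  "on_basis M = (SOME S. S ** M ** ctranspose S = mat 1)"

definition in_frame :: "complex^'r^'r \<Rightarrow> ('n, 'r) curv \<Rightarrow> ('n::finite, 'r::finite) curv" where
  "in_frame S c = (\<chi> j k. S ** (c $ j $ k) ** matrix_inv S)"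

definition in_coords :: "complex^'n^'n \<Rightarrow> ('n, 'r) curv \<Rightarrow> ('n::finite, 'r::finite) curv" where
  "in_coords T c =
     (\<chi> a b. \<chi> l m. \<Sum>j\<in>UNIV. \<Sum>k\<in>UNIV. T $ a $ j * cnj (T $ b $ k) * c $ j $ k $ l $ m)"


section \<open>Positivity and the functionals\<close>

datatype pos_type = Nakano | DualNakano | Griffiths

text \<open>The functions of a coefficient array in this section are applied to coefficients in an
  \<open>h\<close>-orthonormal frame, for which the sums below are real.\<close>

fun positive :: "pos_type \<Rightarrow> ('n::finite, 'r::finite) curv \<Rightarrow> bool" where
  "positive Nakano c \<longleftrightarrow> (\<forall>\<gamma>::complex^'r^'n. \<gamma> \<noteq> 0 \<longrightarrow>
     Re (\<Sum>j\<in>UNIV. \<Sum>k\<in>UNIV. \<Sum>l\<in>UNIV. \<Sum>m\<in>UNIV.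
           c $ j $ k $ l $ m * \<gamma> $ j $ l * cnj (\<gamma> $ k $ m)) > 0)"
| "positive DualNakano c \<longleftrightarrow> (\<forall>\<gamma>::complex^'r^'n. \<gamma> \<noteq> 0 \<longrightarrow>
     Re (\<Sum>j\<in>UNIV. \<Sum>k\<in>UNIV. \<Sum>l\<in>UNIV. \<Sum>m\<in>UNIV.
           c $ j $ k $ m $ l * \<gamma> $ j $ l * cnj (\<gamma> $ k $ m)) > 0)"
| "positive Griffiths c \<longleftrightarrow> (\<forall>(\<xi>::complex^'n) (v::complex^'r). \<xi> \<noteq> 0 \<longrightarrow> v \<noteq> 0 \<longrightarrow>
     Re (\<Sum>j\<in>UNIV. \<Sum>k\<in>UNIV. \<Sum>l\<in>UNIV. \<Sum>m\<in>UNIV.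
           c $ j $ k $ l $ m * \<xi> $ j * cnj (\<xi> $ k) * v $ l * cnj (v $ m)) > 0)"

definition positive_metric ::
  "('x, 'n::finite, 'e, 'r::finite) hvb \<Rightarrow> pos_type \<Rightarrow> real \<Rightarrow> 'e form \<Rightarrow> bool" where
  "positive_metric B P t h \<longleftrightarrow>
     (\<forall>c\<in>atlas B. \<forall>\<tau>\<in>trivs B. \<forall>z\<in>cdom c \<tau>.
        positive P (in_frame (on_basis (gram B h c \<tau> z)) (twisted_curv t (gram B h c \<tau>) z)))"

text \<open>\<open>wedge_top \<alpha>\<close> is the density of the exterior product of the \<open>n\<close> (1,1)-forms
  \<open>i \<Sum> (\<alpha> p)\<^sub>j\<^sub>k dz\<^sub>j \<and> d\<bar>z\<^sub>k\<close>, with \<open>p\<close> ranging over the index type \<open>'n\<close>, with respect to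
  \<open>i dz\<^sub>1 \<and> d\<bar>z\<^sub>1 \<and> \<dots> \<and> i dz\<^sub>n \<and> d\<bar>z\<^sub>n\<close>. It is symmetric in the factors because 2-forms
  commute.\<close>

definition wedge_top :: "('n::finite \<Rightarrow> complex^'n^'n) \<Rightarrow> complex" where
  "wedge_top \<alpha> = (\<Sum>\<rho> | \<rho> permutes (UNIV::'n set). \<Sum>\<pi> | \<pi> permutes (UNIV::'n set).
     of_int (sign \<rho> * sign \<pi>) * (\<Prod>p\<in>UNIV. \<alpha> p $ \<rho> p $ \<pi> p))"

definition top_power :: "complex^'n^'n \<Rightarrow> complex" where
  "top_power a = wedge_top (\<lambda>_. a)"

text \<open>\<open>a\<^sup>n\<^sup>-\<^sup>1 \<and> b\<close>\<close>

definition pow_wedge :: "complex^'n^'n \<Rightarrow> complex^'n^'n \<Rightarrow> complex" where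
  "pow_wedge a b = wedge_top (\<lambda>p. if p = (SOME p. True) then b else a)"

definition nakano_matrix :: "('n::finite, 'r::finite) curv \<Rightarrow> complex^('n \<times> 'r)^('n \<times> 'r)" where
  "nakano_matrix c = (\<chi> p q. c $ fst p $ fst q $ snd p $ snd q)"

definition dual_nakano_matrix :: "('n::finite, 'r::finite) curv \<Rightarrow> complex^('n \<times> 'r)^('n \<times> 'r)" where
  "dual_nakano_matrix c = (\<chi> p q. c $ fst p $ fst q $ snd q $ snd p)"

text \<open>\<open>\<langle>\<Theta> v, v\<rangle>\<close> for \<open>v\<close> with components in an orthonormal frame\<close>

definition contract :: "('n::finite, 'r::finite) curv \<Rightarrow> complex^'r \<Rightarrow> complex^'n^'n" where
  "contract c v = (\<chi> j k. \<Sum>l\<in>UNIV. \<Sum>m\<in>UNIV. c $ j $ k $ l $ m * v $ l * cnj (v $ m))"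

text \<open>An orthonormal frame identifies the unit sphere of a fibre of \<open>E\<close> with that of \<open>\<complex>\<^sup>r\<close>.\<close>

definition unitary_invariant_sphere_measure :: "(complex^'r) measure \<Rightarrow> bool" where
  "unitary_invariant_sphere_measure \<sigma> \<longleftrightarrow>
     prob_space \<sigma> \<and> sets \<sigma> = sets borel \<and> emeasure \<sigma> (sphere 0 1) = 1 \<and>
     (\<forall>U. U ** ctranspose U = mat 1 \<longrightarrow> distr \<sigma> borel ((*v) U) = \<sigma>)"

text \<open>Densities of \<open>\<Phi>\<^sub>P\<close> with respect to \<open>i dz\<^sub>1 \<and> d\<bar>z\<^sub>1 \<and> \<dots> \<and> i dz\<^sub>n \<and> d\<bar>z\<^sub>n\<close>; the
  parameters \<open>s\<close> and \<open>\<sigma>\<close> only matter in the Griffiths case.\<close>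

fun Phi :: "pos_type \<Rightarrow> real \<Rightarrow> (complex^'r) measure \<Rightarrow> ('n::finite, 'r::finite) curv \<Rightarrow> real" where
  "Phi Nakano s \<sigma> c = Re (det (nakano_matrix c)) powr (1 / real CARD('r))"
| "Phi DualNakano s \<sigma> c = Re (det (dual_nakano_matrix c)) powr (1 / real CARD('r))"
| "Phi Griffiths s \<sigma> c =
     (LINT v:sphere 0 1|\<sigma>. Re (top_power (contract c v)) powr (- s)) powr (- 1 / s)"


section \<open>Distortion functions\<close>

definition cof :: "complex^'k^'k \<Rightarrow> complex^'k^'k" where
  "cof A = (\<chi> i j. det (\<chi> p q. if p = i \<and> q = j then 1 else if p = i \<or> q = j then 0 else A $ p $ q))"

text \<open>\<open>norm\<close> on nested vector types is the Hilbert--Schmidt norm of coefficient arrays.\<close>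

definition distortion ::
  "pos_type \<Rightarrow> real \<Rightarrow> (complex^'r) measure \<Rightarrow> real \<Rightarrow> (complex^'n \<Rightarrow> complex^'r^'r) \<Rightarrow> complex^'n \<Rightarrow> real"
  where
  "distortion P s \<sigma> t H z =
     (let S = on_basis (H z);
          T = on_basis (det_curv H z);
          n = real CARD('n);
          \<theta> = in_coords T (in_frame S (twisted_curv t H z));
          \<omega> = T ** det_curv H z ** ctranspose T;
          A = (sqrt (n - 1) + 1) * norm (in_coords T (in_frame S (tracefree_curv H z)))
      in case P of
           Nakano \<Rightarrow>
             A / real CARD('r) * norm (cof (nakano_matrix \<theta>)) / Re (det (nakano_matrix \<theta>))
         | DualNakano \<Rightarrow>
             A / real CARD('r) * norm (cof (dual_nakano_matrix \<theta>)) / Re (det (dual_nakano_matrix \<theta>))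
         | Griffiths \<Rightarrow>
             A * inverse (LINT v:sphere 0 1|\<sigma>. 1 / Re (top_power (contract \<theta> v)) powr s) *
             (LINT v:sphere 0 1|\<sigma>. n * Re (pow_wedge (contract \<theta> v) \<omega>) /
                                   Re (top_power (contract \<theta> v)) powr (s + 1)))"


section \<open>The differential system and its linearization\<close>

text \<open>Matrices (row convention) of trace free endomorphisms that are hermitian for the metric with
  Gram matrix \<open>H\<close>; \<open>M ** H\<close> is the matrix of the form \<open>\<langle>M e\<^sub>l, e\<^sub>m\<rangle>\<close>.\<close>

definition Herm0 :: "complex^'r^'r \<Rightarrow> (complex^'r^'r) set" where
  "Herm0 H = {M. hermitian (M ** H) \<and> trace M = 0}"

text \<open>Right-hand sides \<open>F(z, h, D\<^sub>zh)\<close> and \<open>G(z, h, D\<^sub>zh)\<close> are operators on metrics which, in local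
  coordinates and frames, are smooth functions of the point, of the Gram matrix and of its
  derivatives \<open>\<partial>H/\<partial>z\<^sub>j\<close> (the derivatives \<open>\<partial>H/\<partial>\<bar>z\<^sub>j\<close> are determined by these as \<open>H\<close> is
  hermitian). \<open>jets c \<tau>\<close> is the set of all possible arguments.\<close>

definition jets ::
  "('x, 'n::finite) chart \<Rightarrow> ('e, 'x, 'r::finite) triv
     \<Rightarrow> ((complex^'n) \<times> (complex^'r^'r) \<times> (complex^'r^'r^'n)) set" where
  "jets c \<tau> = {(z, H, D). z \<in> cdom c \<tau> \<and> pos_def H}"

definition jet ::
  "(complex^'n \<Rightarrow> complex^'r^'r) \<Rightarrow> complex^'n \<Rightarrow> (complex^'n) \<times> (complex^'r^'r) \<times> (complex^'r^'r^'n)" where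
  "jet H z = (z, H z, \<chi> j. del_matrix j H z)"

definition first_order_rhs_scalar ::
  "('x, 'n::finite, 'e, 'r::finite) hvb \<Rightarrow> ('e form \<Rightarrow> 'x \<Rightarrow> real) \<Rightarrow> bool" where
  "first_order_rhs_scalar B F \<longleftrightarrow>
     (\<forall>c\<in>atlas B. \<forall>\<tau>\<in>trivs B. \<exists>f. smooth_on (jets c \<tau>) f \<and> (\<forall>J\<in>jets c \<tau>. f J > 0) \<and>
        (\<forall>h. C2_metric B h \<longrightarrow>
           (\<forall>x \<in> fst c \<inter> fst \<tau>. F h x = f (jet (gram B h c \<tau>) (snd c x)))))"

definition first_order_rhs_endo ::
  "('x, 'n::finite, 'e, 'r::finite) hvb \<Rightarrow> ('e form \<Rightarrow> 'e \<Rightarrow> 'e) \<Rightarrow> bool" where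
  "first_order_rhs_endo B G \<longleftrightarrow>
     (\<forall>c\<in>atlas B. \<forall>\<tau>\<in>trivs B. \<exists>g. smooth_on (jets c \<tau>) g \<and>
        (\<forall>(z, H, D)\<in>jets c \<tau>. g (z, H, D) \<in> Herm0 H) \<and>
        (\<forall>h. C2_metric B h \<longrightarrow>
           (\<forall>x \<in> fst c \<inter> fst \<tau>. \<forall>e\<in>fibre B x. G h e \<in> fibre B x \<and>
              snd \<tau> (G h e) = snd \<tau> e v* g (jet (gram B h c \<tau>) (snd c x)))))"

definition endo_matrix ::
  "('x, 'n::finite, 'e, 'r::finite) hvb \<Rightarrow> ('e, 'x, 'r) triv \<Rightarrow> 'x \<Rightarrow> ('e \<Rightarrow> 'e) \<Rightarrow> complex^'r^'r" where
  "endo_matrix B \<tau> x g = (\<chi> l m. snd \<tau> (g (frame B \<tau> x l)) $ m)"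

text \<open>The second order operator on metrics whose vanishing is the system. All second order terms
  are moved to the left-hand sides: the equations are written
  \<open>(\<Phi>\<^sub>P(\<Theta> + t \<omega> \<otimes> Id) / \<Omega>) (\<omega>\<^sup>n / \<Omega>)\<^sup>\<beta> = F\<close> and \<open>\<omega>\<^sup>n\<^sup>-\<^sup>1 \<and> \<Theta>\<degree> / \<omega>\<^sup>n = G\<close>.\<close>

definition scalar_operator ::
  "('x, 'n::finite, 'e, 'r::finite) hvb \<Rightarrow> pos_type \<Rightarrow> real \<Rightarrow> (complex^'r) measure \<Rightarrow> real
    \<Rightarrow> (('x, 'n) chart \<Rightarrow> complex^'n \<Rightarrow> real) \<Rightarrow> real \<Rightarrow> ('e form \<Rightarrow> 'x \<Rightarrow> real)
    \<Rightarrow> ('x, 'n) chart \<Rightarrow> ('e, 'x, 'r) triv \<Rightarrow> 'x \<Rightarrow> 'e form \<Rightarrow> real" where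
  "scalar_operator B P s \<sigma> t \<Omega> \<beta> F c \<tau> x h =
     (let H = gram B h c \<tau>; z = snd c x in
        Phi P s \<sigma> (in_frame (on_basis (H z)) (twisted_curv t H z)) / \<Omega> c z *
        (Re (top_power (det_curv H z)) / \<Omega> c z) powr \<beta> - F h x)"

definition endo_operator ::
  "('x, 'n::finite, 'e, 'r::finite) hvb \<Rightarrow> ('e form \<Rightarrow> 'e \<Rightarrow> 'e)
    \<Rightarrow> ('x, 'n) chart \<Rightarrow> ('e, 'x, 'r) triv \<Rightarrow> 'x \<Rightarrow> 'e form \<Rightarrow> complex^'r^'r" where
  "endo_operator B G c \<tau> x h =
     (let H = gram B h c \<tau>; z = snd c x; \<omega> = det_curv H z in
        (\<chi> l m. pow_wedge \<omega> (\<chi> j k. tracefree_curv H z $ j $ k $ l $ m) / top_power \<omega>)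
        - endo_matrix B \<tau> x (G h))"

text \<open>Ellipticity at the metric \<open>h\<close> and the point \<open>x\<close>: the differential of \<open>\<Psi>\<close> (an operator with
  values in \<open>\<real> \<oplus> End E\<^sub>x\<close>) at \<open>h\<close> is a linear second order differential operator in the variation
  \<open>\<eta>\<close>, with coefficients \<open>A2, A1, A0\<close> in the real coordinates of the chart, and its principal symbol
  \<open>\<Sum> \<zeta>\<^sub>b \<zeta>\<^sub>b\<^sub>' A2\<^sub>b\<^sub>b\<^sub>'\<close> is an isomorphism from the hermitian forms on \<open>E\<^sub>x\<close> onto \<open>\<real> \<oplus> Herm\<degree>\<^sub>h(E\<^sub>x, E\<^sub>x)\<close>
  for every real \<open>\<zeta> \<noteq> 0\<close>.\<close>

definition elliptic_linearization_at ::
  "('x, 'n::finite, 'e, 'r::finite) hvb \<Rightarrow> ('x, 'n) chart \<Rightarrow> ('e, 'x, 'r) triv \<Rightarrow> 'x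
    \<Rightarrow> ('e form \<Rightarrow> real \<times> (complex^'r^'r)) \<Rightarrow> 'e form \<Rightarrow> bool" where
  "elliptic_linearization_at B c \<tau> x \<Psi> h \<longleftrightarrow>
     (\<exists>(A2 :: complex^'n \<Rightarrow> complex^'n \<Rightarrow> complex^'r^'r \<Rightarrow> real \<times> (complex^'r^'r))
       (A1 :: complex^'n \<Rightarrow> complex^'r^'r \<Rightarrow> real \<times> (complex^'r^'r))
       (A0 :: complex^'r^'r \<Rightarrow> real \<times> (complex^'r^'r)).
        (\<forall>b\<in>Basis. \<forall>b'\<in>Basis. linear (A2 b b')) \<and> (\<forall>b\<in>Basis. linear (A1 b)) \<and> linear A0 \<and>
        (\<forall>\<eta>. hermitian_form_section B smooth_on \<eta> \<longrightarrow>
           (let N = gram B \<eta> c \<tau>; z = snd c x in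
             ((\<lambda>\<epsilon>. \<Psi> (\<lambda>e e'. h e e' + of_real \<epsilon> * \<eta> e e')) has_vector_derivative
               ((\<Sum>b\<in>Basis. \<Sum>b'\<in>Basis. A2 b b' (deriv_dir b (deriv_dir b' N) z)) +
                (\<Sum>b\<in>Basis. A1 b (deriv_dir b N z)) + A0 (N z))) (at 0))) \<and>
        (\<forall>\<zeta>::complex^'n. \<zeta> \<noteq> 0 \<longrightarrow>
           bij_betw (\<lambda>M. \<Sum>b\<in>Basis. \<Sum>b'\<in>Basis. ((\<zeta> \<bullet> b) * (\<zeta> \<bullet> b')) *\<^sub>R A2 b b' M)
             {M. hermitian M} (UNIV \<times> Herm0 (gram B h c \<tau> (snd c x)))))"

definition system_elliptic ::
  "('x, 'n::finite, 'e, 'r::finite) hvb \<Rightarrow> pos_type \<Rightarrow> real \<Rightarrow> (complex^'r) measure \<Rightarrow> real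
    \<Rightarrow> (('x, 'n) chart \<Rightarrow> complex^'n \<Rightarrow> real) \<Rightarrow> real
    \<Rightarrow> ('e form \<Rightarrow> 'x \<Rightarrow> real) \<Rightarrow> ('e form \<Rightarrow> 'e \<Rightarrow> 'e) \<Rightarrow> 'e form \<Rightarrow> bool" where
  "system_elliptic B P s \<sigma> t \<Omega> \<beta> F G h \<longleftrightarrow>
     (\<forall>c\<in>atlas B. \<forall>\<tau>\<in>trivs B. \<forall>x \<in> fst c \<inter> fst \<tau>.
        elliptic_linearization_at B c \<tau> x
          (\<lambda>h'. (scalar_operator B P s \<sigma> t \<Omega> \<beta> F c \<tau> x h', endo_operator B G c \<tau> x h')) h)"

text \<open>Basic neighbourhoods of a metric in the \<open>C\<^sup>2\<close> topology are given by finitely many compact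
  subsets of coordinate domains and a bound on the derivatives of order at most 2.\<close>

definition C2_close ::
  "real \<Rightarrow> (complex^'n::finite) set \<Rightarrow> (complex^'n \<Rightarrow> complex^'r^'r) \<Rightarrow> (complex^'n \<Rightarrow> complex^'r^'r) \<Rightarrow> bool"
  where
  "C2_close \<epsilon> K H H' \<longleftrightarrow>
     (let d = (\<lambda>w. H' w - H w) in
      \<forall>z\<in>K. norm (d z) < \<epsilon> \<and> (\<forall>b\<in>Basis. norm (deriv_dir b d z) < \<epsilon>) \<and>
        (\<forall>b\<in>Basis. \<forall>b'\<in>Basis. norm (deriv_dir b (deriv_dir b' d) z) < \<epsilon>))"

definition holds_C2_near ::
  "('x, 'n::finite, 'e, 'r::finite) hvb \<Rightarrow> 'e form \<Rightarrow> ('e form \<Rightarrow> bool) \<Rightarrow> bool" where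
  "holds_C2_near B h Q \<longleftrightarrow>
     (\<exists>\<K> \<epsilon>. finite \<K> \<and> \<epsilon> > 0 \<and>
        (\<forall>(c, \<tau>, K)\<in>\<K>. c \<in> atlas B \<and> \<tau> \<in> trivs B \<and> compact K \<and> K \<subseteq> cdom c \<tau>) \<and>
        (\<forall>h'. C2_metric B h' \<and>
              (\<forall>(c, \<tau>, K)\<in>\<K>. C2_close \<epsilon> K (gram B h c \<tau>) (gram B h' c \<tau>)) \<longrightarrow> Q h'))"

end

theory Submission
  imports Defs "HOL-Complex_Analysis.Cauchy_Integral_Formula"
begin

text \<open>
  Ampleness of \<open>det E\<close> forces \<open>1 + r t > 0\<close>: where the norm of a section of \<open>(det E)\<^sup>m\<close> is maximal,
  the curvature \<open>\<omega>\<close> of \<open>det E\<close> is nonnegative, while \<open>(1 + r t) \<omega>\<close> is positive as the trace of the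
  twisted curvature. Hence \<open>\<omega>\<close> is positive definite for every metric with positive twisted curvature.

  At a covector \<open>\<zeta>\<close>, a variation \<open>M\<close> of the metric changes the curvature, to highest order, by
  \<open>- (1/4) \<xi> \<xi>\<^sup>* \<otimes> K\<close>, where \<open>\<xi>\<close> is the conjugate of \<open>\<zeta>\<close> and \<open>K\<close> is \<open>M\<close> read in an orthonormal frame.
  The symbol of the trace free equation determines \<open>K\<close> up to a real multiple of \<open>K1 = Id/r + Z\<close>, where
  \<open>Z\<close> is the contraction of the trace free curvature with \<open>\<xi> \<xi>\<^sup>* / |\<xi>|\<^sup>2\<close>, whose norm is at most that of
  the trace free curvature. On \<open>K1\<close> the symbol of the logarithm of the scalar equation is
  \<open>- |\<xi>|\<^sup>2/4\<close> times the sum of \<open>b\<close>, a nonnegative contribution of \<open>Id\<close> (\<open>\<Phi>\<^sub>P\<close> is increasing), and a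
  contribution of \<open>Z\<close> that is at least minus the distortion function. It does not vanish if \<open>b\<close> exceeds the
  distortion function, so the symbol is invertible. This condition is open in the 2-jet of the
  metric, which gives the \<open>C\<^sup>2\<close> neighbourhood by compactness.
\<close>

section \<open>Complex matrices\<close>

text \<open>Densities, positivity and distortion are read in an orthonormal frame that
  \<open>on_basis\<close> picks by choice, so it varies neither continuously nor differentiably with
  the metric. As nothing depends on the choice, near a given metric it is replaced by
  \<open>near_basis\<close>, which corrects the old frame by an inverse square root of its Gram
  matrix; limits and derivatives are taken along it. The motion of the frame involves the variation
  undifferentiated (\<open>frame_var\<close>), so it does not reach the symbol.

  The Chern curvature is an explicit function \<open>curvA\<close> of the 2-jet. Differentials along
  a line of metrics become one-variable calculus, and \<open>C2_close\<close> becomes closeness of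
  the arguments of \<open>curvA\<close>.

  Charts and frames act on curvature by \<open>in_coords\<close> and \<open>in_frame\<close>. The
  proof differentiates holomorphic maps twice, while \<open>holo_on\<close> only grants one
  derivative at each point; Cauchy's formula supplies the other.

  The right-hand sides are constrained on metrics only, so a perturbed metric must stay positive
  definite on all of the base for small parameters; this is one more use of compactness.\<close>

lemma ctranspose_nth [simp]: "ctranspose A $ i $ j = cnj (A $ j $ i)"
  by (simp add: ctranspose_def)

lemma ctranspose_mul: "ctranspose (A ** B) = ctranspose B ** ctranspose A"
  by (simp add: vec_eq_iff matrix_matrix_mult_def mult.commute)

lemma ctranspose_ctranspose [simp]: "ctranspose (ctranspose A) = A"
  by (simp add: vec_eq_iff)

lemma ctranspose_mat_1 [simp]: "ctranspose (mat 1) = mat 1"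
  by (simp add: vec_eq_iff mat_def)

lemma ctranspose_add: "ctranspose (A + B) = ctranspose A + ctranspose B"
  and ctranspose_diff: "ctranspose (A - B) = ctranspose A - ctranspose B"
  and ctranspose_minus: "ctranspose (- A) = - ctranspose A"
  and ctranspose_scaleR: "ctranspose (c *\<^sub>R A) = c *\<^sub>R ctranspose A"
  by (simp_all add: vec_eq_iff)

lemma det_ctranspose: "det (ctranspose A) = cnj (det A)"
proof -
  have "det (ctranspose A) = det (transpose (ctranspose A))" by simp
  also have "\<dots> = cnj (det A)"
    by (simp add: det_def transpose_def)
  finally show ?thesis .
qed

lemma trace_ctranspose: "trace (ctranspose A) = cnj (trace A)"
  by (simp add: trace_def)

text \<open>\<open>matrix_inv\<close> picks some two-sided inverse; over a field a right inverse is
  already two-sided and unique, so the choice is determined.\<close>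

lemma matrix_inv_eqI:
  fixes A :: "'a::field^'n^'n"
  assumes "A ** B = mat 1"
  shows "matrix_inv A = B"
proof -
  have BA: "B ** A = mat 1" using assms matrix_left_right_inverse by blast
  have "A ** matrix_inv A = mat 1 \<and> matrix_inv A ** A = mat 1"
    unfolding matrix_inv_def by (rule someI[where x=B]) (use assms BA in blast)
  then show ?thesis
    by (metis BA matrix_mul_assoc matrix_mul_lid matrix_mul_rid)
qed

lemma matrix_inv_cancel:
  fixes A :: "'a::field^'n^'n"
  assumes "invertible A"
  shows "A ** matrix_inv A = mat 1" "matrix_inv A ** A = mat 1"
  using assms matrix_inv_eqI unfolding invertible_def by metis+

lemma matrix_inv_mul:
  fixes A B :: "'a::field^'n^'n"
  assumes "invertible A" "invertible B"
  shows "matrix_inv (A ** B) = matrix_inv B ** matrix_inv A"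
proof (rule matrix_inv_eqI)
  have "(A ** B) ** (matrix_inv B ** matrix_inv A) = A ** (B ** matrix_inv B) ** matrix_inv A"
    by (simp only: matrix_mul_assoc)
  then show "(A ** B) ** (matrix_inv B ** matrix_inv A) = mat 1"
    by (simp add: matrix_inv_cancel assms)
qed

lemma ctranspose_invertible: "invertible A \<Longrightarrow> invertible (ctranspose A)"
  by (metis ctranspose_mat_1 ctranspose_mul invertible_def)

lemma ctranspose_matrix_inv: "invertible A \<Longrightarrow> ctranspose (matrix_inv A) = matrix_inv (ctranspose A)"
  for A :: "complex^'n^'n"
  by (rule sym, rule matrix_inv_eqI) (simp add: ctranspose_mul[symmetric] matrix_inv_cancel)

section \<open>Unitary matrices and orthonormal bases\<close>

lemma invertible_rightI: "A ** B = mat 1 \<Longrightarrow> invertible (A::'a::field^'n^'n)"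
  and invertible_leftI: "B ** A = mat 1 \<Longrightarrow> invertible (A::'a::field^'n^'n)"
  by (meson invertible_right_inverse invertible_left_inverse)+

lemma unitary_comm: "U ** ctranspose U = mat 1 \<Longrightarrow> ctranspose U ** U = mat 1"
  for U :: "complex^'n^'n"
  using matrix_left_right_inverse by blast

lemma unitary_ctranspose: "U ** ctranspose U = mat 1 \<Longrightarrow> ctranspose U ** ctranspose (ctranspose U) = mat 1"
  for U :: "complex^'n^'n"
  by (simp add: unitary_comm)

lemma matrix_inv_unitary: "U ** ctranspose U = mat 1 \<Longrightarrow> matrix_inv U = ctranspose U"
  for U :: "complex^'n^'n"
  by (simp add: matrix_inv_eqI)

lemma unitary_transpose: 
  fixes U :: "complex^'n^'n"
  assumes "U ** ctranspose U = mat 1"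
  shows "transpose U ** ctranspose (transpose U) = mat 1"
proof -
  have "transpose U ** ctranspose (transpose U) = transpose (ctranspose U ** U)"
    by (simp add: vec_eq_iff matrix_matrix_mult_def transpose_def mult.commute)
  then show ?thesis by (simp add: unitary_comm[OF assms] transpose_mat)
qed

text \<open>The matrix carrying one orthonormal basis to another preserves the identity Gram matrix,
  hence is unitary. Later claims of independence from the choice in \<open>on_basis\<close> go
  through this.\<close>

lemma on_basis_change:
  fixes S S' M :: "complex^'n^'n"
  assumes "S ** M ** ctranspose S = mat 1" "S' ** M ** ctranspose S' = mat 1"
  obtains U where "U ** ctranspose U = mat 1" "S' = U ** S"
proof
  define U where "U = S' ** matrix_inv S"
  have inv: "invertible S" using assms(1) by (simp add: invertible_rightI matrix_mul_assoc[symmetric])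
  show "S' = U ** S" by (simp add: U_def matrix_mul_assoc[symmetric] matrix_inv_cancel(2)[OF inv])
  have "U ** ctranspose U = U ** (S ** M ** ctranspose S) ** ctranspose U"
    by (simp add: assms)
  also have "\<dots> = (U ** S) ** M ** ctranspose (U ** S)"
    by (simp only: ctranspose_mul matrix_mul_assoc)
  also have "\<dots> = mat 1" using assms(2) \<open>S' = U ** S\<close> by simp
  finally show "U ** ctranspose U = mat 1" .
qed

text \<open>Dictionary between a Gram matrix and a frame:
  \<open>matrix_inv M = ctranspose S ** S\<close> turns traces and contractions against the inverse
  metric into ordinary ones in the orthonormal basis.\<close>

lemma on_basis_invertible:
  fixes S M :: "complex^'n^'n"
  assumes "S ** M ** ctranspose S = mat 1"
  shows "invertible S" "invertible M" "matrix_inv M = ctranspose S ** S"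
    "M = matrix_inv S ** ctranspose (matrix_inv S)"
proof -
  show inv: "invertible S" using assms by (simp add: invertible_rightI matrix_mul_assoc[symmetric])
  have *: "S ** (M ** ctranspose S) = mat 1" using assms by (simp add: matrix_mul_assoc)
  have "M ** ctranspose S ** S = mat 1"
    using iffD1[OF matrix_left_right_inverse *] .
  then have 1: "M ** (ctranspose S ** S) = mat 1" by (simp add: matrix_mul_assoc)
  then show "invertible M" by (rule invertible_rightI)
  show "matrix_inv M = ctranspose S ** S" by (rule matrix_inv_eqI[OF 1])
  have "M = M ** (ctranspose S ** ctranspose (matrix_inv S))"
    by (simp add: ctranspose_mul[symmetric] matrix_inv_cancel(2)[OF inv])
  also have "\<dots> = matrix_inv S ** ctranspose (matrix_inv S)"
    using matrix_inv_eqI[OF *] by (simp add: matrix_mul_assoc)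
  finally show "M = matrix_inv S ** ctranspose (matrix_inv S)" .
qed

subsection \<open>The Hilbert--Schmidt norm\<close>

lemma norm_vec_sq: "(norm (x::'a::real_normed_vector^'n))\<^sup>2 = (\<Sum>i\<in>UNIV. (norm (x $ i))\<^sup>2)"
  by (simp add: norm_vec_def L2_set_def sum_nonneg)

lemma norm_matrix_sq: "(norm (A::complex^'m^'n))\<^sup>2 = (\<Sum>i\<in>UNIV. \<Sum>j\<in>UNIV. (cmod (A $ i $ j))\<^sup>2)"
  by (simp add: norm_vec_sq)

text \<open>Cauchy-Schwarz for the bilinear pairing; moduli do not see the missing conjugation. The
  Hilbert-Schmidt bounds for products, contractions and \<open>Ddet\<close> reduce to it.\<close>

lemma cmod_sum_mult_sq_le:
  "(cmod (\<Sum>i\<in>I. f i * g i))\<^sup>2 \<le> (\<Sum>i\<in>I. (cmod (f i))\<^sup>2) * (\<Sum>i\<in>I. (cmod (g i))\<^sup>2)"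
proof -
  have "cmod (\<Sum>i\<in>I. f i * g i) \<le> (\<Sum>i\<in>I. cmod (f i) * cmod (g i))"
    by (rule order_trans[OF norm_sum]) (simp add: norm_mult)
  then have "(cmod (\<Sum>i\<in>I. f i * g i))\<^sup>2 \<le> (\<Sum>i\<in>I. cmod (f i) * cmod (g i))\<^sup>2"
    by (simp add: power_mono)
  also have "\<dots> \<le> (\<Sum>i\<in>I. (cmod (f i))\<^sup>2) * (\<Sum>i\<in>I. (cmod (g i))\<^sup>2)"
    by (rule Cauchy_Schwarz_ineq_sum)
  finally show ?thesis .
qed

lemma norm_matrix_mul_le: "norm (A ** B) \<le> norm A * norm (B::complex^'p^'m)" for A :: "complex^'m^'n"
proof (rule power2_le_imp_le)
  have "(norm (A ** B))\<^sup>2 = (\<Sum>i\<in>UNIV. \<Sum>j\<in>UNIV. (cmod (\<Sum>k\<in>UNIV. A$i$k * B$k$j))\<^sup>2)"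
    by (simp add: norm_matrix_sq matrix_matrix_mult_def)
  also have "\<dots> \<le> (\<Sum>i\<in>UNIV. \<Sum>j\<in>UNIV. (\<Sum>k\<in>UNIV. (cmod (A$i$k))\<^sup>2) * (\<Sum>k\<in>UNIV. (cmod (B$k$j))\<^sup>2))"
    by (intro sum_mono cmod_sum_mult_sq_le)
  also have "\<dots> = (\<Sum>i\<in>UNIV. \<Sum>k\<in>UNIV. (cmod (A$i$k))\<^sup>2) * (\<Sum>j\<in>UNIV. \<Sum>k\<in>UNIV. (cmod (B$k$j))\<^sup>2)"
    by (simp add: sum_product)
  also have "\<dots> = (norm A * norm B)\<^sup>2"
    using sum.swap[of "\<lambda>j k. (cmod (B$k$j))\<^sup>2" UNIV UNIV]
    by (simp add: norm_matrix_sq power_mult_distrib)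
  finally show "(norm (A ** B))\<^sup>2 \<le> (norm A * norm B)\<^sup>2" .
qed simp

lemma bounded_bilinear_matrix_mul:
  "bounded_bilinear ((**) :: complex^'m^'n \<Rightarrow> complex^'p^'m \<Rightarrow> complex^'p^'n)"
proof
  show "\<exists>K. \<forall>a b. norm ((a::complex^'m^'n) ** (b::complex^'p^'m)) \<le> norm a * norm b * K"
    by (rule exI[of _ 1]) (simp add: norm_matrix_mul_le)
qed (simp_all add: vec_eq_iff matrix_matrix_mult_def sum.distrib algebra_simps scaleR_sum_right)

lemma bounded_linear_ctranspose: "bounded_linear (ctranspose :: complex^'m^'n \<Rightarrow> complex^'n^'m)"
  by (intro linear_conv_bounded_linear[THEN iffD1] linearI) (simp_all add: ctranspose_add ctranspose_scaleR)

lemmas tendsto_matrix_mul [tendsto_intros] = bounded_bilinear.tendsto[OF bounded_bilinear_matrix_mul]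
lemmas continuous_on_matrix_mul [continuous_intros] = bounded_bilinear.continuous_on[OF bounded_bilinear_matrix_mul]
lemmas tendsto_ctranspose [tendsto_intros] = bounded_linear.tendsto[OF bounded_linear_ctranspose]
lemmas continuous_on_ctranspose [continuous_intros] = bounded_linear.continuous_on[OF bounded_linear_ctranspose]

lemma norm_sq_trace: "(norm (A::complex^'m^'n))\<^sup>2 = Re (trace (A ** ctranspose A))"
  by (simp add: norm_matrix_sq trace_def matrix_matrix_mult_def cmod_power2)
    (simp add: power2_eq_square)

lemma norm_unitary_left: 
  fixes U :: "complex^'n^'n" and A :: "complex^'m^'n"
  assumes "U ** ctranspose U = mat 1"
  shows "norm (U ** A) = norm A"
proof -
  have "(norm (U ** A))\<^sup>2 = Re (trace ((U ** A ** ctranspose A) ** ctranspose U))"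
    by (simp only: norm_sq_trace ctranspose_mul matrix_mul_assoc)
  also have "\<dots> = Re (trace ((ctranspose U ** U) ** (A ** ctranspose A)))"
    by (subst trace_mul_sym) (simp only: matrix_mul_assoc)
  also have "\<dots> = (norm A)\<^sup>2" by (simp add: unitary_comm[OF assms] norm_sq_trace)
  finally show ?thesis by simp
qed

lemma norm_unitary_right: 
  fixes U :: "complex^'n^'n" and A :: "complex^'n^'m"
  assumes "U ** ctranspose U = mat 1"
  shows "norm (A ** U) = norm A"
proof -
  have "(norm (A ** U))\<^sup>2 = Re (trace (A ** (U ** ctranspose U) ** ctranspose A))"
    by (simp only: norm_sq_trace ctranspose_mul matrix_mul_assoc)
  then show ?thesis using assms by (simp add: norm_sq_trace[symmetric])
qed

subsection \<open>The spectral theorem and approximate inverse square roots\<close>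

text \<open>The full hermitian product; \<open>inner\<close> on this type is only its real part
  (\<open>Re_sip\<close>).\<close>

definition sip :: "complex^'k \<Rightarrow> complex^'k \<Rightarrow> complex" where
  "sip x y = (\<Sum>i\<in>UNIV. x $ i * cnj (y $ i))"

lemma sip_add_left: "sip (x + y) z = sip x z + sip y z"
  and sip_diff_left: "sip (x - y) z = sip x z - sip y z"
  and sip_add_right: "sip z (x + y) = sip z x + sip z y"
  and sip_scale_left: "sip (c *s x) z = c * sip x z"
  and sip_scale_right: "sip x (c *s z) = cnj c * sip x z"
  and sip_scaleR_left: "sip (t *\<^sub>R x) z = of_real t * sip x z"
  and sip_scaleR_right: "sip x (t *\<^sub>R z) = of_real t * sip x z"
  by (simp_all add: sip_def sum.distrib sum_subtractf algebra_simps sum_distrib_left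
      scaleR_conv_of_real[where 'a=complex])

lemma sip_cnj: "cnj (sip x y) = sip y x"
  by (simp add: sip_def mult.commute)

lemma Re_sip: "Re (sip x y) = inner x y"
  by (simp add: sip_def inner_vec_def inner_complex_def)

lemma sip_self: "sip x x = of_real ((norm x)\<^sup>2)"
proof -
  have "Im (sip x x) = 0" by (simp add: sip_def)
  then show ?thesis by (simp add: complex_eq_iff Re_sip power2_norm_eq_inner)
qed

lemma sip_hermitian:
  assumes "hermitian A"
  shows "sip (A *v x) y = sip x (A *v y)"
proof -
  have "\<And>i j. cnj (A $ i $ j) = A $ j $ i"
    using assms unfolding hermitian_def by (metis ctranspose_nth)
  then have "sip x (A *v y) = (\<Sum>i\<in>UNIV. \<Sum>j\<in>UNIV. x $ i * (A $ j $ i * cnj (y $ j)))"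
    by (simp add: sip_def matrix_vector_mult_def sum_distrib_left)
  also have "\<dots> = (\<Sum>j\<in>UNIV. \<Sum>i\<in>UNIV. x $ i * (A $ j $ i * cnj (y $ j)))" by (rule sum.swap)
  also have "\<dots> = sip (A *v x) y"
    by (simp add: sip_def matrix_vector_mult_def sum_distrib_left sum_distrib_right mult_ac)
  finally show ?thesis by simp
qed

text \<open>Complex orthogonality to \<open>w\<close> is real orthogonality to both \<open>w\<close>
  and \<open>\<i> *s w\<close>, so the vectors of \<open>W\<close> impose at most twice their number
  of real conditions, fewer than the real dimension.\<close>

lemma exists_sip_orthogonal:
  fixes W :: "(complex^'k) set"
  assumes "finite W" "card W < CARD('k)"
  shows "\<exists>x. x \<noteq> 0 \<and> (\<forall>w\<in>W. sip x w = 0)"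
proof -
  let ?S = "W \<union> (\<lambda>w. \<i> *s w) ` W"
  have "dim ?S \<le> card ?S" by (rule dim_le_card') (use assms in simp)
  also have "\<dots> \<le> card W + card W"
    by (rule order_trans[OF card_Un_le]) (simp add: card_image_le assms)
  also have "\<dots> < DIM(complex^'k)" using assms by simp
  finally obtain x where x: "x \<noteq> 0" "\<And>y. y \<in> span ?S \<Longrightarrow> orthogonal x y"
    using orthogonal_to_subspace_exists[of ?S] by blast
  have "sip x w = 0" if "w \<in> W" for w
  proof -
    have "inner x w = 0" "inner x (\<i> *s w) = 0"
      using x(2)[of w] x(2)[of "\<i> *s w"] that by (auto simp: orthogonal_def span_base)
    then have "Re (sip x w) = 0" "Re (sip x (\<i> *s w)) = 0" by (simp_all add: Re_sip)
    then show ?thesis by (simp add: sip_scale_right complex_eq_iff)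
  qed
  then show ?thesis using x(1) by blast
qed

text \<open>Rayleigh quotient: the orthogonal complement of the eigenvectors found so far is
  preserved by \<open>A\<close>, and a maximiser of the quadratic form on its compact unit sphere is
  an eigenvector.\<close>

lemma hermitian_eigenvector_orthogonal:
  fixes A :: "complex^'k^'k" and W :: "(complex^'k) set"
  assumes A: "hermitian A" and W: "finite W" "card W < CARD('k)"
    and ev: "\<And>w. w \<in> W \<Longrightarrow> \<exists>d::real. A *v w = d *\<^sub>R w"
  shows "\<exists>v d. norm v = 1 \<and> (\<forall>w\<in>W. sip v w = 0) \<and> A *v v = (d::real) *\<^sub>R v"
proof -
  define V where "V = {x. \<forall>w\<in>W. sip x w = 0}"
  have cont: "continuous_on UNIV (\<lambda>x::complex^'k. sip x w)" for w
    unfolding sip_def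
    by (intro continuous_on_sum continuous_on_mult continuous_on_const
        linear_continuous_on[OF bounded_linear_vec_nth])
  have clV: "closed V"
  proof -
    have "V = (\<Inter>w\<in>W. {x. sip x w = 0})" by (auto simp: V_def)
    moreover have "closed {x. sip x w = 0}" for w :: "complex^'k"
      by (intro closed_Collect_eq cont continuous_intros)
    ultimately show ?thesis by auto
  qed
  have Vadd: "x + y \<in> V" if "x \<in> V" "y \<in> V" for x y using that by (simp add: V_def sip_add_left)
  have Vsc: "t *\<^sub>R x \<in> V" if "x \<in> V" for x and t :: real using that by (simp add: V_def sip_scaleR_left)
  have VA: "A *v x \<in> V" if "x \<in> V" for x
  proof -
    have "sip (A *v x) w = 0" if w: "w \<in> W" for w
      using ev[OF w] \<open>x \<in> V\<close> w by (auto simp: sip_hermitian[OF A] V_def sip_scaleR_right)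
    then show ?thesis by (simp add: V_def)
  qed
  obtain x0 where x0: "x0 \<noteq> 0" "x0 \<in> V" using exists_sip_orthogonal[OF W] by (auto simp: V_def)
  let ?S = "sphere 0 1 \<inter> V"
  define q where "q x = Re (sip (A *v x) x)" for x
  have "compact ?S" using clV by (simp add: compact_Int_closed)
  moreover have "(1 / norm x0) *\<^sub>R x0 \<in> ?S" using x0 by (simp add: Vsc)
  moreover have "continuous_on ?S q"
    unfolding q_def sip_def matrix_vector_mult_def by (intro continuous_intros)
  ultimately obtain v where v: "v \<in> ?S" and max: "\<And>y. y \<in> ?S \<Longrightarrow> q y \<le> q v"
    using continuous_attains_sup[of ?S q] by (metis empty_iff)
  let ?l = "q v"
  have Asc: "A *v (t *\<^sub>R x) = t *\<^sub>R (A *v x)" for t x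
    by (simp add: vec_eq_iff matrix_vector_mult_def scaleR_sum_right)
  have qsc: "q (t *\<^sub>R x) = t\<^sup>2 * q x" for t x
    by (simp add: q_def sip_scaleR_left sip_scaleR_right Asc power2_eq_square)
  have qle: "q y \<le> ?l * (norm y)\<^sup>2" if "y \<in> V" for y
  proof (cases "y = 0")
    case True then show ?thesis by (simp add: q_def sip_def)
  next
    case False
    then have "q ((1 / norm y) *\<^sub>R y) \<le> ?l" by (intro max) (simp add: Vsc that)
    then show ?thesis using False by (simp add: qsc field_simps power2_eq_square)
  qed
  have crit: "inner (A *v v - ?l *\<^sub>R v) y = 0" if y: "y \<in> V" for y
  proof -
    let ?a = "inner (A *v v - ?l *\<^sub>R v) y" and ?b = "?l * (norm y)\<^sup>2 - q y"
    \<comment> \<open>Expand \<open>q (v + t y)\<close> against its bound in powers of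
      \<open>t\<close>; the constant terms cancel because \<open>v\<close> is a maximiser of norm
      1.\<close>
    have ineq: "2 * t * ?a \<le> t\<^sup>2 * ?b" for t
    proof -
      have "q (v + t *\<^sub>R y) \<le> ?l * (norm (v + t *\<^sub>R y))\<^sup>2"
        by (intro qle Vadd Vsc y) (use v in simp)
      moreover have "q (v + t *\<^sub>R y) = ?l + 2 * t * inner (A *v v) y + t\<^sup>2 * q y"
      proof -
        have "Re (sip (A *v y) v) = Re (sip (A *v v) y)"
          by (metis A Re_sip inner_commute sip_hermitian)
        then show ?thesis
          by (simp add: q_def matrix_vector_right_distrib Asc
              sip_add_left sip_add_right sip_scaleR_left sip_scaleR_right Re_sip
              power2_eq_square algebra_simps)
      qed
      moreover have "(norm (v + t *\<^sub>R y))\<^sup>2 = 1 + 2 * t * inner v y + t\<^sup>2 * (norm y)\<^sup>2"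
        using v dot_norm[of v y] by (simp add: norm_eq_1 power2_norm_eq_inner inner_add_left
            inner_add_right inner_commute[of y v] power2_eq_square[of t] algebra_simps)
      ultimately show ?thesis by (simp add: inner_diff_left algebra_simps)
    qed
    have b: "0 \<le> ?b" using qle[OF y] by simp
    show "?a = 0"
    proof (rule ccontr)
      assume a: "?a \<noteq> 0"
      \<comment> \<open>For this \<open>t\<close> the linear term is twice \<open>?a\<close> squared
        over \<open>?b + 1\<close>, whereas the quadratic one is at most half of that; the
        \<open>+ 1\<close> keeps the denominator positive.\<close>
      define t where "t = ?a / (?b + 1)"
      have "2 * t * ?a \<le> t\<^sup>2 * ?b" by (rule ineq)
      also have "\<dots> \<le> t\<^sup>2 * (?b + 1)" by (simp add: algebra_simps)
      finally have "2 * ?a\<^sup>2 \<le> ?a\<^sup>2"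
        using b by (simp add: t_def power2_eq_square divide_simps split: if_splits)
      then show False using a by simp
    qed
  qed
  \<comment> \<open>The residual lies in \<open>V\<close> and may therefore be tested against
    itself.\<close>
  have "A *v v - ?l *\<^sub>R v \<in> V"
    using v VA[of v] Vsc[of v "- ?l"] Vadd[of "A *v v" "- ?l *\<^sub>R v"] by simp
  from crit[OF this] have "A *v v = ?l *\<^sub>R v" by simp
  then show ?thesis using v by (auto simp: V_def)
qed

section \<open>Unitary diagonalization\<close>

definition diagm :: "('k \<Rightarrow> real) \<Rightarrow> complex^'k^'k" where
  "diagm d = (\<chi> i j. if i = j then of_real (d i) else 0)"

lemma diagm_mult: "diagm d ** diagm e = diagm (\<lambda>i. d i * e i)"
  by (simp add: vec_eq_iff diagm_def matrix_matrix_mult_def if_distrib[of "\<lambda>x. _ * x"]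
      if_distrib[of "\<lambda>x. x * _"] cong: if_cong)

lemma ctranspose_diagm [simp]: "ctranspose (diagm d) = diagm d"
  by (simp add: vec_eq_iff diagm_def)

lemma diagm_1: "diagm (\<lambda>_. 1) = mat 1"
  by (simp add: vec_eq_iff diagm_def mat_def)

lemma norm_diagm_sq: "(norm (diagm d))\<^sup>2 = (\<Sum>i\<in>UNIV. (d i)\<^sup>2)"
  by (simp add: norm_matrix_sq diagm_def if_distrib[of "\<lambda>x. (cmod x)\<^sup>2"] cong: if_cong)

text \<open>Induction on the number of orthonormal eigenvectors, each new one taken orthogonal to
  the previous ones; at \<open>CARD('k)\<close> vectors they index the rows of a unitary
  matrix.\<close>

theorem hermitian_diagonalization:
  fixes A :: "complex^'k^'k"
  assumes A: "hermitian A"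
  obtains U :: "complex^'k^'k" and d where "U ** ctranspose U = mat 1" "A = ctranspose U ** diagm d ** U"
proof -
  have "\<exists>W. finite W \<and> card W = m \<and> (\<forall>w\<in>W. norm w = 1 \<and> (\<exists>d::real. A *v w = d *\<^sub>R w)) \<and>
      (\<forall>w\<in>W. \<forall>w'\<in>W. w \<noteq> w' \<longrightarrow> sip w w' = 0)" if "m \<le> CARD('k)" for m
    using that
  proof (induction m)
    case 0 then show ?case by (intro exI[of _ "{}"]) auto
  next
    case (Suc m)
    then obtain W where W: "finite W" "card W = m"
      "\<And>w. w \<in> W \<Longrightarrow> norm w = 1 \<and> (\<exists>d::real. A *v w = d *\<^sub>R w)"
      "\<And>w w'. w \<in> W \<Longrightarrow> w' \<in> W \<Longrightarrow> w \<noteq> w' \<Longrightarrow> sip w w' = 0" by auto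
    obtain v d where v: "norm v = 1" "\<And>w. w \<in> W \<Longrightarrow> sip v w = 0" "A *v v = (d::real) *\<^sub>R v"
      using hermitian_eigenvector_orthogonal[OF A W(1)] W(2,3) Suc.prems by (metis Suc_le_eq)
    have "v \<notin> W" using v(1) v(2)[of v] by (auto simp: sip_self)
    moreover have "sip w v = 0" if "w \<in> W" for w using v(2)[OF that] sip_cnj[of v w] by simp
    ultimately show ?case using W v
      by (intro exI[of _ "insert v W"]) auto
  qed
  from this[of "CARD('k)"] obtain W where W: "finite W" "card W = CARD('k)"
      "\<And>w. w \<in> W \<Longrightarrow> norm w = 1 \<and> (\<exists>d::real. A *v w = d *\<^sub>R w)"
      "\<And>w w'. w \<in> W \<Longrightarrow> w' \<in> W \<Longrightarrow> w \<noteq> w' \<Longrightarrow> sip w w' = 0" by auto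
  obtain f :: "'k \<Rightarrow> complex^'k" where f: "bij_betw f UNIV W"
    using finite_same_card_bij[of "UNIV::'k set" W] W by auto
  then have fW: "f i \<in> W" for i by (auto simp: bij_betw_def)
  have orth: "sip (f i) (f j) = (if i = j then 1 else 0)" for i j
    using W(3)[OF fW[of i]] W(4)[OF fW fW, of i j] f by (auto simp: sip_self bij_betw_def inj_eq)
  obtain d where d: "\<And>i. A *v f i = (d i::real) *\<^sub>R f i" using W(3)[OF fW] by metis
  \<comment> \<open>The rows are conjugated, so that the columns of \<open>ctranspose U\<close> are
    the eigenvectors themselves.\<close>
  define U where "U = (\<chi> i j. cnj (f i $ j))"
  have UU: "U ** ctranspose U = mat 1"
  proof -
    have "(U ** ctranspose U) $ i $ j = sip (f j) (f i)" for i j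
      by (simp add: U_def matrix_matrix_mult_def sip_def mult.commute)
    then show ?thesis by (auto simp: vec_eq_iff orth mat_def)
  qed
  have "A ** ctranspose U = ctranspose U ** diagm d"
  proof -
    have "(A ** ctranspose U) $ i $ j = (ctranspose U ** diagm d) $ i $ j" for i j
    proof -
      have "(A ** ctranspose U) $ i $ j = (A *v f j) $ i"
        by (simp add: U_def matrix_matrix_mult_def matrix_vector_mult_def)
      also have "\<dots> = f j $ i * of_real (d j)" by (simp add: d scaleR_conv_of_real[where 'a=complex])
      also have "\<dots> = (ctranspose U ** diagm d) $ i $ j"
        by (simp add: U_def matrix_matrix_mult_def diagm_def if_distrib[of "\<lambda>x. _ * x"] cong: if_cong)
      finally show ?thesis .
    qed
    then show ?thesis by (simp add: vec_eq_iff)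
  qed
  then have "A ** ctranspose U ** U = ctranspose U ** diagm d ** U" by simp
  then have "A = ctranspose U ** diagm d ** U"
    by (simp add: matrix_mul_assoc[symmetric] unitary_comm[OF UU])
  then show thesis using that[OF UU] by blast
qed

lemma unitary_conj_diagm:
  fixes U :: "complex^'k^'k"
  assumes "U ** ctranspose U = mat 1"
  shows "ctranspose U ** diagm d ** U ** (ctranspose U ** diagm e ** U) = ctranspose U ** diagm (\<lambda>i. d i * e i) ** U"
proof -
  have "ctranspose U ** diagm d ** U ** (ctranspose U ** diagm e ** U)
      = ctranspose U ** diagm d ** (U ** ctranspose U) ** diagm e ** U"
    by (simp only: matrix_mul_assoc)
  also have "\<dots> = ctranspose U ** (diagm d ** diagm e) ** U"
    by (simp only: assms matrix_mul_rid matrix_mul_assoc)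
  finally show ?thesis by (simp only: diagm_mult)
qed

text \<open>Taylor bound at 1 obtained algebraically: with \<open>y = sqrt x\<close> the remainder
  is exactly \<open>(y - 1)^2 (1/2 + 1/y)\<close>, and \<open>y \<ge> 1/2\<close> bounds the second
  factor by 3.\<close>

lemma inverse_sqrt_estimate:
  fixes x :: real
  assumes "\<bar>x - 1\<bar> \<le> 1 / 2"
  shows "\<bar>1 / sqrt x - 1 + (x - 1) / 2\<bar> \<le> 3 * (x - 1)\<^sup>2"
proof -
  define y where "y = sqrt x"
  have x: "x \<ge> 1 / 2" using assms by (simp add: abs_if split: if_splits)
  have y2: "x = y\<^sup>2" using x by (simp add: y_def)
  have "sqrt (1/4) \<le> y" unfolding y_def using x by (intro real_sqrt_le_mono) simp
  then have y: "y \<ge> 1/2" by (simp add: real_sqrt_divide)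
  have "1 / y - 1 + (y\<^sup>2 - 1) / 2 = (y - 1)\<^sup>2 * (1 / 2 + 1 / y)"
    using y by (simp add: field_simps power2_eq_square)
  moreover have "(y - 1)\<^sup>2 * (1 / 2 + 1 / y) \<le> (y - 1)\<^sup>2 * 3"
    using y by (intro mult_left_mono) (auto simp: field_simps)
  moreover have "0 \<le> (y - 1)\<^sup>2 * (1 / 2 + 1 / y)" using y by simp
  moreover have "(y - 1)\<^sup>2 \<le> (y\<^sup>2 - 1)\<^sup>2"
  proof -
    have "(y\<^sup>2 - 1)\<^sup>2 = (y - 1)\<^sup>2 * (y + 1)\<^sup>2" by (simp add: power2_eq_square algebra_simps)
    moreover have "(y - 1)\<^sup>2 * 1 \<le> (y - 1)\<^sup>2 * (y + 1)\<^sup>2" using y by (intro mult_left_mono) (auto simp: one_le_power)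
    ultimately show ?thesis by simp
  qed
  ultimately have "\<bar>1 / y - 1 + (y\<^sup>2 - 1) / 2\<bar> \<le> 3 * (y\<^sup>2 - 1)\<^sup>2" by linarith
  then show ?thesis by (simp only: y_def[symmetric] y2 real_sqrt_abs) (use y in simp)
qed

text \<open>Functional calculus: diagonalize and apply the scalar estimate to each eigenvalue.
  Unitary conjugation preserves the Hilbert-Schmidt norm, so the errors of the eigenvalues control
  that of the matrix.\<close>

lemma ex_inverse_sqrt:
  fixes M :: "complex^'k^'k"
  assumes M: "hermitian M" "norm (M - mat 1) \<le> 1 / 2"
  shows "\<exists>R. R ** M ** ctranspose R = mat 1 \<and>
    norm (R - mat 1 + (1 / 2) *\<^sub>R (M - mat 1)) \<le> 3 * (norm (M - mat 1))\<^sup>2"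
proof -
  obtain U :: "complex^'k^'k" and d where U: "U ** ctranspose U = mat 1" and Md: "M = ctranspose U ** diagm d ** U"
    using hermitian_diagonalization[OF M(1)] by blast
  let ?c = "\<lambda>e. ctranspose U ** diagm e ** U"
  have c1: "mat 1 = ?c (\<lambda>_. 1)" by (simp add: diagm_1 unitary_comm[OF U])
  have clin: "?c (\<lambda>i. a * e i + b * e' i) = a *\<^sub>R ?c e + b *\<^sub>R ?c e'" for a b e e'
  proof -
    have "diagm (\<lambda>i. a * e i + b * e' i) = a *\<^sub>R diagm e + b *\<^sub>R diagm e'"
      by (simp add: vec_eq_iff diagm_def scaleR_conv_of_real[where 'a=complex])
    then show ?thesis
      by (simp only: bounded_bilinear.add_left[OF bounded_bilinear_matrix_mul] 
          bounded_bilinear.add_right[OF bounded_bilinear_matrix_mul]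
          bounded_bilinear.scaleR_left[OF bounded_bilinear_matrix_mul]
          bounded_bilinear.scaleR_right[OF bounded_bilinear_matrix_mul])
  qed
  have M1: "M - mat 1 = ?c (\<lambda>i. d i - 1)"
    using clin[of 1 d "-1" "\<lambda>_. 1"] c1 Md by simp
  have normc: "norm (?c e) = norm (diagm e)" for e
    by (simp only: norm_unitary_left[OF unitary_ctranspose[OF U]] norm_unitary_right[OF U] matrix_mul_assoc[symmetric])
  have nM: "(norm (M - mat 1))\<^sup>2 = (\<Sum>i\<in>UNIV. (d i - 1)\<^sup>2)" by (simp add: M1 normc norm_diagm_sq)
  \<comment> \<open>Each eigenvalue of \<open>M - mat 1\<close> is bounded by its Hilbert-Schmidt
    norm, which brings it into the range of the scalar estimate.\<close>
  have di: "\<bar>d i - 1\<bar> \<le> 1 / 2" for i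
  proof -
    have "(d i - 1)\<^sup>2 \<le> (norm (M - mat 1))\<^sup>2" unfolding nM by (rule member_le_sum) auto
    then have "\<bar>d i - 1\<bar> \<le> norm (M - mat 1)" by (simp add: abs_le_square_iff[symmetric])
    then show ?thesis using M(2) by simp
  qed
  have dpos: "d i > 0" for i using di[of i] by (simp add: abs_if split: if_splits)
  define R where "R = ?c (\<lambda>i. 1 / sqrt (d i))"
  have Rs: "ctranspose R = R" by (simp add: R_def ctranspose_mul matrix_mul_assoc)
  have "R ** M ** R = ?c (\<lambda>i. 1 / sqrt (d i) * d i * (1 / sqrt (d i)))"
    unfolding R_def Md by (simp only: unitary_conj_diagm[OF U])
  also have "(\<lambda>i. 1 / sqrt (d i) * d i * (1 / sqrt (d i))) = (\<lambda>_. 1)"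
    using dpos by (intro ext) (simp add: less_imp_le less_imp_neq[symmetric])
  finally have 1: "R ** M ** ctranspose R = mat 1" by (simp add: Rs c1[symmetric])
  have R1: "R - mat 1 = ?c (\<lambda>i. 1 / sqrt (d i) - 1)"
    using clin[of 1 "\<lambda>i. 1 / sqrt (d i)" "-1" "\<lambda>_. 1"] by (simp add: R_def[symmetric] c1[symmetric])
  have "R - mat 1 + (1 / 2) *\<^sub>R (M - mat 1) = ?c (\<lambda>i. 1 / sqrt (d i) - 1 + (d i - 1) / 2)"
    using clin[of 1 "\<lambda>i. 1 / sqrt (d i) - 1" "1/2" "\<lambda>i. d i - 1"]
    by (simp add: R1[symmetric] M1[symmetric])
  then have "norm (R - mat 1 + (1 / 2) *\<^sub>R (M - mat 1)) = sqrt (\<Sum>i\<in>UNIV. (1 / sqrt (d i) - 1 + (d i - 1) / 2)\<^sup>2)"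
    by (simp only: normc norm_diagm_sq[symmetric] real_sqrt_abs abs_norm_cancel)
  also have "\<dots> \<le> (\<Sum>i\<in>UNIV. \<bar>1 / sqrt (d i) - 1 + (d i - 1) / 2\<bar>)"
    by (rule L2_set_le_sum_abs[unfolded L2_set_def])
  also have "\<dots> \<le> (\<Sum>i\<in>UNIV. 3 * (d i - 1)\<^sup>2)"
    by (intro sum_mono inverse_sqrt_estimate di)
  also have "\<dots> = 3 * (norm (M - mat 1))\<^sup>2" by (simp add: nM sum_distrib_left)
  finally show ?thesis using 1 by blast
qed

text \<open>The quadratic error bound is part of the choice: it forces the value 1 at 1 and yields
  the derivative there, without any discussion of uniqueness or regularity of the root.\<close>

definition isqrt_near :: "complex^'k^'k \<Rightarrow> complex^'k^'k" where
  "isqrt_near M = (SOME R. R ** M ** ctranspose R = mat 1 \<and>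
    norm (R - mat 1 + (1 / 2) *\<^sub>R (M - mat 1)) \<le> 3 * (norm (M - mat 1))\<^sup>2)"

lemma isqrt_near:
  assumes "hermitian M" "norm (M - mat 1) \<le> 1 / 2"
  shows "isqrt_near M ** M ** ctranspose (isqrt_near M) = mat 1"
    "norm (isqrt_near M - mat 1 + (1 / 2) *\<^sub>R (M - mat 1)) \<le> 3 * (norm (M - mat 1))\<^sup>2"
  using someI_ex[OF ex_inverse_sqrt[OF assms]] unfolding isqrt_near_def by blast+

lemma isqrt_near_1: "isqrt_near (mat 1) = (mat 1 :: complex^'k^'k)"
  using isqrt_near(2)[of "mat 1 :: complex^'k^'k"] by (simp add: hermitian_def)

text \<open>The derivative is relative to the hermitian matrices, because
  \<open>R ** M ** ctranspose R = mat 1\<close> can only be solved for hermitian \<open>M\<close>;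
  elsewhere the choice is arbitrary.\<close>

lemma isqrt_near_has_derivative:
  "(isqrt_near has_derivative (\<lambda>K. - (1 / 2) *\<^sub>R K)) (at (mat 1 :: complex^'k^'k) within {M. hermitian M})"
  unfolding has_derivative_within_alt
proof (intro conjI allI impI)
  show "bounded_linear (\<lambda>K::complex^'k^'k. - (1 / 2) *\<^sub>R K)" by (intro bounded_linear_intros)
  fix e :: real assume e: "e > 0"
  \<comment> \<open>The bound 1/2 keeps the estimate for \<open>isqrt_near\<close> available, and
    \<open>e / 3\<close> absorbs its constant 3.\<close>
  define d where "d = min (1/2) (e / 3)"
  have key: "norm (isqrt_near y - isqrt_near (mat 1) - - (1 / 2) *\<^sub>R (y - mat 1)) \<le> e * norm (y - mat 1)"
    if y: "y \<in> {M. hermitian M}" "norm (y - mat 1) < d" for y :: "complex^'k^'k"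
  proof -
    have "norm (isqrt_near y - mat 1 + (1 / 2) *\<^sub>R (y - mat 1)) \<le> 3 * (norm (y - mat 1))\<^sup>2"
      by (intro isqrt_near) (use y in \<open>auto simp: d_def\<close>)
    also have "\<dots> = (3 * norm (y - mat 1)) * norm (y - mat 1)" by (simp add: power2_eq_square)
    also have "\<dots> \<le> e * norm (y - mat 1)" using y by (intro mult_right_mono) (auto simp: d_def)
    finally show ?thesis by (simp add: isqrt_near_1)
  qed
  have "d > 0" using e by (simp add: d_def)
  then show "\<exists>d>0. \<forall>y\<in>{M::complex^'k^'k. hermitian M}. norm (y - mat 1) < d \<longrightarrow>
    norm (isqrt_near y - isqrt_near (mat 1) - - (1 / 2) *\<^sub>R (y - mat 1)) \<le> e * norm (y - mat 1)"
    by (intro exI[of _ d] conjI ballI impI key)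
qed

subsection \<open>The differential of the determinant\<close>

text \<open>The differential of the determinant as a multilinear function of the rows; in this form
  it makes sense at singular \<open>A\<close> as well.\<close>

definition Ddet :: "complex^'k^'k \<Rightarrow> complex^'k^'k \<Rightarrow> complex" where
  "Ddet A B = (\<Sum>q\<in>UNIV. det (\<chi> i. if i = q then B $ i else A $ i))"

lemma has_derivative_det: "(det has_derivative Ddet A) (at (A::complex^'k^'k))"
proof -
  have "((\<lambda>A::complex^'k^'k. \<Sum>p | p permutes UNIV. of_int (sign p) * (\<Prod>i\<in>UNIV. A $ i $ p i)) has_derivative
      (\<lambda>B. \<Sum>p | p permutes UNIV. of_int (sign p) *
        (\<Sum>q\<in>UNIV. B $ q $ p q * (\<Prod>i\<in>UNIV - {q}. A $ i $ p i)))) (at A)"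
    by (intro has_derivative_sum has_derivative_mult_right has_derivative_prod
        bounded_linear.has_derivative[OF bounded_linear_vec_nth] has_derivative_ident)
  moreover have "(\<Sum>p | p permutes UNIV. of_int (sign p) *
        (\<Sum>q\<in>UNIV. B $ q $ p q * (\<Prod>i\<in>UNIV - {q}. A $ i $ p i))) = Ddet A B" for B
  proof -
    have *: "B $ q $ p q * (\<Prod>i\<in>UNIV - {q}. A $ i $ p i)
        = (\<Prod>i\<in>UNIV. (\<chi> i. if i = q then B $ i else A $ i) $ i $ p i)" for q and p :: "'k \<Rightarrow> 'k"
    proof -
      have "(\<Prod>i\<in>UNIV. (\<chi> i. if i = q then B $ i else A $ i) $ i $ p i)
          = B $ q $ p q * (\<Prod>i\<in>UNIV - {q}. (\<chi> i. if i = q then B $ i else A $ i) $ i $ p i)"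
        by (subst prod.remove[of _ q]) auto
      then show ?thesis by (simp cong: prod.cong_simp)
    qed
    show ?thesis
      unfolding Ddet_def det_def * sum_distrib_left by (rule sum.swap)
  qed
  ultimately show ?thesis unfolding det_def[abs_def] by simp
qed

lemma bounded_linear_Ddet: "bounded_linear (Ddet A)"
  using has_derivative_det by (rule has_derivative_bounded_linear)

lemma Ddet_add: "Ddet A (B + C) = Ddet A B + Ddet A C"
  and Ddet_diff: "Ddet A (B - C) = Ddet A B - Ddet A C"
  and Ddet_scaleR: "Ddet A (c *\<^sub>R B) = c *\<^sub>R Ddet A B"
  using bounded_linear_Ddet[of A] bounded_linear.linear linear_add linear_diff linear_scale by blast+

text \<open>Both sides are the derivative of \<open>det (P ** X ** Q)\<close> in \<open>X\<close> at
  \<open>A\<close>; uniqueness of derivatives replaces a computation with permutations.\<close>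

lemma Ddet_mult:
  fixes A B P Q :: "complex^'k^'k"
  shows "Ddet (P ** A ** Q) (P ** B ** Q) = det P * det Q * Ddet A B"
proof -
  have lin: "((\<lambda>X. P ** X ** Q) has_derivative (\<lambda>X. P ** X ** Q)) (at A)"
    by (intro bounded_linear.has_derivative[OF bounded_linear_compose
        [OF bounded_bilinear.bounded_linear_left[OF bounded_bilinear_matrix_mul]
          bounded_bilinear.bounded_linear_right[OF bounded_bilinear_matrix_mul]]] has_derivative_ident)
  have "((\<lambda>X. det (P ** X ** Q)) has_derivative (\<lambda>X. Ddet (P ** A ** Q) (P ** X ** Q))) (at A)"
    by (rule has_derivative_compose[OF lin has_derivative_det])
  moreover have "((\<lambda>X. det (P ** X ** Q)) has_derivative (\<lambda>X. det P * det Q * Ddet A X)) (at A)"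
  proof -
    have "((\<lambda>X. det P * det Q * det X) has_derivative (\<lambda>X. det P * det Q * Ddet A X)) (at A)"
      by (intro has_derivative_mult_right has_derivative_det)
    then show ?thesis by (simp add: det_mul mult_ac)
  qed
  ultimately show ?thesis by (metis has_derivative_unique)
qed

text \<open>By Cramer's lemma, exchanging row \<open>q\<close> of \<open>A\<close> for row
  \<open>q\<close> of \<open>C ** A\<close> multiplies the determinant by \<open>C $ q $ q\<close>.
  This is the core of Jacobi's formula.\<close>

lemma Ddet_mult_left: "Ddet A (C ** A) = trace C * det (A::complex^'k^'k)"
proof -
  have "det (\<chi> i. if i = q then (C ** A) $ i else A $ i) = C $ q $ q * det A" for q
  proof -
    have "(\<chi> i. if i = q then (C ** A) $ i else A $ i) =
        (\<chi> i. if i = q then (\<Sum>j\<in>UNIV. (C $ q) $ j *s row j A) else row i A)"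
      by (simp add: vec_eq_iff matrix_matrix_mult_def row_def)
    then show ?thesis by (simp add: cramer_lemma_transpose)
  qed
  then show ?thesis by (simp add: Ddet_def trace_def sum_distrib_right)
qed

lemma Ddet_invertible: 
  assumes "invertible (A::complex^'k^'k)"
  shows "Ddet A B = trace (B ** matrix_inv A) * det A"
  using Ddet_mult_left[of A "B ** matrix_inv A"]
  by (simp add: matrix_mul_assoc[symmetric] matrix_inv_cancel[OF assms])

text \<open>\<open>cof\<close> clears both a row and a column. Clearing only the row gives the same
  determinant: a permutation contributes only if it sends \<open>q\<close> to \<open>j\<close>, and
  then it avoids column \<open>j\<close> in all other rows.\<close>

lemma det_row_axis_eq_cof: "det (\<chi> i. if i = q then axis j 1 else A $ i) = cof A $ q $ j"
proof -
  have "(\<Prod>i\<in>UNIV. (\<chi> i. if i = q then axis j 1 else A $ i) $ i $ p i) =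
     (\<Prod>i\<in>UNIV. (\<chi> a b. if a = q \<and> b = j then 1 else if a = q \<or> b = j then 0 else A $ a $ b) $ i $ p i)"
    if p: "p permutes UNIV" for p
  proof (cases "p q = j")
    case True
    then have "p i \<noteq> j" if "i \<noteq> q" for i using that p by (metis permutes_inverses(2))
    then show ?thesis using True by (intro prod.cong) (auto simp: axis_def)
  next
    case False
    have "(\<Prod>i\<in>UNIV. (\<chi> i. if i = q then axis j 1 else A $ i) $ i $ p i) = 0"
      using False by (intro prod_zero) (auto simp: axis_def)
    moreover have "(\<Prod>i\<in>UNIV. (\<chi> a b. if a = q \<and> b = j then 1 else if a = q \<or> b = j then 0 else A $ a $ b) $ i $ p i) = 0"
      using False by (intro prod_zero) auto
    ultimately show ?thesis by metis
  qed
  then show ?thesis unfolding cof_def det_def by (simp del: vec_lambda_beta cong: sum.cong_simp) (simp cong: sum.cong_simp)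
qed

lemma Ddet_cof: "Ddet A B = (\<Sum>i\<in>UNIV. \<Sum>j\<in>UNIV. B $ i $ j * cof A $ i $ j)"
proof -
  have "det (\<chi> i. if i = q then B $ i else A $ i) = (\<Sum>j\<in>UNIV. B $ q $ j * cof A $ q $ j)" for q
  proof -
    have "(\<chi> i. if i = q then B $ i else A $ i) =
        (\<chi> i. if i = q then (\<Sum>j\<in>UNIV. B $ q $ j *s axis j 1) else A $ i)"
      by (auto simp: vec_eq_iff axis_def if_distrib[of "\<lambda>x. _ * x"] cong: if_cong)
    then show ?thesis by (simp add: det_linear_row_sum det_row_mul det_row_axis_eq_cof)
  qed
  then show ?thesis by (simp add: Ddet_def)
qed

text \<open>Cauchy-Schwarz in the Laplace expansion. This inequality is the origin of the norm of
  the cofactor matrix in the Nakano and dual Nakano distortion functions.\<close>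

lemma cmod_Ddet_le: "cmod (Ddet A B) \<le> norm B * norm (cof A)"
proof (rule power2_le_imp_le)
  have "(cmod (Ddet A B))\<^sup>2 = (cmod (\<Sum>(i,j)\<in>UNIV. B $ i $ j * cof A $ i $ j))\<^sup>2"
    by (simp add: Ddet_cof sum.cartesian_product)
  also have "\<dots> = (cmod (\<Sum>p\<in>UNIV. B $ fst p $ snd p * cof A $ fst p $ snd p))\<^sup>2"
    by (simp add: case_prod_beta)
  also have "\<dots> \<le> (\<Sum>p\<in>UNIV. (cmod (B $ fst p $ snd p))\<^sup>2) * (\<Sum>p\<in>UNIV. (cmod (cof A $ fst p $ snd p))\<^sup>2)"
    by (rule cmod_sum_mult_sq_le)
  also have "\<dots> = (norm B * norm (cof A))\<^sup>2"
    by (simp add: norm_matrix_sq power_mult_distrib sum.cartesian_product case_prod_beta)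
  finally show "(cmod (Ddet A B))\<^sup>2 \<le> (norm B * norm (cof A))\<^sup>2" .
qed simp

text \<open>On an elementary matrix \<open>Ddet\<close> is a cofactor by Laplace expansion and an
  entry of the inverse by Jacobi's formula.\<close>

lemma cof_invertible:
  assumes "invertible (A::complex^'k^'k)"
  shows "cof A = (\<chi> i j. det A * matrix_inv A $ j $ i)"
proof -
  have "cof A $ i $ j = det A * matrix_inv A $ j $ i" for i j
  proof -
    define B :: "complex^'k^'k" where "B = axis i (axis j 1)"
    have "B $ a $ b = (if a = i then (if b = j then 1 else 0) else 0)" for a b
      by (simp add: B_def axis_def)
    moreover have "(\<Sum>b'\<in>UNIV. if a = i then if b' = j then x else 0 else 0) = (if a = i then x else 0)" for a and x :: complex
      by simp
    ultimately have "Ddet A B = cof A $ i $ j" "trace (B ** matrix_inv A) = matrix_inv A $ j $ i"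
      by (simp_all add: Ddet_cof trace_def matrix_matrix_mult_def if_distrib[of "\<lambda>x. x * _"] cong: if_cong)
    then show ?thesis using Ddet_invertible[OF assms, of B] by (simp add: mult.commute)
  qed
  then show ?thesis by (simp add: vec_eq_iff)
qed

text \<open>Reduces unitary invariance of the cofactor norm to that of the determinant and of the
  inverse.\<close>

lemma norm_cof_invertible:
  assumes "invertible (A::complex^'k^'k)"
  shows "norm (cof A) = cmod (det A) * norm (matrix_inv A)"
proof -
  have "(norm (cof A))\<^sup>2 = (cmod (det A) * norm (matrix_inv A))\<^sup>2"
    using sum.swap[of "\<lambda>i j. (cmod (matrix_inv A$i$j))\<^sup>2" UNIV UNIV]
    by (simp add: norm_matrix_sq cof_invertible[OF assms] power_mult_distrib norm_mult
        sum_distrib_left)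
  then show ?thesis by (simp add: power2_eq_iff_nonneg)
qed

text \<open>For a fixed outer permutation, reindexing the inner one turns \<open>wedge_top\<close>
  into a determinant whose row \<open>q\<close> is taken from the factor at position
  \<open>inv \<rho> q\<close>. With equal factors all \<open>fact CARD('n)\<close> terms agree; with
  one exceptional factor, averaging over its row produces \<open>Ddet\<close>.\<close>

lemma top_power_det: "top_power a = of_nat (fact CARD('n)) * det (a::complex^'n^'n)"
  and pow_wedge_Ddet: "pow_wedge a b = of_real (fact CARD('n) / CARD('n)) * Ddet a (b::complex^'n^'n)"
proof -
  have wt: "wedge_top \<alpha> = (\<Sum>\<rho> | \<rho> permutes (UNIV::'n set). det (\<chi> q. \<alpha> (inv \<rho> q) $ q))" for \<alpha> :: "'n \<Rightarrow> complex^'n^'n"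
    unfolding wedge_top_def
  proof (rule sum.cong[OF refl])
    fix \<rho> :: "'n \<Rightarrow> 'n" assume "\<rho> \<in> {\<rho>. \<rho> permutes UNIV}"
    then have r: "\<rho> permutes UNIV" by simp
    have sg: "of_int (sign \<rho> * sign (\<pi> \<circ> \<rho>)) = (of_int (sign \<pi>) :: complex)" if "\<pi> permutes (UNIV::'n set)" for \<pi>
    proof -
      have "sign (\<pi> \<circ> \<rho>) = sign \<pi> * sign \<rho>"
        using that r by (intro sign_compose) (auto intro: permutes_imp_permutation)
      moreover have "sign \<rho> * sign \<rho> = 1" by (simp add: sign_def)
      ultimately show ?thesis by (metis mult.assoc mult.commute mult.right_neutral)
    qed
    have "(\<Sum>\<pi> | \<pi> permutes (UNIV::'n set). of_int (sign \<rho> * sign \<pi>) * (\<Prod>p\<in>UNIV. \<alpha> p $ \<rho> p $ \<pi> p))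
       = (\<Sum>\<pi> | \<pi> permutes (UNIV::'n set). of_int (sign \<rho> * sign (\<pi> \<circ> \<rho>)) * (\<Prod>p\<in>UNIV. \<alpha> p $ \<rho> p $ (\<pi> \<circ> \<rho>) p))"
      by (rule sum_permutations_compose_right[OF r])
    also have "\<dots> = (\<Sum>\<pi> | \<pi> permutes (UNIV::'n set). of_int (sign \<pi>) * (\<Prod>p\<in>UNIV. \<alpha> (inv \<rho> p) $ p $ \<pi> p))"
    proof (rule sum.cong[OF refl])
      fix \<pi> :: "'n \<Rightarrow> 'n" assume "\<pi> \<in> {\<pi>. \<pi> permutes UNIV}"
      then have p: "\<pi> permutes UNIV" by simp
      have "(\<Prod>p\<in>UNIV. \<alpha> (inv \<rho> p) $ p $ \<pi> p) = (\<Prod>p\<in>UNIV. \<alpha> (inv \<rho> (\<rho> p)) $ \<rho> p $ \<pi> (\<rho> p))"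
        using prod.permute[OF r, of "\<lambda>p. \<alpha> (inv \<rho> p) $ p $ \<pi> p"] by (simp add: o_def)
      then show "of_int (sign \<rho> * sign (\<pi> \<circ> \<rho>)) * (\<Prod>p\<in>UNIV. \<alpha> p $ \<rho> p $ (\<pi> \<circ> \<rho>) p)
          = of_int (sign \<pi>) * (\<Prod>p\<in>UNIV. \<alpha> (inv \<rho> p) $ p $ \<pi> p)"
        using sg[OF p] by (simp only: permutes_inverses(2)[OF r] o_apply)
    qed
    finally show "(\<Sum>\<pi> | \<pi> permutes (UNIV::'n set). of_int (sign \<rho> * sign \<pi>) * (\<Prod>p\<in>UNIV. \<alpha> p $ \<rho> p $ \<pi> p))
       = det (\<chi> q. \<alpha> (inv \<rho> q) $ q)" by (simp add: det_def)
  qed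
  have card: "card {\<rho>. \<rho> permutes (UNIV::'n set)} = fact CARD('n)"
    by (rule card_permutations) auto
  show "top_power a = of_nat (fact CARD('n)) * det a"
    unfolding top_power_def wt by (simp add: card)
  define p0 where "p0 = (SOME p::'n. True)"
  define f where "f q = det (\<chi> i. if i = q then b $ i else a $ i)" for q
  have pw: "pow_wedge a b = (\<Sum>\<rho> | \<rho> permutes (UNIV::'n set). f (\<rho> p0))"
    unfolding pow_wedge_def wt p0_def[symmetric] f_def
  proof (rule sum.cong[OF refl])
    fix \<rho> :: "'n \<Rightarrow> 'n" assume "\<rho> \<in> {\<rho>. \<rho> permutes UNIV}"
    then have r: "\<rho> permutes UNIV" by simp
    have "inv \<rho> q = p0 \<longleftrightarrow> q = \<rho> p0" for q using permutes_inverses[OF r] by metis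
    then show "det (\<chi> q. (if inv \<rho> q = p0 then b else a) $ q) = det (\<chi> i. if i = \<rho> p0 then b $ i else a $ i)"
      by (intro arg_cong[where f=det]) (simp add: vec_eq_iff)
  qed
  \<comment> \<open>Composing with the transposition of \<open>p0\<close> and \<open>p\<close> shows
    that the position of the exceptional factor is irrelevant, although \<open>pow_wedge\<close>
    places it at a chosen one.\<close>
  have eqp: "(\<Sum>\<rho> | \<rho> permutes (UNIV::'n set). f (\<rho> p0)) = (\<Sum>\<rho> | \<rho> permutes (UNIV::'n set). f (\<rho> p))" for p
  proof -
    have t: "transpose_perm permutes (UNIV::'n set)" if "transpose_perm = Transposition.transpose p0 p" for transpose_perm
      using that by (simp add: permutes_swap_id)
    show ?thesis
      using sum_permutations_compose_right[OF t[OF refl], of "\<lambda>\<rho>. f (\<rho> p0)"] by simp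
  qed
  \<comment> \<open>Average over all positions; for each permutation the inner sum then runs over
    all rows, which is the sum in \<open>Ddet\<close>.\<close>
  have "of_nat CARD('n) * (\<Sum>\<rho> | \<rho> permutes (UNIV::'n set). f (\<rho> p0)) = (\<Sum>p\<in>(UNIV::'n set). \<Sum>\<rho> | \<rho> permutes (UNIV::'n set). f (\<rho> p0))"
    by simp
  also have "\<dots> = (\<Sum>p\<in>UNIV. \<Sum>\<rho> | \<rho> permutes (UNIV::'n set). f (\<rho> p))"
    by (rule sum.cong[OF refl eqp])
  also have "\<dots> = (\<Sum>\<rho> | \<rho> permutes (UNIV::'n set). \<Sum>p\<in>UNIV. f (\<rho> p))" by (rule sum.swap)
  also have "\<dots> = (\<Sum>\<rho> | \<rho> permutes (UNIV::'n set). \<Sum>p\<in>UNIV. f p)"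
  proof (rule sum.cong[OF refl])
    fix \<rho> :: "'n \<Rightarrow> 'n" assume "\<rho> \<in> {\<rho>. \<rho> permutes UNIV}"
    then show "(\<Sum>p\<in>UNIV. f (\<rho> p)) = (\<Sum>p\<in>UNIV. f p)"
      using sum.permute[of \<rho> UNIV f] by (simp add: o_def)
  qed
  also have "\<dots> = of_nat (fact CARD('n)) * Ddet a b" by (simp add: card Ddet_def f_def)
  finally show "pow_wedge a b = of_real (fact CARD('n) / CARD('n)) * Ddet a b"
    by (simp add: pw field_simps)
qed

subsection \<open>The derivative of the matrix inverse\<close>

lemma continuous_on_det [continuous_intros]:
  "continuous_on S f \<Longrightarrow> continuous_on S (\<lambda>x. det (f x :: complex^'k^'k))"
  unfolding det_def by (intro continuous_intros)

lemma open_invertible: "open {A::complex^'k^'k. invertible A}"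
proof -
  have "open {A::complex^'k^'k. det A \<noteq> 0}"
    by (intro open_Collect_neq continuous_intros)
  then show ?thesis by (simp add: invertible_det_nz)
qed

lemma continuous_on_matrix_inv: "continuous_on {A::complex^'k^'k. invertible A} matrix_inv"
proof -
  have eq: "matrix_inv A = (\<chi> i j. cof A $ j $ i / det A)" if "invertible A" for A :: "complex^'k^'k"
    using that by (simp add: vec_eq_iff cof_invertible invertible_det_nz)
  have "continuous_on {A::complex^'k^'k. invertible A} (\<lambda>A. \<chi> i j. cof A $ j $ i / det A)"
    unfolding continuous_on_def
  proof (intro ballI tendsto_vec_lambda)
    fix A i j assume A: "A \<in> {A::complex^'k^'k. invertible A}"
    have "continuous_on UNIV (\<lambda>A::complex^'k^'k. cof A $ j $ i)"
      unfolding det_row_axis_eq_cof[symmetric]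
      by (intro continuous_on_det) (auto simp: continuous_on_def intro!: tendsto_vec_lambda tendsto_intros)
    then have "continuous_on {A::complex^'k^'k. invertible A} (\<lambda>A. cof A $ j $ i / det A)"
      by (intro continuous_on_divide continuous_on_det continuous_on_id) 
        (auto intro: continuous_on_subset simp: invertible_det_nz)
    then show "((\<lambda>A. cof A $ j $ i / det A) \<longlongrightarrow> cof A $ j $ i / det A) (at A within {A. invertible A})"
      using A by (simp add: continuous_on_def)
  qed
  then show ?thesis by (rule continuous_on_cong[THEN iffD1, rotated 2]) (auto simp: eq)
qed

text \<open>Up to sign the remainder is the difference of the inverses times \<open>B - A\<close>
  times \<open>matrix_inv A\<close>, hence of smaller order than \<open>B - A\<close> by continuity
  of the inverse.\<close>

lemma has_derivative_matrix_inv: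
  fixes A :: "complex^'k^'k"
  assumes A: "invertible A"
  shows "(matrix_inv has_derivative (\<lambda>K. - (matrix_inv A ** K ** matrix_inv A))) (at A)"
proof -
  note bl = bounded_bilinear.bounded_linear_left[OF bounded_bilinear_matrix_mul]
    bounded_bilinear.bounded_linear_right[OF bounded_bilinear_matrix_mul]
  have cont: "(matrix_inv \<longlongrightarrow> matrix_inv A) (at A)"
    using continuous_on_matrix_inv[where 'k='k] A
    by (simp add: continuous_on_eq_continuous_at[OF open_invertible] isCont_def)
  have ev: "eventually (\<lambda>B. invertible B) (at A)"
    using topological_tendstoD[OF tendsto_ident_at open_invertible, of A UNIV] A by simp
  show ?thesis
  proof (rule has_derivativeI)
    show "bounded_linear (\<lambda>K. - (matrix_inv A ** K ** matrix_inv A))"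
      by (intro bounded_linear_minus bounded_linear_compose[OF bl(1) bl(2)])
    have "((\<lambda>B. norm (matrix_inv B - matrix_inv A) * norm (matrix_inv A)) \<longlongrightarrow>
        norm (matrix_inv A - matrix_inv A) * norm (matrix_inv A)) (at A)"
      by (intro tendsto_intros cont)
    then have "((\<lambda>B. norm (matrix_inv B - matrix_inv A) * norm (matrix_inv A)) \<longlongrightarrow> 0) (at A)"
      by simp
    then have "((\<lambda>B. norm ((matrix_inv B - matrix_inv A - - (matrix_inv A ** (B - A) ** matrix_inv A)) /\<^sub>R norm (B - A))) \<longlongrightarrow> 0) (at A)"
    proof (rule Lim_null_comparison[rotated])
      show "\<forall>\<^sub>F B in at A. norm (norm ((matrix_inv B - matrix_inv A - - (matrix_inv A ** (B - A) ** matrix_inv A)) /\<^sub>R norm (B - A)))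
          \<le> norm (matrix_inv B - matrix_inv A) * norm (matrix_inv A)"
        using ev
      proof eventually_elim
        case (elim B)
        note bb = bounded_bilinear.diff_left[OF bounded_bilinear_matrix_mul]
            bounded_bilinear.diff_right[OF bounded_bilinear_matrix_mul]
        have 1: "matrix_inv B ** (B - A) ** matrix_inv A = matrix_inv A - matrix_inv B"
          by (simp add: bb matrix_inv_cancel elim matrix_mul_assoc[symmetric] A)
             
        define X where "X = matrix_inv B - matrix_inv A - - (matrix_inv A ** (B - A) ** matrix_inv A)"
        have "X = - ((matrix_inv B - matrix_inv A) ** (B - A) ** matrix_inv A)"
          using 1 unfolding X_def by (simp only: bb(1)) simp
        then have "norm X \<le> norm (matrix_inv B - matrix_inv A) * norm (B - A) * norm (matrix_inv A)"
          by (simp only: norm_minus_cancel)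
            (rule order_trans[OF norm_matrix_mul_le], intro mult_right_mono norm_matrix_mul_le norm_ge_zero)
        then show ?case
          unfolding X_def[symmetric] by (cases "B = A") (simp_all add: divide_simps mult_ac)
      qed
    qed
    then show "((\<lambda>y. (matrix_inv y - matrix_inv A - - (matrix_inv A ** (y - A) ** matrix_inv A)) /\<^sub>R norm (y - A)) \<longlongrightarrow> 0) (at A)"
      by (simp only: tendsto_norm_zero_iff)
  qed
qed

section \<open>Pointwise algebra of curvature coefficients\<close>

subsection \<open>Positive definite matrices\<close>

definition qform :: "complex^'k^'k \<Rightarrow> complex^'k \<Rightarrow> complex" where
  "qform M v = (\<Sum>l\<in>UNIV. \<Sum>m\<in>UNIV. M $ l $ m * v $ l * cnj (v $ m))"

lemma pos_def_qform: "pos_def M \<longleftrightarrow> hermitian M \<and> (\<forall>v. v \<noteq> 0 \<longrightarrow> Re (qform M v) > 0)"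
  by (simp add: pos_def_def qform_def)

text \<open>Row convention: when the rows of \<open>S\<close> are the new basis vectors, components
  pull back by \<open>v v* S\<close> rather than by \<open>S *v v\<close>.\<close>

lemma qform_congruence: "qform (S ** M ** ctranspose S) v = qform M (v v* S)"
proof -
  have "qform (S ** M ** ctranspose S) v =
      (\<Sum>l\<in>UNIV. \<Sum>m\<in>UNIV. \<Sum>q\<in>UNIV. \<Sum>p\<in>UNIV. v $ l * S $ l $ p * M $ p $ q * cnj (S $ m $ q) * cnj (v $ m))"
    by (simp add: qform_def matrix_matrix_mult_def sum_distrib_left sum_distrib_right mult_ac)
  also have "\<dots> = (\<Sum>l\<in>UNIV. \<Sum>q\<in>UNIV. \<Sum>m\<in>UNIV. \<Sum>p\<in>UNIV. v $ l * S $ l $ p * M $ p $ q * cnj (S $ m $ q) * cnj (v $ m))"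
    by (intro sum.cong refl sum.swap)
  also have "\<dots> = (\<Sum>l\<in>UNIV. \<Sum>q\<in>UNIV. \<Sum>p\<in>UNIV. \<Sum>m\<in>UNIV. v $ l * S $ l $ p * M $ p $ q * cnj (S $ m $ q) * cnj (v $ m))"
    by (intro sum.cong refl sum.swap)
  also have "\<dots> = (\<Sum>q\<in>UNIV. \<Sum>l\<in>UNIV. \<Sum>p\<in>UNIV. \<Sum>m\<in>UNIV. v $ l * S $ l $ p * M $ p $ q * cnj (S $ m $ q) * cnj (v $ m))"
    by (rule sum.swap)
  also have "\<dots> = (\<Sum>q\<in>UNIV. \<Sum>p\<in>UNIV. \<Sum>l\<in>UNIV. \<Sum>m\<in>UNIV. v $ l * S $ l $ p * M $ p $ q * cnj (S $ m $ q) * cnj (v $ m))"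
    by (intro sum.cong refl sum.swap)
  also have "\<dots> = (\<Sum>p\<in>UNIV. \<Sum>q\<in>UNIV. \<Sum>l\<in>UNIV. \<Sum>m\<in>UNIV. v $ l * S $ l $ p * M $ p $ q * cnj (S $ m $ q) * cnj (v $ m))"
    by (rule sum.swap)
  also have "\<dots> = qform M (v v* S)"
    by (simp add: qform_def vector_matrix_mult_def sum_distrib_left sum_distrib_right mult_ac)
  finally show ?thesis .
qed

lemma qform_mat_1: "qform (mat 1) v = of_real ((norm v)\<^sup>2)"
proof -
  have "qform (mat 1) v = (\<Sum>l\<in>UNIV. \<Sum>m\<in>UNIV. if l = m then v $ l * cnj (v $ l) else 0)"
    unfolding qform_def by (intro sum.cong refl) (simp add: mat_def)
  also have "\<dots> = (\<Sum>l\<in>UNIV. of_real ((cmod (v $ l))\<^sup>2))" by (simp add: complex_norm_square[symmetric])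
  finally show ?thesis by (simp only: norm_vec_sq of_real_sum)
qed

lemma qform_add: "qform (A + B) v = qform A v + qform B v"
  and qform_scaleR: "qform (c *\<^sub>R A) v = c *\<^sub>R qform A v"
  by (simp_all add: qform_def sum.distrib algebra_simps scaleR_sum_right)

lemma hermitian_congruence: "hermitian M \<Longrightarrow> hermitian (S ** M ** ctranspose S)"
  by (simp add: hermitian_def ctranspose_mul matrix_mul_assoc)

lemma vector_matrix_mult_nz:
  assumes "invertible (S::complex^'k^'k)" "v \<noteq> 0"
  shows "v v* S \<noteq> 0"
proof
  assume *: "v v* S = 0"
  have "v = v v* (S ** matrix_inv S)" by (simp add: matrix_inv_cancel assms)
  also have "\<dots> = (v v* S) v* matrix_inv S" by (simp add: vector_matrix_mul_assoc)
  finally show False using assms * by simp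
qed

lemma pos_def_congruence:
  assumes "pos_def M" "invertible (S::complex^'k^'k)"
  shows "pos_def (S ** M ** ctranspose S)"
  using assms by (simp add: pos_def_qform hermitian_congruence qform_congruence vector_matrix_mult_nz)

text \<open>Diagonalize and rescale by inverse square roots of the eigenvalues, which are positive
  as values of the form on basis vectors.\<close>

lemma ex_on_basis:
  assumes M: "pos_def (M::complex^'k^'k)"
  shows "\<exists>S::complex^'k^'k. S ** M ** ctranspose S = mat 1"
proof -
  obtain U :: "complex^'k^'k" and d where U: "U ** ctranspose U = mat 1" and Md: "M = ctranspose U ** diagm d ** U"
    using hermitian_diagonalization[of M] M by (auto simp: pos_def_def)
  have inv: "invertible U" using U by (rule invertible_rightI)
  have D: "U ** M ** ctranspose U = diagm d"
  proof -
    have "U ** M ** ctranspose U = (U ** ctranspose U) ** diagm d ** (U ** ctranspose U)"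
      by (simp only: Md matrix_mul_assoc)
    then show ?thesis by (simp add: U)
  qed
  have "d i > 0" for i
  proof -
    have "Re (qform (diagm d) (axis i 1)) > 0"
      using pos_def_congruence[OF M inv] by (auto simp: D pos_def_qform axis_eq_0_iff)
    moreover have "qform (diagm d) (axis i 1) = of_real (d i)"
    proof -
      have "qform (diagm d) (axis i 1) = (\<Sum>l\<in>UNIV. \<Sum>m\<in>UNIV. if m = l then if l = i then of_real (d i) else 0 else 0)"
        unfolding qform_def by (intro sum.cong refl) (auto simp: diagm_def axis_def)
      then show ?thesis by simp
    qed
    ultimately show ?thesis by simp
  qed
  then have "diagm (\<lambda>i. 1 / sqrt (d i)) ** diagm d ** diagm (\<lambda>i. 1 / sqrt (d i)) = mat 1"
    by (simp add: diagm_mult diagm_1[symmetric] less_imp_le less_imp_neq[symmetric])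
  then have "(diagm (\<lambda>i. 1 / sqrt (d i)) ** U) ** M ** ctranspose (diagm (\<lambda>i. 1 / sqrt (d i)) ** U) = mat 1"
    by (simp only: D[symmetric] ctranspose_mul ctranspose_diagm matrix_mul_assoc)
  then show ?thesis by blast
qed

lemma on_basis: "pos_def M \<Longrightarrow> on_basis M ** M ** ctranspose (on_basis M) = mat 1"
  unfolding on_basis_def using ex_on_basis by (rule someI_ex)

text \<open>An orthonormal basis \<open>S\<close> gives \<open>det M\<close> times the squared
  modulus of \<open>det S\<close> equal to 1, which contains both realness and positivity.\<close>

lemma pos_def_det:
  assumes "pos_def (M::complex^'k^'k)"
  shows "Re (det M) > 0" "Im (det M) = 0" "invertible M"
proof -
  obtain S :: "complex^'k^'k" where S: "S ** M ** ctranspose S = mat 1" using ex_on_basis[OF assms] by blast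
  show "invertible M" by (rule on_basis_invertible[OF S])
  have "det (S ** M ** ctranspose S) = 1" by (simp add: S)
  then have 1: "det M * of_real ((cmod (det S))\<^sup>2) = 1"
    unfolding det_mul det_ctranspose complex_norm_square by (simp add: mult_ac)
  then have nz: "(cmod (det S))\<^sup>2 > 0" by (metis mult_zero_right of_real_0 zero_less_power2 zero_neq_one power2_eq_square mult_zero_left)
  then have "det M = of_real (1 / (cmod (det S))\<^sup>2)" using 1 by (simp add: field_simps)
  then show "Re (det M) > 0" "Im (det M) = 0" using nz by simp_all
qed

text \<open>By Jacobi's formula this is \<open>det A\<close> times the trace of \<open>B\<close> in
  an \<open>A\<close>-orthonormal basis, whose diagonal entries are values of the form
  \<open>B\<close>. It expresses that determinants increase along semipositive directions.\<close>

lemma pos_def_Ddet_nonneg: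
  assumes A: "pos_def (A::complex^'k^'k)" and B: "\<And>v. Re (qform B v) \<ge> 0"
  shows "Re (Ddet A B) \<ge> 0"
proof -
  obtain S :: "complex^'k^'k" where S: "S ** A ** ctranspose S = mat 1" using ex_on_basis[OF A] by blast
  have "trace (B ** matrix_inv A) = trace (S ** B ** ctranspose S)"
    unfolding on_basis_invertible(3)[OF S]
    using trace_mul_sym[of B "ctranspose S ** S"] trace_mul_sym[of "S ** B" "ctranspose S"]
    by (simp add: matrix_mul_assoc)
  moreover have "Re (trace (S ** B ** ctranspose S)) \<ge> 0"
  proof -
    have "(S ** B ** ctranspose S) $ i $ i = qform (S ** B ** ctranspose S) (axis i 1)" for i
    proof -
      have "qform (S ** B ** ctranspose S) (axis i 1) = (\<Sum>l\<in>UNIV. \<Sum>m\<in>UNIV. if l = i then if m = i then (S ** B ** ctranspose S) $ i $ i else 0 else 0)"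
        unfolding qform_def by (intro sum.cong refl) (auto simp: axis_def)
      also have "\<dots> = (\<Sum>l\<in>UNIV. if l = i then (S ** B ** ctranspose S) $ i $ i else 0)"
        by (intro sum.cong refl) simp
      finally show ?thesis by simp
    qed
    then show ?thesis unfolding trace_def Re_sum by (simp add: qform_congruence B sum_nonneg)
  qed
  ultimately show ?thesis
    using pos_def_det[OF A] by (simp add: Ddet_invertible)
qed

subsection \<open>Kronecker products and changes of frames and coordinates\<close>

definition kron :: "complex^'n^'n \<Rightarrow> complex^'r^'r \<Rightarrow> complex^('n \<times> 'r)^('n \<times> 'r)" where
  "kron A B = (\<chi> p q. A $ fst p $ fst q * B $ snd p $ snd q)"

lemma sum_UNIV_prod: "(\<Sum>p\<in>(UNIV :: ('a::finite \<times> 'b::finite) set). f p) = (\<Sum>a\<in>UNIV. \<Sum>b\<in>UNIV. f (a, b))"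
  by (simp add: sum.cartesian_product UNIV_Times_UNIV[symmetric] del: UNIV_Times_UNIV)

lemma kron_mult: "kron A B ** kron C D = kron (A ** C) (B ** D)"
  by (simp add: vec_eq_iff kron_def matrix_matrix_mult_def sum_UNIV_prod sum_product mult_ac)

lemma ctranspose_kron: "ctranspose (kron A B) = kron (ctranspose A) (ctranspose B)"
  by (simp add: vec_eq_iff kron_def)

lemma kron_mat_1: "kron (mat 1) (mat 1) = mat 1"
  by (simp add: vec_eq_iff kron_def mat_def prod_eq_iff)

lemma kron_unitary:
  "U ** ctranspose U = mat 1 \<Longrightarrow> V ** ctranspose V = mat 1 \<Longrightarrow> kron U V ** ctranspose (kron U V) = mat 1"
  by (simp add: ctranspose_kron kron_mult kron_mat_1)

lemma kron_invertible: 
  assumes "invertible A" "invertible B" 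
  shows "invertible (kron A B)"
proof (rule invertible_rightI)
  show "kron A B ** kron (matrix_inv A) (matrix_inv B) = mat 1"
    by (simp add: kron_mult kron_mat_1 matrix_inv_cancel assms)
qed

lemma kron_nakano: "kron P Q ** nakano_matrix c ** kron P' Q' =
  nakano_matrix (\<chi> a b. \<chi> l m. \<Sum>j\<in>UNIV. \<Sum>k\<in>UNIV. P $ a $ j * P' $ k $ b * (Q ** (c $ j $ k) ** Q') $ l $ m)"
proof -
  have "(kron P Q ** nakano_matrix c ** kron P' Q') $ (a, l) $ (b, m) =
      (\<Sum>j\<in>UNIV. \<Sum>k\<in>UNIV. P $ a $ j * P' $ k $ b * (Q ** (c $ j $ k) ** Q') $ l $ m)" for a l b m
  proof -
    let ?f = "\<lambda>j p k q. P $ a $ j * P' $ k $ b * (Q $ l $ p * c $ j $ k $ p $ q * Q' $ q $ m)"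
    have "(kron P Q ** nakano_matrix c ** kron P' Q') $ (a, l) $ (b, m) =
        (\<Sum>k\<in>UNIV. \<Sum>q\<in>UNIV. \<Sum>j\<in>UNIV. \<Sum>p\<in>UNIV. ?f j p k q)"
      by (simp add: kron_def nakano_matrix_def matrix_matrix_mult_def sum_UNIV_prod sum_distrib_left sum_distrib_right mult_ac)
    also have "\<dots> = (\<Sum>k\<in>UNIV. \<Sum>j\<in>UNIV. \<Sum>q\<in>UNIV. \<Sum>p\<in>UNIV. ?f j p k q)"
      by (intro sum.cong refl sum.swap)
    also have "\<dots> = (\<Sum>j\<in>UNIV. \<Sum>k\<in>UNIV. \<Sum>q\<in>UNIV. \<Sum>p\<in>UNIV. ?f j p k q)"
      by (rule sum.swap)
    also have "\<dots> = (\<Sum>j\<in>UNIV. \<Sum>k\<in>UNIV. P $ a $ j * P' $ k $ b * (Q ** (c $ j $ k) ** Q') $ l $ m)"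
      by (simp add: matrix_matrix_mult_def sum_distrib_left sum_distrib_right)
    finally show ?thesis .
  qed
  then show ?thesis by (auto simp: vec_eq_iff nakano_matrix_def)
qed

lemma nakano_matrix_inj: "nakano_matrix a = nakano_matrix b \<longleftrightarrow> a = b"
  by (auto simp: vec_eq_iff nakano_matrix_def)

lemma matrix_inv_mat_1 [simp]: "matrix_inv (mat 1 :: 'a::field^'k^'k) = mat 1"
  by (simp add: matrix_inv_eqI)

text \<open>On index pairs, coordinates and frame act together as a Kronecker product, so that
  composition laws and norms become matrix algebra. The action is a congruence only for unitary
  \<open>S\<close>, as the right factor carries \<open>matrix_inv S\<close>.\<close>

lemma nakano_change: "nakano_matrix (in_coords T (in_frame S c)) =
    kron T S ** nakano_matrix c ** kron (ctranspose T) (matrix_inv S)"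
  by (simp add: kron_nakano nakano_matrix_inj vec_eq_iff in_coords_def in_frame_def)

lemma in_frame_mat_1 [simp]: "in_frame (mat 1) c = c"
  by (simp add: vec_eq_iff in_frame_def)

lemma in_coords_mat_1 [simp]: "in_coords (mat 1) c = c"
  by (simp add: nakano_matrix_inj[symmetric] nakano_change[of "mat 1" "mat 1", simplified] kron_mat_1)

lemma nakano_in_coords: "nakano_matrix (in_coords T c) =
    kron T (mat 1) ** nakano_matrix c ** kron (ctranspose T) (mat 1)"
  using nakano_change[of T "mat 1" c] by simp

lemma nakano_in_frame: "nakano_matrix (in_frame S c) =
    kron (mat 1) S ** nakano_matrix c ** kron (mat 1) (matrix_inv S)"
  using nakano_change[of "mat 1" S c] by simp

lemma in_frame_in_frame:
  assumes "invertible S" "invertible U"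
  shows "in_frame U (in_frame S c) = in_frame (U ** S) c"
  by (simp add: in_frame_def vec_eq_iff matrix_inv_mul assms matrix_mul_assoc)

lemma in_coords_in_coords: "in_coords V (in_coords T c) = in_coords (V ** T) c"
proof -
  have "nakano_matrix (in_coords V (in_coords T c)) =
      (kron V (mat 1) ** kron T (mat 1)) ** nakano_matrix c ** (kron (ctranspose T) (mat 1) ** kron (ctranspose V) (mat 1))"
    by (simp only: nakano_in_coords matrix_mul_assoc)
  then show ?thesis by (simp add: kron_mult nakano_in_coords[symmetric] ctranspose_mul[symmetric] nakano_matrix_inj)
qed

lemma in_frame_in_coords: "in_frame S (in_coords T c) = in_coords T (in_frame S c)"
proof -
  have "nakano_matrix (in_frame S (in_coords T c)) =
      (kron (mat 1) S ** kron T (mat 1)) ** nakano_matrix c ** (kron (ctranspose T) (mat 1) ** kron (mat 1) (matrix_inv S))"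
    by (simp only: nakano_in_frame nakano_in_coords matrix_mul_assoc)
  then show ?thesis by (simp add: kron_mult nakano_change[symmetric] nakano_matrix_inj)
qed

lemma nakano_matrix_linear: "linear nakano_matrix"
  by (rule linearI) (simp_all add: vec_eq_iff nakano_matrix_def)

lemma linear_in_frame: "linear (in_frame S)"
  by (rule linearI) (simp_all add: in_frame_def vec_eq_iff
    bounded_bilinear.add_left[OF bounded_bilinear_matrix_mul]
    bounded_bilinear.add_right[OF bounded_bilinear_matrix_mul]
    bounded_bilinear.scaleR_left[OF bounded_bilinear_matrix_mul]
    bounded_bilinear.scaleR_right[OF bounded_bilinear_matrix_mul])

lemma linear_in_coords: "linear (in_coords T)"
  by (rule linearI) (simp_all add: in_coords_def vec_eq_iff sum.distrib algebra_simps scaleR_sum_right)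

lemma norm_curv_sq: "(norm (c::('n::finite,'r::finite) curv))\<^sup>2 =
    (\<Sum>j\<in>UNIV. \<Sum>k\<in>UNIV. \<Sum>l\<in>UNIV. \<Sum>m\<in>UNIV. (cmod (c $ j $ k $ l $ m))\<^sup>2)"
  by (simp add: norm_vec_sq)

lemma norm_nakano: "norm (nakano_matrix c) = norm c"
proof -
  have "(norm (nakano_matrix c))\<^sup>2 = (\<Sum>j\<in>UNIV. \<Sum>l\<in>UNIV. \<Sum>k\<in>UNIV. \<Sum>m\<in>UNIV. (cmod (c $ j $ k $ l $ m))\<^sup>2)"
    by (simp add: norm_matrix_sq nakano_matrix_def sum_UNIV_prod)
  also have "\<dots> = (norm c)\<^sup>2"
    unfolding norm_curv_sq by (intro sum.cong refl sum.swap)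
  finally show ?thesis by (simp add: power2_eq_iff_nonneg)
qed

text \<open>Exchanges the endomorphism indices only, passing from E to its dual; through it the dual
  Nakano case is reduced to the Nakano case throughout.\<close>

definition tcurv :: "('n::finite, 'r::finite) curv \<Rightarrow> ('n, 'r) curv" where
  "tcurv c = (\<chi> j k. transpose (c $ j $ k))"

lemma dual_nakano_tcurv: "dual_nakano_matrix c = nakano_matrix (tcurv c)"
  by (simp add: vec_eq_iff dual_nakano_matrix_def nakano_matrix_def tcurv_def transpose_def)

lemma tcurv_tcurv [simp]: "tcurv (tcurv c) = c"
  by (simp add: tcurv_def vec_eq_iff)

lemma linear_tcurv: "linear tcurv"
  by (rule linearI) (simp_all add: tcurv_def vec_eq_iff transpose_def)

lemma tcurv_in_coords: "tcurv (in_coords T c) = in_coords T (tcurv c)"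
  by (simp add: tcurv_def vec_eq_iff transpose_def in_coords_def)

text \<open>The dual bundle sees the contragredient frame; for unitary \<open>S\<close> it is again
  unitary, so invariance statements carry over.\<close>

lemma tcurv_in_frame:
  assumes "invertible S"
  shows "tcurv (in_frame S c) = in_frame (transpose (matrix_inv S)) (tcurv c)"
proof -
  have "matrix_inv (transpose (matrix_inv S)) = transpose S"
    by (rule matrix_inv_eqI) (simp add: matrix_transpose_mul[symmetric] matrix_inv_cancel assms)
  then show ?thesis
    by (simp add: tcurv_def in_frame_def matrix_transpose_mul matrix_mul_assoc)
qed

lemma linear_contract: "linear (\<lambda>c. contract c v)"
  by (rule linearI) (simp_all add: contract_def vec_eq_iff sum.distrib algebra_simps scaleR_sum_right)

lemma contract_in_coords: "contract (in_coords T c) v = T ** contract c v ** ctranspose T"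
proof -
  have "contract (in_coords T c) v $ a $ b = (T ** contract c v ** ctranspose T) $ a $ b" for a b
  proof -
    let ?f = "\<lambda>j k l m. T $ a $ j * cnj (T $ b $ k) * c $ j $ k $ l $ m * v $ l * cnj (v $ m)"
    have "contract (in_coords T c) v $ a $ b = (\<Sum>l\<in>UNIV. \<Sum>m\<in>UNIV. \<Sum>j\<in>UNIV. \<Sum>k\<in>UNIV. ?f j k l m)"
      by (simp add: contract_def in_coords_def sum_distrib_right)
    also have "\<dots> = (\<Sum>l\<in>UNIV. \<Sum>j\<in>UNIV. \<Sum>m\<in>UNIV. \<Sum>k\<in>UNIV. ?f j k l m)"
      by (intro sum.cong refl sum.swap)
    also have "\<dots> = (\<Sum>l\<in>UNIV. \<Sum>j\<in>UNIV. \<Sum>k\<in>UNIV. \<Sum>m\<in>UNIV. ?f j k l m)"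
      by (intro sum.cong refl sum.swap)
    also have "\<dots> = (\<Sum>j\<in>UNIV. \<Sum>l\<in>UNIV. \<Sum>k\<in>UNIV. \<Sum>m\<in>UNIV. ?f j k l m)"
      by (rule sum.swap)
    also have "\<dots> = (\<Sum>j\<in>UNIV. \<Sum>k\<in>UNIV. \<Sum>l\<in>UNIV. \<Sum>m\<in>UNIV. ?f j k l m)"
      by (intro sum.cong refl sum.swap)
    also have "\<dots> = (\<Sum>k\<in>UNIV. \<Sum>j\<in>UNIV. \<Sum>l\<in>UNIV. \<Sum>m\<in>UNIV. ?f j k l m)"
      by (rule sum.swap)
    also have "\<dots> = (T ** contract c v ** ctranspose T) $ a $ b"
      by (simp add: contract_def matrix_matrix_mult_def sum_distrib_right sum_distrib_left mult_ac)
    finally show ?thesis .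
  qed
  then show ?thesis by (simp add: vec_eq_iff)
qed

lemma contract_qform: "contract c v $ j $ k = qform (c $ j $ k) v"
  by (simp add: contract_def qform_def)

lemma contract_in_frame_unitary:
  assumes "U ** ctranspose U = mat 1"
  shows "contract (in_frame U c) v = contract c (v v* U)"
  by (simp add: vec_eq_iff contract_qform in_frame_def matrix_inv_unitary[OF assms] qform_congruence)

subsection \<open>Hermitian curvature and positivity\<close>

declare positive.simps [simp del]

text \<open>The reality condition for a (1,1)-form with values in hermitian endomorphisms, in an
  orthonormal frame.\<close>

definition hermc :: "('n::finite, 'r::finite) curv \<Rightarrow> bool" where
  "hermc c \<longleftrightarrow> (\<forall>j k. ctranspose (c $ j $ k) = c $ k $ j)"

lemma hermc_nakano: "hermc c \<longleftrightarrow> hermitian (nakano_matrix c)"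
  by (auto simp: hermc_def hermitian_def vec_eq_iff nakano_matrix_def)

lemma hermc_tcurv: "hermc c \<Longrightarrow> hermc (tcurv c)"
  by (auto simp: hermc_def vec_eq_iff tcurv_def transpose_def)

lemma hermc_in_coords: "hermc c \<Longrightarrow> hermc (in_coords T c)"
proof -
  have "ctranspose (kron T (mat 1)) = kron (ctranspose T) (mat 1)" by (simp add: ctranspose_kron)
  then show "hermc c \<Longrightarrow> hermc (in_coords T c)"
    by (metis hermc_nakano hermitian_congruence nakano_in_coords)
qed

lemma hermc_contract: "hermc c \<Longrightarrow> hermitian (contract c v)"
proof -
  assume "hermc c"
  then have *: "cnj (c $ j $ k $ l $ m) = c $ k $ j $ m $ l" for j k l m
    unfolding hermc_def by (metis ctranspose_nth)
  have "cnj (contract c v $ k $ j) = contract c v $ j $ k" for j k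
    unfolding contract_def by (simp add: *) (subst sum.swap, simp add: mult_ac)
  then show ?thesis by (simp add: hermitian_def vec_eq_iff)
qed

lemma positive_Nakano_iff:
  fixes c :: "('n::finite, 'r::finite) curv"
  shows "positive Nakano c \<longleftrightarrow> (\<forall>w. w \<noteq> 0 \<longrightarrow> Re (qform (nakano_matrix c) w) > 0)"
proof -
  have eq: "qform (nakano_matrix c) w = (\<Sum>j\<in>UNIV. \<Sum>k\<in>UNIV. \<Sum>l\<in>UNIV. \<Sum>m\<in>UNIV.
           c $ j $ k $ l $ m * w $ (j, l) * cnj (w $ (k, m)))" for w
  proof -
    have "qform (nakano_matrix c) w = (\<Sum>j\<in>UNIV. \<Sum>l\<in>UNIV. \<Sum>k\<in>UNIV. \<Sum>m\<in>UNIV.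
           c $ j $ k $ l $ m * w $ (j, l) * cnj (w $ (k, m)))"
      by (simp add: qform_def nakano_matrix_def sum_UNIV_prod)
    then show ?thesis by (simp add: sum.swap[of _ "UNIV::'n set" "UNIV::'r set"])
  qed
  show ?thesis
  proof
    assume L: "positive Nakano c"
    show "\<forall>w. w \<noteq> 0 \<longrightarrow> Re (qform (nakano_matrix c) w) > 0"
    proof (intro allI impI)
      fix w :: "complex^('n \<times> 'r)" assume "w \<noteq> 0"
      then have "(\<chi> j l. w $ (j, l)) \<noteq> 0" by (auto simp: vec_eq_iff)
      then show "Re (qform (nakano_matrix c) w) > 0"
        using L unfolding positive.simps eq by (auto dest!: spec[of _ "\<chi> j l. w $ (j, l)"])
    qed
  next
    assume R: "\<forall>w. w \<noteq> 0 \<longrightarrow> Re (qform (nakano_matrix c) w) > 0"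
    show "positive Nakano c"
      unfolding positive.simps
    proof (intro allI impI)
      fix g :: "complex^'r^'n" assume "g \<noteq> 0"
      then have "(\<chi> p. g $ fst p $ snd p) \<noteq> 0" by (auto simp: vec_eq_iff)
      then show "Re (\<Sum>j\<in>UNIV. \<Sum>k\<in>UNIV. \<Sum>l\<in>UNIV. \<Sum>m\<in>UNIV. c $ j $ k $ l $ m * g $ j $ l * cnj (g $ k $ m)) > 0"
        using R unfolding eq by (auto dest!: spec[of _ "\<chi> p. g $ fst p $ snd p"])
    qed
  qed
qed

lemma positive_DualNakano_iff: "positive DualNakano c \<longleftrightarrow> positive Nakano (tcurv c)"
  by (simp add: positive.simps tcurv_def transpose_def)

lemma positive_Griffiths_iff:
  "positive Griffiths c \<longleftrightarrow> (\<forall>\<xi> v. \<xi> \<noteq> 0 \<longrightarrow> v \<noteq> 0 \<longrightarrow> Re (qform (contract c v) \<xi>) > 0)"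
proof -
  have "qform (contract c v) \<xi> = (\<Sum>j\<in>UNIV. \<Sum>k\<in>UNIV. \<Sum>l\<in>UNIV. \<Sum>m\<in>UNIV.
           c $ j $ k $ l $ m * \<xi> $ j * cnj (\<xi> $ k) * v $ l * cnj (v $ m))" for v \<xi>
    by (simp add: qform_def contract_def sum_distrib_left sum_distrib_right mult_ac)
  then show ?thesis by (simp only: positive.simps)
qed

text \<open>Coordinates may change by any invertible matrix, since positivity concerns a form on
  tangent vectors; frames only unitarily, since the coefficients refer to orthonormal
  frames.\<close>

lemma positive_in_frame_in_coords:
  fixes c :: "('n::finite, 'r::finite) curv"
  assumes S: "U ** ctranspose U = mat 1" and T: "invertible T" and pos: "positive P c"
  shows "positive P (in_coords T (in_frame U c))"
proof -
  have nak: "positive Nakano (in_coords T (in_frame U c))"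
    if U: "U ** ctranspose U = mat 1" and "positive Nakano c" for c :: "('n,'r) curv" and U :: "complex^'r^'r"
  proof -
    have "invertible (kron T U)" using T invertible_rightI[OF U] by (rule kron_invertible)
    moreover have "nakano_matrix (in_coords T (in_frame U c)) = kron T U ** nakano_matrix c ** ctranspose (kron T U)"
      by (simp add: nakano_change matrix_inv_unitary[OF U] ctranspose_kron)
    ultimately show ?thesis
      using that(2) by (simp add: positive_Nakano_iff qform_congruence vector_matrix_mult_nz)
  qed
  show ?thesis
  proof (cases P)
    case Nakano then show ?thesis using nak[OF S] pos by simp
  next
    case DualNakano
    have "transpose (matrix_inv U) ** ctranspose (transpose (matrix_inv U)) = mat 1"
      unfolding matrix_inv_unitary[OF S] by (intro unitary_transpose unitary_ctranspose S)
    from nak[OF this] pos show ?thesis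
      unfolding DualNakano positive_DualNakano_iff tcurv_in_coords tcurv_in_frame[OF invertible_rightI[OF S]] .
  next
    case Griffiths
    have "invertible (U::complex^'r^'r)" using S by (rule invertible_rightI)
    then show ?thesis using pos T unfolding Griffiths positive_Griffiths_iff
      by (simp add: contract_in_coords contract_in_frame_unitary[OF S] qform_congruence vector_matrix_mult_nz)
  qed
qed

text \<open>Test on decomposable tensors: \<open>\<xi>\<close> tensor \<open>v\<close> in the Nakano
  case, \<open>\<xi>\<close> tensor the conjugate of \<open>v\<close> in the dual case.\<close>

lemma positive_imp_Griffiths: "positive P c \<Longrightarrow> positive Griffiths c"
  for c :: "('n::finite, 'r::finite) curv"
proof (cases P)
  case Nakano
  assume pos: "positive P c"
  show ?thesis unfolding positive.simps
  proof (intro allI impI)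
    fix \<xi> :: "complex^'n" and v :: "complex^'r" assume "\<xi> \<noteq> 0" "v \<noteq> 0"
    then have "(\<chi> j l. \<xi> $ j * v $ l) \<noteq> 0" by (auto simp: vec_eq_iff)
    from pos[unfolded Nakano positive.simps, rule_format, OF this]
    have "Re (\<Sum>j\<in>UNIV. \<Sum>k\<in>UNIV. \<Sum>l\<in>UNIV. \<Sum>m\<in>UNIV. c $ j $ k $ l $ m * (\<xi> $ j * v $ l) * cnj (\<xi> $ k * v $ m)) > 0"
      by (simp only: vec_lambda_beta)
    moreover have "c $ j $ k $ l $ m * (\<xi> $ j * v $ l) * cnj (\<xi> $ k * v $ m) =
      c $ j $ k $ l $ m * \<xi> $ j * cnj (\<xi> $ k) * v $ l * cnj (v $ m)" for j k l m
      by (simp add: mult_ac)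
    ultimately show "Re (\<Sum>j\<in>UNIV. \<Sum>k\<in>UNIV. \<Sum>l\<in>UNIV. \<Sum>m\<in>UNIV. c $ j $ k $ l $ m * \<xi> $ j * cnj (\<xi> $ k) * v $ l * cnj (v $ m)) > 0"
      by (simp only:)
  qed
next
  case DualNakano
  assume pos: "positive P c"
  show ?thesis unfolding positive.simps
  proof (intro allI impI)
    fix \<xi> :: "complex^'n" and v :: "complex^'r" assume "\<xi> \<noteq> 0" "v \<noteq> 0"
    then have "(\<chi> j l. \<xi> $ j * cnj (v $ l)) \<noteq> 0" by (auto simp: vec_eq_iff)
    from pos[unfolded DualNakano positive.simps, rule_format, OF this]
    have "Re (\<Sum>j\<in>UNIV. \<Sum>k\<in>UNIV. \<Sum>l\<in>UNIV. \<Sum>m\<in>UNIV. c $ j $ k $ m $ l * (\<xi> $ j * cnj (v $ l)) * cnj (\<xi> $ k * cnj (v $ m))) > 0"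
      by (simp only: vec_lambda_beta)
    moreover have "(\<Sum>l\<in>UNIV. \<Sum>m\<in>UNIV. c $ j $ k $ m $ l * (\<xi> $ j * cnj (v $ l)) * cnj (\<xi> $ k * cnj (v $ m))) =
        (\<Sum>l\<in>UNIV. \<Sum>m\<in>UNIV. c $ j $ k $ l $ m * \<xi> $ j * cnj (\<xi> $ k) * v $ l * cnj (v $ m))" for j k
      by (subst sum.swap) (simp add: mult_ac)
    ultimately show "Re (\<Sum>j\<in>UNIV. \<Sum>k\<in>UNIV. \<Sum>l\<in>UNIV. \<Sum>m\<in>UNIV. c $ j $ k $ l $ m * \<xi> $ j * cnj (\<xi> $ k) * v $ l * cnj (v $ m)) > 0"
      by (simp only:)
  qed
qed simp

lemma qform_sum_left: "qform (\<Sum>i\<in>I. A i) v = (\<Sum>i\<in>I. qform (A i) v)"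
  by (induction I rule: infinite_finite_induct) (simp_all add: qform_add, simp_all add: qform_def)

lemma trace_form_contract: "trace_form c = (\<Sum>l\<in>UNIV. contract c (axis l 1))"
proof -
  have "contract c (axis l 1) $ j $ k = c $ j $ k $ l $ l" for j k l
  proof -
    have "contract c (axis l 1) $ j $ k = (\<Sum>a\<in>UNIV. \<Sum>b\<in>UNIV. if a = l then if b = l then c $ j $ k $ l $ l else 0 else 0)"
      unfolding contract_def by (simp, intro sum.cong refl) (auto simp: axis_def)
    also have "\<dots> = (\<Sum>a\<in>UNIV. if a = l then c $ j $ k $ l $ l else 0)" by (intro sum.cong refl) simp
    finally show ?thesis by simp
  qed
  then show ?thesis by (simp add: vec_eq_iff trace_form_def trace_def)
qed

text \<open>The trace is the sum of the contractions with the vectors of the frame, each of which is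
  positive by Griffiths positivity.\<close>

lemma positive_trace_form:
  assumes "positive P c" "\<xi> \<noteq> 0"
  shows "Re (qform (trace_form c) \<xi>) > 0"
proof -
  have "Re (qform (contract c (axis l 1)) \<xi>) > 0" for l
    using positive_imp_Griffiths[OF assms(1)] assms(2) unfolding positive_Griffiths_iff by (auto simp: axis_eq_0_iff)
  then show ?thesis unfolding trace_form_contract qform_sum_left Re_sum by (intro sum_pos) auto
qed

section \<open>Integrals over the unit sphere depending on a parameter\<close>

text \<open>The complement is the projection of a closed set along a compact factor, hence
  closed.\<close>

lemma open_forall_compact:
  fixes F :: "'a::euclidean_space \<Rightarrow> 'b::euclidean_space \<Rightarrow> real"
  assumes "compact K" and cont: "continuous_on UNIV (\<lambda>(c, v). F c v)"
  shows "open {c. \<forall>v\<in>K. F c v > 0}"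
proof -
  have c2: "continuous_on UNIV (\<lambda>p. F (snd p) (fst p))"
    using continuous_on_compose2[OF cont continuous_on_swap[of UNIV]] by (simp add: case_prod_beta)
  have "closed {p. F (snd p) (fst p) \<le> 0}"
    by (rule closed_Collect_le[OF c2 continuous_on_const])
  from closed_compact_projection[OF assms(1) this]
  have "open (- {c. \<exists>v. v \<in> K \<and> F c v \<le> 0})" by (simp add: open_Compl)
  moreover have "- {c. \<exists>v. v \<in> K \<and> F c v \<le> 0} = {c. \<forall>v\<in>K. F c v > 0}"
    by (auto simp: not_le)
  ultimately show ?thesis by simp
qed

lemma set_integrable_continuous_compact:
  fixes f :: "'b::euclidean_space \<Rightarrow> real"
  assumes "prob_space M" "sets M = sets borel" "compact K" "continuous_on K f"
  shows "set_integrable M K f"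
proof -
  interpret prob_space M by fact
  have meas: "(\<lambda>v. indicator K v *\<^sub>R f v) \<in> borel_measurable M"
    unfolding measurable_cong_sets[OF assms(2) refl]
    by (rule borel_measurable_continuous_on_indicator) (use assms in \<open>auto simp: compact_imp_closed\<close>)
  have "compact (f ` K)" using assms by (simp add: compact_continuous_image)
  then obtain B where "\<And>v. v \<in> K \<Longrightarrow> norm (f v) \<le> B"
    using compact_imp_bounded bounded_iff by (metis imageI)
  then have "AE v in M. norm (indicator K v *\<^sub>R f v) \<le> max B 0"
    by (intro AE_I2) (auto simp: indicator_def le_max_iff_disj)
  then show ?thesis unfolding set_integrable_def by (rule integrable_const_bound[OF _ meas])
qed

lemma set_integral_le_const:
  fixes f :: "'b::euclidean_space \<Rightarrow> real"
  assumes M: "prob_space M" "sets M = sets borel" and "compact K" "continuous_on K f"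
    and b: "\<And>v. v \<in> K \<Longrightarrow> \<bar>f v\<bar> \<le> B" and "B \<ge> 0"
  shows "\<bar>LINT v:K|M. f v\<bar> \<le> B"
proof -
  interpret prob_space M by fact
  have int: "integrable M (\<lambda>v. indicator K v *\<^sub>R f v)"
    using set_integrable_continuous_compact[OF assms(1-4)] by (simp add: set_integrable_def)
  have "\<bar>LINT v:K|M. f v\<bar> \<le> (\<integral>v. norm (indicator K v *\<^sub>R f v) \<partial>M)"
    unfolding set_lebesgue_integral_def using integral_norm_bound[of M "\<lambda>v. indicator K v *\<^sub>R f v"] by simp
  also have "\<dots> \<le> (\<integral>v. B \<partial>M)"
    by (intro integral_mono integrable_norm int) (use b \<open>B \<ge> 0\<close> in \<open>auto simp: indicator_def\<close>)
  finally show ?thesis by (simp add: prob_space)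
qed

text \<open>Uniform continuity on the product of a closed ball with \<open>K\<close>; continuity of
  parameter integrals and differentiation under the integral both rest on this estimate, uniform in
  the variable of integration.\<close>

lemma uniform_limit_compact_parameter:
  fixes g :: "'a::euclidean_space \<Rightarrow> 'b::euclidean_space \<Rightarrow> 'c::real_normed_vector"
  assumes "compact K" "open U" "continuous_on (U \<times> K) (\<lambda>(x, v). g x v)" "x0 \<in> U" "e > 0"
  obtains d where "d > 0" "cball x0 d \<subseteq> U" "\<And>x v. x \<in> cball x0 d \<Longrightarrow> v \<in> K \<Longrightarrow> norm (g x v - g x0 v) \<le> e"
proof -
  obtain r where r: "r > 0" "cball x0 r \<subseteq> U" using assms by (meson open_contains_cball)
  have "compact (cball x0 r \<times> K)" using assms by (intro compact_Times) auto
  moreover have "continuous_on (cball x0 r \<times> K) (\<lambda>(x, v). g x v)"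
    using assms(3) by (rule continuous_on_subset) (use r in auto)
  ultimately have "uniformly_continuous_on (cball x0 r \<times> K) (\<lambda>(x, v). g x v)"
    by (rule compact_uniformly_continuous[rotated])
  then obtain d where d: "d > 0" "\<And>p q. p \<in> cball x0 r \<times> K \<Longrightarrow> q \<in> cball x0 r \<times> K \<Longrightarrow> dist q p < d
      \<Longrightarrow> dist (case q of (x, v) \<Rightarrow> g x v) (case p of (x, v) \<Rightarrow> g x v) < e"
    unfolding uniformly_continuous_on_def using \<open>e > 0\<close> by metis
  show ?thesis
  proof
    show "min r (d/2) > 0" using r d by simp
    show "cball x0 (min r (d/2)) \<subseteq> U" using r by auto
    show "norm (g x v - g x0 v) \<le> e" if "x \<in> cball x0 (min r (d/2))" "v \<in> K" for x v
      using d(2)[of "(x0, v)" "(x, v)"] that r d(1)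
      by (auto simp: dist_Pair_Pair dist_commute dist_norm norm_minus_commute)
  qed
qed

lemma continuous_on_parameter:
  assumes "continuous_on (U \<times> K) (\<lambda>(x, v). g x v)" "x \<in> U"
  shows "continuous_on K (g x)"
proof -
  have "continuous_on K (\<lambda>v. (\<lambda>(x, v). g x v) (x, v))"
    by (rule continuous_on_compose2[OF assms(1)]) (use assms(2) in \<open>auto intro!: continuous_intros\<close>)
  then show ?thesis by simp
qed

lemma continuous_on_set_integral:
  fixes f :: "'a::euclidean_space \<Rightarrow> 'b::euclidean_space \<Rightarrow> real"
  assumes M: "prob_space M" "sets M = sets borel" and K: "compact K" and U: "open U"
    and cont: "continuous_on (U \<times> K) (\<lambda>(x, v). f x v)"
  shows "continuous_on U (\<lambda>x. LINT v:K|M. f x v)"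
  unfolding continuous_on_iff
proof (intro ballI allI impI)
  fix x0 and e :: real assume x0: "x0 \<in> U" and e: "e > 0"
  obtain d where d: "d > 0" "cball x0 d \<subseteq> U" "\<And>x v. x \<in> cball x0 d \<Longrightarrow> v \<in> K \<Longrightarrow> norm (f x v - f x0 v) \<le> e / 2"
    using uniform_limit_compact_parameter[OF K U cont x0, of "e/2"] e by auto
  have "dist (LINT v:K|M. f x v) (LINT v:K|M. f x0 v) < e" if "dist x x0 < d" for x
  proof -
    have x: "x \<in> cball x0 d" "x \<in> U" using that d by (auto simp: dist_commute)
    note c = continuous_on_parameter[OF cont x(2)] continuous_on_parameter[OF cont x0]
    have "(LINT v:K|M. f x v) - (LINT v:K|M. f x0 v) = (LINT v:K|M. f x v - f x0 v)"
      by (rule set_integral_diff(2)[symmetric]) (intro set_integrable_continuous_compact M K c)+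
    moreover have "\<bar>LINT v:K|M. f x v - f x0 v\<bar> \<le> e / 2"
      using d(3)[OF x(1)] e by (intro set_integral_le_const M K continuous_on_diff c) auto
    ultimately show ?thesis using e by (simp add: dist_real_def)
  qed
  then show "\<exists>d>0. \<forall>x\<in>U. dist x x0 < d \<longrightarrow> dist (LINT v:K|M. f x v) (LINT v:K|M. f x0 v) < e"
    using d(1) by blast
qed

text \<open>The differential is given by a gradient field \<open>g\<close>, so that its joint
  continuity is a statement about vectors. The mean value inequality bounds the remainder of the
  integrand by \<open>e * norm (y - x0)\<close> uniformly in \<open>v\<close>, and the probability
  measure keeps the bound.\<close>

lemma has_derivative_set_integral:
  fixes f :: "'a::euclidean_space \<Rightarrow> 'b::euclidean_space \<Rightarrow> real" and g :: "'a \<Rightarrow> 'b \<Rightarrow> 'a"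
  assumes M: "prob_space M" "sets M = sets borel" and K: "compact K" and U: "open U"
    and cf: "continuous_on (U \<times> K) (\<lambda>(x, v). f x v)" and cg: "continuous_on (U \<times> K) (\<lambda>(x, v). g x v)"
    and der: "\<And>x v. x \<in> U \<Longrightarrow> v \<in> K \<Longrightarrow> ((\<lambda>x. f x v) has_derivative (\<lambda>h. g x v \<bullet> h)) (at x)"
    and x0: "x0 \<in> U"
  shows "((\<lambda>x. LINT v:K|M. f x v) has_derivative (\<lambda>h. LINT v:K|M. g x0 v \<bullet> h)) (at x0)"
  unfolding has_derivative_at_alt
proof (intro conjI allI impI)
  note si = set_integrable_continuous_compact[OF M K]
  note cgx = continuous_on_parameter[OF cg x0]
  have ig: "set_integrable M K (\<lambda>v. g x0 v \<bullet> h)" for h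
    by (intro si continuous_intros cgx)
  show "bounded_linear (\<lambda>h. LINT v:K|M. g x0 v \<bullet> h)"
    by (intro linear_conv_bounded_linear[THEN iffD1] linearI) (simp_all add: inner_add_right ig)
  fix e :: real assume e: "e > 0"
  obtain d where d: "d > 0" "cball x0 d \<subseteq> U" "\<And>x v. x \<in> cball x0 d \<Longrightarrow> v \<in> K \<Longrightarrow> norm (g x v - g x0 v) \<le> e"
    using uniform_limit_compact_parameter[OF K U cg x0 e] by blast
  have main: "norm ((LINT v:K|M. f y v) - (LINT v:K|M. f x0 v) - (LINT v:K|M. g x0 v \<bullet> (y - x0))) \<le> e * norm (y - x0)"
    if y: "norm (y - x0) < d" for y
  proof -
    have yU: "y \<in> U" using y d by (auto simp: dist_norm norm_minus_commute)
    note c = continuous_on_parameter[OF cf yU] continuous_on_parameter[OF cf x0]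
    have eq: "(LINT v:K|M. f y v) - (LINT v:K|M. f x0 v) - (LINT v:K|M. g x0 v \<bullet> (y - x0)) =
        (LINT v:K|M. f y v - f x0 v - g x0 v \<bullet> (y - x0))"
      by (simp add: si c ig set_integral_diff)
    have "\<bar>LINT v:K|M. f y v - f x0 v - g x0 v \<bullet> (y - x0)\<bar> \<le> e * norm (y - x0)"
    proof (intro set_integral_le_const M K)
      show "continuous_on K (\<lambda>v. f y v - f x0 v - g x0 v \<bullet> (y - x0))" by (intro continuous_intros c cgx)
      fix v assume v: "v \<in> K"
      have 1: "x0 + t *\<^sub>R (y - x0) \<in> cball x0 d" if "t \<in> {0..1}" for t
      proof -
        have "t * norm (y - x0) \<le> 1 * d" using that y by (intro mult_mono) auto
        then show ?thesis using that by (simp add: dist_norm)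
      qed
      have 2: "((\<lambda>x. f x v) has_derivative (\<lambda>h. g x v \<bullet> h)) (at x within cball x0 d)" if "x \<in> cball x0 d" for x
        by (rule has_derivative_at_withinI) (intro der v subsetD[OF d(2)] that)
      have 3: "onorm ((\<lambda>h. g x v \<bullet> h) - (\<lambda>h. g x0 v \<bullet> h)) \<le> e" if "x \<in> cball x0 d" for x
      proof (rule onorm_bound)
        fix h
        have "norm (((\<lambda>h. g x v \<bullet> h) - (\<lambda>h. g x0 v \<bullet> h)) h) = \<bar>(g x v - g x0 v) \<bullet> h\<bar>" by (simp add: inner_diff_left)
        also have "\<dots> \<le> norm (g x v - g x0 v) * norm h" by (rule Cauchy_Schwarz_ineq2)
        also have "\<dots> \<le> e * norm h" by (intro mult_right_mono d(3) that v) auto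
        finally show "norm (((\<lambda>h. g x v \<bullet> h) - (\<lambda>h. g x0 v \<bullet> h)) h) \<le> e * norm h" .
      qed (use e in auto)
      have 4: "x0 \<in> cball x0 d" using d by simp
      have "norm (f y v - f x0 v - g x0 v \<bullet> (y - x0)) \<le> norm (y - x0) * e"
        using differentiable_bound_linearization[of x0 y "cball x0 d" "\<lambda>x. f x v" "\<lambda>x h. g x v \<bullet> h" x0 e, OF 1 2 3 4] .
      then show "\<bar>f y v - f x0 v - g x0 v \<bullet> (y - x0)\<bar> \<le> e * norm (y - x0)" by (simp add: mult.commute)
    qed (use e in auto)
    then show ?thesis unfolding eq by simp
  qed
  show "\<exists>d>0. \<forall>y. norm (y - x0) < d \<longrightarrow>
      norm ((LINT v:K|M. f y v) - (LINT v:K|M. f x0 v) - (LINT v:K|M. g x0 v \<bullet> (y - x0))) \<le> e * norm (y - x0)"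
    using d(1) main by blast
qed

section \<open>The functionals and their logarithmic derivatives\<close>

definition uG :: "('n::finite, 'r::finite) curv \<Rightarrow> complex^'r \<Rightarrow> real" where
  "uG c v = Re (top_power (contract c v))"

text \<open>With \<open>\<theta>\<close> for \<open>c\<close> contracted with \<open>v\<close>, this
  is the density of n \<open>\<theta>^(n-1)\<close> wedged with the contraction of \<open>k\<close>:
  the differential of \<open>uG\<close> in the direction \<open>k\<close>.\<close>

definition duG :: "('n::finite, 'r::finite) curv \<Rightarrow> ('n, 'r) curv \<Rightarrow> complex^'r \<Rightarrow> real" where
  "duG c k v = real CARD('n) * Re (pow_wedge (contract c v) (contract k v))"

lemma uG_det: "uG c v = fact CARD('n) * Re (det (contract (c::('n::finite, 'r::finite) curv) v))"
  by (simp add: uG_def top_power_det)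

lemma duG_Ddet: "duG c k v = fact CARD('n) * Re (Ddet (contract (c::('n::finite, 'r::finite) curv) v) (contract k v))"
  by (simp add: duG_def pow_wedge_Ddet)

lemma continuous_on_Ddet [continuous_intros]:
  "continuous_on S f \<Longrightarrow> continuous_on S g \<Longrightarrow> continuous_on S (\<lambda>x. Ddet (f x) (g x :: complex^'k^'k))"
  unfolding Ddet_def
proof (intro continuous_on_sum continuous_on_det continuous_on_vec_lambda)
  fix q i :: 'k
  assume "continuous_on S f" "continuous_on S g"
  then show "continuous_on S (\<lambda>x. if i = q then g x $ i else f x $ i)"
    by (cases "i = q") (auto intro: continuous_intros)
qed

lemma continuous_on_contract [continuous_intros]:
  "continuous_on S f \<Longrightarrow> continuous_on S g \<Longrightarrow> continuous_on S (\<lambda>x. contract (f x) (g x))"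
  unfolding contract_def by (intro continuous_intros)

lemma continuous_on_uG [continuous_intros]:
  "continuous_on S f \<Longrightarrow> continuous_on S g \<Longrightarrow> continuous_on S (\<lambda>x. uG (f x) (g x))"
  unfolding uG_det by (intro continuous_intros)

lemma continuous_on_duG [continuous_intros]:
  "continuous_on S f \<Longrightarrow> continuous_on S k \<Longrightarrow> continuous_on S g \<Longrightarrow> continuous_on S (\<lambda>x. duG (f x) (k x) (g x))"
  unfolding duG_Ddet by (intro continuous_intros)

lemma bounded_linear_duG: "bounded_linear (\<lambda>k. duG c k v)"
  unfolding duG_Ddet
  by (intro bounded_linear_compose[OF bounded_linear_mult_right] bounded_linear_compose[OF bounded_linear_Re]
      bounded_linear_compose[OF bounded_linear_Ddet] linear_conv_bounded_linear[THEN iffD1] linear_contract)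

lemma has_derivative_uG: "((\<lambda>c. uG c v) has_derivative (\<lambda>k. duG c k v)) (at c)"
  unfolding uG_det duG_Ddet
  by (intro has_derivative_mult_right bounded_linear.has_derivative[OF bounded_linear_Re]
      has_derivative_compose[OF _ has_derivative_det] linear_imp_has_derivative linear_contract)

text \<open>Represents the linear form \<open>duG\<close> by a vector, as differentiation under the
  integral demands.\<close>

definition gradG :: "('n::finite, 'r::finite) curv \<Rightarrow> complex^'r \<Rightarrow> ('n, 'r) curv" where
  "gradG c v = (\<Sum>b\<in>Basis. duG c b v *\<^sub>R b)"

lemma gradG: "gradG c v \<bullet> k = duG c k v"
proof -
  have "duG c k v = duG c (\<Sum>b\<in>Basis. (k \<bullet> b) *\<^sub>R b) v" by (simp add: euclidean_representation)
  also have "\<dots> = (\<Sum>b\<in>Basis. (k \<bullet> b) * duG c b v)"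
    using linear_sum[OF bounded_linear.linear[OF bounded_linear_duG[of c v]], of "\<lambda>b. (k \<bullet> b) *\<^sub>R b" Basis]
      linear_scale[OF bounded_linear.linear[OF bounded_linear_duG[of c v]]] by simp
  also have "\<dots> = gradG c v \<bullet> k"
    by (simp add: gradG_def inner_sum_left) (simp add: inner_commute[of k] mult.commute)
  finally show ?thesis by simp
qed

lemma continuous_on_gradG [continuous_intros]:
  "continuous_on S f \<Longrightarrow> continuous_on S g \<Longrightarrow> continuous_on S (\<lambda>x. gradG (f x) (g x))"
  unfolding gradG_def by (intro continuous_intros)

text \<open>Just enough for \<open>Phi\<close> to be differentiable. No hermitian symmetry is
  demanded, so this cuts out an open subset of all coefficient arrays, on which full derivatives
  exist; hermitian positive arrays belong to it.\<close>

fun good :: "pos_type \<Rightarrow> ('n::finite, 'r::finite) curv \<Rightarrow> bool" where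
  "good Nakano c \<longleftrightarrow> Re (det (nakano_matrix c)) > 0"
| "good DualNakano c \<longleftrightarrow> Re (det (dual_nakano_matrix c)) > 0"
| "good Griffiths c \<longleftrightarrow> (\<forall>v\<in>sphere 0 1. uG c v > 0)"

text \<open>The logarithmic derivative of \<open>Phi\<close> at \<open>c\<close> in the direction
  \<open>k\<close>. In the Griffiths case the outer exponent \<open>- 1 / s\<close> cancels the
  factor \<open>- s\<close> produced inside the integral.\<close>

fun dlog :: "pos_type \<Rightarrow> real \<Rightarrow> (complex^'r) measure \<Rightarrow> ('n::finite, 'r::finite) curv \<Rightarrow> ('n, 'r) curv \<Rightarrow> real" where
  "dlog Nakano s \<sigma> c k = Re (Ddet (nakano_matrix c) (nakano_matrix k)) / Re (det (nakano_matrix c)) / real CARD('r)"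
| "dlog DualNakano s \<sigma> c k = Re (Ddet (dual_nakano_matrix c) (dual_nakano_matrix k)) / Re (det (dual_nakano_matrix c)) / real CARD('r)"
| "dlog Griffiths s \<sigma> c k = (LINT v:sphere 0 1|\<sigma>. duG c k v / uG c v powr (s + 1)) / (LINT v:sphere 0 1|\<sigma>. 1 / uG c v powr s)"

text \<open>The factor of the distortion function that multiplies the norm of the trace free
  curvature. In \<omega>-orthonormal coordinates \<open>otimes_id (mat 1)\<close> stands for
  \<omega> tensor the identity.\<close>

fun dfactor :: "pos_type \<Rightarrow> real \<Rightarrow> (complex^'r) measure \<Rightarrow> ('n::finite, 'r::finite) curv \<Rightarrow> real" where
  "dfactor Nakano s \<sigma> c = norm (cof (nakano_matrix c)) / Re (det (nakano_matrix c)) / real CARD('r)"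
| "dfactor DualNakano s \<sigma> c = norm (cof (dual_nakano_matrix c)) / Re (det (dual_nakano_matrix c)) / real CARD('r)"
| "dfactor Griffiths s \<sigma> c = (LINT v:sphere 0 1|\<sigma>. duG c (otimes_id (mat 1)) v / uG c v powr (s + 1)) / (LINT v:sphere 0 1|\<sigma>. 1 / uG c v powr s)"

lemma bounded_linear_nakano: "bounded_linear nakano_matrix"
  using nakano_matrix_linear linear_conv_bounded_linear by blast

lemma bounded_linear_tcurv: "bounded_linear tcurv"
  using linear_tcurv linear_conv_bounded_linear by blast

lemmas continuous_on_nakano [continuous_intros] = bounded_linear.continuous_on[OF bounded_linear_nakano]
lemmas continuous_on_tcurv [continuous_intros] = bounded_linear.continuous_on[OF bounded_linear_tcurv]

lemma continuous_on_cof [continuous_intros]: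
  "continuous_on S f \<Longrightarrow> continuous_on S (\<lambda>x. cof (f x) :: complex^'k^'k)"
proof -
  assume f: "continuous_on S f"
  have "cof A = (\<chi> q j. det (\<chi> i. if i = q then axis j 1 else A $ i))" for A :: "complex^'k^'k"
    by (simp add: vec_eq_iff det_row_axis_eq_cof)
  moreover have "continuous_on S (\<lambda>x. \<chi> q j. det (\<chi> i. if i = q then axis j 1 else f x $ i))"
  proof (intro continuous_on_vec_lambda continuous_on_det)
    fix q j i :: 'k
    show "continuous_on S (\<lambda>x. if i = q then axis j 1 else f x $ i)"
      by (cases "i = q") (auto intro: continuous_intros f)
  qed
  ultimately show ?thesis by simp
qed

lemma open_good: "open {c. good P c}"
proof (cases P)
  case Nakano
  have "open {c. 0 < Re (det (nakano_matrix c))}" by (intro open_Collect_less continuous_intros)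
  then show ?thesis by (simp add: Nakano)
next
  case DualNakano
  have "open {c. 0 < Re (det (nakano_matrix (tcurv c)))}" by (intro open_Collect_less continuous_intros)
  then show ?thesis by (simp add: DualNakano dual_nakano_tcurv)
next
  case Griffiths
  have "continuous_on UNIV (\<lambda>(c, v). uG c v)"
    unfolding case_prod_beta by (intro continuous_intros)
  from open_forall_compact[OF compact_sphere this] show ?thesis by (simp add: Griffiths)
qed

lemma positive_imp_good:
  assumes "hermc c" "positive P c"
  shows "good P c"
proof (cases P)
  case Nakano
  have "pos_def (nakano_matrix c)" using assms by (simp add: pos_def_qform positive_Nakano_iff Nakano hermc_nakano[symmetric])
  then show ?thesis by (simp add: Nakano pos_def_det)
next
  case DualNakano
  have "pos_def (nakano_matrix (tcurv c))" using assms hermc_tcurv[of c]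
    by (simp add: pos_def_qform positive_Nakano_iff DualNakano positive_DualNakano_iff hermc_nakano[symmetric])
  then show ?thesis by (simp add: DualNakano pos_def_det dual_nakano_tcurv)
next
  case Griffiths
  have "pos_def (contract c v)" if "v \<noteq> 0" for v
    using assms that by (simp add: pos_def_qform Griffiths positive_Griffiths_iff hermc_contract)
  then have "pos_def (contract c v)" if "norm v = 1" for v using that by (metis norm_zero zero_neq_one)
  then show ?thesis by (simp add: Griffiths uG_det pos_def_det)
qed

text \<open>By homogeneity positivity is tested on unit vectors, in the Griffiths case on a product
  of two spheres; a strict inequality over a compact set is an open condition.\<close>

lemma open_positive: "open {c. positive P (c :: ('n::finite, 'r::finite) curv)}"
proof -
  have nak: "open {c. positive Nakano (c :: ('n::finite, 'r::finite) curv)}"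
  proof -
    have "positive Nakano c \<longleftrightarrow> (\<forall>w\<in>sphere 0 1. Re (qform (nakano_matrix c) w) > 0)" for c :: "('n, 'r) curv"
      unfolding positive_Nakano_iff
    proof (intro iffI allI impI ballI)
      fix w :: "complex^('n \<times> 'r)" assume "\<forall>w. w \<noteq> 0 \<longrightarrow> Re (qform (nakano_matrix c) w) > 0" "w \<in> sphere 0 1"
      then show "Re (qform (nakano_matrix c) w) > 0" by (metis dist_0_norm mem_sphere norm_zero zero_neq_one)
    next
      fix w :: "complex^('n \<times> 'r)" assume *: "\<forall>w\<in>sphere 0 1. Re (qform (nakano_matrix c) w) > 0" and w: "w \<noteq> 0"
      have "qform (nakano_matrix c) ((1 / norm w) *\<^sub>R w) = (1 / norm w)\<^sup>2 *\<^sub>R qform (nakano_matrix c) w"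
        by (simp add: qform_def scaleR_sum_right power2_eq_square)
      moreover have "Re (qform (nakano_matrix c) ((1 / norm w) *\<^sub>R w)) > 0"
        using w by (intro *[rule_format]) simp
      ultimately show "Re (qform (nakano_matrix c) w) > 0" using w by (simp add: zero_less_mult_iff)
    qed
    moreover have "continuous_on UNIV (\<lambda>(c :: ('n, 'r) curv, w). Re (qform (nakano_matrix c) w))"
      unfolding case_prod_beta qform_def by (intro continuous_intros)
    ultimately show ?thesis using open_forall_compact[OF compact_sphere] by simp
  qed
  show ?thesis
  proof (cases P)
    case Nakano then show ?thesis using nak by simp
  next
    case DualNakano
    have "open (tcurv -` {c. positive Nakano (c :: ('n::finite, 'r::finite) curv)})"
      by (intro open_vimage nak continuous_intros)
    then show ?thesis by (simp add: DualNakano positive_DualNakano_iff vimage_def)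
  next
    case Griffiths
    have sc: "qform (contract c (b *\<^sub>R v)) (a *\<^sub>R \<xi>) = (a\<^sup>2 * b\<^sup>2) *\<^sub>R qform (contract c v) \<xi>" for c :: "('n, 'r) curv" and v \<xi> a b
      by (simp add: qform_def contract_def scaleR_sum_right sum_distrib_left sum_distrib_right power2_eq_square)
        (simp add: scaleR_conv_of_real mult_ac)
    have "positive Griffiths c \<longleftrightarrow> (\<forall>p\<in>sphere 0 1 \<times> sphere 0 1. Re (qform (contract c (snd p)) (fst p)) > 0)" for c :: "('n, 'r) curv"
      unfolding positive_Griffiths_iff
    proof (intro iffI allI impI ballI)
      fix p :: "(complex^'n) \<times> (complex^'r)"
      assume *: "\<forall>\<xi> v. \<xi> \<noteq> 0 \<longrightarrow> v \<noteq> 0 \<longrightarrow> Re (qform (contract c v) \<xi>) > 0" and p: "p \<in> sphere 0 1 \<times> sphere 0 1"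
      have "fst p \<noteq> 0" "snd p \<noteq> 0" using p by auto
      then show "Re (qform (contract c (snd p)) (fst p)) > 0" using * by blast
    next
      fix \<xi> :: "complex^'n" and v :: "complex^'r"
      assume *: "\<forall>p\<in>sphere 0 1 \<times> sphere 0 1. Re (qform (contract c (snd p)) (fst p)) > 0" and nz: "\<xi> \<noteq> 0" "v \<noteq> 0"
      have "Re (qform (contract c ((1 / norm v) *\<^sub>R v)) ((1 / norm \<xi>) *\<^sub>R \<xi>)) > 0"
        using nz *[rule_format, of "((1 / norm \<xi>) *\<^sub>R \<xi>, (1 / norm v) *\<^sub>R v)"] by simp
      moreover have "(1 / norm \<xi>)\<^sup>2 * (1 / norm v)\<^sup>2 > 0" using nz by simp
      ultimately show "Re (qform (contract c v) \<xi>) > 0" unfolding sc by (simp add: zero_less_mult_iff)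
    qed
    moreover have "continuous_on UNIV (\<lambda>(c :: ('n, 'r) curv, p). Re (qform (contract c (snd p)) (fst p)))"
      unfolding case_prod_beta qform_def by (intro continuous_intros)
    moreover have "compact (sphere (0::complex^'n) 1 \<times> sphere (0::complex^'r) 1)" by (intro compact_Times compact_sphere)
    ultimately show ?thesis using open_forall_compact[of "sphere (0::complex^'n) 1 \<times> sphere (0::complex^'r) 1"
        "\<lambda>(c :: ('n, 'r) curv) p. Re (qform (contract c (snd p)) (fst p))"] by (simp add: Griffiths)
  qed
qed

section \<open>Measurability and change of coordinates in the Griffiths integrands\<close>

lemma uG_measurable: "uG c \<in> borel_measurable borel"
  by (intro borel_measurable_continuous_onI continuous_intros)

lemma duG_measurable: "duG c k \<in> borel_measurable borel"
  by (intro borel_measurable_continuous_onI continuous_intros)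

lemma det_kron_ctranspose: "det (kron (ctranspose T) (mat 1 :: complex^'k^'k)) = cnj (det (kron T (mat 1 :: complex^'k^'k)))"
  by (simp add: det_ctranspose[symmetric] ctranspose_kron)

lemma uG_in_coords: "uG (in_coords T c) v = (cmod (det T))\<^sup>2 * uG c v"
proof -
  have "det (contract (in_coords T c) v) = of_real ((cmod (det T))\<^sup>2) * det (contract c v)"
    unfolding contract_in_coords det_mul det_ctranspose complex_norm_square by (simp add: mult_ac)
  then show ?thesis by (simp add: uG_det)
qed

lemma duG_in_coords: "duG (in_coords T c) (in_coords T k) v = (cmod (det T))\<^sup>2 * duG c k v"
proof -
  have "Ddet (contract (in_coords T c) v) (contract (in_coords T k) v) = of_real ((cmod (det T))\<^sup>2) * Ddet (contract c v) (contract k v)"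
    unfolding contract_in_coords Ddet_mult det_ctranspose complex_norm_square by (simp add: mult_ac)
  then show ?thesis by (simp add: duG_Ddet)
qed

section \<open>Integrals over the sphere and the differential of the functionals\<close>

context
  fixes \<sigma> :: "(complex^'r::finite) measure"
  assumes us: "unitary_invariant_sphere_measure \<sigma>"
begin

lemma sphere_prob: "prob_space \<sigma>" and sphere_sets: "sets \<sigma> = sets borel"
  using us by (auto simp: unitary_invariant_sphere_measure_def)

text \<open>Right multiplication of a row vector by \<open>U\<close> is left multiplication by
  \<open>transpose U\<close>, which is unitary too, so the invariance of the measure
  applies.\<close>

lemma sphere_integral_invariant:
  fixes f :: "complex^'r \<Rightarrow> real"
  assumes f: "f \<in> borel_measurable borel" and U: "U ** ctranspose U = mat 1"
  shows "(LINT v:sphere 0 1|\<sigma>. f (v v* U)) = (LINT v:sphere 0 1|\<sigma>. f v)"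
proof -
  let ?W = "transpose U"
  have W: "?W ** ctranspose ?W = mat 1" by (rule unitary_transpose[OF U])
  have norm: "norm (?W *v v) = norm v" for v
  proof -
    have "?W *v v = v v* U" by simp
    moreover have "(norm (v v* U))\<^sup>2 = (norm v)\<^sup>2"
    proof -
      have "complex_of_real ((norm (v v* U))\<^sup>2) = qform (mat 1) (v v* U)" by (simp add: qform_mat_1)
      also have "\<dots> = qform (U ** mat 1 ** ctranspose U) v" by (simp only: qform_congruence)
      also have "\<dots> = of_real ((norm v)\<^sup>2)" by (simp add: U qform_mat_1)
      finally show ?thesis by (simp only: of_real_eq_iff)
    qed
    ultimately show ?thesis by (simp add: power2_eq_iff_nonneg)
  qed
  have d: "distr \<sigma> borel ((*v) ?W) = \<sigma>" using us W by (simp add: unitary_invariant_sphere_measure_def del: transpose_matrix_vector)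
  have m: "(*v) ?W \<in> measurable \<sigma> borel"
    unfolding measurable_cong_sets[OF sphere_sets refl]
    by (intro borel_measurable_continuous_onI linear_continuous_on matrix_vector_mul_bounded_linear[unfolded scalar_mult_eq_scaleR] linear_conv_bounded_linear[THEN iffD1] linearI)
       (simp_all add: vec_eq_iff matrix_vector_mult_def vector_matrix_mult_def sum.distrib algebra_simps scaleR_sum_right)
  have mf: "(\<lambda>v. indicator (sphere 0 1) v *\<^sub>R f v) \<in> borel_measurable borel"
    using f by (intro borel_measurable_scaleR borel_measurable_indicator) auto
  have "(LINT v:sphere 0 1|\<sigma>. f v) = (\<integral>v. indicator (sphere 0 1) v *\<^sub>R f v \<partial>(distr \<sigma> borel ((*v) ?W)))"
    by (simp add: d set_lebesgue_integral_def)
  also have "\<dots> = (\<integral>v. indicator (sphere 0 1) (?W *v v) *\<^sub>R f (?W *v v) \<partial>\<sigma>)"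
    by (rule integral_distr[OF m mf])
  also have "\<dots> = (LINT v:sphere 0 1|\<sigma>. f (v v* U))"
    unfolding set_lebesgue_integral_def
    by (intro arg_cong[where f="integral\<^sup>L \<sigma>"] ext) (use norm in \<open>auto simp: indicator_def\<close>)
  finally show ?thesis by simp
qed

lemma sphere_integrable: "continuous_on (sphere 0 1) f \<Longrightarrow> set_integrable \<sigma> (sphere 0 1) (f :: complex^'r \<Rightarrow> real)"
  using set_integrable_continuous_compact[OF sphere_prob sphere_sets compact_sphere] .

text \<open>The integrand attains a positive minimum on the sphere, which carries the whole mass
  1.\<close>

lemma sphere_integral_pos:
  assumes c: "continuous_on (sphere 0 1) f" and pos: "\<And>v. v \<in> sphere 0 1 \<Longrightarrow> f v > (0::real)"
  shows "(LINT v:sphere 0 1|\<sigma>. f v) > 0"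
proof -
  interpret prob_space \<sigma> by (rule sphere_prob)
  have "sphere (0::complex^'r) 1 \<noteq> {}" by simp
  then obtain v0 where v0: "v0 \<in> sphere 0 1" "\<And>v. v \<in> sphere 0 1 \<Longrightarrow> f v0 \<le> f v"
    using continuous_attains_inf[OF compact_sphere _ c] by blast
  have "emeasure \<sigma> (sphere 0 1) = 1" using us by (simp add: unitary_invariant_sphere_measure_def)
  then have m: "measure \<sigma> (sphere 0 1) = 1" by (simp add: measure_def)
  have "f v0 = (LINT v:sphere 0 1|\<sigma>. f v0)"
    unfolding set_lebesgue_integral_def using m by (simp add: sphere_sets sets_eq_imp_space_eq[OF sphere_sets])
  also have "\<dots> \<le> (LINT v:sphere 0 1|\<sigma>. f v)"
    by (intro set_integral_mono sphere_integrable c continuous_on_const v0)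
  finally show ?thesis using pos[OF v0(1)] by simp
qed

lemma sphere_integral_nonneg: "(\<And>v. v \<in> sphere 0 1 \<Longrightarrow> f v \<ge> (0::real)) \<Longrightarrow> (LINT v:sphere 0 1|\<sigma>. f v) \<ge> 0"
  unfolding set_lebesgue_integral_def by (intro integral_nonneg_AE AE_I2) (auto simp: indicator_def)

lemma Phi_pos: "good P c \<Longrightarrow> Phi P s \<sigma> c > 0"
proof (cases P)
  case Griffiths
  assume g: "good P c"
  have "(LINT v:sphere 0 1|\<sigma>. uG c v powr (- s)) > 0"
    using g by (intro sphere_integral_pos continuous_intros) (auto simp: Griffiths dest: bspec)
  then show ?thesis by (simp add: Griffiths uG_def[symmetric])
qed auto

text \<open>Chain rule through the determinant in the two Nakano cases; in the Griffiths case
  differentiation under the integral, on the open set of \<open>good\<close> arrays, where the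
  integrand is bounded away from its singularity.\<close>

lemma Phi_has_derivative:
  fixes c :: "('n::finite, 'r) curv"
  assumes g: "good P c" and s: "s > 0"
  shows "(Phi P s \<sigma> has_derivative (\<lambda>k. Phi P s \<sigma> c * dlog P s \<sigma> c k)) (at c)"
proof (cases P)
  case Nakano
  have "((\<lambda>c. Re (det (nakano_matrix c)) powr (1 / real CARD('r))) has_derivative
      (\<lambda>k. Re (det (nakano_matrix c)) powr (1 / real CARD('r)) * (0 * ln (Re (det (nakano_matrix c))) +
        Re (Ddet (nakano_matrix c) (nakano_matrix k)) * (1 / real CARD('r)) / Re (det (nakano_matrix c))))) (at c)"
    using g by (intro has_derivative_powr has_derivative_const bounded_linear.has_derivative[OF bounded_linear_Re]
      has_derivative_compose[OF _ has_derivative_det] linear_imp_has_derivative nakano_matrix_linear) (auto simp: Nakano)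
  moreover have "Phi Nakano s \<sigma> = (\<lambda>c :: ('n, 'r) curv. Re (det (nakano_matrix c)) powr (1 / real CARD('r)))"
    by (simp add: fun_eq_iff)
  ultimately show ?thesis by (simp add: Nakano mult.commute)
next
  case DualNakano
  have "((\<lambda>c. Re (det (nakano_matrix (tcurv c))) powr (1 / real CARD('r))) has_derivative
      (\<lambda>k. Re (det (nakano_matrix (tcurv c))) powr (1 / real CARD('r)) * (0 * ln (Re (det (nakano_matrix (tcurv c)))) +
        Re (Ddet (nakano_matrix (tcurv c)) (nakano_matrix (tcurv k))) * (1 / real CARD('r)) / Re (det (nakano_matrix (tcurv c)))))) (at c)"
    using g by (intro has_derivative_powr has_derivative_const bounded_linear.has_derivative[OF bounded_linear_Re]
      has_derivative_compose[OF _ has_derivative_det] bounded_linear.has_derivative[OF bounded_linear_nakano]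
      linear_imp_has_derivative linear_tcurv) (auto simp: DualNakano dual_nakano_tcurv)
  moreover have "Phi DualNakano s \<sigma> = (\<lambda>c :: ('n, 'r) curv. Re (det (nakano_matrix (tcurv c))) powr (1 / real CARD('r)))"
    by (simp add: fun_eq_iff dual_nakano_tcurv)
  ultimately show ?thesis by (simp add: DualNakano dual_nakano_tcurv mult.commute)
next
  case Griffiths
  let ?U = "{c. good Griffiths (c :: ('n, 'r) curv)}"
  \<comment> \<open>The gradient of \<open>uG c v powr (- s)\<close> with respect to
    \<open>c\<close>.\<close>
  let ?g = "\<lambda>c v. (- s / uG c v powr (s + 1)) *\<^sub>R gradG c v"
  let ?I = "LINT v:sphere 0 1|\<sigma>. uG c v powr (- s)"
  have cU: "c \<in> ?U" using g by (simp add: Griffiths)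
  have eq: "?g c v \<bullet> k = - s * (duG c k v / uG c v powr (s + 1))" for c k v by (simp add: gradG)
  have "((\<lambda>c. LINT v:sphere 0 1|\<sigma>. uG c v powr (- s)) has_derivative (\<lambda>k. LINT v:sphere 0 1|\<sigma>. ?g c v \<bullet> k)) (at c)"
  proof (rule has_derivative_set_integral[OF sphere_prob sphere_sets compact_sphere open_good])
    show "continuous_on (?U \<times> sphere 0 1) (\<lambda>(c, v). uG c v powr (- s))"
      unfolding case_prod_beta by (intro continuous_intros) force
    show "continuous_on (?U \<times> sphere 0 1) (\<lambda>(c, v). ?g c v)"
      unfolding case_prod_beta by (intro continuous_intros) force+
    show "c \<in> ?U" by (rule cU)
    fix x :: "('n, 'r) curv" and v :: "complex^'r" assume x: "x \<in> ?U" "v \<in> sphere 0 1"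
    then have pos: "uG x v > 0" by simp
    have "((\<lambda>c. uG c v powr (- s)) has_derivative
       (\<lambda>k. uG x v powr (- s) * (0 * ln (uG x v) + duG x k v * (- s) / uG x v))) (at x)"
      by (intro has_derivative_powr has_derivative_const has_derivative_uG pos UNIV_I)
    moreover have "uG x v powr (- s) * (0 * ln (uG x v) + duG x k v * (- s) / uG x v) = ?g x v \<bullet> k" for k
      unfolding eq using pos by (simp add: powr_minus_divide powr_add)
    ultimately show "((\<lambda>c. uG c v powr (- s)) has_derivative (\<lambda>k. ?g x v \<bullet> k)) (at x)" by simp
  qed
  then have 1: "((\<lambda>c. LINT v:sphere 0 1|\<sigma>. uG c v powr (- s)) has_derivative
      (\<lambda>k. - s * (LINT v:sphere 0 1|\<sigma>. duG c k v / uG c v powr (s + 1)))) (at c)"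
    unfolding eq set_integral_mult_right .
  have pos: "?I > 0"
    using g by (intro sphere_integral_pos continuous_intros) (auto simp: Griffiths dest: bspec)
  have "((\<lambda>c. (LINT v:sphere 0 1|\<sigma>. uG c v powr (- s)) powr (- 1 / s)) has_derivative
      (\<lambda>k. ?I powr (- 1 / s) * (0 * ln ?I + (- s * (LINT v:sphere 0 1|\<sigma>. duG c k v / uG c v powr (s + 1))) * (- 1 / s) / ?I))) (at c)"
    by (intro has_derivative_powr has_derivative_const 1 pos UNIV_I)
  moreover have "Phi Griffiths s \<sigma> = (\<lambda>c :: ('n, 'r) curv. (LINT v:sphere 0 1|\<sigma>. uG c v powr (- s)) powr (- 1 / s))"
    by (simp add: fun_eq_iff uG_def[symmetric])
  ultimately show ?thesis
    using s by (simp add: Griffiths powr_minus_divide[of _ s])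
qed

text \<open>Linearity is inherited from the derivative of \<open>Phi\<close>, divided by its
  positive value; no look at the three formulas is needed.\<close>

lemma dlog_linear:
  fixes c :: "('n::finite, 'r) curv"
  assumes g: "good P c" and s: "s > 0"
  shows "linear (dlog P s \<sigma> c)"
proof -
  have "linear (\<lambda>k. Phi P s \<sigma> c * dlog P s \<sigma> c k)"
    using Phi_has_derivative[OF assms] has_derivative_bounded_linear bounded_linear.linear by blast
  then have "linear (\<lambda>k. (1 / Phi P s \<sigma> c) *\<^sub>R (Phi P s \<sigma> c * dlog P s \<sigma> c k))"
    by (rule linear_compose_scale_right)
  then show ?thesis using Phi_pos[OF g, of s] by simp
qed

lemma continuous_on_dfactor: "continuous_on {c. good P (c :: ('n::finite, 'r) curv)} (dfactor P s \<sigma>)"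
proof (cases P)
  case Nakano
  show ?thesis unfolding Nakano dfactor.simps by (intro continuous_intros) auto
next
  case DualNakano
  show ?thesis unfolding DualNakano dfactor.simps dual_nakano_tcurv by (intro continuous_intros) (auto simp: dual_nakano_tcurv)
next
  case Griffiths
  have nz: "(LINT v:sphere 0 1|\<sigma>. 1 / uG c v powr s) \<noteq> 0" if "good Griffiths c" for c :: "('n::finite, 'r) curv"
  proof -
    have "(LINT v:sphere 0 1|\<sigma>. 1 / uG c v powr s) > 0"
      using that by (intro sphere_integral_pos continuous_intros) (auto dest: bspec)
    then show ?thesis by simp
  qed
  have "continuous_on ({c. good Griffiths (c :: ('n, 'r) curv)} \<times> sphere 0 1) (\<lambda>(c, v). duG c (otimes_id (mat 1)) v / uG c v powr (s + 1))"
    unfolding case_prod_beta by (intro continuous_intros) force+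
  moreover have "continuous_on ({c. good Griffiths (c :: ('n, 'r) curv)} \<times> sphere 0 1) (\<lambda>(c, v). 1 / uG c v powr s)"
    unfolding case_prod_beta by (intro continuous_intros) force+
  ultimately show ?thesis
    unfolding Griffiths dfactor.simps
    by (intro continuous_on_divide continuous_on_set_integral[OF sphere_prob sphere_sets compact_sphere open_good])
      (use nz in auto)
qed

text \<open>Numerator and denominator scale alike: by the squared modulus of a Kronecker determinant
  in the Nakano cases, and with \<open>d\<close> the squared modulus of \<open>det T\<close>, by
  \<open>d\<close> to the power \<open>- s\<close> in both Griffiths integrals.\<close>

lemma dlog_in_coords:
  fixes c :: "('n::finite, 'r) curv"
  assumes T: "invertible T" and g: "good P c"
  shows "dlog P s \<sigma> (in_coords T c) (in_coords T k) = dlog P s \<sigma> c k"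
proof -
  have nak: "Re (Ddet (nakano_matrix (in_coords T c)) (nakano_matrix (in_coords T k))) / Re (det (nakano_matrix (in_coords T c)))
      = Re (Ddet (nakano_matrix c) (nakano_matrix k)) / Re (det (nakano_matrix c))" for c k :: "('n, 'r) curv"
  proof -
    let ?K = "kron T (mat 1 :: complex^'r^'r)"
    have "invertible ?K" by (intro kron_invertible T invertible_rightI[of _ "mat 1"]) simp
    then have nz: "(cmod (det ?K))\<^sup>2 \<noteq> 0" by (simp add: invertible_det_nz)
    have "Ddet (nakano_matrix (in_coords T c)) (nakano_matrix (in_coords T k)) = of_real ((cmod (det ?K))\<^sup>2) * Ddet (nakano_matrix c) (nakano_matrix k)"
      "det (nakano_matrix (in_coords T c)) = of_real ((cmod (det ?K))\<^sup>2) * det (nakano_matrix c)"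
      unfolding nakano_in_coords Ddet_mult det_mul det_kron_ctranspose complex_norm_square by (simp_all add: mult_ac)
    then show ?thesis using nz by (simp del: power_eq_0_iff)
  qed
  show ?thesis
  proof (cases P)
    case Nakano then show ?thesis using nak by simp
  next
    case DualNakano then show ?thesis using nak by (simp add: dual_nakano_tcurv tcurv_in_coords)
  next
    case Griffiths
    define d where "d = (cmod (det T))\<^sup>2"
    have d: "d > 0" using T by (simp add: d_def invertible_det_nz)
    have u: "uG c v > 0" if "v \<in> sphere 0 1" for v using g that by (simp add: Griffiths)
    have "(LINT v:sphere 0 1|\<sigma>. d * duG c k v / (d * uG c v) powr (s + 1)) =
        (LINT v:sphere 0 1|\<sigma>. (1 / d powr s) * (duG c k v / uG c v powr (s + 1)))"
      by (rule set_lebesgue_integral_cong)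
        (use d in \<open>auto simp: sphere_sets powr_mult powr_add less_imp_le[OF u]\<close>)
    moreover have "(LINT v:sphere 0 1|\<sigma>. 1 / (d * uG c v) powr s) = (LINT v:sphere 0 1|\<sigma>. (1 / d powr s) * (1 / uG c v powr s))"
      by (rule set_lebesgue_integral_cong)
        (use d in \<open>auto simp: sphere_sets powr_mult less_imp_le[OF u]\<close>)
    ultimately show ?thesis using d
      by (simp add: Griffiths uG_in_coords duG_in_coords d_def[symmetric] del: times_divide_eq_left times_divide_eq_right)
  qed
qed

end

lemma hermitian_form_real:
  assumes "hermitian K"
  shows "qform K v = of_real (Re (qform K v))" "\<bar>Re (qform K v)\<bar> \<le> norm K * (norm v)\<^sup>2"
proof -
  have c: "\<And>i j. cnj (K $ i $ j) = K $ j $ i" using assms unfolding hermitian_def by (metis ctranspose_nth)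
  have "cnj (qform K v) = qform K v"
    by (subst (2) qform_def, subst sum.swap) (simp add: qform_def c mult_ac)
  then have "Im (qform K v) = 0" by (metis Reals_cnj_iff complex_is_Real_iff)
  then show "qform K v = of_real (Re (qform K v))" by (simp add: complex_eq_iff)
  have "\<bar>Re (qform K v)\<bar> \<le> cmod (qform K v)" by (rule abs_Re_le_cmod)
  also have "\<dots> \<le> norm K * (norm v)\<^sup>2"
  proof (rule power2_le_imp_le)
    have "(cmod (qform K v))\<^sup>2 = (cmod (\<Sum>p\<in>UNIV. K $ fst p $ snd p * (v $ fst p * cnj (v $ snd p))))\<^sup>2"
      by (simp add: qform_def sum_UNIV_prod mult_ac)
    also have "\<dots> \<le> (\<Sum>p\<in>UNIV. (cmod (K $ fst p $ snd p))\<^sup>2) * (\<Sum>p\<in>UNIV. (cmod (v $ fst p * cnj (v $ snd p)))\<^sup>2)"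
      by (rule cmod_sum_mult_sq_le)
    also have "\<dots> = (norm K)\<^sup>2 * ((norm v)\<^sup>2 * (norm v)\<^sup>2)"
      by (simp add: norm_matrix_sq norm_vec_sq sum_UNIV_prod norm_mult power_mult_distrib sum_product)
    finally show "(cmod (qform K v))\<^sup>2 \<le> (norm K * (norm v)\<^sup>2)\<^sup>2" by (simp add: power2_eq_square mult_ac)
  qed simp
  finally show "\<bar>Re (qform K v)\<bar> \<le> norm K * (norm v)\<^sup>2" .
qed

subsection \<open>Rank one directions\<close>

text \<open>The shape of every highest order variation of the curvature: a rank one form part
  tensored with an endomorphism.\<close>

definition rank1 :: "complex^'n \<Rightarrow> complex^'r^'r \<Rightarrow> ('n::finite, 'r::finite) curv" where
  "rank1 \<xi> K = (\<chi> j k. \<chi> l m. \<xi> $ j * cnj (\<xi> $ k) * K $ l $ m)"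

lemma norm_rank1: "norm (rank1 \<xi> K) = (norm \<xi>)\<^sup>2 * norm K"
proof -
  have "(norm (rank1 \<xi> K))\<^sup>2 = ((norm \<xi>)\<^sup>2 * (norm \<xi>)\<^sup>2) * (norm K)\<^sup>2"
    unfolding norm_curv_sq norm_matrix_sq norm_vec_sq
    by (simp add: rank1_def norm_mult power_mult_distrib sum_product sum_distrib_left sum_distrib_right mult_ac)
  then have "(norm (rank1 \<xi> K))\<^sup>2 = ((norm \<xi>)\<^sup>2 * norm K)\<^sup>2" by (simp add: power2_eq_square mult_ac)
  then show ?thesis by (simp add: power2_eq_iff_nonneg)
qed

lemma tcurv_rank1: "tcurv (rank1 \<xi> K) = rank1 \<xi> (transpose K)"
  by (simp add: vec_eq_iff tcurv_def rank1_def transpose_def)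

lemma linear_rank1: "linear (rank1 \<xi>)"
  by (rule linearI) (simp_all add: vec_eq_iff rank1_def algebra_simps)

definition dyad :: "complex^'n \<Rightarrow> complex^'n^'n" where
  "dyad \<xi> = (\<chi> j k. \<xi> $ j * cnj (\<xi> $ k))"

lemma qform_dyad: "qform (dyad \<xi>) w = of_real ((cmod (\<Sum>j\<in>UNIV. \<xi> $ j * w $ j))\<^sup>2)"
proof -
  have "qform (dyad \<xi>) w = (\<Sum>j\<in>UNIV. \<xi> $ j * w $ j) * cnj (\<Sum>j\<in>UNIV. \<xi> $ j * w $ j)"
    by (simp add: qform_def dyad_def sum_product mult_ac)
  then show ?thesis by (simp only: complex_norm_square)
qed

lemma contract_rank1:
  assumes "hermitian K"
  shows "contract (rank1 \<xi> K) v = Re (qform K v) *\<^sub>R dyad \<xi>"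
proof -
  have "contract (rank1 \<xi> K) v $ j $ k = dyad \<xi> $ j $ k * qform K v" for j k
    by (simp add: contract_qform qform_def rank1_def dyad_def sum_distrib_left mult_ac)
  then show ?thesis
    using hermitian_form_real(1)[OF assms, of v]
    by (simp add: vec_eq_iff scaleR_conv_of_real[where 'a=complex] mult.commute)
qed

lemma contract_otimes_id_mat_1: "contract (otimes_id (mat 1)) v = (norm v)\<^sup>2 *\<^sub>R (mat 1 :: complex^'n^'n)"
proof -
  have "contract (otimes_id (mat 1)) v $ j $ k = of_real ((norm v)\<^sup>2) * mat 1 $ j $ k" for j k :: 'n
    using qform_mat_1[of v] by (auto simp: contract_qform otimes_id_def mat_def qform_def)
  then show ?thesis by (simp add: vec_eq_iff scaleR_conv_of_real[where 'a=complex])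
qed

lemma contract_pos_def:
  "hermc c \<Longrightarrow> positive Griffiths c \<Longrightarrow> v \<noteq> 0 \<Longrightarrow> pos_def (contract c v)"
  by (simp add: pos_def_qform positive_Griffiths_iff hermc_contract)

lemma nakano_pos_def: "hermc c \<Longrightarrow> positive Nakano c \<Longrightarrow> pos_def (nakano_matrix c)"
  by (simp add: pos_def_qform positive_Nakano_iff hermc_nakano[symmetric])

lemma hermitian_mat_1: "hermitian (mat 1)"
  by (simp add: hermitian_def)

lemma norm_transpose: "norm (transpose (K :: complex^'k^'k)) = norm K"
proof -
  have "(norm (transpose K))\<^sup>2 = (norm K)\<^sup>2"
    using sum.swap[of "\<lambda>i j. (cmod (K$i$j))\<^sup>2" UNIV UNIV] by (simp add: norm_matrix_sq transpose_def)
  then show ?thesis by (simp add: power2_eq_iff_nonneg)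
qed

subsection \<open>Unitary invariance\<close>

lemma norm_curv_unitary:
  assumes U: "U ** ctranspose U = mat 1" and V: "V ** ctranspose V = mat 1"
  shows "norm (in_coords V (in_frame U c)) = norm c"
proof -
  have W: "kron V U ** ctranspose (kron V U) = mat 1" using V U by (rule kron_unitary)
  have "nakano_matrix (in_coords V (in_frame U c)) = kron V U ** nakano_matrix c ** ctranspose (kron V U)"
    by (simp add: nakano_change matrix_inv_unitary[OF U] ctranspose_kron)
  then have "norm (nakano_matrix (in_coords V (in_frame U c))) = norm (nakano_matrix c)"
    by (simp add: matrix_mul_assoc[symmetric] norm_unitary_right[OF unitary_ctranspose[OF W]] norm_unitary_left[OF W])
  then show ?thesis by (simp add: norm_nakano)
qed

lemma in_frame_otimes_id: "invertible S \<Longrightarrow> in_frame S (otimes_id a) = otimes_id a"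
proof -
  assume S: "invertible S"
  have m: "mat x = (\<chi> i j. x * mat 1 $ i $ j)" for x :: complex by (simp add: vec_eq_iff mat_def)
  have "(S ** mat x ** matrix_inv S) $ l $ m = x * (S ** matrix_inv S) $ l $ m" for x l m
    by (simp add: matrix_matrix_mult_def mat_def if_distrib[of "\<lambda>x. _ * x"] sum_distrib_left mult_ac cong: if_cong)
  then show ?thesis by (simp add: vec_eq_iff in_frame_def otimes_id_def matrix_inv_cancel[OF S]) (simp add: mat_def)
qed

lemma in_coords_otimes_id: "in_coords T (otimes_id a) = (otimes_id (T ** a ** ctranspose T) :: ('n::finite, 'k::finite) curv)"
proof -
  have "in_coords T (otimes_id a) $ i $ j $ l $ m = otimes_id (T ** a ** ctranspose T) $ i $ j $ l $ m" for i j :: 'n and l m :: 'k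
  proof -
    have "(\<Sum>x\<in>UNIV. \<Sum>y\<in>UNIV. T $ i $ x * cnj (T $ j $ y) * a $ x $ y) = (T ** a ** ctranspose T) $ i $ j"
      by (subst sum.swap) (simp add: matrix_matrix_mult_def sum_distrib_left sum_distrib_right mult_ac)
    then show ?thesis by (auto simp: in_coords_def otimes_id_def mat_def)
  qed
  then show ?thesis by (simp add: vec_eq_iff)
qed

section \<open>Monotonicity, lower bounds and unitary invariance of the functionals\<close>

context
  fixes \<sigma> :: "(complex^'r::finite) measure"
  assumes us: "unitary_invariant_sphere_measure \<sigma>"
begin

text \<open>The direction \<open>\<xi>\<close> \<open>\<xi>\<close>-conjugate tensor the identity is
  semipositive for each of the three notions, and the functionals do not decrease along semipositive
  directions (\<open>pos_def_Ddet_nonneg\<close>).\<close>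

lemma dlog_rank1_nonneg:
  fixes c :: "('n::finite, 'r) curv"
  assumes c: "hermc c" "positive P c"
  shows "dlog P s \<sigma> c (rank1 \<xi> (mat 1)) \<ge> 0"
proof -
  have nak: "Re (Ddet (nakano_matrix c) (nakano_matrix (rank1 \<xi> (mat 1)))) / Re (det (nakano_matrix c)) \<ge> 0"
    if "hermc c" "positive Nakano c" for c :: "('n, 'r) curv"
  proof (intro divide_nonneg_pos pos_def_Ddet_nonneg)
    show pd: "pos_def (nakano_matrix c)" by (rule nakano_pos_def[OF that])
    show "Re (det (nakano_matrix c)) > 0" by (rule pos_def_det[OF pd])
    fix w :: "complex^('n \<times> 'r)"
    have "qform (nakano_matrix (rank1 \<xi> (mat 1 :: complex^'r^'r))) w =
        (\<Sum>j\<in>UNIV. \<Sum>l\<in>UNIV. \<Sum>k\<in>UNIV. \<Sum>m\<in>UNIV. if m = l then \<xi> $ j * w $ (j, l) * cnj (\<xi> $ k * w $ (k, l)) else 0)"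
      unfolding qform_def nakano_matrix_def rank1_def sum_UNIV_prod
      by (intro sum.cong refl) (auto simp: mat_def)
    also have "\<dots> = (\<Sum>j\<in>UNIV. \<Sum>l\<in>UNIV. \<Sum>k\<in>UNIV. \<xi> $ j * w $ (j, l) * cnj (\<xi> $ k * w $ (k, l)))"
      by simp
    also have "\<dots> = (\<Sum>l\<in>UNIV. \<Sum>j\<in>UNIV. \<Sum>k\<in>UNIV. \<xi> $ j * w $ (j, l) * cnj (\<xi> $ k * w $ (k, l)))"
      by (rule sum.swap)
    also have "\<dots> = (\<Sum>l\<in>UNIV. (\<Sum>j\<in>UNIV. \<xi> $ j * w $ (j, l)) * cnj (\<Sum>j\<in>UNIV. \<xi> $ j * w $ (j, l)))"
      by (simp add: sum_product)
    also have "\<dots> = (\<Sum>l\<in>UNIV. of_real ((cmod (\<Sum>j\<in>UNIV. \<xi> $ j * w $ (j, l)))\<^sup>2))"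
      by (simp only: complex_norm_square)
    finally show "Re (qform (nakano_matrix (rank1 \<xi> (mat 1 :: complex^'r^'r))) w) \<ge> 0"
      by (simp only: Re_sum Re_complex_of_real) (simp add: sum_nonneg)
  qed
  show ?thesis
  proof (cases P)
    case Nakano then show ?thesis using divide_nonneg_nonneg[OF nak[of c], of "real CARD('r)"] c by simp
  next
    case DualNakano then show ?thesis
      using divide_nonneg_nonneg[OF nak[of "tcurv c"], of "real CARD('r)"] c hermc_tcurv[of c]
      by (simp add: dual_nakano_tcurv tcurv_rank1 positive_DualNakano_iff transpose_mat)
  next
    case Griffiths
    have "duG c (rank1 \<xi> (mat 1)) v \<ge> 0" if "v \<in> sphere 0 1" for v
    proof -
      have "v \<noteq> 0" using that by auto
      then have "Re (Ddet (contract c v) (dyad \<xi>)) \<ge> 0"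
        using c by (intro pos_def_Ddet_nonneg contract_pos_def) (auto simp: Griffiths qform_dyad)
      then show ?thesis using that
        by (simp add: duG_Ddet contract_rank1 hermitian_mat_1 qform_mat_1 del: of_real_power)
    qed
    then show ?thesis unfolding Griffiths dlog.simps
      by (intro divide_nonneg_nonneg sphere_integral_nonneg[OF us] zero_le_one powr_ge_zero)
  qed
qed

text \<open>Nakano cases: Cauchy-Schwarz against the cofactor matrix. Griffiths case: contraction
  with a unit vector turns \<open>K\<close> into a real number of modulus at most
  \<open>norm K\<close> times \<open>dyad \<xi>\<close>, and the dyad is dominated by
  \<open>(norm \<xi>)^2\<close> times the identity; this is why \<omega> appears in the numerator
  integral of the distortion.\<close>

lemma dlog_rank1_lower:
  fixes c :: "('n::finite, 'r) curv"
  assumes c: "hermc c" "positive P c" and K: "hermitian K"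
  shows "dlog P s \<sigma> c (rank1 \<xi> K) \<ge> - ((norm \<xi>)\<^sup>2 * norm K * dfactor P s \<sigma> c)"
proof -
  have nak: "Re (Ddet (nakano_matrix c) (nakano_matrix (rank1 \<xi> K))) / Re (det (nakano_matrix c)) / real CARD('r)
      \<ge> - ((norm \<xi>)\<^sup>2 * norm K * (norm (cof (nakano_matrix c)) / Re (det (nakano_matrix c)) / real CARD('r)))"
    if "hermc c" "positive Nakano c" for c :: "('n, 'r) curv" and K :: "complex^'r^'r"
  proof -
    let ?D = "Re (det (nakano_matrix c)) * real CARD('r)"
    have D: "?D > 0" using pos_def_det(1)[OF nakano_pos_def[OF that]] by simp
    have "\<bar>Re (Ddet (nakano_matrix c) (nakano_matrix (rank1 \<xi> K)))\<bar> \<le> (norm \<xi>)\<^sup>2 * norm K * norm (cof (nakano_matrix c))"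
      using order_trans[OF abs_Re_le_cmod cmod_Ddet_le, of "nakano_matrix c" "nakano_matrix (rank1 \<xi> K)"]
      by (simp only: norm_nakano norm_rank1)
    then have "- ((norm \<xi>)\<^sup>2 * norm K * norm (cof (nakano_matrix c))) / ?D \<le> Re (Ddet (nakano_matrix c) (nakano_matrix (rank1 \<xi> K))) / ?D"
      using D by (intro divide_right_mono) auto
    then show ?thesis by (simp add: divide_divide_eq_left)
  qed
  show ?thesis
  proof (cases P)
    case Nakano then show ?thesis using nak[of c] c by simp
  next
    case DualNakano then show ?thesis using nak[of "tcurv c" "transpose K"] c hermc_tcurv[of c]
      by (simp add: dual_nakano_tcurv tcurv_rank1 positive_DualNakano_iff norm_transpose)
  next
    case Griffiths
    have u: "uG c v > 0" if "v \<in> sphere 0 1" for v using positive_imp_good[OF c] that by (simp add: Griffiths)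
    let ?a = "(norm \<xi>)\<^sup>2 * norm K"
    have le: "duG c (rank1 \<xi> K) v \<ge> - ?a * duG c (otimes_id (mat 1)) v" if "v \<in> sphere 0 1" for v
    proof -
      have nv: "norm v = 1" and v0: "v \<noteq> 0" using that by auto
      have pd: "pos_def (contract c v)" using c v0 by (simp add: contract_pos_def Griffiths)
      let ?y = "Re (Ddet (contract c v) (dyad \<xi>))"
      have y0: "?y \<ge> 0" by (rule pos_def_Ddet_nonneg[OF pd]) (simp add: qform_dyad)
      \<comment> \<open>As hermitian forms, \<open>dyad \<xi>\<close> lies below
        \<open>(norm \<xi>)^2\<close> times the identity by Cauchy-Schwarz; monotonicity of the
        determinant transfers this to \<open>Ddet\<close>.\<close>
      have "Re (Ddet (contract c v) ((norm \<xi>)\<^sup>2 *\<^sub>R mat 1 - dyad \<xi>)) \<ge> 0"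
      proof (rule pos_def_Ddet_nonneg[OF pd])
        fix w :: "complex^'n"
        have "(cmod (\<Sum>j\<in>UNIV. \<xi> $ j * w $ j))\<^sup>2 \<le> (norm \<xi>)\<^sup>2 * (norm w)\<^sup>2"
          unfolding norm_vec_sq by (rule cmod_sum_mult_sq_le)
        moreover have "qform ((norm \<xi>)\<^sup>2 *\<^sub>R mat 1 - dyad \<xi>) w = (norm \<xi>)\<^sup>2 *\<^sub>R qform (mat 1) w - qform (dyad \<xi>) w"
          using qform_add[of "(norm \<xi>)\<^sup>2 *\<^sub>R mat 1 - dyad \<xi>" "dyad \<xi>" w] by (simp add: qform_scaleR)
        ultimately show "Re (qform ((norm \<xi>)\<^sup>2 *\<^sub>R mat 1 - dyad \<xi>) w) \<ge> 0"
          by (simp add: qform_mat_1 qform_dyad del: of_real_power)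
      qed
      then have y1: "?y \<le> (norm \<xi>)\<^sup>2 * Re (Ddet (contract c v) (mat 1))"
        by (simp add: Ddet_diff Ddet_scaleR)
      have "\<bar>Re (qform K v)\<bar> \<le> norm K" using hermitian_form_real(2)[OF K, of v] nv by simp
      then have "Re (qform K v) * ?y \<ge> - norm K * ?y" by (intro mult_right_mono y0) auto
      moreover have "norm K * ?y \<le> norm K * ((norm \<xi>)\<^sup>2 * Re (Ddet (contract c v) (mat 1)))" by (intro mult_left_mono y1) simp
      ultimately have "Re (qform K v) * ?y \<ge> - ?a * Re (Ddet (contract c v) (mat 1))" by (simp add: mult_ac)
      then have "fact CARD('n) * (Re (qform K v) * ?y) \<ge> fact CARD('n) * (- ?a * Re (Ddet (contract c v) (mat 1)))"
        by (intro mult_left_mono) auto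
      then show ?thesis using nv
        by (simp add: duG_Ddet contract_rank1[OF K] contract_otimes_id_mat_1 Ddet_scaleR mult_ac)
    qed
    have cs: "continuous_on (sphere 0 1) (\<lambda>v. duG c k v / uG c v powr (s + 1))" for k
      by (intro continuous_intros) (use u in force)+
    have "(LINT v:sphere 0 1|\<sigma>. - ?a * (duG c (otimes_id (mat 1)) v / uG c v powr (s + 1))) \<le> (LINT v:sphere 0 1|\<sigma>. duG c (rank1 \<xi> K) v / uG c v powr (s + 1))"
    proof (intro set_integral_mono sphere_integrable[OF us])
      fix v :: "complex^'r" assume v: "v \<in> sphere 0 1"
      show "- ?a * (duG c (otimes_id (mat 1)) v / uG c v powr (s + 1)) \<le> duG c (rank1 \<xi> K) v / uG c v powr (s + 1)"
        using divide_right_mono[OF le[OF v], of "uG c v powr (s + 1)"] by simp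
    qed (intro continuous_on_mult continuous_on_const cs)+
    moreover have "(LINT v:sphere 0 1|\<sigma>. 1 / uG c v powr s) \<ge> 0" by (intro sphere_integral_nonneg[OF us]) simp
    ultimately have "(- ?a * (LINT v:sphere 0 1|\<sigma>. duG c (otimes_id (mat 1)) v / uG c v powr (s + 1))) / (LINT v:sphere 0 1|\<sigma>. 1 / uG c v powr s)
       \<le> (LINT v:sphere 0 1|\<sigma>. duG c (rank1 \<xi> K) v / uG c v powr (s + 1)) / (LINT v:sphere 0 1|\<sigma>. 1 / uG c v powr s)"
      unfolding set_integral_mult_right by (rule divide_right_mono)
    then show ?thesis by (simp add: Griffiths)
  qed
qed

lemma dfactor_nonneg:
  fixes c :: "('n::finite, 'r) curv"
  assumes c: "hermc c" "positive P c"
  shows "dfactor P s \<sigma> c \<ge> 0"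
proof (cases P)
  case Griffiths
  have "duG c (otimes_id (mat 1)) v \<ge> 0" if "v \<in> sphere 0 1" for v
  proof -
    have v: "v \<noteq> 0" "norm v = 1" using that by auto
    have "Re (Ddet (contract c v) (mat 1)) \<ge> 0"
      using c v by (intro pos_def_Ddet_nonneg contract_pos_def) (auto simp: Griffiths qform_mat_1)
    then show ?thesis using v by (simp add: duG_Ddet contract_otimes_id_mat_1)
  qed
  then show ?thesis unfolding Griffiths dfactor.simps
    by (intro divide_nonneg_nonneg sphere_integral_nonneg[OF us] zero_le_one powr_ge_zero)
qed (use positive_imp_good[OF c] in \<open>simp_all\<close>)

text \<open>The two Kronecker factors that conjugate the Nakano matrix have inverse determinants; in
  the Griffiths case the substitution \<open>v v* U\<close> is absorbed by the invariant
  measure.\<close>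

lemma Phi_unitary:
  fixes c :: "('n::finite, 'r) curv"
  assumes U: "U ** ctranspose U = mat 1"
  shows "Phi P s \<sigma> (in_frame U c) = Phi P s \<sigma> c"
proof -
  have nak: "det (nakano_matrix (in_frame U c)) = det (nakano_matrix c)"
    if U: "U ** ctranspose U = mat 1" for c :: "('n, 'r) curv" and U :: "complex^'r^'r"
  proof -
    have "kron (mat 1) U ** kron (mat 1) (matrix_inv U) = (mat 1 :: complex^('n \<times> 'r)^('n \<times> 'r))"
      by (simp add: kron_mult kron_mat_1 matrix_inv_unitary[OF U] U)
    then have "det (kron (mat 1) U :: complex^('n \<times> 'r)^('n \<times> 'r)) * det (kron (mat 1) (matrix_inv U) :: complex^('n \<times> 'r)^('n \<times> 'r)) = 1"
      by (metis det_I det_mul)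
    then show ?thesis by (simp add: nakano_in_frame det_mul mult_ac)
  qed
  show ?thesis
  proof (cases P)
    case Nakano then show ?thesis using nak[OF U] by simp
  next
    case DualNakano
    have "transpose (matrix_inv U) ** ctranspose (transpose (matrix_inv U)) = mat 1"
      unfolding matrix_inv_unitary[OF U] by (intro unitary_transpose unitary_ctranspose U)
    from nak[OF this] show ?thesis
      by (simp add: DualNakano dual_nakano_tcurv tcurv_in_frame[OF invertible_rightI[OF U]])
  next
    case Griffiths
    have "(\<lambda>v. uG c v powr (- s)) \<in> borel_measurable borel" by (intro powr_real_measurable uG_measurable borel_measurable_const)
    from sphere_integral_invariant[OF us this U] show ?thesis
      by (simp add: Griffiths contract_in_frame_unitary[OF U] uG_def)
  qed
qed

text \<open>Through \<open>norm_cof_invertible\<close> the cofactor norm is a product of unitary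
  invariants; the Griffiths integrals are handled by the invariance of the measure.\<close>

lemma dfactor_unitary:
  fixes c :: "('n::finite, 'r) curv"
  assumes U: "U ** ctranspose U = mat 1" and V: "V ** ctranspose V = mat 1" and g: "good P c"
  shows "dfactor P s \<sigma> (in_coords V (in_frame U c)) = dfactor P s \<sigma> c"
proof -
  have nak: "norm (cof (nakano_matrix (in_coords V (in_frame U c)))) = norm (cof (nakano_matrix c))"
    "det (nakano_matrix (in_coords V (in_frame U c))) = det (nakano_matrix c)"
    if U: "U ** ctranspose U = mat 1" and g: "good Nakano c" for c :: "('n, 'r) curv" and U :: "complex^'r^'r"
  proof -
    let ?A = "nakano_matrix c" and ?W = "kron V U"
    have W: "?W ** ctranspose ?W = mat 1" using V U by (rule kron_unitary)
    have eq: "nakano_matrix (in_coords V (in_frame U c)) = ?W ** ?A ** ctranspose ?W"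
      by (simp add: nakano_change matrix_inv_unitary[OF U] ctranspose_kron)
    have "det ?W * det (ctranspose ?W) = 1" using W by (metis det_I det_mul)
    then show d: "det (nakano_matrix (in_coords V (in_frame U c))) = det ?A"
      unfolding eq det_mul by (simp add: mult_ac)
    have A: "invertible ?A" using g by (auto simp: invertible_det_nz)
    have Wi: "invertible ?W" "invertible (ctranspose ?W)" using W unitary_comm[OF W] by (auto intro: invertible_rightI)
    have "matrix_inv (?W ** ?A ** ctranspose ?W) = ?W ** matrix_inv ?A ** ctranspose ?W"
      using A Wi by (simp add: matrix_inv_mul invertible_mult matrix_inv_unitary[OF W]
          matrix_inv_unitary[OF unitary_ctranspose[OF W]] matrix_mul_assoc)
    then have "norm (matrix_inv (?W ** ?A ** ctranspose ?W)) = norm (matrix_inv ?A)"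
      by (simp add: matrix_mul_assoc[symmetric] norm_unitary_right[OF unitary_ctranspose[OF W]] norm_unitary_left[OF W])
    moreover have "invertible (?W ** ?A ** ctranspose ?W)" using A Wi by (simp add: invertible_mult)
    ultimately show "norm (cof (nakano_matrix (in_coords V (in_frame U c)))) = norm (cof ?A)"
      unfolding eq using A d[unfolded eq] by (simp add: norm_cof_invertible)
  qed
  show ?thesis
  proof (cases P)
    case Nakano then show ?thesis using nak[OF U] g by simp
  next
    case DualNakano
    have "transpose (matrix_inv U) ** ctranspose (transpose (matrix_inv U)) = mat 1"
      unfolding matrix_inv_unitary[OF U] by (intro unitary_transpose unitary_ctranspose U)
    from nak[OF this, of "tcurv c"] g show ?thesis
      by (simp add: DualNakano dual_nakano_tcurv tcurv_in_coords tcurv_in_frame[OF invertible_rightI[OF U]])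
  next
    case Griffiths
    have "cmod (det V) = 1"
    proof -
      have "det V * cnj (det V) = 1" using V by (metis det_I det_mul det_ctranspose)
      then have "(cmod (det V))\<^sup>2 = 1" unfolding complex_norm_square[symmetric] by (simp only: of_real_eq_1_iff)
      then show ?thesis using norm_ge_zero[of "det V"] by (auto simp: power2_eq_1_iff simp del: norm_ge_zero)
    qed
    then have u: "uG (in_coords V (in_frame U c)) v = uG c (v v* U)" for v
      by (simp add: uG_in_coords) (simp add: uG_def contract_in_frame_unitary[OF U])
    \<comment> \<open>The identity array is fixed by simultaneous unitary changes, so the
      transformation rule for \<open>duG\<close> can be applied to both of its arguments.\<close>
    have "otimes_id (mat 1) = in_coords V (in_frame U (otimes_id (mat 1)))"
      by (simp add: in_frame_otimes_id invertible_rightI[OF U] in_coords_otimes_id V)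
    then have du: "duG (in_coords V (in_frame U c)) (otimes_id (mat 1)) v = duG c (otimes_id (mat 1)) (v v* U)" for v
      using \<open>cmod (det V) = 1\<close> duG_in_coords[of V "in_frame U c" "in_frame U (otimes_id (mat 1))" v]
      by (simp add: duG_def contract_in_frame_unitary[OF U])
    have "(\<lambda>v. duG c (otimes_id (mat 1)) v / uG c v powr (s + 1)) \<in> borel_measurable borel"
      "(\<lambda>v. 1 / uG c v powr s) \<in> borel_measurable borel"
      by (intro borel_measurable_divide powr_real_measurable uG_measurable duG_measurable borel_measurable_const)+
    from this[THEN sphere_integral_invariant[OF us], OF U] show ?thesis
      by (simp add: Griffiths u du)
  qed
qed

end

section \<open>Curvature relative to a metric at a point\<close>

text \<open>The same reality condition in an arbitrary frame with Gram matrix \<open>H\<close>: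
  \<open>c $ j $ k ** H\<close> is the matrix of the sesquilinear form attached to the
  endomorphism.\<close>

definition hermH :: "complex^'r^'r \<Rightarrow> ('n::finite, 'r::finite) curv \<Rightarrow> bool" where
  "hermH H c \<longleftrightarrow> (\<forall>j k. ctranspose (c $ j $ k ** H) = c $ k $ j ** H)"

definition tw :: "real \<Rightarrow> ('n::finite, 'r::finite) curv \<Rightarrow> ('n, 'r) curv" where
  "tw t c = c + t *\<^sub>R otimes_id (trace_form c)"

definition tf :: "('n::finite, 'r::finite) curv \<Rightarrow> ('n, 'r) curv" where
  "tf c = c - (1 / real CARD('r)) *\<^sub>R otimes_id (trace_form c)"

lemma twisted_curv_tw: "twisted_curv t H z = tw t (chern H z)"
  and tracefree_curv_tf: "tracefree_curv H z = tf (chern H z)"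
  by (simp_all add: twisted_curv_def tracefree_curv_def tw_def tf_def det_curv_def)

lemma hermc_in_frame:
  fixes c :: "('n::finite, 'r::finite) curv"
  assumes S: "S ** H ** ctranspose S = mat 1" and c: "hermH H c"
  shows "hermc (in_frame S c)"
  unfolding hermc_def
proof (intro allI)
  fix j k
  note inv = on_basis_invertible[OF S]
  have "ctranspose (c $ j $ k ** H) = H ** ctranspose (c $ j $ k)"
  proof -
    have "ctranspose H = H" by (subst (1 2) inv(4)) (simp add: ctranspose_mul)
    then show ?thesis by (simp add: ctranspose_mul)
  qed
  then have "H ** ctranspose (c $ j $ k) = c $ k $ j ** H" using c by (simp add: hermH_def)
  then have "matrix_inv H ** (H ** ctranspose (c $ j $ k)) = matrix_inv H ** (c $ k $ j ** H)" by simp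
  then have cc: "ctranspose (c $ j $ k) = matrix_inv H ** c $ k $ j ** H"
    by (simp add: matrix_mul_assoc matrix_inv_cancel[OF inv(2)])
  have SS: "ctranspose (matrix_inv S) ** ctranspose S = mat 1"
    by (simp add: ctranspose_mul[symmetric] matrix_inv_cancel[OF inv(1)])
  have "ctranspose (in_frame S c $ j $ k) = ctranspose (matrix_inv S) ** ctranspose (c $ j $ k) ** ctranspose S"
    by (simp add: in_frame_def ctranspose_mul matrix_mul_assoc)
  also have "\<dots> = (ctranspose (matrix_inv S) ** ctranspose S) ** S ** c $ k $ j ** (H ** ctranspose S)"
    unfolding cc inv(3) by (simp only: matrix_mul_assoc)
  also have "H ** ctranspose S = matrix_inv S ** (ctranspose (matrix_inv S) ** ctranspose S)"
    by (subst inv(4)) (simp only: matrix_mul_assoc)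
  also have "(ctranspose (matrix_inv S) ** ctranspose S) ** S ** c $ k $ j ** (matrix_inv S ** (ctranspose (matrix_inv S) ** ctranspose S))
      = in_frame S c $ k $ j" by (simp add: SS in_frame_def)
  finally show "ctranspose (in_frame S c $ j $ k) = in_frame S c $ k $ j" .
qed

lemma trace_form_in_frame:
  assumes "invertible S"
  shows "trace_form (in_frame S c) = trace_form c"
proof -
  have "trace (S ** c $ j $ k ** matrix_inv S) = trace (c $ j $ k)" for j k
    using trace_mul_sym[of "S ** c $ j $ k" "matrix_inv S"] by (simp add: matrix_mul_assoc matrix_inv_cancel[OF assms])
  then show ?thesis by (simp add: vec_eq_iff trace_form_def in_frame_def)
qed

lemma trace_form_in_coords: "trace_form (in_coords T c) = T ** trace_form c ** ctranspose T"
proof -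
  have "trace_form (in_coords T c) $ a $ b = (T ** trace_form c ** ctranspose T) $ a $ b" for a b
  proof -
    have "trace_form (in_coords T c) $ a $ b = (\<Sum>l\<in>UNIV. \<Sum>p\<in>UNIV. T $ a $ fst p * cnj (T $ b $ snd p) * c $ fst p $ snd p $ l $ l)"
      by (simp add: trace_form_def trace_def in_coords_def sum_UNIV_prod)
    also have "\<dots> = (\<Sum>p\<in>UNIV. \<Sum>l\<in>UNIV. T $ a $ fst p * cnj (T $ b $ snd p) * c $ fst p $ snd p $ l $ l)"
      by (rule sum.swap)
    also have "\<dots> = (\<Sum>j\<in>UNIV. \<Sum>k\<in>UNIV. T $ a $ j * cnj (T $ b $ k) * trace_form c $ j $ k)"
      by (simp add: trace_form_def trace_def sum_UNIV_prod sum_distrib_left)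
    also have "\<dots> = (T ** trace_form c ** ctranspose T) $ a $ b"
      by (subst sum.swap) (simp add: matrix_matrix_mult_def sum_distrib_left sum_distrib_right mult_ac)
    finally show ?thesis .
  qed
  then show ?thesis by (simp add: vec_eq_iff)
qed

lemma linear_trace_form: "linear trace_form"
  by (rule linearI) (simp_all add: vec_eq_iff trace_form_def trace_def sum.distrib scaleR_sum_right)

lemma linear_otimes_id: "linear otimes_id"
  by (rule linearI) (simp_all add: vec_eq_iff otimes_id_def mat_def)

lemma linear_tw: "linear (tw t)"
  unfolding tw_def
  by (intro linear_compose_add linear_id[unfolded id_def] linear_compose_scale_right
      linear_compose[OF linear_trace_form linear_otimes_id, unfolded o_def])

lemma linear_tf: "linear tf"
  unfolding tf_def
  by (intro linear_compose_sub linear_id[unfolded id_def] linear_compose_scale_right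
      linear_compose[OF linear_trace_form linear_otimes_id, unfolded o_def])

lemma in_frame_tw: "invertible S \<Longrightarrow> in_frame S (tw t c) = tw t (in_frame S c)"
  by (simp add: tw_def linear_add[OF linear_in_frame] linear_scale[OF linear_in_frame] in_frame_otimes_id trace_form_in_frame)

lemma in_frame_tf: "invertible S \<Longrightarrow> in_frame S (tf c) = tf (in_frame S c)"
  by (simp add: tf_def linear_diff[OF linear_in_frame] linear_scale[OF linear_in_frame] in_frame_otimes_id trace_form_in_frame)

lemma hermitian_trace_form: 
  assumes "hermc c"
  shows "hermitian (trace_form c)"
proof -
  have "cnj (trace (c $ j $ k)) = trace (c $ k $ j)" for j k
    using assms by (simp only: trace_ctranspose[symmetric] hermc_def)
  then show ?thesis by (simp add: hermitian_def vec_eq_iff trace_form_def)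
qed

lemma hermc_otimes_id: "hermitian a \<Longrightarrow> hermc (otimes_id a)"
  by (auto simp: hermc_def hermitian_def vec_eq_iff otimes_id_def mat_def)

lemma hermc_tw: "hermc c \<Longrightarrow> hermc (tw t c)" and hermc_tf: "hermc c \<Longrightarrow> hermc (tf c)"
  for c :: "('n::finite, 'r::finite) curv"
proof -
  assume c: "hermc c"
  have "hermc (otimes_id (trace_form c) :: ('n, 'r) curv)" by (intro hermc_otimes_id hermitian_trace_form c)
  with c show "hermc (tw t c)" "hermc (tf c)"
    unfolding hermc_def tw_def tf_def
    by (simp_all only: vector_add_component vector_minus_component vector_scaleR_component ctranspose_add ctranspose_diff ctranspose_scaleR) simp_all
qed

lemma trace_form_otimes_id: "trace_form (otimes_id a :: ('n::finite, 'r::finite) curv) = real CARD('r) *\<^sub>R a"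
  by (simp add: vec_eq_iff trace_form_def otimes_id_def trace_def mat_def scaleR_conv_of_real[where 'a=complex])

text \<open>The source of the number \<open>1 + r t\<close>: twisting adds \<open>t\<close> times
  the trace on each of the r diagonal places.\<close>

lemma trace_form_tw: "trace_form (tw t (c :: ('n::finite, 'r::finite) curv)) = (1 + real CARD('r) * t) *\<^sub>R trace_form c"
  by (simp add: tw_def linear_add[OF linear_trace_form] linear_scale[OF linear_trace_form] trace_form_otimes_id algebra_simps)

lemma trace_form_tf: "trace_form (tf c) = 0"
  by (simp add: tf_def linear_diff[OF linear_trace_form] linear_scale[OF linear_trace_form] trace_form_otimes_id)

text \<open>\<open>tw\<close>, \<open>tf\<close>, \<open>posp\<close> and \<open>distp\<close> express the twisted and the trace free curvature, positivity and the
  distortion function through the Gram matrix \<open>H\<close> and the Chern curvature \<open>c\<close> at a single point.\<close>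

definition posp :: "pos_type \<Rightarrow> real \<Rightarrow> complex^'r^'r \<Rightarrow> ('n::finite, 'r::finite) curv \<Rightarrow> bool" where
  "posp P t H c \<longleftrightarrow> positive P (in_frame (on_basis H) (tw t c))"

text \<open>The two orthonormal bases are arguments, so that independence of their choice can be
  stated and continuously varying bases can be inserted.\<close>

definition distf :: "pos_type \<Rightarrow> real \<Rightarrow> (complex^'r) measure \<Rightarrow> real \<Rightarrow> complex^'r^'r \<Rightarrow> complex^'n^'n \<Rightarrow> ('n::finite, 'r::finite) curv \<Rightarrow> real" where
  "distf P s \<sigma> t S T c = (sqrt (real CARD('n) - 1) + 1) * norm (in_coords T (in_frame S (tf c))) *
     dfactor P s \<sigma> (in_coords T (in_frame S (tw t c)))"

definition distp :: "pos_type \<Rightarrow> real \<Rightarrow> (complex^'r) measure \<Rightarrow> real \<Rightarrow> complex^'r^'r \<Rightarrow> ('n::finite, 'r::finite) curv \<Rightarrow> real" where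
  "distp P s \<sigma> t H c = distf P s \<sigma> t (on_basis H) (on_basis (trace_form c)) c"

lemma posp_iff:
  fixes c :: "('n::finite, 'r::finite) curv"
  assumes H: "pos_def H" and S: "S ** H ** ctranspose S = mat 1"
  shows "posp P t H c \<longleftrightarrow> positive P (in_frame S (tw t c))"
proof -
  have imp: "positive P (in_frame S2 (tw t c))"
    if S1: "S1 ** H ** ctranspose S1 = mat 1" and S2: "S2 ** H ** ctranspose S2 = mat 1" and pos: "positive P (in_frame S1 (tw t c))"
    for S1 S2 :: "complex^'r^'r"
  proof -
    obtain U :: "complex^'r^'r" where U: "U ** ctranspose U = mat 1" "S2 = U ** S1" using on_basis_change[OF S1 S2] .
    have "positive P (in_coords (mat 1) (in_frame U (in_frame S1 (tw t c))))"
      by (rule positive_in_frame_in_coords[OF U(1) _ pos]) (rule invertible_rightI[of _ "mat 1"], simp)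
    then show ?thesis
      by (simp add: in_frame_in_frame[OF on_basis_invertible(1)[OF S1] invertible_rightI[OF U(1)]] U(2))
  qed
  show ?thesis unfolding posp_def using imp[OF S on_basis[OF H]] imp[OF on_basis[OF H] S] by blast
qed

text \<open>Positivity of the twisted curvature bounds \<open>1 + r t\<close> times \<omega> from
  below; with the sign of that number known, \<omega> itself is positive and \<omega>-orthonormal
  coordinates exist.\<close>

lemma posp_pos_def_trace_form:
  fixes c :: "('n::finite, 'r::finite) curv"
  assumes H: "pos_def H" "hermH H c" and rt: "1 + real CARD('r) * t > 0" and p: "posp P t H c"
  shows "pos_def (trace_form c)"
proof -
  note S = on_basis[OF H(1)]
  note inv = on_basis_invertible(1)[OF S]
  have "hermitian (trace_form c)"
    using hermitian_trace_form[OF hermc_in_frame[OF S H(2)]] by (simp add: trace_form_in_frame[OF inv])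
  moreover have "Re (qform (trace_form c) v) > 0" if "v \<noteq> 0" for v
    using positive_trace_form[OF p[unfolded posp_def] that] rt
    by (simp add: trace_form_in_frame[OF inv] trace_form_tw qform_scaleR zero_less_mult_iff)
  ultimately show ?thesis by (simp add: pos_def_qform)
qed

text \<open>The version without knowledge of the sign of \<open>1 + r t\<close>; confronted with a
  point where \<omega> is nonnegative in some direction, it determines that sign.\<close>

lemma trace_form_neg:
  fixes c :: "('n::finite, 'r::finite) curv"
  assumes H: "pos_def H" and p: "posp P t H c" and "v \<noteq> 0"
  shows "(1 + real CARD('r) * t) * Re (qform (trace_form c) v) > 0"
  using positive_trace_form[OF p[unfolded posp_def] assms(3)]
  by (simp add: trace_form_in_frame[OF on_basis_invertible(1)[OF on_basis[OF H]]] trace_form_tw qform_scaleR)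

lemma frame_coords:
  fixes c :: "('n::finite, 'r::finite) curv"
  assumes H: "pos_def H" and S: "S ** H ** ctranspose S = mat 1" and c: "hermH H c"
    and p: "posp P t H c" and T: "invertible T"
  shows "hermc (in_coords T (in_frame S (tw t c)))" "positive P (in_coords T (in_frame S (tw t c)))"
    "hermc (in_frame S (tw t c))" "positive P (in_frame S (tw t c))"
proof -
  show 1: "hermc (in_frame S (tw t c))"
    unfolding in_frame_tw[OF on_basis_invertible(1)[OF S]] by (intro hermc_tw hermc_in_frame[OF S c])
  then show "hermc (in_coords T (in_frame S (tw t c)))" by (rule hermc_in_coords)
  show 2: "positive P (in_frame S (tw t c))" using p posp_iff[OF H S] by blast
  have "mat 1 ** ctranspose (mat 1) = (mat 1 :: complex^'r^'r)" by simp
  from positive_in_frame_in_coords[OF this T 2] show "positive P (in_coords T (in_frame S (tw t c)))" by simp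
qed

lemma distf_cong:
  fixes c :: "('n::finite, 'r::finite) curv"
  assumes us: "unitary_invariant_sphere_measure \<sigma>"
    and H: "pos_def H" and c: "hermH H c" and p: "posp P t H c"
    and S: "S1 ** H ** ctranspose S1 = mat 1" "S2 ** H ** ctranspose S2 = mat 1"
    and T: "T1 ** w ** ctranspose T1 = mat 1" "T2 ** w ** ctranspose T2 = mat 1"
  shows "distf P s \<sigma> t S2 T2 c = distf P s \<sigma> t S1 T1 c"
proof -
  obtain U :: "complex^'r^'r" where U: "U ** ctranspose U = mat 1" "S2 = U ** S1" using on_basis_change[OF S] .
  obtain V :: "complex^'n^'n" where V: "V ** ctranspose V = mat 1" "T2 = V ** T1" using on_basis_change[OF T] .
  have eq: "in_coords T2 (in_frame S2 x) = in_coords V (in_frame U (in_coords T1 (in_frame S1 x)))" for x :: "('n, 'r) curv"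
    unfolding U(2) V(2) by (simp add: in_frame_in_frame[symmetric] on_basis_invertible(1)[OF S(1)] invertible_rightI[OF U(1)]
      in_coords_in_coords[symmetric] in_frame_in_coords)
  have "good P (in_coords T1 (in_frame S1 (tw t c)))"
    using frame_coords[OF H S(1) c p on_basis_invertible(1)[OF T(1)]] by (intro positive_imp_good)
  then show ?thesis
    unfolding distf_def eq by (simp add: norm_curv_unitary[OF U(1) V(1)] dfactor_unitary[OF us U(1) V(1)])
qed

lemma distp_eq_distf:
  fixes c :: "('n::finite, 'r::finite) curv"
  assumes us: "unitary_invariant_sphere_measure \<sigma>"
    and H: "pos_def H" and c: "hermH H c" and rt: "1 + real CARD('r) * t > 0" and p: "posp P t H c"
    and S: "S ** H ** ctranspose S = mat 1" and T: "T ** trace_form c ** ctranspose T = mat 1"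
  shows "distp P s \<sigma> t H c = distf P s \<sigma> t S T c"
  unfolding distp_def
  by (rule distf_cong[OF us H c p S on_basis[OF H] T on_basis[OF posp_pos_def_trace_form[OF H c rt p]]])

lemma distp_nonneg:
  fixes c :: "('n::finite, 'r::finite) curv"
  assumes us: "unitary_invariant_sphere_measure \<sigma>"
    and H: "pos_def H" and c: "hermH H c" and rt: "1 + real CARD('r) * t > 0" and p: "posp P t H c"
  shows "distp P s \<sigma> t H c \<ge> 0"
proof -
  note T = on_basis[OF posp_pos_def_trace_form[OF H c rt p]]
  show ?thesis unfolding distp_def distf_def
    by (intro mult_nonneg_nonneg norm_ge_zero dfactor_nonneg[OF us] add_nonneg_nonneg
      frame_coords[OF H on_basis[OF H] c p on_basis_invertible(1)[OF T]]) (auto simp: Suc_le_eq)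
qed

text \<open>In an \<omega>-orthonormal basis the form \<omega> occurring in
  \<open>distortion\<close> is the identity matrix; positivity of \<omega> ensures that the chosen
  basis really is orthonormal.\<close>

lemma distortion_eq_distp:
  fixes H :: "complex^'n::finite \<Rightarrow> complex^'r::finite^'r"
  assumes w: "pos_def (trace_form (chern H z))"
  shows "distortion P s \<sigma> t H z = distp P s \<sigma> t (H z) (chern H z)"
proof -
  have w1: "on_basis (det_curv H z) ** det_curv H z ** ctranspose (on_basis (det_curv H z)) = mat 1"
    unfolding det_curv_def by (rule on_basis[OF w])
  show ?thesis
  proof (cases P)
    case Griffiths
    let ?\<theta> = "in_coords (on_basis (det_curv H z)) (in_frame (on_basis (H z)) (twisted_curv t H z))"
    have "real CARD('n) * Re (pow_wedge (contract ?\<theta> v) (mat 1)) = duG ?\<theta> (otimes_id (mat 1)) v" if "norm v = 1" for v :: "complex^'r"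
      using that by (simp add: duG_def contract_otimes_id_mat_1)
    then have "(LINT v:sphere 0 1|\<sigma>. real CARD('n) * Re (pow_wedge (contract ?\<theta> v) (mat 1)) / Re (top_power (contract ?\<theta> v)) powr (s + 1))
      = (LINT v:sphere 0 1|\<sigma>. duG ?\<theta> (otimes_id (mat 1)) v / uG ?\<theta> v powr (s + 1))"
      unfolding set_lebesgue_integral_def
      by (intro arg_cong[where f="integral\<^sup>L \<sigma>"] ext) (auto simp: indicator_def uG_def)
    then show ?thesis
      unfolding distp_def distf_def distortion_def Let_def w1
      by (simp add: Griffiths twisted_curv_tw tracefree_curv_tf det_curv_def uG_def[symmetric] divide_inverse mult_ac)
  qed (simp_all add: distp_def distf_def distortion_def Let_def twisted_curv_tw tracefree_curv_tf det_curv_def)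
qed

subsection \<open>Orthonormal bases close to a given one\<close>

text \<open>An orthonormal basis for \<open>H\<close> found by correcting the given basis
  \<open>S\<close> with the inverse square root of its Gram matrix. Unlike \<open>on_basis\<close>
  it is controlled when \<open>H\<close> approaches the form for which \<open>S\<close> is
  orthonormal.\<close>

definition near_basis :: "complex^'k^'k \<Rightarrow> complex^'k^'k \<Rightarrow> complex^'k^'k" where
  "near_basis S H = isqrt_near (S ** H ** ctranspose S) ** S"

lemma near_basis:
  fixes S :: "complex^'k^'k"
  assumes "hermitian H" "norm (S ** H ** ctranspose S - mat 1) \<le> 1 / 2"
  shows "near_basis S H ** H ** ctranspose (near_basis S H) = mat 1"
proof -
  have "near_basis S H ** H ** ctranspose (near_basis S H) =
    isqrt_near (S ** H ** ctranspose S) ** (S ** H ** ctranspose S) ** ctranspose (isqrt_near (S ** H ** ctranspose S))"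
    by (simp only: near_basis_def ctranspose_mul matrix_mul_assoc)
  then show ?thesis using isqrt_near(1)[OF hermitian_congruence[OF assms(1)] assms(2)] by simp
qed

lemma near_basis_self: "S ** H ** ctranspose S = mat 1 \<Longrightarrow> near_basis S H = S"
  by (simp add: near_basis_def isqrt_near_1)

lemma bounded_linear_sandwich: "bounded_linear (\<lambda>X :: complex^'k^'k. A ** X ** B)"
  by (intro bounded_linear_compose[OF bounded_bilinear.bounded_linear_left[OF bounded_bilinear_matrix_mul]
        bounded_bilinear.bounded_linear_right[OF bounded_bilinear_matrix_mul]])

lemma near_basis_has_derivative:
  fixes S :: "complex^'k^'k"
  assumes S: "S ** H ** ctranspose S = mat 1"
  shows "(near_basis S has_derivative (\<lambda>N. (- (1 / 2) *\<^sub>R (S ** N ** ctranspose S)) ** S)) (at H within {M. hermitian M})"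
proof -
  let ?f = "\<lambda>H. S ** H ** ctranspose S"
  have 1: "(?f has_derivative ?f) (at H within {M. hermitian M})"
    by (rule bounded_linear_imp_has_derivative[OF bounded_linear_sandwich])
  have "(isqrt_near has_derivative (\<lambda>K. - (1 / 2) *\<^sub>R K)) (at (?f H) within ?f ` {M. hermitian M})"
    unfolding S by (rule has_derivative_subset[OF isqrt_near_has_derivative]) (auto simp: hermitian_congruence)
  from has_derivative_in_compose[OF 1 this]
  have "((\<lambda>H. isqrt_near (?f H)) has_derivative (\<lambda>N. - (1 / 2) *\<^sub>R ?f N)) (at H within {M. hermitian M})" .
  from bounded_linear.has_derivative[OF bounded_bilinear.bounded_linear_left[OF bounded_bilinear_matrix_mul, of S] this]
  show ?thesis unfolding near_basis_def[abs_def] .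
qed

lemma near_basis_eventually:
  fixes S :: "complex^'k^'k"
  assumes S: "S ** H0 ** ctranspose S = mat 1" and f: "(f \<longlongrightarrow> H0) F"
    and herm: "eventually (\<lambda>x. hermitian (f x)) F"
  shows "eventually (\<lambda>x. near_basis S (f x) ** f x ** ctranspose (near_basis S (f x)) = mat 1) F"
    "((\<lambda>x. near_basis S (f x)) \<longlongrightarrow> S) F"
proof -
  have "((\<lambda>x. norm (S ** f x ** ctranspose S - mat 1)) \<longlongrightarrow> norm (S ** H0 ** ctranspose S - mat 1)) F"
    by (intro tendsto_intros f)
  then have "eventually (\<lambda>x. norm (S ** f x ** ctranspose S - mat 1) < 1 / 2) F"
    using order_tendstoD(2)[of _ _ F "1/2 :: real"] by (simp add: S)
  then show "eventually (\<lambda>x. near_basis S (f x) ** f x ** ctranspose (near_basis S (f x)) = mat 1) F"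
    using herm by eventually_elim (simp add: near_basis)
  have "continuous (at H0 within {M. hermitian M}) (near_basis S)"
    using near_basis_has_derivative[OF S] has_derivative_continuous by blast
  from continuous_within_tendsto_compose[OF this _ f]
  show "((\<lambda>x. near_basis S (f x)) \<longlongrightarrow> S) F" using herm by (simp add: near_basis_self[OF S])
qed

lemma tendsto_matrix_inv:
  assumes "(f \<longlongrightarrow> A) F" "invertible (A::complex^'k^'k)"
  shows "((\<lambda>x. matrix_inv (f x)) \<longlongrightarrow> matrix_inv A) F"
proof -
  have "isCont matrix_inv A"
    using continuous_on_matrix_inv[where 'k='k] assms(2) by (simp add: continuous_on_eq_continuous_at[OF open_invertible])
  then show ?thesis using assms(1) by (rule isCont_tendsto_compose)
qed

lemma tendsto_in_frame:
  assumes "(S \<longlongrightarrow> S0) F" "(c \<longlongrightarrow> c0) F" "invertible S0"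
  shows "((\<lambda>x. in_frame (S x) (c x)) \<longlongrightarrow> in_frame S0 c0) F"
  unfolding in_frame_def by (intro tendsto_intros tendsto_matrix_inv assms)

lemma tendsto_in_coords:
  assumes "(T \<longlongrightarrow> T0) F" "(c \<longlongrightarrow> c0) F"
  shows "((\<lambda>x. in_coords (T x) (c x)) \<longlongrightarrow> in_coords T0 c0) F"
  unfolding in_coords_def by (intro tendsto_intros assms)

lemma tendsto_linear:
  fixes f :: "'a::euclidean_space \<Rightarrow> 'b::real_normed_vector"
  shows "linear f \<Longrightarrow> (g \<longlongrightarrow> l) F \<Longrightarrow> ((\<lambda>x. f (g x)) \<longlongrightarrow> f l) F"
  by (simp add: linear_conv_bounded_linear bounded_linear.tendsto)

text \<open>Fibre and tangent bases are both replaced by \<open>near_basis\<close>, after which only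
  continuous functions remain. The statement uses a filter because admissible pairs do not form an
  open set: hermitian symmetry must be assumed along the approach.\<close>

lemma posp_distp_tendsto:
  fixes c :: "'a \<Rightarrow> ('n::finite, 'r::finite) curv"
  assumes us: "unitary_invariant_sphere_measure \<sigma>" and rt: "1 + real CARD('r) * t > 0"
    and lim: "(H \<longlongrightarrow> H0) F" "(c \<longlongrightarrow> c0) F"
    and adm: "eventually (\<lambda>x. pos_def (H x) \<and> hermH (H x) (c x)) F"
    and adm0: "pos_def H0" "hermH H0 c0" and p: "posp P t H0 c0"
  shows "eventually (\<lambda>x. posp P t (H x) (c x)) F"
    "((\<lambda>x. distp P s \<sigma> t (H x) (c x)) \<longlongrightarrow> distp P s \<sigma> t H0 c0) F"
proof -
  note w0 = posp_pos_def_trace_form[OF adm0 rt p]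
  define S0 where "S0 = on_basis H0"
  define T0 where "T0 = on_basis (trace_form c0)"
  have S0: "S0 ** H0 ** ctranspose S0 = mat 1" unfolding S0_def by (rule on_basis[OF adm0(1)])
  have T0: "T0 ** trace_form c0 ** ctranspose T0 = mat 1" unfolding T0_def by (rule on_basis[OF w0])
  have limw: "((\<lambda>x. trace_form (c x)) \<longlongrightarrow> trace_form c0) F" by (rule tendsto_linear[OF linear_trace_form lim(2)])
  have hermH: "eventually (\<lambda>x. hermitian (H x)) F" using adm by eventually_elim (simp add: pos_def_def)
  have hermw: "eventually (\<lambda>x. hermitian (trace_form (c x))) F"
    using adm
  proof eventually_elim
    case (elim x)
    note S = on_basis[of "H x"]
    show ?case using elim hermitian_trace_form[OF hermc_in_frame[OF S, of "c x"]]
      by (simp add: trace_form_in_frame[OF on_basis_invertible(1)[OF S]])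
  qed
  let ?S = "\<lambda>x. near_basis S0 (H x)" and ?T = "\<lambda>x. near_basis T0 (trace_form (c x))"
  note nS = near_basis_eventually[OF S0 lim(1) hermH] and nT = near_basis_eventually[OF T0 limw hermw]
  note i = on_basis_invertible(1)[OF S0]
  have l1: "((\<lambda>x. in_frame (?S x) (tw t (c x))) \<longlongrightarrow> in_frame S0 (tw t c0)) F"
    by (intro tendsto_in_frame nS(2) tendsto_linear[OF linear_tw] lim i)
  have l2: "((\<lambda>x. in_frame (?S x) (tf (c x))) \<longlongrightarrow> in_frame S0 (tf c0)) F"
    by (intro tendsto_in_frame nS(2) tendsto_linear[OF linear_tf] lim i)
  have "in_frame S0 (tw t c0) \<in> {c. positive P c}" using p posp_iff[OF adm0(1) S0, of P t c0] by simp
  from topological_tendstoD[OF l1 open_positive this]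
  show ev: "eventually (\<lambda>x. posp P t (H x) (c x)) F"
    using nS(1) adm by eventually_elim (use posp_iff in blast)
  have "good P (in_coords T0 (in_frame S0 (tw t c0)))"
    using frame_coords[OF adm0(1) S0 adm0(2) p on_basis_invertible(1)[OF T0]] by (intro positive_imp_good)
  then have "isCont (dfactor P s \<sigma>) (in_coords T0 (in_frame S0 (tw t c0)))"
    using continuous_on_dfactor[OF us, of P s, where 'n='n] by (simp add: continuous_on_eq_continuous_at[OF open_good])
  then have "((\<lambda>x. distf P s \<sigma> t (?S x) (?T x) (c x)) \<longlongrightarrow> distf P s \<sigma> t S0 T0 c0) F"
    unfolding distf_def
    by (intro tendsto_intros isCont_tendsto_compose[where g="dfactor P s \<sigma>"] tendsto_in_coords nT(2) l1 l2)
  moreover have "eventually (\<lambda>x. distf P s \<sigma> t (?S x) (?T x) (c x) = distp P s \<sigma> t (H x) (c x)) F"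
    using nS(1) nT(1) adm ev by eventually_elim (simp add: distp_eq_distf[OF us _ _ rt])
  moreover have "distf P s \<sigma> t S0 T0 c0 = distp P s \<sigma> t H0 c0"
    by (simp add: distp_eq_distf[OF us adm0 rt p S0 T0])
  ultimately show "((\<lambda>x. distp P s \<sigma> t (H x) (c x)) \<longlongrightarrow> distp P s \<sigma> t H0 c0) F"
    by (metis (no_types) Lim_transform_eventually)
qed

subsection \<open>Derivatives along a line of metrics\<close>

lemma has_derivative_vec_lambda:
  fixes f :: "'a::real_normed_vector \<Rightarrow> 'k::finite \<Rightarrow> 'b::real_normed_vector"
  assumes "\<And>i. ((\<lambda>x. f x i) has_derivative (\<lambda>h. f' h i)) F"
  shows "((\<lambda>x. \<chi> i. f x i) has_derivative (\<lambda>h. \<chi> i. f' h i)) F"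
proof -
  have ax: "bounded_linear (\<lambda>y::'b. axis i y :: 'b^'k)" for i
  proof (rule bounded_linear_intro[where K=1])
    fix x :: 'b
    have "norm (axis i x :: 'b^'k) = norm x"
      by (simp add: norm_vec_def L2_set_def axis_def if_distrib[of norm] if_distrib[of "\<lambda>x. x\<^sup>2"] cong: if_cong)
    then show "norm (axis i x :: 'b^'k) \<le> norm x * 1" by simp
  qed (simp_all add: vec_eq_iff axis_def)
  have eq: "(\<chi> i. g i) = (\<Sum>i\<in>UNIV. axis i (g i))" for g :: "'k \<Rightarrow> 'b"
    by (simp add: vec_eq_iff axis_def if_distrib cong: if_cong)
  show ?thesis unfolding eq
    by (intro has_derivative_sum bounded_linear.has_derivative[OF ax] assms)
qed

lemma has_vector_derivative_vec_lambda:
  fixes f :: "real \<Rightarrow> 'k::finite \<Rightarrow> 'b::real_normed_vector"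
  assumes "\<And>i. ((\<lambda>x. f x i) has_vector_derivative f' i) F"
  shows "((\<lambda>x. \<chi> i. f x i) has_vector_derivative (\<chi> i. f' i)) F"
proof -
  have "((\<lambda>x. \<chi> i. f x i) has_derivative (\<lambda>h. \<chi> i. h *\<^sub>R f' i)) F"
    using assms unfolding has_vector_derivative_def by (rule has_derivative_vec_lambda)
  moreover have "(\<lambda>h. \<chi> i. h *\<^sub>R f' i) = (\<lambda>h. h *\<^sub>R (\<chi> i. f' i))" by (simp add: fun_eq_iff vec_eq_iff)
  ultimately show ?thesis by (simp add: has_vector_derivative_def)
qed

lemmas has_vector_derivative_matrix_mul = bounded_bilinear.has_vector_derivative[OF bounded_bilinear_matrix_mul]
lemmas has_vector_derivative_vec_nth = bounded_linear.has_vector_derivative[OF bounded_linear_vec_nth]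

lemma has_vector_derivative_matrix_inv:
  fixes f :: "real \<Rightarrow> complex^'k^'k"
  assumes f: "(f has_vector_derivative f') (at x)" and inv: "invertible (f x)"
  shows "((\<lambda>x. matrix_inv (f x)) has_vector_derivative - (matrix_inv (f x) ** f' ** matrix_inv (f x))) (at x)"
proof -
  have "((\<lambda>x. matrix_inv (f x)) has_derivative (\<lambda>h. - (matrix_inv (f x) ** (h *\<^sub>R f') ** matrix_inv (f x)))) (at x)"
    using has_derivative_compose[OF f[unfolded has_vector_derivative_def] has_derivative_matrix_inv[OF inv]] .
  moreover have "- (matrix_inv (f x) ** (h *\<^sub>R f') ** matrix_inv (f x)) = h *\<^sub>R - (matrix_inv (f x) ** f' ** matrix_inv (f x))" for h
    by (simp add: bounded_bilinear.scaleR_left[OF bounded_bilinear_matrix_mul] bounded_bilinear.scaleR_right[OF bounded_bilinear_matrix_mul])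
  ultimately show ?thesis by (simp add: has_vector_derivative_def)
qed

lemma has_vector_derivative_linear:
  fixes L :: "'a::euclidean_space \<Rightarrow> 'b::real_normed_vector"
  shows "linear L \<Longrightarrow> (f has_vector_derivative f') F \<Longrightarrow> ((\<lambda>x. L (f x)) has_vector_derivative L f') F"
  by (simp add: linear_conv_bounded_linear bounded_linear.has_vector_derivative)

text \<open>The commutator with the velocity of \<open>near_basis\<close>, written in the frame
  \<open>S\<close>: what the motion of the orthonormal frame contributes to the derivative of the
  coefficients. It contains \<open>N\<close> without derivatives.\<close>

definition frame_var :: "complex^'r^'r \<Rightarrow> complex^'r^'r \<Rightarrow> ('n::finite, 'r::finite) curv \<Rightarrow> ('n, 'r) curv" where
  "frame_var S N c = (\<chi> j k. (- (1 / 2) *\<^sub>R (S ** N ** ctranspose S)) ** c $ j $ k - c $ j $ k ** (- (1 / 2) *\<^sub>R (S ** N ** ctranspose S)))"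

lemma near_basis_line:
  fixes S :: "complex^'k^'k"
  assumes S: "S ** H ** ctranspose S = mat 1" and N: "hermitian N" and H: "hermitian H"
  shows "((\<lambda>\<epsilon>. near_basis S (H + \<epsilon> *\<^sub>R N)) has_vector_derivative (- (1 / 2) *\<^sub>R (S ** N ** ctranspose S)) ** S) (at 0)"
proof -
  let ?h = "\<lambda>\<epsilon>::real. H + \<epsilon> *\<^sub>R N"
  have h: "hermitian (?h \<epsilon>)" for \<epsilon> using N H by (simp add: hermitian_def ctranspose_add ctranspose_scaleR)
  have 1: "(?h has_derivative (\<lambda>\<epsilon>. \<epsilon> *\<^sub>R N)) (at 0)"
    by (auto intro!: derivative_eq_intros)
  have "(near_basis S has_derivative (\<lambda>N. (- (1 / 2) *\<^sub>R (S ** N ** ctranspose S)) ** S)) (at (?h 0) within range ?h)"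
    using h by (intro has_derivative_subset[OF near_basis_has_derivative]) (auto simp: S)
  from has_derivative_in_compose[OF 1 this]
  have "((\<lambda>\<epsilon>. near_basis S (?h \<epsilon>)) has_derivative (\<lambda>\<epsilon>. (- (1 / 2) *\<^sub>R (S ** (\<epsilon> *\<^sub>R N) ** ctranspose S)) ** S)) (at 0)" .
  moreover have "(- (1 / 2) *\<^sub>R (S ** (\<epsilon> *\<^sub>R N) ** ctranspose S)) ** S = \<epsilon> *\<^sub>R ((- (1 / 2) *\<^sub>R (S ** N ** ctranspose S)) ** S)" for \<epsilon>
    by (simp add: bounded_bilinear.minus_left[OF bounded_bilinear_matrix_mul] bounded_bilinear.scaleR_left[OF bounded_bilinear_matrix_mul] bounded_bilinear.scaleR_right[OF bounded_bilinear_matrix_mul])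
  ultimately show ?thesis by (simp add: has_vector_derivative_def)
qed

lemma Phi_on_basis:
  fixes c :: "('n::finite, 'r::finite) curv"
  assumes us: "unitary_invariant_sphere_measure \<sigma>" and S: "S ** H ** ctranspose S = mat 1"
  shows "Phi P s \<sigma> (in_frame (on_basis H) c) = Phi P s \<sigma> (in_frame S c)"
proof -
  have "on_basis H ** H ** ctranspose (on_basis H) = mat 1" unfolding on_basis_def by (rule someI[of _ S]) (rule S)
  from on_basis_change[OF S this] obtain U :: "complex^'r^'r" where U: "U ** ctranspose U = mat 1" "on_basis H = U ** S" .
  then show ?thesis
    using Phi_unitary[OF us U(1), of P s "in_frame S c"]
    by (simp add: in_frame_in_frame on_basis_invertible(1)[OF S] invertible_rightI[OF U(1)])
qed

text \<open>By unitary invariance the value in \<open>on_basis\<close> equals that in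
  \<open>near_basis\<close> for small parameters, and the latter frame is differentiable at 0; then
  the chain rule applies.\<close>

lemma Phi_line:
  fixes c :: "real \<Rightarrow> ('n::finite, 'r::finite) curv"
  assumes us: "unitary_invariant_sphere_measure \<sigma>" and s: "s > 0"
    and H: "pos_def H" and N: "hermitian N" and c: "(c has_vector_derivative c') (at 0)"
    and C: "C = in_frame (on_basis H) (tw t (c 0))" and g: "good P C"
  shows "((\<lambda>\<epsilon>. Phi P s \<sigma> (in_frame (on_basis (H + \<epsilon> *\<^sub>R N)) (tw t (c \<epsilon>)))) has_vector_derivative
    Phi P s \<sigma> C * dlog P s \<sigma> C (in_frame (on_basis H) (tw t c') + frame_var (on_basis H) N C)) (at 0)"
proof -
  define S where "S = on_basis H"
  have S: "S ** H ** ctranspose S = mat 1" unfolding S_def by (rule on_basis[OF H])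
  note i = on_basis_invertible(1)[OF S]
  have hH: "hermitian H" using H by (simp add: pos_def_def)
  let ?S = "\<lambda>\<epsilon>::real. near_basis S (H + \<epsilon> *\<^sub>R N)" and ?X = "\<lambda>\<epsilon>. tw t (c \<epsilon>)"
  let ?L = "- (1 / 2) *\<^sub>R (S ** N ** ctranspose S)"
  have S0: "?S 0 = S" "near_basis S H = S" by (simp_all add: near_basis_self[OF S])
  have dS: "(?S has_vector_derivative ?L ** S) (at 0)" by (rule near_basis_line[OF S N hH])
  have dX: "(?X has_vector_derivative tw t c') (at 0)" by (rule has_vector_derivative_linear[OF linear_tw c])
  have "((\<lambda>\<epsilon>. in_frame (?S \<epsilon>) (?X \<epsilon>)) has_vector_derivative in_frame S (tw t c') + frame_var S N C) (at 0)"
  proof -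
    have "((\<lambda>\<epsilon>. ?S \<epsilon> ** ?X \<epsilon> $ j $ k ** matrix_inv (?S \<epsilon>)) has_vector_derivative
        (in_frame S (tw t c') + frame_var S N C) $ j $ k) (at 0)" for j k
    proof -
      have "((\<lambda>\<epsilon>. ?S \<epsilon> ** ?X \<epsilon> $ j $ k ** matrix_inv (?S \<epsilon>)) has_vector_derivative
         (?S 0 ** ?X 0 $ j $ k ** (- (matrix_inv (?S 0) ** (?L ** S) ** matrix_inv (?S 0))) +
          (?S 0 ** tw t c' $ j $ k + (?L ** S) ** ?X 0 $ j $ k) ** matrix_inv (?S 0))) (at 0)"
        by (intro has_vector_derivative_matrix_mul has_vector_derivative_matrix_inv dS
            has_vector_derivative_vec_nth dX) (simp add: S0 i)
      moreover have "?S 0 ** ?X 0 $ j $ k ** (- (matrix_inv (?S 0) ** (?L ** S) ** matrix_inv (?S 0))) +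
          (?S 0 ** tw t c' $ j $ k + (?L ** S) ** ?X 0 $ j $ k) ** matrix_inv (?S 0) =
         (in_frame S (tw t c') + frame_var S N C) $ j $ k"
      proof -
        have "matrix_inv S ** (?L ** S) ** matrix_inv S = matrix_inv S ** ?L"
          by (simp only: matrix_mul_assoc[symmetric] matrix_inv_cancel[OF i] matrix_mul_rid)
        then show ?thesis
          unfolding S0 by (simp add: C S_def[symmetric] frame_var_def in_frame_def matrix_mul_assoc
              bounded_bilinear.add_left[OF bounded_bilinear_matrix_mul]
              bounded_bilinear.minus_right[OF bounded_bilinear_matrix_mul] del: scaleR_minus_left)
      qed
      ultimately show ?thesis by simp
    qed
    then have "((\<lambda>\<epsilon>. \<chi> j k. ?S \<epsilon> ** ?X \<epsilon> $ j $ k ** matrix_inv (?S \<epsilon>)) has_vector_derivative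
        (\<chi> j k. (in_frame S (tw t c') + frame_var S N C) $ j $ k)) (at 0)"
      by (intro has_vector_derivative_vec_lambda)
    then show ?thesis by (simp only: vec_lambda_eta in_frame_def[symmetric])
  qed
  then have 1: "((\<lambda>\<epsilon>. in_frame (?S \<epsilon>) (?X \<epsilon>)) has_derivative (\<lambda>\<epsilon>. \<epsilon> *\<^sub>R (in_frame S (tw t c') + frame_var S N C))) (at 0)"
    by (simp add: has_vector_derivative_def)
  have "((\<lambda>\<epsilon>. Phi P s \<sigma> (in_frame (?S \<epsilon>) (?X \<epsilon>))) has_derivative
     (\<lambda>\<epsilon>. Phi P s \<sigma> C * dlog P s \<sigma> C (\<epsilon> *\<^sub>R (in_frame S (tw t c') + frame_var S N C)))) (at 0)"
    using has_derivative_compose[OF 1, of "Phi P s \<sigma>"] Phi_has_derivative[OF us g s] by (simp add: S0 C S_def[symmetric])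
  then have 2: "((\<lambda>\<epsilon>. Phi P s \<sigma> (in_frame (?S \<epsilon>) (?X \<epsilon>))) has_derivative
     (\<lambda>\<epsilon>. \<epsilon> *\<^sub>R (Phi P s \<sigma> C * dlog P s \<sigma> C (in_frame S (tw t c') + frame_var S N C)))) (at 0)"
    by (simp add: linear_scale[OF dlog_linear[OF us g s]] mult_ac)
  have lim: "((\<lambda>\<epsilon>::real. H + \<epsilon> *\<^sub>R N) \<longlongrightarrow> H) (at 0)"
    by (auto intro!: tendsto_eq_intros)
  have "hermitian (H + \<epsilon> *\<^sub>R N)" for \<epsilon> using N hH by (simp add: hermitian_def ctranspose_add ctranspose_scaleR)
  then have ev: "eventually (\<lambda>\<epsilon>. ?S \<epsilon> ** (H + \<epsilon> *\<^sub>R N) ** ctranspose (?S \<epsilon>) = mat 1) (at 0)"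
    using near_basis_eventually(1)[OF S lim] by simp
  then have "eventually (\<lambda>\<epsilon>. Phi P s \<sigma> (in_frame (?S \<epsilon>) (?X \<epsilon>)) = Phi P s \<sigma> (in_frame (on_basis (H + \<epsilon> *\<^sub>R N)) (?X \<epsilon>))) (at 0)"
    by eventually_elim (simp add: Phi_on_basis[OF us])
  moreover have "Phi P s \<sigma> (in_frame (?S 0) (?X 0)) = Phi P s \<sigma> (in_frame (on_basis (H + 0 *\<^sub>R N)) (?X 0))"
    by (simp add: S0 Phi_on_basis[OF us S])
  ultimately have "((\<lambda>\<epsilon>. Phi P s \<sigma> (in_frame (on_basis (H + \<epsilon> *\<^sub>R N)) (?X \<epsilon>))) has_derivative
     (\<lambda>\<epsilon>. \<epsilon> *\<^sub>R (Phi P s \<sigma> C * dlog P s \<sigma> C (in_frame S (tw t c') + frame_var S N C)))) (at 0)"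
    by (rule has_derivative_transform_eventually[OF 2]) simp
  then show ?thesis by (simp add: has_vector_derivative_def S_def)
qed

subsection \<open>Contraction of the form part\<close>

text \<open>For \<open>W\<close> the inverse matrix of \<omega> this is the trace of the form part
  with respect to \<omega>.\<close>

definition ctr :: "complex^'n^'n \<Rightarrow> ('n::finite, 'r::finite) curv \<Rightarrow> complex^'r^'r" where
  "ctr W X = (\<chi> l m. \<Sum>j\<in>UNIV. \<Sum>k\<in>UNIV. W $ k $ j * X $ j $ k $ l $ m)"

lemma norm_ctr_le: "norm (ctr W X) \<le> norm W * norm (X :: ('n::finite, 'r::finite) curv)"
proof (rule power2_le_imp_le)
  have "(cmod (ctr W X $ l $ m))\<^sup>2 \<le> (norm W)\<^sup>2 * (\<Sum>j\<in>UNIV. \<Sum>k\<in>UNIV. (cmod (X $ j $ k $ l $ m))\<^sup>2)" for l m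
  proof -
    have "(cmod (ctr W X $ l $ m))\<^sup>2 = (cmod (\<Sum>p\<in>UNIV. W $ snd p $ fst p * X $ fst p $ snd p $ l $ m))\<^sup>2"
      by (simp add: ctr_def sum_UNIV_prod)
    also have "\<dots> \<le> (\<Sum>p\<in>UNIV. (cmod (W $ snd p $ fst p))\<^sup>2) * (\<Sum>p\<in>UNIV. (cmod (X $ fst p $ snd p $ l $ m))\<^sup>2)"
      by (rule cmod_sum_mult_sq_le)
    also have "(\<Sum>p\<in>UNIV. (cmod (W $ snd p $ fst p))\<^sup>2) = (norm W)\<^sup>2"
      by (simp add: sum_UNIV_prod norm_matrix_sq) (rule sum.swap)
    finally show ?thesis by (simp add: sum_UNIV_prod)
  qed
  then have "(norm (ctr W X))\<^sup>2 \<le> (\<Sum>l\<in>UNIV. \<Sum>m\<in>UNIV. (norm W)\<^sup>2 * (\<Sum>j\<in>UNIV. \<Sum>k\<in>UNIV. (cmod (X $ j $ k $ l $ m))\<^sup>2))"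
    unfolding norm_matrix_sq[of "ctr W X"] by (intro sum_mono)
  also have "\<dots> = (norm W)\<^sup>2 * (\<Sum>p\<in>UNIV. \<Sum>q\<in>UNIV. (cmod (X $ fst q $ snd q $ fst p $ snd p))\<^sup>2)"
    by (simp add: sum_UNIV_prod sum_distrib_left)
  also have "\<dots> = (norm W)\<^sup>2 * (\<Sum>q\<in>UNIV. \<Sum>p\<in>UNIV. (cmod (X $ fst q $ snd q $ fst p $ snd p))\<^sup>2)"
    by (subst sum.swap) (rule refl)
  also have "\<dots> = (norm W * norm X)\<^sup>2"
    by (simp add: sum_UNIV_prod norm_curv_sq power_mult_distrib)
  finally show "(norm (ctr W X))\<^sup>2 \<le> (norm W * norm X)\<^sup>2" .
qed simp

lemma bounded_bilinear_ctr: "bounded_bilinear (ctr :: complex^'n^'n \<Rightarrow> ('n::finite, 'r::finite) curv \<Rightarrow> complex^'r^'r)"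
proof
  show "\<exists>K. \<forall>a b. norm (ctr (a :: complex^'n^'n) (b :: ('n, 'r) curv)) \<le> norm a * norm b * K"
    by (rule exI[of _ 1]) (simp add: norm_ctr_le)
qed (simp_all add: vec_eq_iff ctr_def sum.distrib algebra_simps scaleR_sum_right)

lemma ctr_in_frame: "S ** ctr W X ** matrix_inv S = ctr W (in_frame S X)"
proof -
  have "(S ** ctr W X ** matrix_inv S) $ l $ m = ctr W (in_frame S X) $ l $ m" for l m
  proof -
    let ?f = "\<lambda>q p j k. S $ l $ p * (W $ k $ j * X $ j $ k $ p $ q) * matrix_inv S $ q $ m"
    have "(S ** ctr W X ** matrix_inv S) $ l $ m = (\<Sum>q\<in>UNIV. \<Sum>p\<in>UNIV. \<Sum>jk\<in>UNIV. ?f q p (fst jk) (snd jk))"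
      by (simp add: matrix_matrix_mult_def ctr_def sum_distrib_left sum_distrib_right sum_UNIV_prod)
    also have "\<dots> = (\<Sum>q\<in>UNIV. \<Sum>jk\<in>UNIV. \<Sum>p\<in>UNIV. ?f q p (fst jk) (snd jk))"
      by (intro sum.cong refl sum.swap)
    also have "\<dots> = (\<Sum>jk\<in>UNIV. \<Sum>q\<in>UNIV. \<Sum>p\<in>UNIV. ?f q p (fst jk) (snd jk))"
      by (rule sum.swap)
    also have "\<dots> = ctr W (in_frame S X) $ l $ m"
      by (simp add: matrix_matrix_mult_def ctr_def in_frame_def sum_distrib_left sum_distrib_right sum_UNIV_prod mult_ac)
    finally show ?thesis .
  qed
  then show ?thesis by (simp add: vec_eq_iff)
qed

lemma ctr_in_coords: "ctr (ctranspose T ** W ** T) X = ctr W (in_coords T X)"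
proof -
  have "ctr (ctranspose T ** W ** T) X $ l $ m = ctr W (in_coords T X) $ l $ m" for l m
  proof -
    let ?f = "\<lambda>j k a b. cnj (T $ b $ k) * W $ b $ a * T $ a $ j * X $ j $ k $ l $ m"
    have "ctr (ctranspose T ** W ** T) X $ l $ m = (\<Sum>jk\<in>UNIV. \<Sum>ab\<in>UNIV. ?f (fst jk) (snd jk) (fst ab) (snd ab))"
      by (simp add: matrix_matrix_mult_def ctr_def sum_distrib_left sum_distrib_right sum_UNIV_prod)
    also have "\<dots> = (\<Sum>ab\<in>UNIV. \<Sum>jk\<in>UNIV. ?f (fst jk) (snd jk) (fst ab) (snd ab))" by (rule sum.swap)
    also have "\<dots> = ctr W (in_coords T X) $ l $ m"
      by (simp add: ctr_def in_coords_def sum_distrib_left sum_distrib_right sum_UNIV_prod mult_ac)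
    finally show ?thesis .
  qed
  then show ?thesis by (simp add: vec_eq_iff)
qed

lemma ctr_mat_1_rank1: "ctr (mat 1) (rank1 \<xi> K) = (norm \<xi>)\<^sup>2 *\<^sub>R K"
proof -
  have "ctr (mat 1) (rank1 \<xi> K) $ l $ m = of_real ((norm \<xi>)\<^sup>2) * K $ l $ m" for l m
  proof -
    have "ctr (mat 1) (rank1 \<xi> K) $ l $ m = (\<Sum>j\<in>UNIV. \<Sum>k\<in>UNIV. if k = j then \<xi> $ j * cnj (\<xi> $ j) * K $ l $ m else 0)"
      unfolding ctr_def rank1_def vec_lambda_beta by (intro sum.cong refl) (simp add: mat_def)
    also have "\<dots> = (\<Sum>j\<in>UNIV. of_real ((cmod (\<xi> $ j))\<^sup>2)) * K $ l $ m"
      by (simp add: complex_norm_square[symmetric] sum_distrib_right)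
    finally show ?thesis by (simp only: norm_vec_sq of_real_sum)
  qed
  then show ?thesis by (simp add: vec_eq_iff scaleR_conv_of_real[where 'a=complex])
qed

lemma hermitian_ctr:
  assumes "hermitian W" "hermc X"
  shows "hermitian (ctr W X)"
proof -
  have W: "cnj (W $ i $ j) = W $ j $ i" for i j using assms(1) unfolding hermitian_def by (metis ctranspose_nth)
  have X: "cnj (X $ j $ k $ l $ m) = X $ k $ j $ m $ l" for j k l m
    using assms(2) unfolding hermc_def by (metis ctranspose_nth)
  have "cnj (ctr W X $ m $ l) = ctr W X $ l $ m" for l m
    by (simp add: ctr_def W X) (rule sum.swap)
  then show ?thesis by (simp add: hermitian_def vec_eq_iff)
qed

lemma trace_ctr: "trace (ctr W X) = (\<Sum>j\<in>UNIV. \<Sum>k\<in>UNIV. W $ k $ j * trace_form X $ j $ k)"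
proof -
  have "trace (ctr W X) = (\<Sum>l\<in>UNIV. \<Sum>p\<in>UNIV. W $ snd p $ fst p * X $ fst p $ snd p $ l $ l)"
    by (simp add: trace_def ctr_def sum_UNIV_prod)
  also have "\<dots> = (\<Sum>p\<in>UNIV. \<Sum>l\<in>UNIV. W $ snd p $ fst p * X $ fst p $ snd p $ l $ l)" by (rule sum.swap)
  finally show ?thesis by (simp add: trace_form_def trace_def sum_UNIV_prod sum_distrib_left)
qed

lemma hermitian_dyad: "hermitian (dyad \<xi>)"
  by (simp add: hermitian_def vec_eq_iff dyad_def)

lemma norm_dyad: "norm (dyad \<xi>) = (norm \<xi>)\<^sup>2"
proof -
  have "(norm (dyad \<xi>))\<^sup>2 = ((norm \<xi>)\<^sup>2)\<^sup>2"
    by (simp add: norm_matrix_sq dyad_def norm_mult power_mult_distrib norm_vec_sq power2_eq_square[of "sum _ _"] sum_product)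
  then show ?thesis by (rule power2_eq_imp_eq) simp_all
qed

lemma dyad_coords: "T ** dyad \<xi> ** ctranspose T = dyad (T *v \<xi>)"
proof -
  have "(T ** dyad \<xi> ** ctranspose T) $ a $ b = dyad (T *v \<xi>) $ a $ b" for a b
    by (simp add: matrix_matrix_mult_def matrix_vector_mult_def dyad_def sum_distrib_left sum_distrib_right mult_ac)
  then show ?thesis by (simp add: vec_eq_iff)
qed

lemma rank1_coords: "in_coords T (rank1 \<xi> K) = rank1 (T *v \<xi>) K"
proof -
  have "in_coords T (rank1 \<xi> K) $ a $ b $ l $ m = rank1 (T *v \<xi>) K $ a $ b $ l $ m" for a b l m
    by (simp add: in_coords_def rank1_def matrix_vector_mult_def sum_distrib_left sum_distrib_right mult_ac)
      (rule sum.swap)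
  then show ?thesis by (simp add: vec_eq_iff)
qed

lemma trace_dyad: "trace (dyad \<xi>) = of_real ((norm \<xi>)\<^sup>2)"
  by (simp only: norm_vec_sq of_real_sum complex_norm_square) (simp add: trace_def dyad_def)

subsection \<open>The principal symbol\<close>

text \<open>The quotient of the densities is a trace against \<omega> by Jacobi's formula; the
  factor n!/n of \<open>pow_wedge\<close> over the n! of \<open>top_power\<close> leaves
  1/n.\<close>

lemma pow_wedge_top_power:
  assumes w: "invertible w"
  shows "(\<chi> l m. pow_wedge w (\<chi> j k. X $ j $ k $ l $ m) / top_power w) =
    (1 / real CARD('n)) *\<^sub>R ctr (matrix_inv w) (X :: ('n::finite, 'r::finite) curv)"
proof -
  have d: "det w \<noteq> 0" using w by (simp add: invertible_det_nz)
  have "pow_wedge w (\<chi> j k. X $ j $ k $ l $ m) / top_power w = ctr (matrix_inv w) X $ l $ m / of_nat CARD('n)" for l m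
  proof -
    have "trace ((\<chi> j k. X $ j $ k $ l $ m) ** matrix_inv w) = ctr (matrix_inv w) X $ l $ m"
      by (simp add: trace_def matrix_matrix_mult_def ctr_def mult.commute)
    then show ?thesis using d by (simp add: pow_wedge_Ddet top_power_det Ddet_invertible[OF w])
  qed
  then show ?thesis by (simp add: vec_eq_iff scaleR_conv_of_real[where 'a=complex])
qed

text \<open>Invertibility is open, so near 0 the quotient is a contraction with the inverse of
  \<omega>; the product rule then gives one term from the curvature and one from the
  inverse.\<close>

lemma endo_line:
  fixes c :: "real \<Rightarrow> ('n::finite, 'r::finite) curv"
  assumes c: "(c has_vector_derivative c') (at 0)" and w: "w = trace_form (c 0)" "invertible w"
  shows "((\<lambda>\<epsilon>. \<chi> l m. pow_wedge (trace_form (c \<epsilon>)) (\<chi> j k. tf (c \<epsilon>) $ j $ k $ l $ m) / top_power (trace_form (c \<epsilon>))) has_vector_derivative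
    (1 / real CARD('n)) *\<^sub>R (ctr (matrix_inv w) (tf c') - ctr (matrix_inv w ** trace_form c' ** matrix_inv w) (tf (c 0)))) (at 0)"
proof -
  note dw = has_vector_derivative_linear[OF linear_trace_form c]
  have "((\<lambda>\<epsilon>. (1 / real CARD('n)) *\<^sub>R ctr (matrix_inv (trace_form (c \<epsilon>))) (tf (c \<epsilon>))) has_vector_derivative
    (1 / real CARD('n)) *\<^sub>R (ctr (matrix_inv (trace_form (c 0))) (tf c') +
      ctr (- (matrix_inv (trace_form (c 0)) ** trace_form c' ** matrix_inv (trace_form (c 0)))) (tf (c 0)))) (at 0)"
    by (intro bounded_linear.has_vector_derivative[OF bounded_linear_scaleR_right]
      bounded_bilinear.has_vector_derivative[OF bounded_bilinear_ctr] has_vector_derivative_matrix_inv dw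
      has_vector_derivative_linear[OF linear_tf c]) (use w in simp)
  then have 1: "((\<lambda>\<epsilon>. (1 / real CARD('n)) *\<^sub>R ctr (matrix_inv (trace_form (c \<epsilon>))) (tf (c \<epsilon>))) has_vector_derivative
    (1 / real CARD('n)) *\<^sub>R (ctr (matrix_inv w) (tf c') - ctr (matrix_inv w ** trace_form c' ** matrix_inv w) (tf (c 0)))) (at 0)"
    by (simp add: w(1) bounded_bilinear.minus_left[OF bounded_bilinear_ctr])
  have "((\<lambda>\<epsilon>. trace_form (c \<epsilon>)) \<longlongrightarrow> trace_form (c 0)) (at 0)"
    using has_vector_derivative_continuous[OF dw] by (simp add: continuous_within)
  then have "eventually (\<lambda>\<epsilon>. trace_form (c \<epsilon>) \<in> {A. invertible A}) (at 0)"
    by (rule topological_tendstoD[OF _ open_invertible]) (use w in simp)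
  then have "eventually (\<lambda>\<epsilon>. (1 / real CARD('n)) *\<^sub>R ctr (matrix_inv (trace_form (c \<epsilon>))) (tf (c \<epsilon>)) =
      (\<chi> l m. pow_wedge (trace_form (c \<epsilon>)) (\<chi> j k. tf (c \<epsilon>) $ j $ k $ l $ m) / top_power (trace_form (c \<epsilon>)))) (at 0)"
    by eventually_elim (simp add: pow_wedge_top_power)
  then show ?thesis
    unfolding has_vector_derivative_def
    by (rule has_derivative_transform_eventually[OF 1[unfolded has_vector_derivative_def]])
      (use w in \<open>simp_all add: pow_wedge_top_power\<close>)
qed

text \<open>Since \<open>H ** ctranspose S = matrix_inv S\<close>, conjugating \<open>M\<close> by
  \<open>S\<close> is the same as applying the congruence by \<open>S\<close> to the form
  \<open>M ** H\<close>.\<close>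

lemma Herm0_frame:
  fixes S H :: "complex^'r^'r"
  assumes S: "S ** H ** ctranspose S = mat 1"
  shows "M \<in> Herm0 H \<longleftrightarrow> hermitian (S ** M ** matrix_inv S) \<and> trace (S ** M ** matrix_inv S) = 0"
proof -
  note i = on_basis_invertible[OF S]
  have "trace (S ** M ** matrix_inv S) = trace M"
    using trace_mul_sym[of "S ** M" "matrix_inv S"] by (simp add: matrix_mul_assoc matrix_inv_cancel[OF i(1)])
  moreover have "hermitian (M ** H) \<longleftrightarrow> hermitian (S ** M ** matrix_inv S)"
  proof -
    have HS: "H ** ctranspose S = matrix_inv S"
    proof -
      have SS: "ctranspose (matrix_inv S) ** ctranspose S = mat 1"
        by (simp add: ctranspose_mul[symmetric] matrix_inv_cancel[OF i(1)])
      have "H ** ctranspose S = matrix_inv S ** (ctranspose (matrix_inv S) ** ctranspose S)"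
        by (subst i(4)) (simp only: matrix_mul_assoc)
      then show ?thesis by (simp add: SS)
    qed
    have 1: "S ** (M ** H) ** ctranspose S = S ** M ** matrix_inv S"
      by (simp only: HS matrix_mul_assoc[symmetric])
    have 2: "M ** H = matrix_inv S ** (S ** M ** matrix_inv S) ** ctranspose (matrix_inv S)"
      by (subst i(4)) (simp only: matrix_mul_assoc matrix_inv_cancel[OF i(1)] matrix_mul_lid)
    show ?thesis
      using hermitian_congruence[of "M ** H" S] hermitian_congruence[of "S ** M ** matrix_inv S" "matrix_inv S"] 1 2 by metis
  qed
  ultimately show ?thesis by (simp add: Herm0_def)
qed

text \<open>In an orthonormal frame the symbol is triangular: its endomorphism part determines the
  variation up to a multiple of \<open>K1\<close>, on which the scalar part does not vanish.\<close>

lemma triangular_bij_betw: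
  fixes S H K1 :: "complex^'r^'r" and L :: "complex^'r^'r \<Rightarrow> real" and E :: "complex^'r^'r \<Rightarrow> complex^'r^'r"
  assumes S: "S ** H ** ctranspose S = mat 1"
    and L: "linear L" and K1: "hermitian K1" "trace K1 = 1" "L K1 \<noteq> 0" and q: "q \<noteq> 0"
    and fst: "\<And>M. hermitian M \<Longrightarrow> F M = L (S ** M ** ctranspose S)"
    and snd: "\<And>M. hermitian M \<Longrightarrow> S ** E M ** matrix_inv S = q *\<^sub>R (S ** M ** ctranspose S - Re (trace (S ** M ** ctranspose S)) *\<^sub>R K1)"
  shows "bij_betw (\<lambda>M. (F M, E M)) {M. hermitian M} (UNIV \<times> Herm0 H)"
proof -
  note i = on_basis_invertible(1)[OF S]
  let ?R = "matrix_inv S"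
  have SR: "S ** ?R = mat 1" "?R ** S = mat 1" by (simp_all add: matrix_inv_cancel[OF i])
  have SRc: "ctranspose S ** ctranspose ?R = mat 1" "ctranspose ?R ** ctranspose S = mat 1"
    by (simp_all add: ctranspose_mul[symmetric] SR)
  have cancel4: "?R ** (S ** X ** ?R) ** S = X" "?R ** (S ** X ** ctranspose S) ** ctranspose ?R = X"
      "S ** (?R ** X ** S) ** ?R = X" "S ** (?R ** X ** ctranspose ?R) ** ctranspose S = X" for X
  proof -
    have "?R ** (S ** X ** ?R) ** S = (?R ** S) ** X ** (?R ** S)" by (simp only: matrix_mul_assoc)
    then show "?R ** (S ** X ** ?R) ** S = X" by (simp add: SR)
    have "?R ** (S ** X ** ctranspose S) ** ctranspose ?R = (?R ** S) ** X ** (ctranspose S ** ctranspose ?R)" by (simp only: matrix_mul_assoc)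
    then show "?R ** (S ** X ** ctranspose S) ** ctranspose ?R = X" by (simp add: SR SRc)
    have "S ** (?R ** X ** S) ** ?R = (S ** ?R) ** X ** (S ** ?R)" by (simp only: matrix_mul_assoc)
    then show "S ** (?R ** X ** S) ** ?R = X" by (simp add: SR)
    have "S ** (?R ** X ** ctranspose ?R) ** ctranspose S = (S ** ?R) ** X ** (ctranspose ?R ** ctranspose S)" by (simp only: matrix_mul_assoc)
    then show "S ** (?R ** X ** ctranspose ?R) ** ctranspose S = X" by (simp add: SR SRc)
  qed
  have tr: "trace (a *\<^sub>R X) = a *\<^sub>R trace X" for a and X :: "complex^'r^'r" by (simp add: trace_def scaleR_sum_right)
  have hsc: "hermitian (X + Y)" "hermitian (X - Y)" if "hermitian X" "hermitian Y" for X Y :: "complex^'r^'r"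
    using that by (simp_all add: hermitian_def ctranspose_add ctranspose_diff)
  have hsc1: "hermitian (a *\<^sub>R X)" if "hermitian X" for a and X :: "complex^'r^'r"
    using that by (simp add: hermitian_def ctranspose_scaleR)
  have trh: "trace X = of_real (Re (trace X))" if "hermitian X" for X :: "complex^'r^'r"
  proof -
    have "cnj (trace X) = trace X" using that trace_ctranspose[of X] by (simp add: hermitian_def)
    then have "Im (trace X) = 0" by (metis Reals_cnj_iff complex_is_Real_iff)
    then show ?thesis by (simp add: complex_eq_iff)
  qed
  define k where "k M = S ** M ** ctranspose S" for M
  have kh: "hermitian (k M)" if "hermitian M" for M unfolding k_def by (rule hermitian_congruence[OF that])
  \<comment> \<open>The preimage in the frame \<open>S\<close>: \<open>Y\<close> is trace free and
    \<open>K1\<close> has trace 1, so the endomorphism component leaves only the trace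
    \<open>\<tau>\<close> open, and the scalar component determines it after division by
    \<open>L K1\<close>.\<close>
  define iv where "iv p = (let Y = (1 / q) *\<^sub>R (S ** snd p ** ?R); \<tau> = (fst p - L Y) / L K1 in
      ?R ** (Y + \<tau> *\<^sub>R K1) ** ctranspose ?R)" for p :: "real \<times> (complex^'r^'r)"
  show ?thesis
  proof (rule bij_betw_byWitness[where f' = iv])
    show "\<forall>M\<in>{M. hermitian M}. iv (F M, E M) = M"
    proof
      fix M :: "complex^'r^'r" assume "M \<in> {M. hermitian M}"
      then have M: "hermitian M" by simp
      let ?t = "Re (trace (k M))"
      have Y: "(1 / q) *\<^sub>R (S ** E M ** ?R) = k M - ?t *\<^sub>R K1" using q by (simp add: snd[OF M] k_def)
      have "(F M - L (k M - ?t *\<^sub>R K1)) / L K1 = ?t"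
        using K1(3) by (simp add: fst[OF M] k_def linear_diff[OF L] linear_scale[OF L])
      then show "iv (F M, E M) = M" by (simp add: iv_def Let_def Y) (simp add: k_def cancel4)
    qed
    have key: "hermitian (iv p) \<and> k (iv p) = (1 / q) *\<^sub>R (S ** snd p ** ?R) + ((fst p - L ((1 / q) *\<^sub>R (S ** snd p ** ?R))) / L K1) *\<^sub>R K1"
      if "snd p \<in> Herm0 H" for p
    proof -
      have "hermitian (S ** snd p ** ?R)" using that Herm0_frame[OF S] by blast
      then show ?thesis
        unfolding iv_def Let_def k_def cancel4 by (intro conjI hermitian_congruence hsc hsc1 K1(1) refl)
    qed
    show "\<forall>p\<in>UNIV \<times> Herm0 H. (F (iv p), E (iv p)) = p"
    proof
      fix p :: "real \<times> (complex^'r^'r)" assume "p \<in> UNIV \<times> Herm0 H"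
      then have p: "snd p \<in> Herm0 H" by auto
      let ?Y = "(1 / q) *\<^sub>R (S ** snd p ** ?R)" and ?t = "(fst p - L ((1 / q) *\<^sub>R (S ** snd p ** ?R))) / L K1"
      have h: "hermitian (iv p)" and k: "k (iv p) = ?Y + ?t *\<^sub>R K1" using key[OF p] by auto
      have "trace (k (iv p)) = of_real ?t"
        using p Herm0_frame[OF S, of "snd p"] by (simp add: k trace_add tr K1(2) scaleR_conv_of_real[where 'a=complex])
      then have t: "Re (trace (k (iv p))) = ?t" by simp
      have "F (iv p) = fst p"
        unfolding fst[OF h] k_def[symmetric] k using K1(3) by (simp add: linear_add[OF L] linear_scale[OF L])
      moreover have "S ** E (iv p) ** ?R = S ** snd p ** ?R"
        unfolding snd[OF h] k_def[symmetric] t unfolding k using q by simp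
      then have "E (iv p) = snd p" using cancel4(1) by metis
      ultimately show "(F (iv p), E (iv p)) = p" by (simp add: prod_eq_iff)
    qed
    show "(\<lambda>M. (F M, E M)) ` {M. hermitian M} \<subseteq> UNIV \<times> Herm0 H"
    proof clarsimp
      fix M :: "complex^'r^'r" assume M: "hermitian M"
      show "E M \<in> Herm0 H"
        unfolding Herm0_frame[OF S] snd[OF M] k_def[symmetric] tr trace_sub K1(2)
        using trh[OF kh[OF M]] by (auto intro!: hsc hsc1 kh M K1(1) simp: scaleR_conv_of_real[where 'a=complex])
    qed
    show "iv ` (UNIV \<times> Herm0 H) \<subseteq> {M. hermitian M}" using key by auto
  qed
qed

text \<open>Symbol of the Chern curvature. The operators d/dz and d/dz-bar have symbols half the
  conjugate of \<open>\<zeta> $ j\<close> and half of \<open>\<zeta> $ k\<close>, hence the factor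
  1/4 and the conjugation; the sign is that of the second order term in the curvature.\<close>

definition symb :: "complex^'n \<Rightarrow> complex^'r^'r \<Rightarrow> complex^'r^'r \<Rightarrow> ('n::finite, 'r::finite) curv" where
  "symb \<zeta> H M = - (1 / 4) *\<^sub>R rank1 (\<chi> j. cnj (\<zeta> $ j)) (M ** matrix_inv H)"

text \<open>In an orthonormal frame and \<omega>-orthonormal coordinates both parts of the symbol
  depend on \<open>S ** M ** ctranspose S\<close> alone, and \<open>triangular_bij_betw\<close>
  applies. What remains is \<open>L K1 \<noteq> 0\<close>, where the bound on \<open>b\<close>
  enters.\<close>

theorem symbol_bij_betw:
  fixes c :: "('n::finite, 'r::finite) curv"
  assumes us: "unitary_invariant_sphere_measure \<sigma>" and s: "s > 0"
    and H: "pos_def H" and c: "hermH H c" and rt: "1 + real CARD('r) * t > 0" and p: "posp P t H c"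
    and b: "b > distp P s \<sigma> t H c" and \<zeta>: "\<zeta> \<noteq> 0" and A: "A > 0"
  defines "w \<equiv> trace_form c" and "C \<equiv> in_frame (on_basis H) (tw t c)"
  shows "bij_betw (\<lambda>M. (A * (dlog P s \<sigma> C (in_frame (on_basis H) (tw t (symb \<zeta> H M))) +
        b * (Re (Ddet w (trace_form (symb \<zeta> H M))) / Re (det w))),
      (1 / real CARD('n)) *\<^sub>R (ctr (matrix_inv w) (tf (symb \<zeta> H M)) -
        ctr (matrix_inv w ** trace_form (symb \<zeta> H M) ** matrix_inv w) (tf c))))
    {M. hermitian M} (UNIV \<times> Herm0 H)"
proof -
  define S where "S = on_basis H"
  define T where "T = on_basis w"
  have S: "S ** H ** ctranspose S = mat 1" unfolding S_def by (rule on_basis[OF H])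
  have w: "pos_def w" unfolding w_def by (rule posp_pos_def_trace_form[OF H c rt p])
  have T: "T ** w ** ctranspose T = mat 1" unfolding T_def by (rule on_basis[OF w])
  note iS = on_basis_invertible[OF S] and iT = on_basis_invertible[OF T]
  define \<xi>0 where "\<xi>0 = (\<chi> j. cnj (\<zeta> $ j))"
  define \<xi> where "\<xi> = T *v \<xi>0"
  have "\<xi>0 \<noteq> 0" using \<zeta> by (auto simp: \<xi>0_def vec_eq_iff)
  then have "\<xi> \<noteq> 0" unfolding \<xi>_def using iT(1) by (metis matrix_inv_cancel(2) matrix_vector_mul_assoc matrix_vector_mul_lid matrix_vector_mult_0_right)
  then have N: "norm \<xi> > 0" by simp
  define \<theta> where "\<theta> = in_coords T C"
  have C: "hermc C" "positive P C" "hermc \<theta>" "positive P \<theta>"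
    unfolding \<theta>_def C_def S_def[symmetric] using frame_coords[OF H S c p iT(1)] by auto
  note g = positive_imp_good[OF C(1,2)] positive_imp_good[OF C(3,4)]
  define \<theta>0 where "\<theta>0 = in_coords T (in_frame S (tf c))"
  \<comment> \<open>Varying \<omega> in the trace with respect to \<omega> contracts the trace free
    curvature with a multiple of \<open>dyad \<xi>\<close>; \<open>Z\<close> is that contraction,
    normalized by the squared length of \<open>\<xi>\<close>.\<close>
  define Z where "Z = (1 / (norm \<xi>)\<^sup>2) *\<^sub>R ctr (dyad \<xi>) \<theta>0"
  define K1 where "K1 = (1 / real CARD('r)) *\<^sub>R mat 1 + Z" \<comment> \<open>spans the kernel of the endomorphism part of the symbol\<close>
  define D where "D = dlog P s \<sigma> \<theta>"
  have D: "linear D" unfolding D_def by (rule dlog_linear[OF us g(2) s])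
  \<comment> \<open>The scalar part of the symbol: the twist by \<open>t\<close> adds a multiple of
    the identity to \<open>K\<close>, and the power \<open>b\<close> enters through the relative
    variation of the volume of \<omega>.\<close>
  define L where "L K = - (A / 4) * (D (rank1 \<xi> (K + (t * Re (trace K)) *\<^sub>R mat 1)) + b * (Re (trace K) * (norm \<xi>)\<^sup>2))" for K
  have tr: "trace (a *\<^sub>R X) = a *\<^sub>R trace X" for a and X :: "complex^'r^'r" by (simp add: trace_def scaleR_sum_right)
  have \<theta>0: "hermc \<theta>0" "trace_form \<theta>0 = 0"
  proof -
    have "in_frame S (tf c) = tf (in_frame S c)" by (rule in_frame_tf[OF iS(1)])
    then show "hermc \<theta>0" unfolding \<theta>0_def using hermc_in_coords hermc_tf hermc_in_frame[OF S c] by metis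
    have "trace_form (in_frame S (tf c)) = 0" by (simp add: trace_form_in_frame[OF iS(1)] trace_form_tf)
    then show "trace_form \<theta>0 = 0" by (simp add: \<theta>0_def trace_form_in_coords)
  qed
  have Zh: "hermitian Z" and Z0: "trace Z = 0" and Zn: "norm Z \<le> norm \<theta>0"
  proof -
    have "hermitian (ctr (dyad \<xi>) \<theta>0)" by (rule hermitian_ctr[OF hermitian_dyad \<theta>0(1)])
    then show "hermitian Z" by (simp add: Z_def hermitian_def ctranspose_scaleR)
    show "trace Z = 0" by (simp add: Z_def tr trace_ctr \<theta>0(2))
    have "norm (ctr (dyad \<xi>) \<theta>0) \<le> (norm \<xi>)\<^sup>2 * norm \<theta>0" using norm_ctr_le[of "dyad \<xi>" \<theta>0] by (simp add: norm_dyad)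
    then show "norm Z \<le> norm \<theta>0" using N by (simp add: Z_def divide_simps mult.commute)
  qed
  have K1: "hermitian K1" "trace K1 = 1"
    using Zh Z0 by (simp_all add: K1_def hermitian_def ctranspose_add ctranspose_scaleR trace_add tr trace_I scaleR_conv_of_real[where 'a=complex])
  have "L K1 \<noteq> 0"
  proof -
    \<comment> \<open>The coefficient of the identity after twisting \<open>K1\<close>; it equals
      \<open>(1 + r t) / r\<close>, hence is positive.\<close>
    let ?a = "1 / real CARD('r) + t"
    have a: "?a > 0" using rt by (simp add: field_simps)
    have "K1 + (t * Re (trace K1)) *\<^sub>R mat 1 = ?a *\<^sub>R mat 1 + Z" unfolding K1(2) unfolding K1_def by (simp add: scaleR_left_distrib)
    then have "D (rank1 \<xi> (K1 + (t * Re (trace K1)) *\<^sub>R mat 1)) = ?a * D (rank1 \<xi> (mat 1)) + D (rank1 \<xi> Z)"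
      by (simp only: linear_add[OF linear_rank1] linear_scale[OF linear_rank1] linear_add[OF D] linear_scale[OF D]) simp
    moreover have "D (rank1 \<xi> (mat 1)) \<ge> 0" unfolding D_def by (rule dlog_rank1_nonneg[OF us C(3,4)])
    then have "?a * D (rank1 \<xi> (mat 1)) \<ge> 0" using a by simp
    moreover have "D (rank1 \<xi> Z) \<ge> - ((norm \<xi>)\<^sup>2 * norm Z * dfactor P s \<sigma> \<theta>)"
      unfolding D_def by (rule dlog_rank1_lower[OF us C(3,4) Zh])
    moreover have "norm Z * dfactor P s \<sigma> \<theta> < b"
    proof -
      have f: "dfactor P s \<sigma> \<theta> \<ge> 0" by (rule dfactor_nonneg[OF us C(3,4)])
      have "norm Z * dfactor P s \<sigma> \<theta> \<le> norm \<theta>0 * dfactor P s \<sigma> \<theta>" by (rule mult_right_mono[OF Zn f])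
      \<comment> \<open>The numerical factor is at least 1, because \<open>CARD('n) \<ge> 1\<close>
        makes the square root nonnegative.\<close>
      also have "\<dots> \<le> (sqrt (real CARD('n) - 1) + 1) * (norm \<theta>0 * dfactor P s \<sigma> \<theta>)"
      proof -
        have "0 \<le> sqrt (real CARD('n) - 1) * (norm \<theta>0 * dfactor P s \<sigma> \<theta>)"
          using f by (intro mult_nonneg_nonneg) (auto simp: Suc_le_eq)
        then show ?thesis by (simp add: algebra_simps)
      qed
      also have "\<dots> = distp P s \<sigma> t H c"
        by (simp add: distp_def distf_def S_def[symmetric] w_def[symmetric] T_def[symmetric] \<theta>0_def \<theta>_def C_def mult_ac)
      finally show ?thesis using b by simp
    qed
    then have "(norm \<xi>)\<^sup>2 * (norm Z * dfactor P s \<sigma> \<theta>) < (norm \<xi>)\<^sup>2 * b" using N by (intro mult_strict_left_mono) auto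
    ultimately have "D (rank1 \<xi> (K1 + (t * Re (trace K1)) *\<^sub>R mat 1)) + b * (norm \<xi>)\<^sup>2 > 0" by (simp add: mult_ac)
    then show ?thesis using A by (simp add: L_def K1(2))
  qed
  have Llin: "linear L"
  proof (rule linearI)
    fix X Y :: "complex^'r^'r" and a :: real
    have 1: "X + Y + (t * Re (trace (X + Y))) *\<^sub>R mat 1 = (X + (t * Re (trace X)) *\<^sub>R mat 1) + (Y + (t * Re (trace Y)) *\<^sub>R mat 1)"
      by (simp add: trace_add algebra_simps)
    show "L (X + Y) = L X + L Y"
      unfolding L_def 1 linear_add[OF linear_rank1, of _ "X + _"] linear_add[OF D, of "rank1 \<xi> (X + _)"] by (simp add: trace_add algebra_simps)
    have 2: "a *\<^sub>R X + (t * Re (trace (a *\<^sub>R X))) *\<^sub>R mat 1 = a *\<^sub>R (X + (t * Re (trace X)) *\<^sub>R mat 1)"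
      by (simp add: tr algebra_simps)
    show "L (a *\<^sub>R X) = a *\<^sub>R L X"
      unfolding L_def 2 linear_scale[OF linear_rank1] linear_scale[OF D] by (simp add: tr algebra_simps)
  qed
  define \<delta> where "\<delta> M = symb \<zeta> H M" for M :: "complex^'r^'r"
  have trh: "trace X = of_real (Re (trace X))" if "hermitian X" for X :: "complex^'r^'r"
  proof -
    have "cnj (trace X) = trace X" using that trace_ctranspose[of X] by (simp add: hermitian_def)
    then have "Im (trace X) = 0" by (metis Reals_cnj_iff complex_is_Real_iff)
    then show ?thesis by (simp add: complex_eq_iff)
  qed
  have frame: "in_frame S (\<delta> M) = - (1 / 4) *\<^sub>R rank1 \<xi>0 (S ** M ** ctranspose S)" for M
  proof -
    have cs: "S ** (M ** matrix_inv H) ** matrix_inv S = S ** M ** ctranspose S"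
      unfolding iS(3) by (simp only: matrix_mul_assoc[symmetric] matrix_inv_cancel[OF iS(1)] matrix_mul_rid)
    have "in_frame S (rank1 \<xi>0 X) = rank1 \<xi>0 (S ** X ** matrix_inv S)" for X
    proof -
      have "(S ** (\<chi> l m. z * X $ l $ m) ** matrix_inv S) $ l $ m = z * (S ** X ** matrix_inv S) $ l $ m" for z l m
        by (simp add: matrix_matrix_mult_def sum_distrib_left sum_distrib_right mult_ac)
      then show ?thesis by (simp add: vec_eq_iff in_frame_def rank1_def)
    qed
    then show ?thesis by (simp only: \<delta>_def symb_def \<xi>0_def[symmetric] linear_scale[OF linear_in_frame] cs)
  qed
  have trf: "trace_form (rank1 \<xi>0 X) = Re (trace X) *\<^sub>R dyad \<xi>0" if "hermitian X" for X :: "complex^'r^'r"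
  proof -
    have "trace_form (rank1 \<xi>0 X) $ j $ k = dyad \<xi>0 $ j $ k * trace X" for j k
      by (simp add: trace_form_def trace_def rank1_def dyad_def sum_distrib_left)
    then show ?thesis using trh[OF that] by (simp add: vec_eq_iff scaleR_conv_of_real[where 'a=complex] mult.commute)
  qed
  have oid: "otimes_id (a *\<^sub>R dyad \<xi>0) = rank1 \<xi>0 (a *\<^sub>R (mat 1 :: complex^'r^'r))" for a
    by (simp add: vec_eq_iff otimes_id_def rank1_def dyad_def mat_def)
  have trw: "trace_form (\<delta> M) = - (Re (trace (S ** M ** ctranspose S)) / 4) *\<^sub>R dyad \<xi>0" if "hermitian M" for M
  proof -
    have "trace_form (\<delta> M) = trace_form (in_frame S (\<delta> M))" by (simp add: trace_form_in_frame[OF iS(1)])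
    also have "\<dots> = - (1 / 4) *\<^sub>R (Re (trace (S ** M ** ctranspose S)) *\<^sub>R dyad \<xi>0)"
      unfolding frame linear_scale[OF linear_trace_form] trf[OF hermitian_congruence[OF that]] ..
    finally show ?thesis by simp
  qed
  have fst: "A * (dlog P s \<sigma> C (in_frame S (tw t (\<delta> M))) + b * (Re (Ddet w (trace_form (\<delta> M))) / Re (det w))) = L (S ** M ** ctranspose S)"
    if M: "hermitian M" for M
  proof -
    let ?K = "S ** M ** ctranspose S"
    have K: "hermitian ?K" by (rule hermitian_congruence[OF M])
    have "tw t (rank1 \<xi>0 ?K) = rank1 \<xi>0 (?K + (t * Re (trace ?K)) *\<^sub>R mat 1)"
      unfolding tw_def trf[OF K] oid linear_add[OF linear_rank1] by (simp add: linear_scale[OF linear_rank1])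
    then have "in_frame S (tw t (\<delta> M)) = - (1 / 4) *\<^sub>R rank1 \<xi>0 (?K + (t * Re (trace ?K)) *\<^sub>R mat 1)"
      unfolding in_frame_tw[OF iS(1)] frame linear_scale[OF linear_tw] by simp
    moreover have "dlog P s \<sigma> C X = D (in_coords T X)" for X
      unfolding D_def \<theta>_def using dlog_in_coords[OF us iT(1) g(1)] by simp
    ultimately have 1: "dlog P s \<sigma> C (in_frame S (tw t (\<delta> M))) = - (1 / 4) * D (rank1 \<xi> (?K + (t * Re (trace ?K)) *\<^sub>R mat 1))"
      by (simp only: linear_scale[OF linear_in_coords] linear_scale[OF D] rank1_coords \<xi>_def real_scaleR_def)
    \<comment> \<open>The squared length of the covector with respect to \<omega>, evaluated in
      \<omega>-orthonormal coordinates.\<close>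
    have "trace (dyad \<xi>0 ** matrix_inv w) = trace (T ** dyad \<xi>0 ** ctranspose T)"
      unfolding iT(3) using trace_mul_sym[of "dyad \<xi>0 ** ctranspose T" T] by (simp add: matrix_mul_assoc)
    then have "trace (dyad \<xi>0 ** matrix_inv w) = of_real ((norm \<xi>)\<^sup>2)" by (simp only: dyad_coords trace_dyad \<xi>_def)
    then have "Re (Ddet w (dyad \<xi>0)) / Re (det w) = (norm \<xi>)\<^sup>2"
      using pos_def_det[OF w] by (simp add: Ddet_invertible[OF pos_def_det(3)[OF w]] del: of_real_power)
    then have "Re (Ddet w (trace_form (\<delta> M))) / Re (det w) = - (Re (trace ?K) / 4) * (norm \<xi>)\<^sup>2"
      unfolding trw[OF M] Ddet_scaleR scaleR_complex.simps(1) times_divide_eq_right[symmetric] by simp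
    then show ?thesis by (simp only: 1 L_def) (simp add: algebra_simps)
  qed
  have snd: "S ** ((1 / real CARD('n)) *\<^sub>R (ctr (matrix_inv w) (tf (\<delta> M)) - ctr (matrix_inv w ** trace_form (\<delta> M) ** matrix_inv w) (tf c))) ** matrix_inv S
      = (- ((norm \<xi>)\<^sup>2 / (4 * real CARD('n)))) *\<^sub>R (S ** M ** ctranspose S - Re (trace (S ** M ** ctranspose S)) *\<^sub>R K1)"
    if M: "hermitian M" for M
  proof -
    let ?K = "S ** M ** ctranspose S" and ?n = "1 / real CARD('n)"
    let ?k = "Re (trace ?K)"
    have K: "hermitian ?K" by (rule hermitian_congruence[OF M])
    have "tf (rank1 \<xi>0 ?K) = rank1 \<xi>0 (?K - (?k / real CARD('r)) *\<^sub>R mat 1)"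
      unfolding tf_def trf[OF K] oid linear_diff[OF linear_rank1] by (simp add: linear_scale[OF linear_rank1])
    then have fr: "in_frame S (tf (\<delta> M)) = - (1 / 4) *\<^sub>R rank1 \<xi>0 (?K - (?k / real CARD('r)) *\<^sub>R mat 1)"
      unfolding in_frame_tf[OF iS(1)] frame linear_scale[OF linear_tf] by simp
    have "S ** ctr (matrix_inv w) (tf (\<delta> M)) ** matrix_inv S = ctr (ctranspose T ** mat 1 ** T) (in_frame S (tf (\<delta> M)))"
      by (simp add: ctr_in_frame iT(3))
    also have "\<dots> = - (1 / 4) *\<^sub>R ctr (mat 1) (rank1 \<xi> (?K - (?k / real CARD('r)) *\<^sub>R mat 1))"
      unfolding ctr_in_coords fr linear_scale[OF linear_in_coords] rank1_coords \<xi>_def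
        bounded_bilinear.scaleR_right[OF bounded_bilinear_ctr] ..
    finally have 1: "S ** ctr (matrix_inv w) (tf (\<delta> M)) ** matrix_inv S = - (1 / 4) *\<^sub>R ((norm \<xi>)\<^sup>2 *\<^sub>R (?K - (?k / real CARD('r)) *\<^sub>R mat 1))"
      by (simp only: ctr_mat_1_rank1)
    have "matrix_inv w ** dyad \<xi>0 ** matrix_inv w = ctranspose T ** (T ** dyad \<xi>0 ** ctranspose T) ** T"
      unfolding iT(3) by (simp only: matrix_mul_assoc)
    then have wd: "matrix_inv w ** dyad \<xi>0 ** matrix_inv w = ctranspose T ** dyad \<xi> ** T" by (simp only: dyad_coords \<xi>_def)
    have "S ** ctr (matrix_inv w ** trace_form (\<delta> M) ** matrix_inv w) (tf c) ** matrix_inv S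
        = - (?k / 4) *\<^sub>R ctr (ctranspose T ** dyad \<xi> ** T) (in_frame S (tf c))"
      unfolding trw[OF M] bounded_bilinear.scaleR_right[OF bounded_bilinear_matrix_mul] bounded_bilinear.scaleR_left[OF bounded_bilinear_matrix_mul]
        wd ctr_in_frame bounded_bilinear.scaleR_left[OF bounded_bilinear_ctr] ..
    also have "\<dots> = - (?k / 4) *\<^sub>R ((norm \<xi>)\<^sup>2 *\<^sub>R Z)"
      unfolding ctr_in_coords \<theta>0_def[symmetric] Z_def using N by simp
    finally have 2: "S ** ctr (matrix_inv w ** trace_form (\<delta> M) ** matrix_inv w) (tf c) ** matrix_inv S = - (?k / 4) *\<^sub>R ((norm \<xi>)\<^sup>2 *\<^sub>R Z)" .
    \<comment> \<open>Facts 1 and 2 combine because \<open>?K\<close> minus \<open>?k / r\<close>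
      times the identity minus \<open>?k\<close> times \<open>Z\<close> is \<open>?K\<close> minus
      \<open>?k\<close> times \<open>K1\<close>.\<close>
    have "S ** (?n *\<^sub>R (ctr (matrix_inv w) (tf (\<delta> M)) - ctr (matrix_inv w ** trace_form (\<delta> M) ** matrix_inv w) (tf c))) ** matrix_inv S
       = ?n *\<^sub>R (S ** ctr (matrix_inv w) (tf (\<delta> M)) ** matrix_inv S - S ** ctr (matrix_inv w ** trace_form (\<delta> M) ** matrix_inv w) (tf c) ** matrix_inv S)"
      by (simp only: bounded_bilinear.scaleR_right[OF bounded_bilinear_matrix_mul] bounded_bilinear.scaleR_left[OF bounded_bilinear_matrix_mul]
        bounded_bilinear.diff_right[OF bounded_bilinear_matrix_mul] bounded_bilinear.diff_left[OF bounded_bilinear_matrix_mul])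
    also have "\<dots> = (- ((norm \<xi>)\<^sup>2 / (4 * real CARD('n)))) *\<^sub>R (?K - ?k *\<^sub>R K1)"
      unfolding 1 2 K1_def by (simp add: vec_eq_iff scaleR_conv_of_real[where 'a=complex] field_simps)
    finally show ?thesis .
  qed
  show ?thesis
    unfolding \<delta>_def[symmetric] S_def[symmetric]
    by (rule triangular_bij_betw[OF S Llin K1 \<open>L K1 \<noteq> 0\<close> _ fst snd]) (use N in auto)
qed

section \<open>Differential calculus\<close>

subsection \<open>Functions of class \<open>C\<^sup>k\<close>\<close>

text \<open>Both sides are chosen by the same predicate, so they agree even where no derivative
  exists.\<close>

lemma frechet_derivative_cong_open:
  assumes "open S" "x \<in> S" "\<And>y. y \<in> S \<Longrightarrow> f y = g y"
  shows "frechet_derivative f (at x) = frechet_derivative g (at x)"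
proof -
  have "(f has_derivative D) (at x) \<longleftrightarrow> (g has_derivative D) (at x)" for D
    using has_derivative_transform_within_open[of f D x UNIV S g] has_derivative_transform_within_open[of g D x UNIV S f] assms by auto
  then show ?thesis unfolding frechet_derivative_def by simp
qed

lemma differentiable_cong_open:
  assumes "open S" "x \<in> S" "\<And>y. y \<in> S \<Longrightarrow> f y = g y" "f differentiable (at x)"
  shows "g differentiable (at x)"
  using assms has_derivative_transform_within_open[of f _ x UNIV S g] unfolding differentiable_def by blast

lemma Ck_on_cong:
  "open S \<Longrightarrow> (\<And>y. y \<in> S \<Longrightarrow> f y = g y) \<Longrightarrow> Ck_on k S f \<Longrightarrow> Ck_on k S g"
proof (induction k arbitrary: f g)
  case 0 then show ?case using continuous_on_cong[of S S f g] by simp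
next
  case (Suc k)
  have "Ck_on k S (\<lambda>x. frechet_derivative g (at x) v)" for v
  proof (rule Suc.IH[OF Suc.prems(1)])
    show "Ck_on k S (\<lambda>x. frechet_derivative f (at x) v)" using Suc.prems(3) by simp
  qed (use frechet_derivative_cong_open[OF Suc.prems(1) _ Suc.prems(2)] in simp)
  then show ?case using Suc.prems differentiable_cong_open[OF Suc.prems(1) _ Suc.prems(2)] by auto
qed

lemma Ck_on_subset: "Ck_on k S f \<Longrightarrow> T \<subseteq> S \<Longrightarrow> Ck_on k T f"
  by (induction k arbitrary: f) (auto intro: continuous_on_subset)

lemma smooth_on_imp_Ck_on:
  assumes "open S" "smooth_on S f"
  shows "Ck_on k S f"
proof -
  obtain W g where "S \<subseteq> W" "Ck_on k W g" "\<forall>x\<in>S. g x = f x" using assms(2) by (auto simp: smooth_on_def)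
  then show ?thesis using Ck_on_cong[OF assms(1), of g f k] Ck_on_subset by blast
qed

lemma smooth_on_imp_differentiable:
  assumes "smooth_on S f" "x \<in> S"
  obtains g W where "open W" "S \<subseteq> W" "\<And>y. y \<in> S \<Longrightarrow> g y = f y" "g differentiable (at x)"
proof -
  obtain W g where W: "open W" "S \<subseteq> W" "\<forall>k. Ck_on k W g" "\<forall>x\<in>S. g x = f x" using assms(1) by (auto simp: smooth_on_def)
  have "Ck_on (Suc 0) W g" using W(3) by blast
  then have "g differentiable (at x)" using assms(2) W(2) by auto
  then show thesis using that[of W g] W by auto
qed

lemma Ck2_on:
  "Ck_on 2 S f \<longleftrightarrow> (\<forall>x\<in>S. f differentiable (at x)) \<and> (\<forall>v. \<forall>x\<in>S. (\<lambda>x. deriv_dir v f x) differentiable (at x)) \<and>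
    (\<forall>v w. continuous_on S (\<lambda>x. deriv_dir w (\<lambda>y. deriv_dir v f y) x))"
  by (auto simp: numeral_2_eq_2)

lemma differentiable_has_derivative: "f differentiable (at x) \<Longrightarrow> (f has_derivative frechet_derivative f (at x)) (at x)"
  using frechet_derivative_works by blast

lemma deriv_dir_add_scaleR:
  assumes "f differentiable (at x)" "g differentiable (at x)"
  shows "deriv_dir v (\<lambda>x. f x + e *\<^sub>R g x) x = deriv_dir v f x + e *\<^sub>R deriv_dir v g x"
proof -
  have "((\<lambda>x. f x + e *\<^sub>R g x) has_derivative (\<lambda>v. deriv_dir v f x + e *\<^sub>R deriv_dir v g x)) (at x)"
    by (intro has_derivative_add has_derivative_scaleR_right differentiable_has_derivative assms)
  from frechet_derivative_at[OF this] show ?thesis by metis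
qed

lemma Ck2_on_add_scaleR:
  assumes S: "open S" and f: "Ck_on 2 S f" and g: "Ck_on 2 S g"
  shows "Ck_on 2 S (\<lambda>x. f x + e *\<^sub>R g x)"
    "\<And>x v w. x \<in> S \<Longrightarrow> deriv_dir w (\<lambda>y. deriv_dir v (\<lambda>x. f x + e *\<^sub>R g x) y) x =
      deriv_dir w (\<lambda>y. deriv_dir v f y) x + e *\<^sub>R deriv_dir w (\<lambda>y. deriv_dir v g y) x"
proof -
  have d: "f differentiable (at x)" "g differentiable (at x)"
    "(\<lambda>y. deriv_dir v f y) differentiable (at x)" "(\<lambda>y. deriv_dir v g y) differentiable (at x)" if "x \<in> S" for x v
    using f g that by (auto simp: Ck2_on)
  have 1: "deriv_dir v (\<lambda>x. f x + e *\<^sub>R g x) x = deriv_dir v f x + e *\<^sub>R deriv_dir v g x" if "x \<in> S" for x v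
    by (rule deriv_dir_add_scaleR[OF d(1,2)[OF that]])
  have 2: "(\<lambda>y. deriv_dir v f y + e *\<^sub>R deriv_dir v g y) differentiable (at x)" if "x \<in> S" for x v
    by (intro differentiable_add differentiable_scaleR differentiable_const d that)
  show 3: "deriv_dir w (\<lambda>y. deriv_dir v (\<lambda>x. f x + e *\<^sub>R g x) y) x =
      deriv_dir w (\<lambda>y. deriv_dir v f y) x + e *\<^sub>R deriv_dir w (\<lambda>y. deriv_dir v g y) x" if "x \<in> S" for x v w
    using frechet_derivative_cong_open[OF S that, of "\<lambda>y. deriv_dir v (\<lambda>x. f x + e *\<^sub>R g x) y" "\<lambda>y. deriv_dir v f y + e *\<^sub>R deriv_dir v g y"]
      deriv_dir_add_scaleR[OF d(3)[OF that, of v] d(4)[OF that, of v]] 1 by simp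
  have "continuous_on S (\<lambda>x. deriv_dir w (\<lambda>y. deriv_dir v f y) x + e *\<^sub>R deriv_dir w (\<lambda>y. deriv_dir v g y) x)" for v w
    using f g by (intro continuous_intros) (auto simp: Ck2_on)
  then have "continuous_on S (\<lambda>x. deriv_dir w (\<lambda>y. deriv_dir v (\<lambda>x. f x + e *\<^sub>R g x) y) x)" for v w
    using 3 by (subst continuous_on_cong[OF refl]) auto
  moreover have "(\<lambda>y. deriv_dir v (\<lambda>x. f x + e *\<^sub>R g x) y) differentiable (at x)" if "x \<in> S" for x v
    by (rule differentiable_cong_open[OF S that _ 2[OF that, of v]]) (simp add: 1)
  ultimately show "Ck_on 2 S (\<lambda>x. f x + e *\<^sub>R g x)"
    unfolding Ck2_on using d by (auto intro!: differentiable_add differentiable_scaleR differentiable_const)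
qed

section \<open>Symmetry of second derivatives\<close>

lemma has_derivative_line:
  assumes "f differentiable (at (p + s *\<^sub>R u))"
  shows "((\<lambda>s. f (p + s *\<^sub>R u)) has_vector_derivative deriv_dir u f (p + s *\<^sub>R u)) (at s)"
proof -
  have 1: "((\<lambda>s. p + s *\<^sub>R u) has_derivative (\<lambda>h. h *\<^sub>R u)) (at s)" by (auto intro!: derivative_eq_intros)
  have "((\<lambda>s. f (p + s *\<^sub>R u)) has_derivative (\<lambda>h. frechet_derivative f (at (p + s *\<^sub>R u)) (h *\<^sub>R u))) (at s)"
    by (rule has_derivative_compose[OF 1 differentiable_has_derivative[OF assms]])
  moreover have "linear (frechet_derivative f (at (p + s *\<^sub>R u)))"
    by (rule linear_frechet_derivative[OF assms])
  ultimately show ?thesis by (simp add: has_vector_derivative_def linear_scale)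
qed

text \<open>The mean value theorem twice: along \<open>u\<close> for the difference of
  \<open>f\<close> on two parallel segments, then along \<open>v\<close> for the derivative of
  \<open>f\<close> in the direction \<open>u\<close>.\<close>

lemma second_difference:
  fixes f :: "'a::real_normed_vector \<Rightarrow> real"
  assumes h: "h > 0"
    and S: "\<And>a b. 0 \<le> a \<Longrightarrow> a \<le> h \<Longrightarrow> 0 \<le> b \<Longrightarrow> b \<le> h \<Longrightarrow> z + a *\<^sub>R u + b *\<^sub>R v \<in> S"
    and f: "\<And>x. x \<in> S \<Longrightarrow> f differentiable (at x)" "\<And>x. x \<in> S \<Longrightarrow> (\<lambda>x. deriv_dir u f x) differentiable (at x)"
  shows "\<exists>a b. 0 \<le> a \<and> a \<le> h \<and> 0 \<le> b \<and> b \<le> h \<and>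
    f (z + h *\<^sub>R u + h *\<^sub>R v) - f (z + h *\<^sub>R u) - f (z + h *\<^sub>R v) + f z = h * (h * deriv_dir v (\<lambda>x. deriv_dir u f x) (z + a *\<^sub>R u + b *\<^sub>R v))"
proof -
  define \<phi> where "\<phi> s = f (z + h *\<^sub>R v + s *\<^sub>R u) - f (z + s *\<^sub>R u)" for s
  have "(\<phi> has_real_derivative (deriv_dir u f (z + h *\<^sub>R v + s *\<^sub>R u) - deriv_dir u f (z + s *\<^sub>R u))) (at s)" if "0 \<le> s" "s \<le> h" for s
    unfolding \<phi>_def has_real_derivative_iff_has_vector_derivative
    by (intro has_vector_derivative_diff has_derivative_line f)
      (use S[of s h] S[of s 0] that h in \<open>auto simp: algebra_simps\<close>)
  from MVT2[OF h this] obtain a where a: "0 < a" "a < h" "\<phi> h - \<phi> 0 = h * (deriv_dir u f (z + h *\<^sub>R v + a *\<^sub>R u) - deriv_dir u f (z + a *\<^sub>R u))"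
    by auto
  have "((\<lambda>s. deriv_dir u f (z + a *\<^sub>R u + s *\<^sub>R v)) has_real_derivative deriv_dir v (\<lambda>x. deriv_dir u f x) (z + a *\<^sub>R u + s *\<^sub>R v)) (at s)" if "0 \<le> s" "s \<le> h" for s
    unfolding has_real_derivative_iff_has_vector_derivative
    by (intro has_derivative_line f(2)) (use S[of a s] that a in auto)
  from MVT2[OF h this] obtain b where b: "0 < b" "b < h"
    "deriv_dir u f (z + a *\<^sub>R u + h *\<^sub>R v) - deriv_dir u f (z + a *\<^sub>R u + 0 *\<^sub>R v) = h * deriv_dir v (\<lambda>x. deriv_dir u f x) (z + a *\<^sub>R u + b *\<^sub>R v)"
    by auto
  have "f (z + h *\<^sub>R u + h *\<^sub>R v) - f (z + h *\<^sub>R u) - f (z + h *\<^sub>R v) + f z = \<phi> h - \<phi> 0"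
    by (simp add: \<phi>_def algebra_simps)
  also have "\<dots> = h * (h * deriv_dir v (\<lambda>x. deriv_dir u f x) (z + a *\<^sub>R u + b *\<^sub>R v))"
    using a(3) b(3) by (simp add: add.commute add.left_commute add.assoc)
  finally show ?thesis using a b by (intro exI[of _ a] exI[of _ b]) auto
qed

text \<open>The second difference is symmetric in the two directions, while it is the same multiple
  of either mixed derivative at points arbitrarily near \<open>z\<close>; continuity of the mixed
  derivatives forbids distinct values.\<close>

lemma symmetric_second_derivative_real:
  fixes f :: "'a::real_normed_vector \<Rightarrow> real"
  assumes S: "open S" "z \<in> S" and f: "Ck_on 2 S f"
  shows "deriv_dir v (\<lambda>x. deriv_dir u f x) z = deriv_dir u (\<lambda>x. deriv_dir v f x) z"
proof (rule ccontr)
  let ?F = "\<lambda>u v z. deriv_dir v (\<lambda>x. deriv_dir u f x) z"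
  assume ne: "?F u v z \<noteq> ?F v u z"
  define e where "e = dist (?F u v z) (?F v u z) / 2"
  have e: "e > 0" using ne by (simp add: e_def)
  have F: "continuous_on S (?F a b)" for a b using f by (simp add: Ck2_on)
  obtain r where r: "r > 0" "ball z r \<subseteq> S" using S by (meson openE)
  obtain d1 where d1: "d1 > 0" "\<And>x. x \<in> S \<Longrightarrow> dist x z < d1 \<Longrightarrow> dist (?F u v x) (?F u v z) < e"
    using F[of u v] S(2) e unfolding continuous_on_iff by metis
  obtain d2 where d2: "d2 > 0" "\<And>x. x \<in> S \<Longrightarrow> dist x z < d2 \<Longrightarrow> dist (?F v u x) (?F v u z) < e"
    using F[of v u] S(2) e unfolding continuous_on_iff by metis
  define d where "d = min r (min d1 d2)"
  have d: "d > 0" using r d1 d2 by (simp add: d_def)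
  \<comment> \<open>With \<open>h\<close> equal to \<open>d / (2 * n)\<close> the whole
    parallelogram stays within distance \<open>d\<close> of \<open>z\<close>; the \<open>+ 1\<close>
    covers the case that both directions vanish.\<close>
  define n where "n = norm u + norm v + 1"
  define h where "h = d / (2 * n)"
  have n: "n > 0" unfolding n_def by (smt (verit) norm_ge_zero)
  have h: "h > 0" using d n by (simp add: h_def)
  have near: "dist (z + a *\<^sub>R u + b *\<^sub>R v) z < d" if "0 \<le> a" "a \<le> h" "0 \<le> b" "b \<le> h" for a b
  proof -
    have "norm (a *\<^sub>R u + b *\<^sub>R v) \<le> a * norm u + b * norm v" using norm_triangle_ineq[of "a *\<^sub>R u" "b *\<^sub>R v"] that by simp
    also have "\<dots> \<le> h * norm u + h * norm v" using that by (intro add_mono mult_right_mono) auto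
    also have "\<dots> \<le> h * n" using h by (simp add: n_def algebra_simps)
    also have "\<dots> = d / 2" using n by (simp add: h_def)
    also have "\<dots> < d" using d by simp
    finally show ?thesis by (simp add: dist_norm add.assoc)
  qed
  then have inS: "z + a *\<^sub>R u + b *\<^sub>R v \<in> S" if "0 \<le> a" "a \<le> h" "0 \<le> b" "b \<le> h" for a b
    using r that by (auto simp: d_def dist_commute)
  have fd: "\<And>x. x \<in> S \<Longrightarrow> f differentiable (at x)" "\<And>x w. x \<in> S \<Longrightarrow> (\<lambda>x. deriv_dir w f x) differentiable (at x)"
    using f by (auto simp: Ck2_on)
  obtain a b where ab: "0 \<le> a" "a \<le> h" "0 \<le> b" "b \<le> h"
    "f (z + h *\<^sub>R u + h *\<^sub>R v) - f (z + h *\<^sub>R u) - f (z + h *\<^sub>R v) + f z = h * (h * ?F u v (z + a *\<^sub>R u + b *\<^sub>R v))"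
    using second_difference[OF h inS fd(1) fd(2)] by blast
  have inS': "z + a *\<^sub>R v + b *\<^sub>R u \<in> S" if "0 \<le> a" "a \<le> h" "0 \<le> b" "b \<le> h" for a b
    using inS[of b a] that by (simp add: algebra_simps)
  obtain a' b' where ab': "0 \<le> a'" "a' \<le> h" "0 \<le> b'" "b' \<le> h"
    "f (z + h *\<^sub>R v + h *\<^sub>R u) - f (z + h *\<^sub>R v) - f (z + h *\<^sub>R u) + f z = h * (h * ?F v u (z + a' *\<^sub>R v + b' *\<^sub>R u))"
    using second_difference[OF h inS' fd(1) fd(2)] by blast
  have "h * (h * ?F u v (z + a *\<^sub>R u + b *\<^sub>R v)) = h * (h * ?F v u (z + b' *\<^sub>R u + a' *\<^sub>R v))"
    using ab(5) ab'(5) by (simp add: algebra_simps)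
  then have "?F u v (z + a *\<^sub>R u + b *\<^sub>R v) = ?F v u (z + b' *\<^sub>R u + a' *\<^sub>R v)" using h by simp
  moreover have "dist (?F u v (z + a *\<^sub>R u + b *\<^sub>R v)) (?F u v z) < e"
    using near[OF ab(1-4)] by (intro d1(2) inS ab) (simp add: d_def)
  moreover have "dist (?F v u (z + b' *\<^sub>R u + a' *\<^sub>R v)) (?F v u z) < e"
    using near[OF ab'(3,4,1,2)] by (intro d2(2) inS ab') (simp add: d_def)
  ultimately show False
    using dist_triangle3[of "?F u v z" "?F v u z" "?F u v (z + a *\<^sub>R u + b *\<^sub>R v)"] by (simp add: e_def)
qed

lemma symmetric_second_derivative:
  fixes f :: "'a::real_normed_vector \<Rightarrow> 'b::euclidean_space"
  assumes S: "open S" "z \<in> S" and f: "Ck_on 2 S f"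
  shows "deriv_dir v (\<lambda>x. deriv_dir u f x) z = deriv_dir u (\<lambda>x. deriv_dir v f x) z"
proof (rule euclidean_eqI)
  fix i :: 'b assume "i \<in> Basis"
  let ?g = "\<lambda>x. f x \<bullet> i"
  have fd: "\<And>x. x \<in> S \<Longrightarrow> f differentiable (at x)" "\<And>x w. x \<in> S \<Longrightarrow> (\<lambda>x. deriv_dir w f x) differentiable (at x)"
    using f by (auto simp: Ck2_on)
  have d: "((\<lambda>x. h x \<bullet> i) has_derivative (\<lambda>w. deriv_dir w h x \<bullet> i)) (at x)" if "h differentiable (at x)" for h :: "'a \<Rightarrow> 'b" and x
    by (intro has_derivative_inner_left differentiable_has_derivative that)
  have d': "deriv_dir w (\<lambda>x. h x \<bullet> i) x = deriv_dir w h x \<bullet> i" "(\<lambda>x. h x \<bullet> i) differentiable (at x)" if "h differentiable (at x)" for h :: "'a \<Rightarrow> 'b" and x w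
    using frechet_derivative_at[OF d[OF that]] d[OF that] unfolding differentiable_def by metis+
  have 1: "deriv_dir w ?g x = deriv_dir w f x \<bullet> i" if "x \<in> S" for x w by (rule d'(1)[OF fd(1)[OF that]])
  have 2: "deriv_dir w' (\<lambda>x. deriv_dir w ?g x) x = deriv_dir w' (\<lambda>x. deriv_dir w f x) x \<bullet> i" if "x \<in> S" for x w w'
    using frechet_derivative_cong_open[OF S(1) that, of "\<lambda>x. deriv_dir w ?g x" "\<lambda>x. deriv_dir w f x \<bullet> i"] 1 d'(1)[OF fd(2)[OF that]] by metis
  have "Ck_on 2 S ?g"
    unfolding Ck2_on
  proof (intro conjI allI ballI)
    fix x v assume x: "x \<in> S"
    show "?g differentiable (at x)" by (rule d'(2)[OF fd(1)[OF x]])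
    show "(\<lambda>x. deriv_dir v ?g x) differentiable (at x)"
      by (rule differentiable_cong_open[OF S(1) x _ d'(2)[OF fd(2)[OF x, of v]]]) (simp add: 1)
  next
    fix v w
    have "continuous_on S (\<lambda>x. deriv_dir w (\<lambda>x. deriv_dir v f x) x \<bullet> i)" using f by (intro continuous_intros) (simp add: Ck2_on)
    then show "continuous_on S (\<lambda>x. deriv_dir w (\<lambda>x. deriv_dir v ?g x) x)" using 2 by (subst continuous_on_cong[OF refl]) auto
  qed
  from symmetric_second_derivative_real[OF S this, of v u] 2[OF S(2)]
  show "deriv_dir v (\<lambda>x. deriv_dir u f x) z \<bullet> i = deriv_dir u (\<lambda>x. deriv_dir v f x) z \<bullet> i" by simp
qed

subsection \<open>Wirtinger derivatives of matrix valued functions\<close>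

definition cs :: "complex \<Rightarrow> complex^'p^'q \<Rightarrow> complex^'p^'q" where
  "cs z A = (\<chi> a b. z * A $ a $ b)"

lemma cs_nth [simp]: "cs z A $ a $ b = z * A $ a $ b"
  by (simp add: cs_def)

lemma cs_mul_left: "cs z A ** B = cs z (A ** B)"
  and cs_mul_right: "A' ** cs z B' = cs z (A' ** B')"
  by (simp_all add: vec_eq_iff matrix_matrix_mult_def sum_distrib_left mult_ac)

lemma cs_cs: "cs a (cs b A) = cs (a * b) A"
  and cs_add: "cs a (A + B) = cs a A + cs a B"
  and cs_diff: "cs a (A - B) = cs a A - cs a B"
  and cs_minus: "cs a (- A) = - cs a A"
  and cs_sum: "cs a (sum f I) = (\<Sum>i\<in>I. cs a (f i))"
  and cs_add_left: "cs (a + b) A = cs a A + cs b A"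
  and cs_of_real: "cs (of_real x) A = x *\<^sub>R A"
  and cs_scaleR: "cs a (x *\<^sub>R A) = x *\<^sub>R cs a A"
  and cs_0 [simp]: "cs 0 A = 0" and cs_1 [simp]: "cs 1 A = A"
  and ctranspose_cs: "ctranspose (cs a A) = cs (cnj a) (ctranspose A)"
  by (simp_all add: vec_eq_iff algebra_simps sum_distrib_left scaleR_conv_of_real[where 'a=complex])

lemma bounded_linear_cs: "bounded_linear (cs a :: complex^'p^'q \<Rightarrow> _)"
  by (intro linear_conv_bounded_linear[THEN iffD1] linearI) (simp_all add: cs_add cs_scaleR)

text \<open>Wirtinger operators on a given real linear derivative instead of on a function: product
  and chain rules then become linear algebra, with differentiability dealt with beforehand.\<close>

definition ldel :: "'n \<Rightarrow> (complex^'n::finite \<Rightarrow> complex^'p^'q) \<Rightarrow> complex^'p^'q" where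
  "ldel j L = cs (1 / 2) (L (axis j 1) - cs \<i> (L (axis j \<i>)))"

definition ldbar :: "'n \<Rightarrow> (complex^'n::finite \<Rightarrow> complex^'p^'q) \<Rightarrow> complex^'p^'q" where
  "ldbar j L = cs (1 / 2) (L (axis j 1) + cs \<i> (L (axis j \<i>)))"

definition delbar_matrix :: "'n::finite \<Rightarrow> (complex^'n \<Rightarrow> complex^'r^'r) \<Rightarrow> complex^'n \<Rightarrow> complex^'r^'r" where
  "delbar_matrix j H z = (\<chi> a b. delbar j (\<lambda>w. H w $ a $ b) z)"

lemma del_matrix_ldel:
  assumes "(H has_derivative H') (at z)"
  shows "del_matrix j H z = ldel j H'" "delbar_matrix j H z = ldbar j H'"
proof -
  have "((\<lambda>w. H w $ a $ b) has_derivative (\<lambda>v. H' v $ a $ b)) (at z)" for a b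
    by (intro bounded_linear.has_derivative[OF bounded_linear_vec_nth] assms)
  from frechet_derivative_at[OF this] have "deriv_dir v (\<lambda>w. H w $ a $ b) z = H' v $ a $ b" for a b v by metis
  then show "del_matrix j H z = ldel j H'" "delbar_matrix j H z = ldbar j H'"
    by (simp_all add: vec_eq_iff del_matrix_def delbar_matrix_def del_def delbar_def ldel_def ldbar_def)
qed

lemma ldel_mul:
  "ldel j (\<lambda>v. F ** L v + M v ** G) = F ** ldel j L + ldel j M ** (G :: complex^'p^'q)"
  "ldbar j (\<lambda>v. F ** L v + M v ** G) = F ** ldbar j L + ldbar j M ** (G :: complex^'p^'q)"
  unfolding ldel_def ldbar_def
  by (simp_all add: cs_mul_left cs_mul_right cs_add cs_diff
    bounded_bilinear.add_left[OF bounded_bilinear_matrix_mul] bounded_bilinear.add_right[OF bounded_bilinear_matrix_mul]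
    bounded_bilinear.diff_left[OF bounded_bilinear_matrix_mul] bounded_bilinear.diff_right[OF bounded_bilinear_matrix_mul])

lemma sum_Basis_cvec:
  fixes f :: "complex^'n::finite \<Rightarrow> 'b::comm_monoid_add"
  shows "(\<Sum>b\<in>Basis. f b) = (\<Sum>j\<in>UNIV. f (axis j 1) + f (axis j \<i>))"
proof -
  have "(Basis :: (complex^'n) set) = (\<Union>j. {axis j 1, axis j \<i>})"
    by (auto simp: Basis_vec_def Basis_complex_def)
  moreover have "(\<Sum>b\<in>(\<Union>j. {axis j 1, axis j \<i>}). f b) = (\<Sum>j\<in>UNIV. \<Sum>b\<in>{axis j 1, axis j \<i>}. f b)"
    by (rule sum.UNION_disjoint) (auto simp: axis_eq_axis)
  moreover have "(\<Sum>b\<in>{axis j 1, axis j \<i> :: complex^'n}. f b) = f (axis j 1) + f (axis j \<i>)" for j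
    by (simp add: axis_eq_axis complex_eq_iff)
  ultimately show ?thesis by simp
qed

text \<open>Coefficients of d/dz and (for \<open>qc\<close>) d/dz-bar along the real basis vectors.
  Extended linearly, the same functions are the symbols of these operators at a real
  covector.\<close>

definition pc :: "'n \<Rightarrow> complex^'n \<Rightarrow> complex" where "pc j b = cnj (b $ j) / 2"
definition qc :: "'n \<Rightarrow> complex^'n \<Rightarrow> complex" where "qc j b = b $ j / 2"

lemma ldel_Basis:
  "ldel j L = (\<Sum>b\<in>Basis. cs (pc j b) (L b))" "ldbar j L = (\<Sum>b\<in>Basis. cs (qc j b) (L b))"
proof -
  have "(\<Sum>b\<in>Basis. cs (pc j b) (L b)) = (\<Sum>i\<in>UNIV. if i = j then cs (1/2) (L (axis j 1)) + cs (- \<i> / 2) (L (axis j \<i>)) else 0)"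
    unfolding sum_Basis_cvec by (intro sum.cong refl) (auto simp: pc_def axis_def)
  then show "ldel j L = (\<Sum>b\<in>Basis. cs (pc j b) (L b))" by (simp add: ldel_def vec_eq_iff algebra_simps)
  have "(\<Sum>b\<in>Basis. cs (qc j b) (L b)) = (\<Sum>i\<in>UNIV. if i = j then cs (1/2) (L (axis j 1)) + cs (\<i> / 2) (L (axis j \<i>)) else 0)"
    unfolding sum_Basis_cvec by (intro sum.cong refl) (auto simp: qc_def axis_def)
  then show "ldbar j L = (\<Sum>b\<in>Basis. cs (qc j b) (L b))" by (simp add: ldbar_def vec_eq_iff algebra_simps)
qed

text \<open>The splitting of a real linear map into its complex linear and antilinear parts.\<close>

lemma linear_wirtinger:
  fixes L :: "complex^'n::finite \<Rightarrow> complex^'p^'q"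
  assumes "linear L"
  shows "L u = (\<Sum>a\<in>UNIV. cs (u $ a) (ldel a L) + cs (cnj (u $ a)) (ldbar a L))"
proof -
  have "L u = L (\<Sum>b\<in>Basis. (u \<bullet> b) *\<^sub>R b)" by (simp add: euclidean_representation)
  also have "\<dots> = (\<Sum>b\<in>Basis. (u \<bullet> b) *\<^sub>R L b)" by (simp add: linear_sum[OF assms] linear_scale[OF assms])
  also have "\<dots> = (\<Sum>a\<in>UNIV. Re (u $ a) *\<^sub>R L (axis a 1) + Im (u $ a) *\<^sub>R L (axis a \<i>))"
    unfolding sum_Basis_cvec by (simp add: inner_axis inner_complex_def)
  also have "\<dots> = (\<Sum>a\<in>UNIV. cs (u $ a) (ldel a L) + cs (cnj (u $ a)) (ldbar a L))"
    by (intro sum.cong refl) (simp add: ldel_def ldbar_def vec_eq_iff complex_eq_iff scaleR_conv_of_real[where 'a=complex], auto simp: field_simps)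
  finally show ?thesis .
qed

lemma ldbar_complex_linear:
  assumes "\<And>j. L (axis j \<i>) = cs \<i> (L (axis j 1))"
  shows "ldbar j L = 0" "ldel j L = L (axis j 1)"
  unfolding ldbar_def ldel_def assms by (simp_all add: vec_eq_iff)

text \<open>Chain rule for an inner holomorphic map: its derivative is complex linear, so
  holomorphic and antiholomorphic derivatives do not mix.\<close>

lemma ldel_compose_complex_linear:
  fixes L :: "complex^'n::finite \<Rightarrow> complex^'p^'q" and W :: "complex^'m::finite \<Rightarrow> complex^'n"
  assumes L: "linear L" and W: "W (axis j \<i>) = \<i> *s W (axis j 1)"
  shows "ldel j (\<lambda>v. L (W v)) = (\<Sum>a\<in>UNIV. cs (W (axis j 1) $ a) (ldel a L))"
    "ldbar j (\<lambda>v. L (W v)) = (\<Sum>a\<in>UNIV. cs (cnj (W (axis j 1) $ a)) (ldbar a L))"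
proof -
  show "ldel j (\<lambda>v. L (W v)) = (\<Sum>a\<in>UNIV. cs (W (axis j 1) $ a) (ldel a L))"
    unfolding ldel_def[of j] W linear_wirtinger[OF L, of "W (axis j 1)"] linear_wirtinger[OF L, of "\<i> *s W (axis j 1)"]
    by (simp add: vec_eq_iff sum_distrib_left sum_subtractf[symmetric] algebra_simps)
  show "ldbar j (\<lambda>v. L (W v)) = (\<Sum>a\<in>UNIV. cs (cnj (W (axis j 1) $ a)) (ldbar a L))"
    unfolding ldbar_def[of j] W linear_wirtinger[OF L, of "W (axis j 1)"] linear_wirtinger[OF L, of "\<i> *s W (axis j 1)"]
    by (simp add: vec_eq_iff sum_distrib_left sum.distrib[symmetric] algebra_simps)
qed

subsection \<open>The Chern curvature in terms of the 2-jet\<close>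

text \<open>\<open>jetP\<close>, \<open>jetQ\<close> and \<open>jetR\<close> collect the
  holomorphic, antiholomorphic and mixed Wirtinger derivatives of a Gram matrix. They are written
  over the real basis because both ellipticity and closeness are phrased with real directional
  derivatives.\<close>

definition jetP :: "(complex^'n \<Rightarrow> complex^'r^'r) \<Rightarrow> complex^'n \<Rightarrow> complex^'r^'r^'n::finite" where
  "jetP H z = (\<chi> j. \<Sum>b\<in>Basis. cs (pc j b) (deriv_dir b H z))"

definition jetQ :: "(complex^'n \<Rightarrow> complex^'r^'r) \<Rightarrow> complex^'n \<Rightarrow> complex^'r^'r^'n::finite" where
  "jetQ H z = (\<chi> k. \<Sum>b\<in>Basis. cs (qc k b) (deriv_dir b H z))"

definition jetR :: "(complex^'n \<Rightarrow> complex^'r^'r) \<Rightarrow> complex^'n \<Rightarrow> ('n::finite, 'r::finite) curv" where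
  "jetR H z = (\<chi> j k. \<Sum>b\<in>Basis. \<Sum>b'\<in>Basis. cs (qc k b * pc j b') (deriv_dir b (deriv_dir b' H) z))"

text \<open>The curvature after carrying out the outer differentiation of the connection form: a
  function of the 2-jet, smooth where \<open>H\<close> is invertible.\<close>

definition curvA :: "complex^'r^'r \<Rightarrow> complex^'r^'r^'n \<Rightarrow> complex^'r^'r^'n \<Rightarrow> ('n, 'r) curv \<Rightarrow> ('n::finite, 'r::finite) curv" where
  "curvA H P Q R = (\<chi> j k. P $ j ** matrix_inv H ** Q $ k ** matrix_inv H - R $ j $ k ** matrix_inv H)"

lemma jetP_del_matrix:
  assumes "H differentiable (at z)"
  shows "jetP H z = (\<chi> j. del_matrix j H z)" "jetQ H z = (\<chi> j. delbar_matrix j H z)"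
  using del_matrix_ldel[OF differentiable_has_derivative[OF assms]]
  by (simp_all add: vec_eq_iff jetP_def jetQ_def ldel_Basis)

lemma chern_ldbar:
  assumes "((\<lambda>w. del_matrix j H w ** matrix_inv (H w)) has_derivative G) (at z)"
  shows "chern H z $ j $ k = - ldbar k G"
  using del_matrix_ldel(2)[OF assms, of k] by (simp add: chern_def delbar_matrix_def vec_eq_iff)

text \<open>Product rule and derivative of the inverse. The second conclusion is what allows the
  curvature to be read off from a derivative of the connection form under changes of frame and at a
  maximum.\<close>

lemma chern_curvA:
  assumes U: "open U" "z \<in> U" and H: "Ck_on 2 U H" and inv: "invertible (H z)"
  shows "chern H z = curvA (H z) (jetP H z) (jetQ H z) (jetR H z)"
    "\<And>j. (\<lambda>w. del_matrix j H w ** matrix_inv (H w)) differentiable (at z)"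
proof -
  have d: "H differentiable (at x)" "(\<lambda>y. deriv_dir v H y) differentiable (at x)" if "x \<in> U" for x v
    using H that by (auto simp: Ck2_on)
  let ?H' = "frechet_derivative H (at z)" and ?Hi = "matrix_inv (H z)"
  have dH: "(H has_derivative ?H') (at z)" by (rule differentiable_has_derivative[OF d(1)[OF U(2)]])
  let ?P' = "\<lambda>j v. \<Sum>b\<in>Basis. cs (pc j b) (deriv_dir v (deriv_dir b H) z)"
  have dP: "((\<lambda>w. del_matrix j H w) has_derivative ?P' j) (at z)" for j
  proof -
    have "((\<lambda>w. \<Sum>b\<in>Basis. cs (pc j b) (deriv_dir b H w)) has_derivative ?P' j) (at z)"
      by (intro has_derivative_sum bounded_linear.has_derivative[OF bounded_linear_cs] differentiable_has_derivative d U)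
    then show ?thesis
      by (rule has_derivative_transform_within_open[OF _ U])
        (use jetP_del_matrix(1)[OF d(1)] in \<open>simp add: vec_eq_iff jetP_def\<close>)
  qed
  let ?G = "\<lambda>j v. del_matrix j H z ** (- (?Hi ** ?H' v ** ?Hi)) + ?P' j v ** ?Hi"
  have dG: "((\<lambda>w. del_matrix j H w ** matrix_inv (H w)) has_derivative ?G j) (at z)" for j
    by (intro bounded_bilinear.FDERIV[OF bounded_bilinear_matrix_mul] dP
        has_derivative_compose[OF dH has_derivative_matrix_inv[OF inv]])
  then show "\<And>j. (\<lambda>w. del_matrix j H w ** matrix_inv (H w)) differentiable (at z)" unfolding differentiable_def by blast
  have "chern H z $ j $ k = curvA (H z) (jetP H z) (jetQ H z) (jetR H z) $ j $ k" for j k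
  proof -
    have l1: "ldbar k (\<lambda>v. - (?Hi ** ?H' v ** ?Hi)) = - (?Hi ** ldbar k ?H' ** ?Hi)"
      unfolding ldbar_def by (simp add: cs_mul_left cs_mul_right cs_add cs_diff cs_minus
        bounded_bilinear.add_left[OF bounded_bilinear_matrix_mul] bounded_bilinear.add_right[OF bounded_bilinear_matrix_mul])
    have l2: "ldbar k (?P' j) = jetR H z $ j $ k"
      unfolding ldel_Basis(2) by (simp add: jetR_def cs_sum cs_cs)
    have "chern H z $ j $ k = - (del_matrix j H z ** (- (?Hi ** ldbar k ?H' ** ?Hi)) + jetR H z $ j $ k ** ?Hi)"
      unfolding chern_ldbar[OF dG] ldel_mul l1 l2 ..
    moreover have "ldbar k ?H' = jetQ H z $ k" by (simp add: ldel_Basis jetQ_def)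
    moreover have "del_matrix j H z = jetP H z $ j" using jetP_del_matrix(1)[OF d(1)[OF U(2)]] by simp
    ultimately show ?thesis
      by (simp add: curvA_def bounded_bilinear.minus_right[OF bounded_bilinear_matrix_mul] matrix_mul_assoc)
  qed
  then show "chern H z = curvA (H z) (jetP H z) (jetQ H z) (jetR H z)" by (simp add: vec_eq_iff)
qed

lemma deriv_dir_hermitian:
  fixes H :: "complex^'n::finite \<Rightarrow> complex^'r::finite^'r"
  assumes U: "open U" "x \<in> U" and H: "H differentiable (at x)" and herm: "\<And>x. x \<in> U \<Longrightarrow> hermitian (H x)"
  shows "hermitian (deriv_dir v H x)"
proof -
  have "((\<lambda>x. ctranspose (H x)) has_derivative (\<lambda>v. ctranspose (deriv_dir v H x))) (at x)"
    by (intro bounded_linear.has_derivative[OF bounded_linear_ctranspose] differentiable_has_derivative H)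
  from frechet_derivative_at[OF this] have "deriv_dir v (\<lambda>x. ctranspose (H x)) x = ctranspose (deriv_dir v H x)" by metis
  moreover have "frechet_derivative (\<lambda>x. ctranspose (H x)) (at x) = frechet_derivative H (at x)"
    by (rule frechet_derivative_cong_open[OF U]) (use herm in \<open>simp add: hermitian_def\<close>)
  ultimately show ?thesis by (simp add: hermitian_def)
qed

text \<open>For hermitian \<open>H\<close> the arrays \<open>jetP\<close> and \<open>jetQ\<close>
  are adjoint to each other, and symmetry of second derivatives makes \<open>jetR\<close> adjoint to
  itself with form indices exchanged; after multiplication by \<open>H\<close> the formula
  \<open>curvA\<close> is visibly symmetric.\<close>

lemma hermH_chern:
  fixes H :: "complex^'n::finite \<Rightarrow> complex^'r::finite^'r"
  assumes U: "open U" "z \<in> U" and H: "Ck_on 2 U H" and inv: "invertible (H z)" and herm: "\<And>x. x \<in> U \<Longrightarrow> hermitian (H x)"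
  shows "hermH (H z) (chern H z)"
proof -
  have d: "H differentiable (at x)" "(\<lambda>y. deriv_dir v H y) differentiable (at x)" if "x \<in> U" for x v
    using H that by (auto simp: Ck2_on)
  have h1: "ctranspose (deriv_dir v H x) = deriv_dir v H x" if "x \<in> U" for v x
    using deriv_dir_hermitian[OF U(1) that d(1)[OF that] herm] by (simp add: hermitian_def)
  have h2: "ctranspose (deriv_dir w (deriv_dir v H) z) = deriv_dir w (deriv_dir v H) z" for v w
    using deriv_dir_hermitian[OF U d(2)[OF U(2)]] h1 by (simp add: hermitian_def)
  have cnj_pc: "cnj (pc j b) = qc j b" "cnj (qc j b) = pc j b" for j and b :: "complex^'n" by (simp_all add: pc_def qc_def)
  have ctsum: "ctranspose (sum f I) = (\<Sum>i\<in>I. ctranspose (f i))" for f :: "complex^'n \<Rightarrow> complex^'r^'r" and I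
    by (simp add: vec_eq_iff)
  have P: "ctranspose (jetP H z $ j) = jetQ H z $ j" for j
    by (simp add: jetP_def jetQ_def ctsum ctranspose_cs cnj_pc h1[OF U(2)])
  then have Q: "ctranspose (jetQ H z $ j) = jetP H z $ j" for j by (metis ctranspose_ctranspose)
  have R: "ctranspose (jetR H z $ j $ k) = jetR H z $ k $ j" for j k
  proof -
    have "ctranspose (jetR H z $ j $ k) = (\<Sum>b\<in>Basis. \<Sum>b'\<in>Basis. cs (pc k b * qc j b') (deriv_dir b (deriv_dir b' H) z))"
      by (simp add: jetR_def ctsum ctranspose_cs cnj_pc h2)
    also have "\<dots> = (\<Sum>b'\<in>Basis. \<Sum>b\<in>Basis. cs (qc j b' * pc k b) (deriv_dir b' (deriv_dir b H) z))"
      by (subst sum.swap) (simp add: mult.commute symmetric_second_derivative[OF U H])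
    finally show ?thesis by (simp add: jetR_def)
  qed
  have "hermitian (H z)" by (rule herm[OF U(2)])
  then have Hi: "ctranspose (matrix_inv (H z)) = matrix_inv (H z)"
    by (simp add: ctranspose_matrix_inv[OF inv] hermitian_def)
  have HiH: "X ** matrix_inv (H z) ** H z = X" for X :: "complex^'r^'r"
    by (simp add: matrix_mul_assoc[symmetric] matrix_inv_cancel[OF inv])
  have "chern H z $ j $ k ** H z = jetP H z $ j ** matrix_inv (H z) ** jetQ H z $ k - jetR H z $ j $ k" for j k
    unfolding chern_curvA(1)[OF U H inv] by (simp add: curvA_def bounded_bilinear.diff_left[OF bounded_bilinear_matrix_mul] HiH)
  then show ?thesis
    by (simp add: hermH_def ctranspose_diff ctranspose_mul P Q R Hi matrix_mul_assoc)
qed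

lemma jets_add_scaleR:
  assumes U: "open U" "z \<in> U" and H: "Ck_on 2 U H" and N: "Ck_on 2 U N"
  shows "jetP (\<lambda>z. H z + e *\<^sub>R N z) z = jetP H z + e *\<^sub>R jetP N z"
    "jetQ (\<lambda>z. H z + e *\<^sub>R N z) z = jetQ H z + e *\<^sub>R jetQ N z"
    "jetR (\<lambda>z. H z + e *\<^sub>R N z) z = jetR H z + e *\<^sub>R jetR N z"
proof -
  have d: "H differentiable (at z)" "N differentiable (at z)" using H N U by (auto simp: Ck2_on)
  show "jetP (\<lambda>z. H z + e *\<^sub>R N z) z = jetP H z + e *\<^sub>R jetP N z" "jetQ (\<lambda>z. H z + e *\<^sub>R N z) z = jetQ H z + e *\<^sub>R jetQ N z"
    by (simp_all add: jetP_def jetQ_def deriv_dir_add_scaleR[OF d] cs_add cs_scaleR sum.distrib scaleR_sum_right vec_eq_iff)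
  show "jetR (\<lambda>z. H z + e *\<^sub>R N z) z = jetR H z + e *\<^sub>R jetR N z"
    by (simp add: jetR_def Ck2_on_add_scaleR(2)[OF U(1) H N U(2)] cs_add cs_scaleR sum.distrib scaleR_sum_right vec_eq_iff)
qed

text \<open>The differential of \<open>curvA\<close>, with the jets of the variation as independent
  arguments: putting all but the last to 0 isolates the second order part.\<close>

definition dcurvA :: "complex^'r^'r \<Rightarrow> complex^'r^'r^'n \<Rightarrow> complex^'r^'r^'n \<Rightarrow> ('n, 'r) curv \<Rightarrow>
    complex^'r^'r \<Rightarrow> complex^'r^'r^'n \<Rightarrow> complex^'r^'r^'n \<Rightarrow> ('n, 'r) curv \<Rightarrow> ('n::finite, 'r::finite) curv" where
  "dcurvA H P Q R N PN QN RN = (\<chi> j k.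
     (P $ j ** matrix_inv H ** QN $ k + (PN $ j ** matrix_inv H - P $ j ** (matrix_inv H ** N ** matrix_inv H)) ** Q $ k) ** matrix_inv H
     - P $ j ** matrix_inv H ** Q $ k ** (matrix_inv H ** N ** matrix_inv H)
     - (RN $ j $ k ** matrix_inv H - R $ j $ k ** (matrix_inv H ** N ** matrix_inv H)))"

lemma curvA_line:
  fixes P Q PN QN :: "complex^'r::finite^'r^'n::finite"
  assumes inv: "invertible H"
  shows "((\<lambda>e. curvA (H + e *\<^sub>R N) (P + e *\<^sub>R PN) (Q + e *\<^sub>R QN) (R + e *\<^sub>R RN)) has_vector_derivative dcurvA H P Q R N PN QN RN) (at 0)"
proof -
  have l: "((\<lambda>e::real. X + e *\<^sub>R Y) has_vector_derivative Y) (at 0)" for X Y :: "'b::real_normed_vector"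
    by (auto intro!: derivative_eq_intros)
  have i: "((\<lambda>e. matrix_inv (H + e *\<^sub>R N)) has_vector_derivative - (matrix_inv H ** N ** matrix_inv H)) (at 0)"
    using has_vector_derivative_matrix_inv[OF l[of H N]] inv by simp
  have "((\<lambda>e. (P + e *\<^sub>R PN) $ j ** matrix_inv (H + e *\<^sub>R N) ** (Q + e *\<^sub>R QN) $ k ** matrix_inv (H + e *\<^sub>R N) - (R + e *\<^sub>R RN) $ j $ k ** matrix_inv (H + e *\<^sub>R N)) has_vector_derivative
    dcurvA H P Q R N PN QN RN $ j $ k) (at 0)" for j k
  proof -
    have "((\<lambda>e. (P + e *\<^sub>R PN) $ j ** matrix_inv (H + e *\<^sub>R N) ** (Q + e *\<^sub>R QN) $ k ** matrix_inv (H + e *\<^sub>R N) - (R + e *\<^sub>R RN) $ j $ k ** matrix_inv (H + e *\<^sub>R N)) has_vector_derivative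
      (((P + 0 *\<^sub>R PN) $ j ** matrix_inv (H + 0 *\<^sub>R N) ** (Q + 0 *\<^sub>R QN) $ k) ** (- (matrix_inv H ** N ** matrix_inv H)) +
       ((P + 0 *\<^sub>R PN) $ j ** matrix_inv (H + 0 *\<^sub>R N) ** QN $ k +
        ((P + 0 *\<^sub>R PN) $ j ** (- (matrix_inv H ** N ** matrix_inv H)) + PN $ j ** matrix_inv (H + 0 *\<^sub>R N)) ** (Q + 0 *\<^sub>R QN) $ k) ** matrix_inv (H + 0 *\<^sub>R N)) -
       ((R + 0 *\<^sub>R RN) $ j $ k ** (- (matrix_inv H ** N ** matrix_inv H)) + RN $ j $ k ** matrix_inv (H + 0 *\<^sub>R N))) (at 0)"
      by (intro has_vector_derivative_diff has_vector_derivative_matrix_mul has_vector_derivative_vec_nth l i)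
    then show ?thesis
      by (simp add: dcurvA_def bounded_bilinear.minus_right[OF bounded_bilinear_matrix_mul] algebra_simps)
  qed
  then have "((\<lambda>e. \<chi> j k. (P + e *\<^sub>R PN) $ j ** matrix_inv (H + e *\<^sub>R N) ** (Q + e *\<^sub>R QN) $ k ** matrix_inv (H + e *\<^sub>R N) - (R + e *\<^sub>R RN) $ j $ k ** matrix_inv (H + e *\<^sub>R N)) has_vector_derivative
      (\<chi> j k. dcurvA H P Q R N PN QN RN $ j $ k)) (at 0)"
    by (intro has_vector_derivative_vec_lambda)
  then show ?thesis by (simp only: curvA_def[symmetric] vec_lambda_eta)
qed

lemma linear_dcurvA:
  "linear (\<lambda>(N, PN, QN, RN). dcurvA H P Q R N PN QN RN)"
  by (rule linearI) (auto simp: dcurvA_def vec_eq_iff algebra_simps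
    bounded_bilinear.add_left[OF bounded_bilinear_matrix_mul] bounded_bilinear.add_right[OF bounded_bilinear_matrix_mul]
    bounded_bilinear.diff_left[OF bounded_bilinear_matrix_mul] bounded_bilinear.diff_right[OF bounded_bilinear_matrix_mul]
    bounded_bilinear.scaleR_left[OF bounded_bilinear_matrix_mul] bounded_bilinear.scaleR_right[OF bounded_bilinear_matrix_mul])

lemma dcurvA_second_order:
  "dcurvA H P Q R 0 0 0 RN = (\<chi> j k. - (RN $ j $ k ** matrix_inv H))"
  by (simp add: dcurvA_def vec_eq_iff bounded_bilinear.zero_left[OF bounded_bilinear_matrix_mul] bounded_bilinear.zero_right[OF bounded_bilinear_matrix_mul])

lemma continuous_on_curvA:
  fixes P Q :: "'x::topological_space \<Rightarrow> complex^'r::finite^'r^'n::finite"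
  assumes "continuous_on S H" "continuous_on S P" "continuous_on S Q" "continuous_on S R" "\<And>x. x \<in> S \<Longrightarrow> invertible (H x)"
  shows "continuous_on S (\<lambda>x. curvA (H x) (P x) (Q x) (R x))"
proof -
  have "continuous_on S (\<lambda>x. matrix_inv (H x))"
    by (rule continuous_on_compose2[OF continuous_on_matrix_inv assms(1)]) (use assms(5) in auto)
  then show ?thesis unfolding curvA_def by (intro continuous_intros assms)
qed

lemma continuous_on_cs [continuous_intros]: "continuous_on S f \<Longrightarrow> continuous_on S (\<lambda>x. cs a (f x))"
  by (rule bounded_linear.continuous_on[OF bounded_linear_cs])

lemma continuous_on_jets:
  assumes H: "Ck_on 2 U H"
  shows "continuous_on U H" "continuous_on U (jetP H)" "continuous_on U (jetQ H)" "continuous_on U (jetR H)"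
proof -
  have d: "continuous_on U H" "continuous_on U (\<lambda>y. deriv_dir v H y)" "continuous_on U (\<lambda>x. deriv_dir w (deriv_dir v H) x)" for v w
    using H by (auto simp: Ck2_on intro!: continuous_at_imp_continuous_on differentiable_imp_continuous_within)
  show "continuous_on U H" by (rule d)
  show "continuous_on U (jetP H)" "continuous_on U (jetQ H)" "continuous_on U (jetR H)"
    unfolding jetP_def[abs_def] jetQ_def[abs_def] jetR_def[abs_def] by (intro continuous_intros d)+
qed

subsection \<open>Holomorphic functions of several variables\<close>

lemma holo_onD:
  assumes "holo_on S f" "z \<in> S"
  shows "(f has_derivative frechet_derivative f (at z)) (at z)" "frechet_derivative f (at z) (c *s v) = c * frechet_derivative f (at z) v"
proof -
  obtain f' where f': "(f has_derivative f') (at z)" "\<And>c v. f' (c *s v) = c * f' v" using assms by (auto simp: holo_on_def)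
  moreover have "f' = frechet_derivative f (at z)" by (rule frechet_derivative_at[OF f'(1)])
  ultimately show "(f has_derivative frechet_derivative f (at z)) (at z)" "frechet_derivative f (at z) (c *s v) = c * frechet_derivative f (at z) v" by auto
qed

lemma norm_axis: "norm (axis j x :: 'b::real_normed_vector^'n) = norm x"
  by (simp add: norm_vec_def L2_set_def axis_def if_distrib[of norm] if_distrib[of "\<lambda>x. x\<^sup>2"] cong: if_cong)

lemma bounded_linear_axis: "bounded_linear (\<lambda>x. axis j x :: 'b::real_normed_vector^'n)"
proof (rule bounded_linear_intro[where K=1])
  show "norm (axis j x :: 'b^'n) \<le> norm x * 1" for x by (simp add: norm_axis)
qed (simp_all add: vec_eq_iff axis_def)

text \<open>Cauchy's formula for a derivative at the centre of a disc in the j-th variable; on the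
  circle du is 2 pi i u dt, so one of the two powers of u in the denominator cancels.\<close>

lemma holo_on_partial_integral:
  fixes z :: "complex^'n::finite"
  assumes S: "cball z r \<subseteq> S" "open S" and r: "r > 0" and f: "holo_on S f"
  shows "frechet_derivative f (at z) (axis j 1) =
    integral (cbox 0 1) (\<lambda>t::real. f (z + axis j (circlepath 0 r t)) / circlepath 0 r t)"
proof -
  define g where "g \<zeta> = f (z + axis j \<zeta>)" for \<zeta>
  have ax: "axis j \<zeta> = \<zeta> *s axis j (1::complex)" for \<zeta> by (simp add: vec_eq_iff axis_def)
  have inS: "z + axis j \<zeta> \<in> S" if "cmod \<zeta> \<le> r" for \<zeta> using S(1) that by (auto simp: dist_norm norm_axis)
  have der: "(g has_field_derivative frechet_derivative f (at (z + axis j \<zeta>)) (axis j 1)) (at \<zeta>)" if "cmod \<zeta> \<le> r" for \<zeta>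
  proof -
    have "((\<lambda>\<zeta>. z + axis j \<zeta>) has_derivative (\<lambda>h. axis j h)) (at \<zeta>)"
      using has_derivative_add[OF has_derivative_const[of z] bounded_linear_imp_has_derivative[OF bounded_linear_axis]] by simp
    from has_derivative_compose[OF this holo_onD(1)[OF f inS[OF that]]]
    have "(g has_derivative (\<lambda>h. frechet_derivative f (at (z + axis j \<zeta>)) (axis j h))) (at \<zeta>)" unfolding g_def .
    moreover have "(\<lambda>h. frechet_derivative f (at (z + axis j \<zeta>)) (axis j h)) = (*) (frechet_derivative f (at (z + axis j \<zeta>)) (axis j 1))"
    proof
      fix h show "frechet_derivative f (at (z + axis j \<zeta>)) (axis j h) = frechet_derivative f (at (z + axis j \<zeta>)) (axis j 1) * h"
        unfolding ax[of h] holo_onD(2)[OF f inS[OF that]] by (rule mult.commute)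
    qed
    ultimately show ?thesis by (simp only: has_field_derivative_def)
  qed
  have "continuous_on (cball 0 r) g"
    by (intro continuous_at_imp_continuous_on ballI DERIV_isCont[OF der]) auto
  moreover have "g holomorphic_on ball 0 r"
    unfolding holomorphic_on_def field_differentiable_def 
    by (intro ballI, rule exI, rule has_field_derivative_at_within, rule der) auto
  ultimately have "(g has_field_derivative (1 / (2 * of_real pi * \<i>) * contour_integral (circlepath 0 r) (\<lambda>u. g u / (u - 0)^2))) (at 0)"
    using r by (intro Cauchy_derivative_integral_circlepath(2)) auto
  have a0: "axis j (0::complex) = (0 :: complex^'n)" by (simp add: vec_eq_iff axis_def)
  from DERIV_unique[OF der \<open>(g has_field_derivative _) _\<close>] r
  have "frechet_derivative f (at z) (axis j 1) = 1 / (2 * of_real pi * \<i>) * contour_integral (circlepath 0 r) (\<lambda>u. g u / (u - 0)^2)"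
    by (simp add: a0)
  also have "\<dots> = 1 / (2 * of_real pi * \<i>) * integral {0..1} (\<lambda>t. (2 * of_real pi * \<i>) * (g (circlepath 0 r t) / circlepath 0 r t))"
  proof -
    have "g (circlepath 0 r t) / (circlepath 0 r t - 0)^2 * vector_derivative (circlepath 0 r) (at t) = (2 * of_real pi * \<i>) * (g (circlepath 0 r t) / circlepath 0 r t)" for t
      unfolding vector_derivative_circlepath using r by (simp add: circlepath power2_eq_square field_simps)
    then show ?thesis unfolding contour_integral_integral by simp
  qed
  also have "\<dots> = integral {0..1} (\<lambda>t. g (circlepath 0 r t) / circlepath 0 r t)"
    by (subst integral_mult_right) simp
  finally show ?thesis by (simp add: g_def)
qed

lemma holo_on_continuous: "holo_on S f \<Longrightarrow> continuous_on S f"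
  using holo_onD(1) has_derivative_continuous by (blast intro: continuous_at_imp_continuous_on)

lemma continuous_on_circlepath: "continuous_on T (circlepath z r)"
  using continuous_on_subset[of UNIV "circlepath z r" T] unfolding circlepath by (auto intro!: continuous_intros)

lemma continuous_on_axis [continuous_intros]:
  "continuous_on T f \<Longrightarrow> continuous_on T (\<lambda>x. axis j (f x) :: 'b::real_normed_vector^'n)"
  unfolding axis_def
proof (intro continuous_on_vec_lambda)
  fix i assume "continuous_on T f"
  then show "continuous_on T (\<lambda>x. if i = j then f x else 0)" by (cases "i = j") auto
qed

lemma circle_in_cball:
  fixes x z :: "complex^'n"
  assumes "x \<in> ball z (r::real)" "r > 0"
  shows "x + axis j (circlepath 0 r t) \<in> cball z (2 * r)"
proof -
  have "norm (axis j (circlepath 0 r t) :: complex^'n) = cmod (circlepath 0 r t)" by (rule norm_axis)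
  also have "\<dots> = r" using assms by (simp add: circlepath norm_mult)
  finally have "norm (axis j (circlepath 0 r t) :: complex^'n) = r" .
  moreover have "norm (z - (x + axis j (circlepath 0 r t))) \<le> norm (z - x) + norm (axis j (circlepath 0 r t) :: complex^'n)"
    using norm_triangle_ineq4[of "z - x" "axis j (circlepath 0 r t)"] by (simp add: algebra_simps)
  ultimately show ?thesis using assms by (simp add: dist_norm)
qed

text \<open>Since \<open>holo_on\<close> grants only a derivative at each point, the partial
  derivative is represented locally by Cauchy integrals over circles of a fixed radius, and these
  are differentiated under the integral sign.\<close>

lemma holo_on_partial:
  fixes f :: "complex^'n::finite \<Rightarrow> complex"
  assumes S: "open S" and f: "holo_on S f"
  shows "holo_on S (\<lambda>z. frechet_derivative f (at z) (axis j 1))"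
  unfolding holo_on_def
proof
  fix z0 assume z0: "z0 \<in> S"
  obtain r0 where r0: "r0 > 0" "cball z0 r0 \<subseteq> S" using S z0 by (meson open_contains_cball)
  define r where "r = r0 / 2"
  have r: "r > 0" "cball z0 (2 * r) \<subseteq> S" using r0 by (auto simp: r_def)
  let ?B = "ball z0 r" and ?c = "circlepath (0::complex) r"
  have BS: "x + axis i (?c t) \<in> S" if "x \<in> ?B" for x i t using circle_in_cball[OF that r(1)] r(2) by blast
  have cb: "cball x r \<subseteq> S" if "x \<in> ?B" for x
  proof
    fix y assume "y \<in> cball x r"
    then have "dist z0 y \<le> 2 * r" using that dist_triangle[of z0 y x] by auto
    then show "y \<in> S" using r(2) by auto
  qed
  have cnz: "?c t \<noteq> 0" for t using r by (simp add: circlepath)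
  have formula: "frechet_derivative f (at x) (axis i 1) = integral (cbox 0 1) (\<lambda>t::real. f (x + axis i (?c t)) / ?c t)"
    if "cball x r \<subseteq> S" for x i using holo_on_partial_integral[OF that S r(1) f] .
  \<comment> \<open>Continuity of the partial derivatives has to come first, as Leibniz' rule needs
    the differential of the integrand to be jointly continuous.\<close>
  have partial_cont: "continuous_on S (\<lambda>x. frechet_derivative f (at x) (axis i 1))" for i
    unfolding continuous_on_eq_continuous_at[OF S]
  proof
    fix y assume "y \<in> S"
    then obtain q0 where q0: "q0 > 0" "cball y q0 \<subseteq> S" using S by (meson open_contains_cball)
    define q where "q = q0 / 2"
    have q: "q > 0" "cball y (2 * q) \<subseteq> S" using q0 by (auto simp: q_def)
    have "continuous_on (ball y q \<times> cbox 0 (1::real)) (\<lambda>(x, t). f (x + axis i (circlepath 0 q t)) / circlepath 0 q t)"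
      unfolding case_prod_beta
    proof (intro continuous_on_divide continuous_on_compose2[OF holo_on_continuous[OF f]] continuous_on_add continuous_on_axis
        continuous_on_compose2[OF continuous_on_circlepath[of UNIV]] continuous_on_fst continuous_on_snd continuous_on_id)
      show "(\<lambda>p. fst p + axis i (circlepath 0 q (snd p))) ` (ball y q \<times> cbox 0 1) \<subseteq> S"
        by (auto intro!: subsetD[OF q(2)] circle_in_cball q(1))
    qed (use q in \<open>auto simp: circlepath\<close>)
    from integral_continuous_on_param[OF this]
    have 1: "continuous_on (ball y q) (\<lambda>x. integral (cbox 0 1) (\<lambda>t::real. f (x + axis i (circlepath 0 q t)) / circlepath 0 q t))" .
    have "frechet_derivative f (at x) (axis i 1) = integral (cbox 0 1) (\<lambda>t::real. f (x + axis i (circlepath 0 q t)) / circlepath 0 q t)" if "x \<in> ball y q" for x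
    proof (rule holo_on_partial_integral[OF _ S q(1) f])
      show "cball x q \<subseteq> S"
      proof
        fix w assume "w \<in> cball x q"
        then have "dist y w \<le> 2 * q" using that dist_triangle[of y w x] by auto
        then show "w \<in> S" using q(2) by auto
      qed
    qed
    then have "continuous_on (ball y q) (\<lambda>x. frechet_derivative f (at x) (axis i 1))"
      using 1 continuous_on_cong[OF refl] by (metis (no_types, lifting))
    then show "isCont (\<lambda>x. frechet_derivative f (at x) (axis i 1)) y"
      using q(1) by (simp add: continuous_on_eq_continuous_at)
  qed
  have expand: "frechet_derivative f (at x) v = (\<Sum>i\<in>UNIV. v $ i * frechet_derivative f (at x) (axis i 1))" if "x \<in> S" for x v
  proof -
    have lin: "linear (frechet_derivative f (at x))" using holo_onD(1)[OF f that] has_derivative_linear by blast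
    have "v = (\<Sum>i\<in>UNIV. v $ i *s axis i 1)" by (simp add: vec_eq_iff axis_def if_distrib cong: if_cong)
    then have "frechet_derivative f (at x) v = (\<Sum>i\<in>UNIV. frechet_derivative f (at x) (v $ i *s axis i 1))"
      using linear_sum[OF lin, of "\<lambda>i. v $ i *s axis i 1" UNIV] by simp
    then show ?thesis by (simp add: holo_onD(2)[OF f that])
  qed
  have dir_cont: "continuous_on S (\<lambda>x. frechet_derivative f (at x) v)" for v
  proof -
    have "continuous_on S (\<lambda>x. \<Sum>i\<in>UNIV. v $ i * frechet_derivative f (at x) (axis i 1))" by (intro continuous_intros partial_cont)
    then show ?thesis using expand continuous_on_cong[OF refl] by (metis (no_types, lifting))
  qed
  \<comment> \<open>The differential of the integrand as a bounded linear function, the type in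
    which \<open>leibniz_rule\<close> integrates it.\<close>
  define fx where "fx x t = Blinfun (\<lambda>v. frechet_derivative f (at (x + axis j (?c t))) v / ?c t)" for x :: "complex^'n" and t :: real
  have fx: "blinfun_apply (fx x t) = (\<lambda>v. frechet_derivative f (at (x + axis j (?c t))) v / ?c t)" if "x \<in> ?B" for x t
    unfolding fx_def
  proof (rule bounded_linear_Blinfun_apply)
    have "bounded_linear (frechet_derivative f (at (x + axis j (?c t))))"
      using holo_onD(1)[OF f BS[OF that]] by (rule has_derivative_bounded_linear)
    then show "bounded_linear (\<lambda>v. frechet_derivative f (at (x + axis j (?c t))) v / ?c t)"
      by (rule bounded_linear_compose[OF bounded_linear_divide])
  qed
  have cfx: "continuous_on (?B \<times> cbox 0 1) (\<lambda>(x, t). fx x t)"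
    unfolding case_prod_beta
  proof (rule continuous_on_blinfun_componentwise)
    fix i :: "complex^'n"
    have "continuous_on (?B \<times> cbox 0 1) (\<lambda>p. frechet_derivative f (at (fst p + axis j (?c (snd p)))) i / ?c (snd p))"
    proof (intro continuous_on_divide continuous_on_compose2[OF dir_cont] continuous_on_add continuous_on_axis
        continuous_on_compose2[OF continuous_on_circlepath[of UNIV]] continuous_on_fst continuous_on_snd continuous_on_id)
      show "(\<lambda>p. fst p + axis j (?c (snd p))) ` (?B \<times> cbox 0 1) \<subseteq> S" using BS by auto
    qed (use cnz in auto)
    then show "continuous_on (?B \<times> cbox 0 1) (\<lambda>p. blinfun_apply (fx (fst p) (snd p)) i)"
      by (rule continuous_on_cong[THEN iffD1, rotated 2]) (auto simp: fx)
  qed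
  have ffx: "((\<lambda>x. f (x + axis j (?c t)) / ?c t) has_derivative blinfun_apply (fx x t)) (at x within ?B)" if "x \<in> ?B" for x t
  proof -
    have "((\<lambda>x. x + axis j (?c t)) has_derivative (\<lambda>v. v)) (at x)" by (auto intro!: derivative_eq_intros)
    from has_derivative_compose[OF this holo_onD(1)[OF f BS[OF that]]]
    have "((\<lambda>x. f (x + axis j (?c t)) / ?c t) has_derivative (\<lambda>v. frechet_derivative f (at (x + axis j (?c t))) v / ?c t)) (at x)"
      by (rule bounded_linear.has_derivative[OF bounded_linear_divide])
    then show ?thesis unfolding fx[OF that] by (rule has_derivative_at_withinI)
  qed
  have int: "(\<lambda>t::real. f (x + axis j (?c t)) / ?c t) integrable_on cbox 0 1" if "x \<in> ?B" for x
  proof (rule integrable_continuous)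
    show "continuous_on (cbox 0 1) (\<lambda>t::real. f (x + axis j (?c t)) / ?c t)"
      by (intro continuous_on_divide continuous_on_compose2[OF holo_on_continuous[OF f]] continuous_on_add continuous_on_axis
        continuous_on_circlepath continuous_on_const) (use BS[OF that] cnz in auto)
  qed
  have z0B: "z0 \<in> ?B" using r by simp
  have 1: "((\<lambda>x. integral (cbox 0 1) (\<lambda>t::real. f (x + axis j (?c t)) / ?c t)) has_derivative integral (cbox 0 1) (fx z0)) (at z0 within ?B)"
    by (rule leibniz_rule[OF ffx int cfx z0B convex_ball])
  have 2: "((\<lambda>x. integral (cbox 0 1) (\<lambda>t::real. f (x + axis j (?c t)) / ?c t)) has_derivative integral (cbox 0 1) (fx z0)) (at z0)"
    using 1 at_within_open[OF z0B open_ball] by simp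
  have 3: "((\<lambda>x. frechet_derivative f (at x) (axis j 1)) has_derivative integral (cbox 0 1) (fx z0)) (at z0)"
    by (rule has_derivative_transform_within_open[OF 2 open_ball z0B]) (simp add: formula cb)
  have intfx: "fx z0 integrable_on cbox 0 1"
  proof (rule integrable_continuous)
    show "continuous_on (cbox 0 1) (fx z0)"
      by (rule continuous_on_parameter[OF cfx z0B])
  qed
  have app: "blinfun_apply (integral (cbox 0 1) (fx z0)) v = integral (cbox 0 1) (\<lambda>t. blinfun_apply (fx z0 t) v)" for v
    using integral_linear[OF intfx blinfun.bounded_linear_left, of v] by (simp add: o_def)
  have "blinfun_apply (integral (cbox 0 1) (fx z0)) (c *s v) = c * blinfun_apply (integral (cbox 0 1) (fx z0)) v" for c v
  proof -
    have "blinfun_apply (fx z0 t) (c *s v) = c * blinfun_apply (fx z0 t) v" for t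
      unfolding fx[OF z0B] using holo_onD(2)[OF f BS[OF z0B]] by simp
    then show ?thesis unfolding app by simp
  qed
  then show "\<exists>f'. ((\<lambda>z. frechet_derivative f (at z) (axis j 1)) has_derivative f') (at z0) \<and> (\<forall>c v. f' (c *s v) = c * f' v)"
    using 3 by blast
qed

subsection \<open>Changes of coordinates and frames\<close>

lemma norm_cs: "norm (cs a M :: complex^'p^'q) = cmod a * norm M"
proof -
  have "(norm (cs a M))\<^sup>2 = (cmod a * norm M)\<^sup>2"
    by (simp add: power_mult_distrib norm_matrix_sq norm_mult sum_distrib_left)
  then show ?thesis by (simp add: power2_eq_iff_nonneg)
qed

lemma bounded_bilinear_cs: "bounded_bilinear (cs :: complex \<Rightarrow> complex^'p^'q \<Rightarrow> complex^'p^'q)"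
  by (rule bounded_bilinear.intro) (auto simp: vec_eq_iff algebra_simps norm_cs intro!: exI[of _ 1])

lemma holo_matrix_derivative:
  fixes A :: "complex^'n::finite \<Rightarrow> complex^'p::finite^'q::finite"
  assumes A: "\<And>l m. holo_on U (\<lambda>x. A x $ l $ m)" and x: "x \<in> U"
  defines "A' \<equiv> \<lambda>v. \<chi> l m. frechet_derivative (\<lambda>x. A x $ l $ m) (at x) v"
  shows "(A has_derivative A') (at x)" "A' (axis j \<i>) = cs \<i> (A' (axis j 1))"
proof -
  have "((\<lambda>x. \<chi> l m. A x $ l $ m) has_derivative A') (at x)"
    unfolding A'_def by (intro has_derivative_vec_lambda holo_onD(1)[OF A x])
  then show "(A has_derivative A') (at x)" by simp
  have "axis j \<i> = \<i> *s axis j (1::complex)" by (simp add: vec_eq_iff axis_def)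
  then have "frechet_derivative (\<lambda>x. A x $ l $ m) (at x) (axis j \<i>) = \<i> * frechet_derivative (\<lambda>x. A x $ l $ m) (at x) (axis j 1)" for l m
    by (simp only: holo_onD(2)[OF A x])
  then show "A' (axis j \<i>) = cs \<i> (A' (axis j 1))" by (simp add: A'_def vec_eq_iff)
qed

text \<open>The connection form changes by conjugation plus an inhomogeneous term
  \<open>\<partial>A\<close> times the inverse of \<open>A\<close>. As \<open>A\<close>, the
  Jacobian and the inhomogeneous term are holomorphic, the antiholomorphic derivative only sees the
  old connection form, composed with the coordinate change.\<close>

theorem chern_change:
  fixes H H' :: "complex^'n::finite \<Rightarrow> complex^'r::finite^'r" and w :: "complex^'n \<Rightarrow> complex^'n"
    and A :: "complex^'n \<Rightarrow> complex^'r^'r"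
  assumes U: "open U" "z \<in> U" and U': "open U'" "\<And>x. x \<in> U \<Longrightarrow> w x \<in> U'"
    and H': "Ck_on 2 U' H'" "\<And>y. y \<in> U' \<Longrightarrow> invertible (H' y)"
    and w: "\<And>a. holo_on U (\<lambda>x. w x $ a)" and A: "\<And>l m. holo_on U (\<lambda>x. A x $ l $ m)"
    and Ai: "\<And>x. x \<in> U \<Longrightarrow> invertible (A x)"
    and eq: "\<And>x. x \<in> U \<Longrightarrow> H x = A x ** H' (w x) ** ctranspose (A x)"
  shows "chern H z = in_coords (\<chi> j a. frechet_derivative (\<lambda>x. w x $ a) (at z) (axis j 1)) (in_frame (A z) (chern H' (w z)))"
proof -
  define T where "T x = (\<chi> j a. frechet_derivative (\<lambda>x. w x $ a) (at x) (axis j 1))" for x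
  define W where "W x v = (\<chi> a. frechet_derivative (\<lambda>x. w x $ a) (at x) v)" for x v
  define A' where "A' x v = (\<chi> l m. frechet_derivative (\<lambda>x. A x $ l $ m) (at x) v)" for x v
  have dA: "(A has_derivative A' x) (at x)" "A' x (axis j \<i>) = cs \<i> (A' x (axis j 1))" if "x \<in> U" for x j
    unfolding A'_def using holo_matrix_derivative[OF A that] by blast+
  have lA: "ldbar k (A' x) = 0" "ldel k (A' x) = A' x (axis k 1)" if "x \<in> U" for x k
    using ldbar_complex_linear[of "A' x"] dA(2)[OF that] by blast+
  have dw: "(w has_derivative W x) (at x)" if "x \<in> U" for x
  proof -
    have "((\<lambda>x. \<chi> a. w x $ a) has_derivative W x) (at x)"
      unfolding W_def by (intro has_derivative_vec_lambda holo_onD(1)[OF w that])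
    then show ?thesis by simp
  qed
  have Wi: "W x (axis j \<i>) = \<i> *s W x (axis j 1)" if "x \<in> U" for x j
  proof -
    have "axis j \<i> = \<i> *s axis j (1::complex)" by (simp add: vec_eq_iff axis_def)
    then have "frechet_derivative (\<lambda>x. w x $ a) (at x) (axis j \<i>) = \<i> * frechet_derivative (\<lambda>x. w x $ a) (at x) (axis j 1)" for a
      by (simp only: holo_onD(2)[OF w that])
    then show ?thesis by (simp add: W_def vec_eq_iff)
  qed
  have WT: "W x (axis j 1) $ a = T x $ j $ a" for x j a by (simp add: W_def T_def)
  define G where "G a y = del_matrix a H' y ** matrix_inv (H' y)" for a y
  define Y where "Y j x = (\<Sum>a\<in>UNIV. cs (T x $ j $ a) (G a (w x)))" for j x
  \<comment> \<open>The gauge formula; \<open>ctranspose (A x)\<close> is antiholomorphic and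
    contributes nothing to the holomorphic derivative.\<close>
  have first: "del_matrix j H x ** matrix_inv (H x) = A x ** Y j x ** matrix_inv (A x) + A' x (axis j 1) ** matrix_inv (A x)"
    if x: "x \<in> U" for j x
  proof -
    let ?h = "H' (w x)" and ?D = "frechet_derivative H' (at (w x))"
    have dH': "(H' has_derivative ?D) (at (w x))"
      using H'(1) U'(2)[OF x] by (intro differentiable_has_derivative) (simp add: Ck2_on)
    have dct: "((\<lambda>x. ctranspose (A x)) has_derivative (\<lambda>v. ctranspose (A' x v))) (at x)"
      by (intro bounded_linear.has_derivative[OF bounded_linear_ctranspose] dA x)
    have "((\<lambda>x. A x ** H' (w x) ** ctranspose (A x)) has_derivative
       (\<lambda>v. (A x ** ?h) ** ctranspose (A' x v) + (A x ** ?D (W x v) + A' x v ** ?h) ** ctranspose (A x))) (at x)"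
      by (intro bounded_bilinear.FDERIV[OF bounded_bilinear_matrix_mul] dA x dct has_derivative_compose[OF dw[OF x] dH'])
    then have "(H has_derivative (\<lambda>v. (A x ** ?h) ** ctranspose (A' x v) + (A x ** ?D (W x v) + A' x v ** ?h) ** ctranspose (A x))) (at x)"
      by (rule has_derivative_transform_within_open[OF _ U(1) x]) (simp add: eq)
    then have "del_matrix j H x = (A x ** ?h) ** ldel j (\<lambda>v. ctranspose (A' x v)) + (A x ** ldel j (\<lambda>v. ?D (W x v)) + ldel j (A' x) ** ?h) ** ctranspose (A x)"
      by (simp only: del_matrix_ldel(1) ldel_mul)
    moreover have "ldel j (\<lambda>v. ctranspose (A' x v)) = 0"
      unfolding ldel_def dA(2)[OF x] by (simp add: vec_eq_iff)
    moreover have "ldel j (\<lambda>v. ?D (W x v)) = (\<Sum>a\<in>UNIV. cs (T x $ j $ a) (del_matrix a H' (w x)))"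
      using ldel_compose_complex_linear(1)[OF has_derivative_linear[OF dH'] Wi[OF x]] by (simp only: WT del_matrix_ldel(1)[OF dH'])
    ultimately have d: "del_matrix j H x = (A x ** (\<Sum>a\<in>UNIV. cs (T x $ j $ a) (del_matrix a H' (w x))) + A' x (axis j 1) ** ?h) ** ctranspose (A x)"
      using lA(2)[OF x] by (simp add: bounded_bilinear.zero_right[OF bounded_bilinear_matrix_mul])
    have i: "invertible (A x)" "invertible ?h" "invertible (ctranspose (A x))" using Ai[OF x] H'(2)[OF U'(2)[OF x]] by (auto intro: ctranspose_invertible)
    have Hi: "matrix_inv (H x) = matrix_inv (ctranspose (A x)) ** matrix_inv ?h ** matrix_inv (A x)"
      by (simp add: eq[OF x] matrix_inv_mul i invertible_mult matrix_mul_assoc)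
    have "del_matrix j H x ** matrix_inv (H x) =
        (A x ** (\<Sum>a\<in>UNIV. cs (T x $ j $ a) (del_matrix a H' (w x))) + A' x (axis j 1) ** ?h) ** (ctranspose (A x) ** matrix_inv (ctranspose (A x))) ** matrix_inv ?h ** matrix_inv (A x)"
      unfolding d Hi by (simp only: matrix_mul_assoc)
    also have "\<dots> = A x ** ((\<Sum>a\<in>UNIV. cs (T x $ j $ a) (del_matrix a H' (w x))) ** matrix_inv ?h) ** matrix_inv (A x) + A' x (axis j 1) ** (?h ** matrix_inv ?h) ** matrix_inv (A x)"
      by (simp only: matrix_inv_cancel(1)[OF i(3)] matrix_mul_rid bounded_bilinear.add_left[OF bounded_bilinear_matrix_mul] matrix_mul_assoc)
    also have "(\<Sum>a\<in>UNIV. cs (T x $ j $ a) (del_matrix a H' (w x))) ** matrix_inv ?h = Y j x"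
      by (simp add: Y_def G_def bounded_bilinear.sum_left[OF bounded_bilinear_matrix_mul] cs_mul_left)
    finally show ?thesis by (simp add: matrix_inv_cancel i)
  qed
  have wz: "w z \<in> U'" by (rule U'(2)[OF U(2)])
  obtain D where D: "\<And>a. (G a has_derivative D a) (at (w z))"
  proof -
    have "\<forall>a. \<exists>D. (G a has_derivative D) (at (w z))"
      using chern_curvA(2)[OF U'(1) wz H'(1) H'(2)[OF wz]] unfolding differentiable_def G_def[abs_def] by blast
    then show thesis using that by metis
  qed
  have chern': "chern H' (w z) $ a $ b = - ldbar b (D a)" for a b
    by (rule chern_ldbar) (use D[of a] in \<open>simp add: G_def[abs_def]\<close>)
  \<comment> \<open>The entries of the Jacobian are partial derivatives of holomorphic functions,
    hence holomorphic themselves by \<open>holo_on_partial\<close>.\<close>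
  have dT: "\<exists>t'. ((\<lambda>x. T x $ j $ a) has_derivative t') (at z) \<and> (\<forall>k. t' (axis k \<i>) = \<i> * t' (axis k 1))" for j a
  proof -
    have h: "holo_on U (\<lambda>x. T x $ j $ a)" unfolding T_def using holo_on_partial[OF U(1) w[of a], of j] by simp
    have "axis k \<i> = \<i> *s axis k (1::complex)" for k :: 'n by (simp add: vec_eq_iff axis_def)
    then show ?thesis using holo_onD[OF h U(2)] by metis
  qed
  then obtain T' where T': "\<And>j a. ((\<lambda>x. T x $ j $ a) has_derivative T' j a) (at z)" "\<And>j a k. T' j a (axis k \<i>) = \<i> * T' j a (axis k 1)" by metis
  define Y' where "Y' j v = (\<Sum>a\<in>UNIV. cs (T z $ j $ a) (D a (W z v)) + cs (T' j a v) (G a (w z)))" for j v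
  have dY: "(Y j has_derivative Y' j) (at z)" for j
    unfolding Y_def[abs_def] Y'_def[abs_def]
    by (intro has_derivative_sum bounded_bilinear.FDERIV[OF bounded_bilinear_cs] T' has_derivative_compose[OF dw[OF U(2)] D])
  have lY: "ldbar k (Y' j) = (\<Sum>a\<in>UNIV. cs (T z $ j $ a) (\<Sum>b\<in>UNIV. cs (cnj (T z $ k $ b)) (ldbar b (D a))))" for j k
  proof -
    have "ldbar k (Y' j) = (\<Sum>a\<in>UNIV. cs (T z $ j $ a) (ldbar k (\<lambda>v. D a (W z v))) + cs (1/2) (cs (T' j a (axis k 1)) (G a (w z)) + cs \<i> (cs (T' j a (axis k \<i>)) (G a (w z)))))"
      by (simp add: ldbar_def Y'_def cs_sum cs_add sum.distrib cs_cs mult.commute)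
    also have "\<dots> = (\<Sum>a\<in>UNIV. cs (T z $ j $ a) (ldbar k (\<lambda>v. D a (W z v))))"
      unfolding T'(2) by (intro sum.cong refl) (simp add: vec_eq_iff mult.assoc[symmetric])
    finally show ?thesis
      unfolding ldel_compose_complex_linear(2)[OF has_derivative_linear[OF D] Wi[OF U(2)]] WT .
  qed
  let ?Az = "A z" and ?Ai = "matrix_inv (A z)"
  let ?I = "\<lambda>v. - (?Ai ** A' z v ** ?Ai)"
  have dI: "((\<lambda>x. matrix_inv (A x)) has_derivative ?I) (at z)"
    by (rule has_derivative_compose[OF dA(1)[OF U(2)] has_derivative_matrix_inv[OF Ai[OF U(2)]]])
  have lI: "ldbar k ?I = 0" for k
  proof (rule ldbar_complex_linear(1))
    show "?I (axis j \<i>) = cs \<i> (?I (axis j 1))" for j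
      by (simp add: dA(2)[OF U(2)] cs_mul_left cs_mul_right cs_minus)
  qed
  \<comment> \<open>The derivative occurring in the inhomogeneous term; being holomorphic again, it
    disappears from the curvature.\<close>
  define A2 where "A2 j x = A' x (axis j 1)" for j x
  have hA2: "holo_on U (\<lambda>x. A2 j x $ l $ m)" for j l m
    unfolding A2_def A'_def using holo_on_partial[OF U(1) A[of l m], of j] by simp
  define A2' where "A2' j v = (\<chi> l m. frechet_derivative (\<lambda>x. A2 j x $ l $ m) (at z) v)" for j v
  have A2': "(A2 j has_derivative A2' j) (at z)" "A2' j (axis k \<i>) = cs \<i> (A2' j (axis k 1))" for j k
    unfolding A2'_def using holo_matrix_derivative[OF hA2 U(2)] by blast+
  have lA2: "ldbar k (A2' j) = 0" for j k by (rule ldbar_complex_linear(1)) (rule A2'(2))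
  have "chern H z $ j $ k = in_coords (T z) (in_frame (A z) (chern H' (w z))) $ j $ k" for j k
  proof -
    let ?F = "\<lambda>v. ((?Az ** Y j z) ** ?I v + (?Az ** Y' j v + A' z v ** Y j z) ** ?Ai) + (A2 j z ** ?I v + A2' j v ** ?Ai)"
    have d0: "((\<lambda>x. A x ** Y j x ** matrix_inv (A x) + A2 j x ** matrix_inv (A x)) has_derivative ?F) (at z)"
      by (rule has_derivative_add[OF
          bounded_bilinear.FDERIV[OF bounded_bilinear_matrix_mul
            bounded_bilinear.FDERIV[OF bounded_bilinear_matrix_mul dA(1)[OF U(2)] dY] dI]
          bounded_bilinear.FDERIV[OF bounded_bilinear_matrix_mul A2'(1) dI]])
    have e: "A x ** Y j x ** matrix_inv (A x) + A2 j x ** matrix_inv (A x) = del_matrix j H x ** matrix_inv (H x)" if "x \<in> U" for x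
      unfolding A2_def by (rule first[OF that, symmetric])
    have "chern H z $ j $ k = - ldbar k ?F"
      by (rule chern_ldbar[OF has_derivative_transform_within_open[OF d0 U e]])
    also have "ldbar k (\<lambda>v. ((?Az ** Y j z) ** ?I v + (?Az ** Y' j v + A' z v ** Y j z) ** ?Ai) + (A2 j z ** ?I v + A2' j v ** ?Ai))
      = ldbar k (\<lambda>v. (?Az ** Y j z) ** ?I v + (?Az ** Y' j v + A' z v ** Y j z) ** ?Ai) + ldbar k (\<lambda>v. A2 j z ** ?I v + A2' j v ** ?Ai)"
      unfolding ldbar_def by (simp add: cs_add)
    also have "\<dots> = ?Az ** ldbar k (Y' j) ** ?Ai"
      unfolding ldel_mul lI lA[OF U(2)] lA2
      by (simp add: bounded_bilinear.zero_left[OF bounded_bilinear_matrix_mul] bounded_bilinear.zero_right[OF bounded_bilinear_matrix_mul])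
    also have "- (?Az ** ldbar k (Y' j) ** ?Ai) = (\<Sum>a\<in>UNIV. \<Sum>b\<in>UNIV. cs (T z $ j $ a * cnj (T z $ k $ b)) (?Az ** chern H' (w z) $ a $ b ** ?Ai))"
      unfolding lY chern'
      by (simp add: bounded_bilinear.sum_left[OF bounded_bilinear_matrix_mul] bounded_bilinear.sum_right[OF bounded_bilinear_matrix_mul]
        bounded_bilinear.minus_left[OF bounded_bilinear_matrix_mul] bounded_bilinear.minus_right[OF bounded_bilinear_matrix_mul]
        cs_sum cs_cs cs_mul_left cs_mul_right cs_minus sum_negf)
    also have "\<dots> = in_coords (T z) (in_frame (A z) (chern H' (w z))) $ j $ k"
      by (simp add: vec_eq_iff in_coords_def in_frame_def)
    finally show ?thesis .
  qed
  then show ?thesis by (simp add: vec_eq_iff T_def)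
qed

section \<open>Changing frames and coordinates at a point\<close>

lemma tw_in_coords: "tw t (in_coords T c) = in_coords T (tw t c)"
  by (simp add: tw_def linear_add[OF linear_in_coords] linear_scale[OF linear_in_coords] in_coords_otimes_id trace_form_in_coords)

lemma tf_in_coords: "tf (in_coords T c) = in_coords T (tf c)"
  by (simp add: tf_def linear_diff[OF linear_in_coords] linear_scale[OF linear_in_coords] in_coords_otimes_id trace_form_in_coords)

text \<open>An orthonormal basis \<open>S\<close> for the new metric gives the orthonormal basis
  \<open>S ** A\<close> for the old one, and likewise on tangent vectors; with these bases both
  sides are the same expression.\<close>

lemma change_point:
  fixes c :: "('n::finite, 'r::finite) curv" and A :: "complex^'r^'r" and T :: "complex^'n^'n"
  assumes H: "pos_def H" and c: "hermH H c" and A: "invertible A" and T: "invertible T"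
    and H': "H' = A ** H ** ctranspose A" and c': "c' = in_coords T (in_frame A c)" "hermH H' c'"
    and p: "posp P t H c"
  shows "posp P t H' c'"
    "unitary_invariant_sphere_measure \<sigma> \<Longrightarrow> 1 + real CARD('r) * t > 0 \<Longrightarrow> distp P s \<sigma> t H' c' = distp P s \<sigma> t H c"
proof -
  have pd: "pos_def H'" unfolding H' by (rule pos_def_congruence[OF H A])
  define S where "S = on_basis H'"
  have S: "S ** H' ** ctranspose S = mat 1" unfolding S_def by (rule on_basis[OF pd])
  have SA: "(S ** A) ** H ** ctranspose (S ** A) = mat 1"
    using S unfolding H' by (simp only: ctranspose_mul matrix_mul_assoc)
  note iS = on_basis_invertible(1)[OF S]
  have fr: "in_frame S (in_coords T (in_frame A X)) = in_coords T (in_frame (S ** A) X)" for X :: "('n, 'r) curv"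
    by (simp add: in_frame_in_coords in_frame_in_frame[OF A iS])
  have tw: "in_frame S (tw t c') = in_coords T (in_frame (S ** A) (tw t c))"
    unfolding c' tw_in_coords in_frame_tw[OF A, symmetric] fr ..
  have tf: "in_frame S (tf c') = in_coords T (in_frame (S ** A) (tf c))"
    unfolding c' tf_in_coords in_frame_tf[OF A, symmetric] fr ..
  show p': "posp P t H' c'"
    unfolding posp_iff[OF pd S] tw by (rule frame_coords(2)[OF H SA c p T])
  assume us: "unitary_invariant_sphere_measure \<sigma>" and rt: "1 + real CARD('r) * t > 0"
  define T' where "T' = on_basis (trace_form c')"
  have T': "T' ** trace_form c' ** ctranspose T' = mat 1"
    unfolding T'_def by (rule on_basis[OF posp_pos_def_trace_form[OF pd c'(2) rt p']])
  have TT: "(T' ** T) ** trace_form c ** ctranspose (T' ** T) = mat 1"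
    using T' unfolding c' trace_form_in_coords trace_form_in_frame[OF A] by (simp only: ctranspose_mul matrix_mul_assoc)
  have "distp P s \<sigma> t H' c' = distf P s \<sigma> t S T' c'" by (rule distp_eq_distf[OF us pd c'(2) rt p' S T'])
  also have "\<dots> = distf P s \<sigma> t (S ** A) (T' ** T) c"
    unfolding distf_def tw tf in_coords_in_coords ..
  also have "\<dots> = distp P s \<sigma> t H c" by (rule distp_eq_distf[OF us H c rt p SA TT, symmetric])
  finally show "distp P s \<sigma> t H' c' = distp P s \<sigma> t H c" .
qed

section \<open>Metrics on holomorphic vector bundles\<close>

lemma invertible_transpose: "invertible (M :: complex^'k^'k) \<Longrightarrow> invertible (transpose M)"
  by (rule invertible_leftI[of "transpose (matrix_inv M)"])
    (simp add: matrix_transpose_mul[symmetric] matrix_inv_cancel transpose_mat)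

lemma holo_on_subset: "holo_on S f \<Longrightarrow> T \<subseteq> S \<Longrightarrow> holo_on T f"
  unfolding holo_on_def by blast

locale hbundle =
  fixes B :: "('x, 'n::finite, 'e, 'r::finite) hvb"
  assumes hvb: "holomorphic_vector_bundle B"
begin

section \<open>Charts, trivializations and compact covers\<close>

lemma chart:
  assumes c: "c \<in> atlas B"
  shows "openin (base B) (fst c)" "open (snd c ` fst c)" "inj_on (snd c) (fst c)"
    "homeomorphic_map (subtopology (base B) (fst c)) (top_of_set (snd c ` fst c)) (snd c)"
proof -
  have *: "\<forall>(U, \<phi>)\<in>atlas B. openin (base B) U \<and> open (\<phi> ` U) \<and> homeomorphic_map (subtopology (base B) U) (top_of_set (\<phi> ` U)) \<phi>"
    using hvb by (simp add: holomorphic_vector_bundle_def complex_manifold_def)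
  show 1: "openin (base B) (fst c)" "open (snd c ` fst c)"
    and 2: "homeomorphic_map (subtopology (base B) (fst c)) (top_of_set (snd c ` fst c)) (snd c)"
    using bspec[OF * c] by (simp_all add: case_prod_beta)
  have "topspace (subtopology (base B) (fst c)) = fst c" using openin_subset[OF 1(1)] by (auto simp: topspace_subtopology)
  then show "inj_on (snd c) (fst c)" using homeomorphic_imp_injective_map[OF 2] by simp
qed

lemma triv:
  assumes "\<tau> \<in> trivs B"
  shows "openin (base B) (fst \<tau>)" "\<And>x. x \<in> fst \<tau> \<Longrightarrow> bij_betw (snd \<tau>) (fibre B x) UNIV"
  using hvb assms by (auto simp: holomorphic_vector_bundle_def)

lemma covers:
  assumes "x \<in> topspace (base B)"
  obtains c \<tau> where "c \<in> atlas B" "\<tau> \<in> trivs B" "x \<in> fst c \<inter> fst \<tau>"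
proof -
  have "\<Union>(fst ` atlas B) = topspace (base B)" "\<Union>(fst ` trivs B) = topspace (base B)"
    using hvb by (simp_all add: holomorphic_vector_bundle_def complex_manifold_def)
  then obtain c \<tau> where "c \<in> atlas B" "x \<in> fst c" "\<tau> \<in> trivs B" "x \<in> fst \<tau>" using assms by blast
  then show thesis using that by blast
qed

lemma in_topspace: "c \<in> atlas B \<Longrightarrow> x \<in> fst c \<Longrightarrow> x \<in> topspace (base B)"
  using chart(1) openin_subset by blast

lemma inv_chart: "c \<in> atlas B \<Longrightarrow> x \<in> fst c \<Longrightarrow> inv_into (fst c) (snd c) (snd c x) = x"
  by (simp add: chart(3))

lemma open_chart_image:
  assumes c: "c \<in> atlas B" and W: "openin (base B) W"
  shows "open (snd c ` (fst c \<inter> W))"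
proof -
  have "openin (subtopology (base B) (fst c)) (fst c \<inter> W)"
    using W by (auto simp: openin_subtopology)
  then have "openin (top_of_set (snd c ` fst c)) (snd c ` (fst c \<inter> W))"
    using homeomorphic_imp_open_map[OF chart(4)[OF c]] unfolding open_map_def by blast
  then show ?thesis using openin_open_trans[OF _ chart(2)[OF c]] by blast
qed

lemma open_cdom: "c \<in> atlas B \<Longrightarrow> \<tau> \<in> trivs B \<Longrightarrow> open (cdom c \<tau>)"
  unfolding cdom_def by (intro open_chart_image triv)

lemma openin_chart_vimage:
  assumes c: "c \<in> atlas B" and W: "openin (base B) W" and V: "open V"
  shows "openin (base B) {x \<in> fst c \<inter> W. snd c x \<in> V}"
proof -
  have "continuous_map (subtopology (base B) (fst c)) (top_of_set (snd c ` fst c)) (snd c)"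
    using homeomorphic_imp_continuous_map[OF chart(4)[OF c]] .
  then have "continuous_map (subtopology (base B) (fst c)) euclidean (snd c)"
    by (rule continuous_map_into_fulltopology)
  then have "openin (subtopology (base B) (fst c)) {x \<in> topspace (subtopology (base B) (fst c)). snd c x \<in> V}"
    by (rule openin_continuous_map_preimage) (use V in simp)
  moreover have ts: "topspace (subtopology (base B) (fst c)) = fst c"
    using openin_subset[OF chart(1)[OF c]] by (auto simp: topspace_subtopology)
  ultimately have "openin (base B) {x \<in> fst c. snd c x \<in> V}"
    using openin_trans_full[OF _ chart(1)[OF c]] by (simp only: ts)
  from openin_Int[OF this W] show ?thesis by (rule arg_cong[where f="openin (base B)", THEN iffD1, rotated]) auto
qed

lemma continuous_map_charts:
  fixes F :: "'x \<Rightarrow> real"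
  assumes F: "\<And>c \<tau>. c \<in> atlas B \<Longrightarrow> \<tau> \<in> trivs B \<Longrightarrow> \<exists>g. continuous_on (cdom c \<tau>) g \<and> (\<forall>x \<in> fst c \<inter> fst \<tau>. F x = g (snd c x))"
  shows "continuous_map (base B) euclideanreal F"
  unfolding continuous_map_def
proof (intro conjI allI impI)
  show "F \<in> topspace (base B) \<rightarrow> topspace euclideanreal" by simp
  fix V :: "real set" assume "openin euclideanreal V"
  then have V: "open V" by simp
  show "openin (base B) {x \<in> topspace (base B). F x \<in> V}"
    unfolding openin_subopen[of "base B" "{x \<in> topspace (base B). F x \<in> V}"]
  proof
    fix x assume "x \<in> {x \<in> topspace (base B). F x \<in> V}"
    then have x: "x \<in> topspace (base B)" "F x \<in> V" by auto
    obtain c \<tau> where c: "c \<in> atlas B" "\<tau> \<in> trivs B" "x \<in> fst c \<inter> fst \<tau>" using covers[OF x(1)] .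
    obtain g where g: "continuous_on (cdom c \<tau>) g" "\<And>y. y \<in> fst c \<inter> fst \<tau> \<Longrightarrow> F y = g (snd c y)" using F[OF c(1,2)] by blast
    define Q where "Q = cdom c \<tau> \<inter> g -` V"
    have "open Q" unfolding Q_def by (rule continuous_open_preimage[OF g(1) open_cdom[OF c(1,2)] V])
    then have "openin (base B) {y \<in> fst c \<inter> fst \<tau>. snd c y \<in> Q}" by (rule openin_chart_vimage[OF c(1) triv(1)[OF c(2)]])
    moreover have "x \<in> {y \<in> fst c \<inter> fst \<tau>. snd c y \<in> Q}" using c(3) x(2) g(2)[OF c(3)] by (auto simp: Q_def cdom_def)
    moreover have "{y \<in> fst c \<inter> fst \<tau>. snd c y \<in> Q} \<subseteq> {x \<in> topspace (base B). F x \<in> V}"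
      using g(2) in_topspace[OF c(1)] by (auto simp: Q_def)
    ultimately show "\<exists>T. openin (base B) T \<and> x \<in> T \<and> T \<subseteq> {x \<in> topspace (base B). F x \<in> V}" by blast
  qed
qed

text \<open>Each point has an open neighbourhood whose chart image lies in a closed ball inside the
  coordinate domain. Finitely many cover the base, and the closed balls are compact sets of the kind
  that describe \<open>C\<^sup>2\<close> neighbourhoods.\<close>

lemma compact_chart_cover:
  assumes cpt: "compact_space (base B)"
  obtains \<K> where "finite \<K>" "\<forall>(c, \<tau>, K)\<in>\<K>. c \<in> atlas B \<and> \<tau> \<in> trivs B \<and> compact K \<and> K \<subseteq> cdom c \<tau>"
    "\<And>x. x \<in> topspace (base B) \<Longrightarrow> \<exists>(c, \<tau>, K)\<in>\<K>. x \<in> fst c \<inter> fst \<tau> \<and> snd c x \<in> K"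
proof -
  define R where "R x q \<longleftrightarrow> (case fst q of (c, \<tau>, K) \<Rightarrow> c \<in> atlas B \<and> \<tau> \<in> trivs B \<and> compact K \<and> K \<subseteq> cdom c \<tau> \<and>
      (\<forall>y\<in>snd q. y \<in> fst c \<inter> fst \<tau> \<and> snd c y \<in> K)) \<and> openin (base B) (snd q) \<and> x \<in> snd q" for x q
  have "\<exists>q. R x q" if x: "x \<in> topspace (base B)" for x
  proof -
    obtain c \<tau> where c: "c \<in> atlas B" "\<tau> \<in> trivs B" "x \<in> fst c \<inter> fst \<tau>" using covers[OF x] .
    have "snd c x \<in> cdom c \<tau>" using c(3) by (auto simp: cdom_def)
    then obtain r where r: "r > 0" "cball (snd c x) r \<subseteq> cdom c \<tau>" using open_cdom[OF c(1,2)] by (meson open_contains_cball)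
    have "openin (base B) {y \<in> fst c \<inter> fst \<tau>. snd c y \<in> ball (snd c x) r}"
      by (rule openin_chart_vimage[OF c(1) triv(1)[OF c(2)] open_ball])
    then have "R x ((c, \<tau>, cball (snd c x) r), {y \<in> fst c \<inter> fst \<tau>. snd c y \<in> ball (snd c x) r})"
      using c r by (auto simp: R_def)
    then show ?thesis by blast
  qed
  then obtain q where q: "\<And>x. x \<in> topspace (base B) \<Longrightarrow> R x (q x)" using bchoice[of "topspace (base B)" R] by blast
  define W where "W x = snd (q x)" for x
  define p where "p x = fst (q x)" for x
  have W: "openin (base B) (W x)" "x \<in> W x" if "x \<in> topspace (base B)" for x
    using q[OF that] by (simp_all add: R_def W_def)
  have p: "case p x of (c, \<tau>, K) \<Rightarrow> c \<in> atlas B \<and> \<tau> \<in> trivs B \<and> compact K \<and> K \<subseteq> cdom c \<tau> \<and>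
      (\<forall>y\<in>W x. y \<in> fst c \<inter> fst \<tau> \<and> snd c y \<in> K)" if "x \<in> topspace (base B)" for x
    using q[OF that] by (simp add: R_def W_def p_def)
  have "\<Union>(W ` topspace (base B)) = topspace (base B)"
    using W openin_subset by blast
  moreover have "\<forall>U\<in>W ` topspace (base B). openin (base B) U" using W(1) by blast
  ultimately obtain \<F> where \<F>: "finite \<F>" "\<F> \<subseteq> W ` topspace (base B)" "topspace (base B) \<subseteq> \<Union>\<F>"
    using cpt unfolding compact_space_alt by (metis order_refl)
  obtain F where F: "F \<subseteq> topspace (base B)" "finite F" "\<F> = W ` F" using finite_subset_image[OF \<F>(1,2)] by blast
  show thesis
  proof (rule that[of "p ` F"])
    show "finite (p ` F)" using F by simp
    show "\<forall>(c, \<tau>, K)\<in>p ` F. c \<in> atlas B \<and> \<tau> \<in> trivs B \<and> compact K \<and> K \<subseteq> cdom c \<tau>"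
      using p F(1) by fastforce
    fix x assume "x \<in> topspace (base B)"
    then obtain y where y: "y \<in> F" "x \<in> W y" using \<F>(3) F(3) by blast
    then have "y \<in> topspace (base B)" using F(1) by blast
    from p[OF this] y show "\<exists>(c, \<tau>, K)\<in>p ` F. x \<in> fst c \<inter> fst \<tau> \<and> snd c x \<in> K" by force
  qed
qed

lemma frame:
  assumes "\<tau> \<in> trivs B" "x \<in> fst \<tau>"
  shows "frame B \<tau> x l \<in> fibre B x" "snd \<tau> (frame B \<tau> x l) = axis l 1"
proof -
  have "axis l 1 \<in> snd \<tau> ` fibre B x" using triv(2)[OF assms] by (simp add: bij_betw_def)
  then show "frame B \<tau> x l \<in> fibre B x" "snd \<tau> (frame B \<tau> x l) = axis l 1"
    unfolding frame_def by (auto intro: inv_into_into f_inv_into_f)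
qed

section \<open>Gram matrices and their change under trivializations\<close>

lemma gram_at:
  assumes "c \<in> atlas B" "x \<in> fst c"
  shows "gram B h c \<tau> (snd c x) = (\<chi> l m. h (frame B \<tau> x l) (frame B \<tau> x m))"
  using inv_chart[OF assms] by (simp add: gram_def Let_def)

lemma form_section:
  assumes "hermitian_form_section B reg h"
  shows "c \<in> atlas B \<Longrightarrow> \<tau> \<in> trivs B \<Longrightarrow> reg (cdom c \<tau>) (gram B h c \<tau>)"
    "x \<in> topspace (base B) \<Longrightarrow> e \<in> fibre B x \<Longrightarrow> e' \<in> fibre B x \<Longrightarrow> h e' e = cnj (h e e')"
    "\<tau> \<in> trivs B \<Longrightarrow> x \<in> fst \<tau> \<Longrightarrow> e \<in> fibre B x \<Longrightarrow> e' \<in> fibre B x \<Longrightarrow> h e e' = (\<Sum>l\<in>UNIV. \<Sum>m\<in>UNIV.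
          h (frame B \<tau> x l) (frame B \<tau> x m) * snd \<tau> e $ l * cnj (snd \<tau> e' $ m))"
proof -
  note a = assms[unfolded hermitian_form_section_def]
  show "c \<in> atlas B \<Longrightarrow> \<tau> \<in> trivs B \<Longrightarrow> reg (cdom c \<tau>) (gram B h c \<tau>)" by (rule a[THEN conjunct1, rule_format])
  show "x \<in> topspace (base B) \<Longrightarrow> e \<in> fibre B x \<Longrightarrow> e' \<in> fibre B x \<Longrightarrow> h e' e = cnj (h e e')"
    by (rule a[THEN conjunct2, THEN conjunct1, rule_format])
  show "\<tau> \<in> trivs B \<Longrightarrow> x \<in> fst \<tau> \<Longrightarrow> e \<in> fibre B x \<Longrightarrow> e' \<in> fibre B x \<Longrightarrow> h e e' = (\<Sum>l\<in>UNIV. \<Sum>m\<in>UNIV.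
          h (frame B \<tau> x l) (frame B \<tau> x m) * snd \<tau> e $ l * cnj (snd \<tau> e' $ m))"
    by (rule a[THEN conjunct2, THEN conjunct2, rule_format])
qed

lemma gram_hermitian:
  assumes h: "hermitian_form_section B reg h" and c: "c \<in> atlas B" "\<tau> \<in> trivs B" "z \<in> cdom c \<tau>"
  shows "hermitian (gram B h c \<tau> z)"
proof -
  obtain x where x: "x \<in> fst c" "x \<in> fst \<tau>" "z = snd c x" using c(3) by (auto simp: cdom_def)
  have "cnj (h (frame B \<tau> x l) (frame B \<tau> x m)) = h (frame B \<tau> x m) (frame B \<tau> x l)" for l m
    by (rule form_section(2)[OF h in_topspace[OF c(1) x(1)] frame(1)[OF c(2) x(2)] frame(1)[OF c(2) x(2)], symmetric])
  then show ?thesis unfolding x(3) gram_at[OF c(1) x(1)] by (simp only: hermitian_def ctranspose_def vec_lambda_beta vec_eq_iff simp_thms)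
qed

text \<open>Transposed to fit the row convention of Gram matrices: row \<open>l\<close> holds the
  components with respect to \<open>\<tau>\<close> of the l-th frame vector of
  \<open>\<tau>'\<close>.\<close>

definition tmat :: "('e, 'x, 'r) triv \<Rightarrow> ('e, 'x, 'r) triv \<Rightarrow> 'x \<Rightarrow> complex^'r^'r" where
  "tmat \<tau>' \<tau> x = transpose (transition B \<tau>' \<tau> x)"

lemma gram_change:
  assumes h: "hermitian_form_section B reg h"
    and c: "c \<in> atlas B" "c' \<in> atlas B" and \<tau>: "\<tau> \<in> trivs B" "\<tau>' \<in> trivs B"
    and x: "x \<in> fst c" "x \<in> fst c'" "x \<in> fst \<tau>" "x \<in> fst \<tau>'"
  shows "gram B h c' \<tau>' (snd c' x) = tmat \<tau>' \<tau> x ** gram B h c \<tau> (snd c x) ** ctranspose (tmat \<tau>' \<tau> x)"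
proof -
  have 1: "h (frame B \<tau>' x l) (frame B \<tau>' x m) = (\<Sum>a\<in>UNIV. \<Sum>b\<in>UNIV.
      h (frame B \<tau> x a) (frame B \<tau> x b) * snd \<tau> (frame B \<tau>' x l) $ a * cnj (snd \<tau> (frame B \<tau>' x m) $ b))" for l m
    by (rule form_section(3)[OF h \<tau>(1) x(3) frame(1)[OF \<tau>(2) x(4)] frame(1)[OF \<tau>(2) x(4)]])
  have 2: "(tmat \<tau>' \<tau> x ** gram B h c \<tau> (snd c x) ** ctranspose (tmat \<tau>' \<tau> x)) $ l $ m =
     (\<Sum>b\<in>UNIV. \<Sum>a\<in>UNIV. h (frame B \<tau> x a) (frame B \<tau> x b) * snd \<tau> (frame B \<tau>' x l) $ a * cnj (snd \<tau> (frame B \<tau>' x m) $ b))" for l m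
    unfolding gram_at[OF c(1) x(1)]
    by (simp add: matrix_matrix_mult_def tmat_def transition_def transpose_def sum_distrib_left sum_distrib_right mult_ac)
  have "gram B h c' \<tau>' (snd c' x) $ l $ m = (tmat \<tau>' \<tau> x ** gram B h c \<tau> (snd c x) ** ctranspose (tmat \<tau>' \<tau> x)) $ l $ m" for l m
    unfolding 2 gram_at[OF c(2) x(2)] vec_lambda_beta 1 by (rule sum.swap)
  then show ?thesis by (simp only: vec_eq_iff simp_thms)
qed

text \<open>Applying the two transition rules in turn to the frame vectors shows that the transition
  matrices are inverse to each other.\<close>

lemma tmat_inverse:
  assumes \<tau>: "\<tau> \<in> trivs B" "\<tau>' \<in> trivs B" and x: "x \<in> fst \<tau>" "x \<in> fst \<tau>'"
  shows "invertible (tmat \<tau>' \<tau> x)"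
proof -
  have "transition B \<tau>' \<tau> x ** transition B \<tau> \<tau>' x = mat 1"
  proof -
    have "snd \<tau> e = transition B \<tau>' \<tau> x *v snd \<tau>' e" if "e \<in> fibre B x" for e
      using hvb \<tau> x that unfolding holomorphic_vector_bundle_def by blast
    moreover have "snd \<tau>' e = transition B \<tau> \<tau>' x *v snd \<tau> e" if "e \<in> fibre B x" for e
      using hvb \<tau> x that unfolding holomorphic_vector_bundle_def by blast
    ultimately have "axis l 1 = transition B \<tau>' \<tau> x *v (transition B \<tau> \<tau>' x *v axis l 1)" for l
      using frame[OF \<tau>(1) x(1), of l] by metis
    then have "(transition B \<tau>' \<tau> x ** transition B \<tau> \<tau>' x) *v axis l 1 = axis l 1" for l
      by (simp add: matrix_vector_mul_assoc)
    moreover have "(M *v axis l 1) $ i = M $ i $ l" for M :: "complex^'r^'r" and i l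
      by (simp add: matrix_vector_mult_def axis_def if_distrib cong: if_cong)
    ultimately have "(transition B \<tau>' \<tau> x ** transition B \<tau> \<tau>' x) $ i $ l = axis l 1 $ i" for i l
      by metis
    then show ?thesis by (auto simp: vec_eq_iff mat_def axis_def)
  qed
  then have "invertible (transition B \<tau>' \<tau> x)" by (rule invertible_rightI)
  then show ?thesis by (simp add: tmat_def invertible_transpose)
qed

lemma smooth_form_Ck:
  assumes "hermitian_form_section B smooth_on \<eta>" "c \<in> atlas B" "\<tau> \<in> trivs B"
  shows "Ck_on k (cdom c \<tau>) (gram B \<eta> c \<tau>)"
  by (rule smooth_on_imp_Ck_on[OF open_cdom[OF assms(2,3)] form_section(1)[OF assms]])

lemma smooth_imp_C2:
  assumes "smooth_metric B h"
  shows "C2_metric B h"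
proof -
  have "hermitian_form_section B smooth_on h" using assms by (simp add: hermitian_metric_def)
  then have "hermitian_form_section B (Ck_on 2) h"
    unfolding hermitian_form_section_def[of B "Ck_on 2"]
    by (intro conjI ballI smooth_form_Ck form_section(2,3)) assumption+
  then show ?thesis using assms by (simp add: hermitian_metric_def)
qed

section \<open>Curvature of a metric of class \<open>C\<^sup>2\<close> in different charts\<close>

context
  fixes h assumes h: "C2_metric B h"
begin

lemma metric:
  assumes "c \<in> atlas B" "\<tau> \<in> trivs B"
  shows "Ck_on 2 (cdom c \<tau>) (gram B h c \<tau>)" "\<And>z. z \<in> cdom c \<tau> \<Longrightarrow> pos_def (gram B h c \<tau> z)"
    "\<And>z. z \<in> cdom c \<tau> \<Longrightarrow> invertible (gram B h c \<tau> z)" "\<And>z. z \<in> cdom c \<tau> \<Longrightarrow> hermitian (gram B h c \<tau> z)"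
proof -
  have hs: "hermitian_form_section B (Ck_on 2) h" using h by (simp add: hermitian_metric_def)
  show "Ck_on 2 (cdom c \<tau>) (gram B h c \<tau>)" by (rule form_section(1)[OF hs assms])
  show pd: "pos_def (gram B h c \<tau> z)" if "z \<in> cdom c \<tau>" for z
    using h[unfolded hermitian_metric_def, THEN conjunct2] assms that by blast
  show "invertible (gram B h c \<tau> z)" if "z \<in> cdom c \<tau>" for z using pos_def_det(3)[OF pd[OF that]] .
  show "hermitian (gram B h c \<tau> z)" if "z \<in> cdom c \<tau>" for z using gram_hermitian[OF hs assms that] .
qed

lemma metric_hermH:
  assumes "c \<in> atlas B" "\<tau> \<in> trivs B" "z \<in> cdom c \<tau>"
  shows "hermH (gram B h c \<tau> z) (chern (gram B h c \<tau>) z)"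
  by (rule hermH_chern[OF open_cdom[OF assms(1,2)] assms(3) metric(1)[OF assms(1,2)] metric(3)[OF assms] metric(4)[OF assms(1,2)]])

lemma metric_chern:
  assumes "c \<in> atlas B" "\<tau> \<in> trivs B" "z \<in> cdom c \<tau>"
  shows "chern (gram B h c \<tau>) z = curvA (gram B h c \<tau> z) (jetP (gram B h c \<tau>) z) (jetQ (gram B h c \<tau>) z) (jetR (gram B h c \<tau>) z)"
  by (rule chern_curvA(1)[OF open_cdom[OF assms(1,2)] assms(3) metric(1)[OF assms(1,2)] metric(3)[OF assms]])

text \<open>On the overlap, expressed in the chart \<open>c'\<close>, coordinate change and frame
  change are holomorphic, so \<open>chern_change\<close> applies; \<open>T\<close> is the transposed
  Jacobian.\<close>

lemma metric_change:
  assumes c: "c \<in> atlas B" "c' \<in> atlas B" and \<tau>: "\<tau> \<in> trivs B" "\<tau>' \<in> trivs B"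
    and x: "x \<in> fst c" "x \<in> fst c'" "x \<in> fst \<tau>" "x \<in> fst \<tau>'"
  obtains T where "invertible T"
    "chern (gram B h c' \<tau>') (snd c' x) = in_coords T (in_frame (tmat \<tau>' \<tau> x) (chern (gram B h c \<tau>) (snd c x)))"
proof -
  let ?W = "fst c \<inter> (fst \<tau> \<inter> fst \<tau>')"
  define U where "U = snd c' ` (fst c' \<inter> ?W)"
  have oW: "openin (base B) ?W" by (intro openin_Int chart triv c \<tau>)
  have oU: "open U" unfolding U_def by (rule open_chart_image[OF c(2) oW])
  define \<psi> where "\<psi> = inv_into (fst c') (snd c')"
  have \<psi>: "\<psi> z \<in> fst c' \<inter> ?W" "snd c' (\<psi> z) = z" if "z \<in> U" for z
    using that inv_chart[OF c(2)] by (auto simp: U_def \<psi>_def)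
  define w where "w z = snd c (\<psi> z)" for z
  have xU: "snd c' x \<in> U" using x by (auto simp: U_def)
  have px: "\<psi> (snd c' x) = x" using inv_chart[OF c(2) x(2)] by (simp add: \<psi>_def)
  have wx: "w (snd c' x) = snd c x" by (simp add: w_def px)
  have man: "\<forall>(U, \<phi>)\<in>atlas B. \<forall>(V, \<psi>)\<in>atlas B. \<forall>i. holo_on (\<phi> ` (U \<inter> V)) (\<lambda>z. \<psi> (inv_into U \<phi> z) $ i)"
    using hvb by (simp add: holomorphic_vector_bundle_def complex_manifold_def)
  have hw: "holo_on U (\<lambda>z. w z $ a)" for a
  proof -
    have "holo_on (snd c' ` (fst c' \<inter> fst c)) (\<lambda>z. snd c (inv_into (fst c') (snd c') z) $ a)"
      using man c by (auto simp: case_prod_beta)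
    then show ?thesis unfolding w_def \<psi>_def by (rule holo_on_subset) (auto simp: U_def)
  qed
  define A where "A z = tmat \<tau>' \<tau> (\<psi> z)" for z
  have hA: "holo_on U (\<lambda>z. A z $ l $ m)" for l m
  proof -
    have "holo_fun (atlas B) (fst \<tau>' \<inter> fst \<tau>) (\<lambda>x. transition B \<tau>' \<tau> x $ m $ l)"
      using hvb \<tau> unfolding holomorphic_vector_bundle_def by blast
    then have "holo_on (snd c' ` (fst c' \<inter> (fst \<tau>' \<inter> fst \<tau>))) (\<lambda>z. transition B \<tau>' \<tau> (\<psi> z) $ m $ l)"
      using c(2) unfolding holo_fun_def \<psi>_def by (auto simp: case_prod_beta)
    then show ?thesis unfolding A_def tmat_def transpose_def by (simp, elim holo_on_subset) (auto simp: U_def)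
  qed
  have Ai: "invertible (A z)" if "z \<in> U" for z
    unfolding A_def using \<psi>(1)[OF that] by (intro tmat_inverse \<tau>) auto
  have wU: "w z \<in> cdom c \<tau>" if "z \<in> U" for z using \<psi>(1)[OF that] by (auto simp: w_def cdom_def)
  have hs: "hermitian_form_section B (Ck_on 2) h" using h by (simp add: hermitian_metric_def)
  have eq: "gram B h c' \<tau>' z = A z ** gram B h c \<tau> (w z) ** ctranspose (A z)" if "z \<in> U" for z
    using gram_change[OF hs c \<tau>, of "\<psi> z"] \<psi>[OF that] by (simp add: A_def w_def)
  define T where "T = (\<chi> j a. frechet_derivative (\<lambda>x. w x $ a) (at (snd c' x)) (axis j 1))"
  have ch: "chern (gram B h c' \<tau>') (snd c' x) = in_coords T (in_frame (tmat \<tau>' \<tau> x) (chern (gram B h c \<tau>) (snd c x)))"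
    using chern_change[OF oU xU open_cdom[OF c(1) \<tau>(1)] wU metric(1,3)[OF c(1) \<tau>(1)] hw hA Ai eq]
    by (simp add: T_def wx A_def px)
  \<comment> \<open>The reverse coordinate change \<open>w2\<close> is differentiable too, so the
    chain rule for \<open>w2 (w z) = z\<close> provides a left inverse of the derivative of
    \<open>w\<close>.\<close>
  have "invertible T"
  proof -
    define \<psi>2 where "\<psi>2 = inv_into (fst c) (snd c)"
    define w2 where "w2 z = snd c' (\<psi>2 z)" for z
    define V where "V = snd c ` (fst c \<inter> fst c')"
    have "holo_on V (\<lambda>z. w2 z $ a)" for a
      using man c unfolding w2_def \<psi>2_def V_def by (auto simp: case_prod_beta)
    moreover have xV: "snd c x \<in> V" using x by (auto simp: V_def)
    ultimately have d2: "((\<lambda>z. \<chi> a. w2 z $ a) has_derivative (\<lambda>v. \<chi> a. frechet_derivative (\<lambda>z. w2 z $ a) (at (snd c x)) v)) (at (snd c x))"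
      by (intro has_derivative_vec_lambda holo_onD(1))
    then obtain D2 where D2: "(w2 has_derivative D2) (at (w (snd c' x)))" unfolding wx by auto
    define W where "W v = (\<chi> a. frechet_derivative (\<lambda>x. w x $ a) (at (snd c' x)) v)" for v
    have "((\<lambda>z. \<chi> a. w z $ a) has_derivative W) (at (snd c' x))"
      unfolding W_def by (intro has_derivative_vec_lambda holo_onD(1)[OF hw xU])
    then have dW: "(w has_derivative W) (at (snd c' x))" by simp
    have "((\<lambda>z. w2 (w z)) has_derivative (\<lambda>v. D2 (W v))) (at (snd c' x))" by (rule has_derivative_compose[OF dW D2])
    moreover have "w2 (w z) = z" if "z \<in> U" for z
      using \<psi>[OF that] inv_chart[OF c(1)] by (simp add: w2_def w_def \<psi>2_def)
    ultimately have "((\<lambda>z. z) has_derivative (\<lambda>v. D2 (W v))) (at (snd c' x))"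
      using has_derivative_transform_within_open[OF _ oU xU, of "\<lambda>z. w2 (w z)" _ UNIV "\<lambda>z. z"] by simp
    then have id: "D2 (W v) = v" for v using has_derivative_unique[OF has_derivative_ident] by metis
    have linW: "linear W" using dW has_derivative_linear by blast
    have WT: "W v = transpose T *v v" for v
    proof -
      have "W v $ a = (\<Sum>j\<in>UNIV. v $ j * T $ j $ a)" for a
      proof -
        have lin: "linear (frechet_derivative (\<lambda>x. w x $ a) (at (snd c' x)))" using holo_onD(1)[OF hw xU] has_derivative_linear by blast
        have "v = (\<Sum>i\<in>UNIV. v $ i *s axis i 1)" by (simp add: vec_eq_iff axis_def if_distrib cong: if_cong)
        then have "frechet_derivative (\<lambda>x. w x $ a) (at (snd c' x)) v = (\<Sum>i\<in>UNIV. frechet_derivative (\<lambda>x. w x $ a) (at (snd c' x)) (v $ i *s axis i 1))"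
          using linear_sum[OF lin, of "\<lambda>i. v $ i *s axis i 1" UNIV] by simp
        then show ?thesis by (simp add: W_def T_def holo_onD(2)[OF hw xU])
      qed
      then show ?thesis by (simp add: vec_eq_iff vector_matrix_mult_def mult.commute)
    qed
    have "v = 0" if "transpose T *v v = 0" for v
    proof -
      have "v = D2 (W v)" by (simp only: id)
      also have "\<dots> = D2 (W 0)" using that linear_0[OF linW] by (simp only: WT)
      also have "\<dots> = 0" by (simp only: id)
      finally show ?thesis .
    qed
    then have "\<exists>R. R ** transpose T = mat 1" unfolding matrix_left_invertible_ker by blast
    then have "invertible (transpose T)" using invertible_leftI by blast
    then show "invertible T" by (metis invertible_transpose transpose_transpose)
  qed
  then show thesis using that ch by blast
qed

text \<open>Makes positivity and distortion properties of a point of the base, so they may be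
  checked in whichever chart and trivialization is convenient.\<close>

lemma posp_distp_change:
  assumes c: "c \<in> atlas B" "c' \<in> atlas B" and \<tau>: "\<tau> \<in> trivs B" "\<tau>' \<in> trivs B"
    and x: "x \<in> fst c" "x \<in> fst c'" "x \<in> fst \<tau>" "x \<in> fst \<tau>'"
    and p: "posp P t (gram B h c \<tau> (snd c x)) (chern (gram B h c \<tau>) (snd c x))"
  shows "posp P t (gram B h c' \<tau>' (snd c' x)) (chern (gram B h c' \<tau>') (snd c' x))"
    "unitary_invariant_sphere_measure \<sigma> \<Longrightarrow> 1 + real CARD('r) * t > 0 \<Longrightarrow>
      distp P s \<sigma> t (gram B h c' \<tau>' (snd c' x)) (chern (gram B h c' \<tau>') (snd c' x)) =
      distp P s \<sigma> t (gram B h c \<tau> (snd c x)) (chern (gram B h c \<tau>) (snd c x))"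
proof -
  obtain T where T: "invertible T"
    "chern (gram B h c' \<tau>') (snd c' x) = in_coords T (in_frame (tmat \<tau>' \<tau> x) (chern (gram B h c \<tau>) (snd c x)))"
    using metric_change[OF c \<tau> x] .
  have z: "snd c x \<in> cdom c \<tau>" "snd c' x \<in> cdom c' \<tau>'" using x by (auto simp: cdom_def)
  have hs: "hermitian_form_section B (Ck_on 2) h" using h by (simp add: hermitian_metric_def)
  note * = change_point[OF metric(2)[OF c(1) \<tau>(1) z(1)] metric_hermH[OF c(1) \<tau>(1) z(1)]
    tmat_inverse[OF \<tau> x(3,4)] T(1) gram_change[OF hs c \<tau> x] T(2) metric_hermH[OF c(2) \<tau>(2) z(2)] p]
  show "posp P t (gram B h c' \<tau>' (snd c' x)) (chern (gram B h c' \<tau>') (snd c' x))" by (rule *(1))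
  show "unitary_invariant_sphere_measure \<sigma> \<Longrightarrow> 1 + real CARD('r) * t > 0 \<Longrightarrow>
      distp P s \<sigma> t (gram B h c' \<tau>' (snd c' x)) (chern (gram B h c' \<tau>') (snd c' x)) =
      distp P s \<sigma> t (gram B h c \<tau> (snd c x)) (chern (gram B h c \<tau>) (snd c x))" by (rule *(2))
qed

lemma continuous_on_chern:
  assumes "c \<in> atlas B" "\<tau> \<in> trivs B"
  shows "continuous_on (cdom c \<tau>) (chern (gram B h c \<tau>))"
proof -
  note j = continuous_on_jets[OF metric(1)[OF assms]]
  have "continuous_on (cdom c \<tau>) (\<lambda>z. curvA (gram B h c \<tau> z) (jetP (gram B h c \<tau>) z) (jetQ (gram B h c \<tau>) z) (jetR (gram B h c \<tau>) z))"
    by (intro continuous_on_curvA j metric(3)[OF assms])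
  then show ?thesis using metric_chern[OF assms] continuous_on_cong[OF refl] by (metis (no_types, lifting))
qed

end

lemma positive_metric_iff:
  "positive_metric B P t h \<longleftrightarrow> (\<forall>c\<in>atlas B. \<forall>\<tau>\<in>trivs B. \<forall>z\<in>cdom c \<tau>. posp P t (gram B h c \<tau> z) (chern (gram B h c \<tau>) z))"
  by (simp add: positive_metric_def posp_def twisted_curv_tw)

end

section \<open>Ampleness of the determinant\<close>

text \<open>If \<open>d > 0\<close>, then \<open>g'\<close> would be positive immediately to the
  right of its zero at 0, making \<open>g\<close> increase past its maximum.\<close>

lemma second_derivative_test:
  fixes g :: "real \<Rightarrow> real"
  assumes e: "e > 0" and g: "\<And>x. \<bar>x\<bar> < e \<Longrightarrow> (g has_real_derivative g' x) (at x)"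
    and g': "(g' has_real_derivative d) (at 0)" and max: "\<And>x. \<bar>x\<bar> < e \<Longrightarrow> g x \<le> g 0"
  shows "d \<le> 0"
proof (rule ccontr)
  assume "\<not> d \<le> 0"
  then obtain \<delta> where \<delta>: "\<delta> > 0" "\<And>h. h > 0 \<Longrightarrow> h < \<delta> \<Longrightarrow> g' 0 < g' (0 + h)"
    using DERIV_pos_inc_right[OF g'] by auto
  have "g' 0 = 0" by (rule DERIV_local_max[OF g[of 0] e]) (use e max in auto)
  define x where "x = min \<delta> e / 2"
  have x: "0 < x" "x < \<delta>" "x < e" using \<delta> e by (auto simp: x_def min_def)
  have "g 0 < g x"
  proof (rule DERIV_pos_imp_increasing_open[OF x(1)])
    fix y assume y: "0 < y" "y < x"
    then have "(g has_real_derivative g' y) (at y)" "g' y > 0" using g[of y] \<delta>(2)[of y] x \<open>g' 0 = 0\<close> by auto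
    then show "\<exists>z. DERIV g y :> z \<and> z > 0" by blast
  next
    show "continuous_on {0..x} g"
      by (rule DERIV_atLeastAtMost_imp_continuous_on, rule exI, rule g) (use x in auto)
  qed
  then show False using max[of x] x by auto
qed

text \<open>\<open>K ** matrix_inv H\<close> is conjugate to its own adjoint by cyclicity of the
  trace.\<close>

lemma trace_hermitian_real:
  fixes K H :: "complex^'k^'k"
  assumes "hermitian K" "hermitian H" "invertible H"
  shows "Im (trace (K ** matrix_inv H)) = 0"
proof -
  have "cnj (trace (K ** matrix_inv H)) = trace (ctranspose (K ** matrix_inv H))" by (simp add: trace_ctranspose)
  also have "\<dots> = trace (matrix_inv H ** K)"
    using assms by (simp add: ctranspose_mul ctranspose_matrix_inv hermitian_def)
  also have "\<dots> = trace (K ** matrix_inv H)" by (rule trace_mul_sym)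
  finally show ?thesis by (metis complex_cnj_cancel_iff Im_complex_of_real Reals_cnj_iff complex_is_Real_iff)
qed

lemma trace_cs: "trace (cs a M) = a * trace M"
  by (simp add: trace_def sum_distrib_left)

lemma bounded_linear_trace: "bounded_linear (trace :: complex^'k^'k \<Rightarrow> complex)"
  unfolding linear_conv_bounded_linear[symmetric]
  by (rule linearI) (simp_all add: trace_def sum.distrib scaleR_sum_right)

text \<open>At a maximum of the squared norm of a section of a positive power of \<open>det E\<close>, the curvature of
  \<open>det E\<close> is nonnegative, since it is \<open>- i/m\<close> times \<open>\<partial>\<bar>\<partial>\<close> of the logarithm of that function.\<close>

lemma trace_chern_at_max:
  fixes H :: "complex^'n::finite \<Rightarrow> complex^'r::finite^'r"
  assumes U: "open U" "z \<in> U" and H: "Ck_on 2 U H" and pd: "\<And>x. x \<in> U \<Longrightarrow> pos_def (H x)"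
    and q: "holo_on U q" "q z \<noteq> 0" and m: "m \<ge> (1::nat)"
    and max: "\<And>x. x \<in> U \<Longrightarrow> (cmod (q x))\<^sup>2 * Re (det (H x)) ^ m \<le> (cmod (q z))\<^sup>2 * Re (det (H z)) ^ m"
  shows "Re (trace_form (chern H z) $ j $ j) \<ge> 0"
proof -
  \<comment> \<open>The part of \<open>U\<close> where \<open>q\<close> has no zero, so that the
    logarithm of the norm is differentiable.\<close>
  define V where "V = U \<inter> q -` (- {0})"
  have V: "open V" "z \<in> V" "V \<subseteq> U"
    using U q continuous_open_preimage[OF holo_on_continuous[OF q(1)] U(1), of "- {0}"] by (auto simp: V_def)
  have qV: "q x \<noteq> 0" if "x \<in> V" for x using that by (auto simp: V_def)
  have inv: "invertible (H x)" "hermitian (H x)" "Re (det (H x)) > 0" "Im (det (H x)) = 0" if "x \<in> U" for x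
    using pos_def_det[OF pd[OF that]] pd[OF that] by (auto simp: pos_def_def)
  have Hd: "H differentiable (at x)" if "x \<in> U" for x using H that by (auto simp: Ck2_on)
  define f where "f x = ln ((cmod (q x))\<^sup>2 * Re (det (H x)) ^ m)" for x
  define T where "T x = trace (del_matrix j H x ** matrix_inv (H x))" for x
  define q' where "q' x = frechet_derivative q (at x) (axis j 1)" for x
  \<comment> \<open>This is the derivative of \<open>f\<close> with respect to the j-th complex
    coordinate: along the two real axes the derivatives of \<open>f\<close> are
    \<open>2 * Re (Q x)\<close> and \<open>- 2 * Im (Q x)\<close>, so second derivatives of
    \<open>f\<close> come from one derivative of \<open>Q\<close>.\<close>
  define Q where "Q x = q' x / q x + of_nat m * T x" for x
  have T: "Re (trace (deriv_dir (axis j 1) H x ** matrix_inv (H x))) = 2 * Re (T x)"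
    "Re (trace (deriv_dir (axis j \<i>) H x ** matrix_inv (H x))) = - 2 * Im (T x)" if x: "x \<in> U" for x
  proof -
    have dm: "del_matrix j H x = cs (1 / 2) (deriv_dir (axis j 1) H x - cs \<i> (deriv_dir (axis j \<i>) H x))"
      using del_matrix_ldel(1)[OF differentiable_has_derivative[OF Hd[OF x]]] by (simp add: ldel_def)
    have "T x = (1 / 2) * (trace (deriv_dir (axis j 1) H x ** matrix_inv (H x)) - \<i> * trace (deriv_dir (axis j \<i>) H x ** matrix_inv (H x)))"
      unfolding T_def dm by (simp only: cs_mul_left trace_cs bounded_bilinear.diff_left[OF bounded_bilinear_matrix_mul] trace_sub)
    moreover have "Im (trace (deriv_dir v H x ** matrix_inv (H x))) = 0" for v
      by (intro trace_hermitian_real deriv_dir_hermitian[OF U(1) x Hd[OF x]] inv x)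
    ultimately show "Re (trace (deriv_dir (axis j 1) H x ** matrix_inv (H x))) = 2 * Re (T x)"
      "Re (trace (deriv_dir (axis j \<i>) H x ** matrix_inv (H x))) = - 2 * Im (T x)"
      by (simp_all add: complex_eq_iff)
  qed
  have df: "(f has_derivative (\<lambda>v. 2 * Re (frechet_derivative q (at x) v / q x) +
      real m * Re (trace (deriv_dir v H x ** matrix_inv (H x))))) (at x)" if x: "x \<in> V" for x
  proof -
    have xU: "x \<in> U" using x V by blast
    have dq: "(q has_derivative frechet_derivative q (at x)) (at x)" using holo_onD(1)[OF q(1) xU] .
    have dH: "(H has_derivative frechet_derivative H (at x)) (at x)" by (rule differentiable_has_derivative[OF Hd[OF xU]])
    have 1: "((\<lambda>x. q x \<bullet> q x) has_derivative (\<lambda>v. q x \<bullet> frechet_derivative q (at x) v + frechet_derivative q (at x) v \<bullet> q x)) (at x)"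
      by (rule has_derivative_inner[OF dq dq])
    have 2: "((\<lambda>x. Re (det (H x))) has_derivative (\<lambda>v. Re (Ddet (H x) (frechet_derivative H (at x) v)))) (at x)"
      by (rule bounded_linear.has_derivative[OF bounded_linear_Re has_derivative_compose[OF dH has_derivative_det]])
    have qq: "q x \<bullet> q x > 0" using qV[OF x] by simp
    have "((\<lambda>x. ln (q x \<bullet> q x) + real m * ln (Re (det (H x)))) has_derivative
      (\<lambda>v. (q x \<bullet> frechet_derivative q (at x) v + frechet_derivative q (at x) v \<bullet> q x) / (q x \<bullet> q x) +
        real m * (Re (Ddet (H x) (frechet_derivative H (at x) v)) / Re (det (H x))))) (at x)"
      by (rule has_derivative_eq_rhs, (rule derivative_intros 1 2 qq inv(3)[OF xU])+) (simp add: divide_inverse mult_ac)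
    moreover have "(q x \<bullet> frechet_derivative q (at x) v + frechet_derivative q (at x) v \<bullet> q x) / (q x \<bullet> q x) = 2 * Re (frechet_derivative q (at x) v / q x)" for v
      by (simp add: inner_complex_def Re_divide power2_eq_square mult_ac add_divide_distrib[symmetric])
    moreover have "Re (Ddet (H x) (frechet_derivative H (at x) v)) / Re (det (H x)) = Re (trace (deriv_dir v H x ** matrix_inv (H x)))" for v
      unfolding Ddet_invertible[OF inv(1)[OF xU]] using inv(3,4)[OF xU] by simp
    ultimately have "((\<lambda>x. ln (q x \<bullet> q x) + real m * ln (Re (det (H x)))) has_derivative (\<lambda>v. 2 * Re (frechet_derivative q (at x) v / q x) +
      real m * Re (trace (deriv_dir v H x ** matrix_inv (H x))))) (at x)" by simp
    then show ?thesis
    proof (rule has_derivative_transform_within_open[OF _ V(1) x])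
      fix y assume y: "y \<in> V"
      then have "y \<in> U" using V by blast
      then show "ln (q y \<bullet> q y) + real m * ln (Re (det (H y))) = f y"
        using qV[OF y] inv(3)[of y] by (simp add: f_def ln_mult ln_realpow power2_norm_eq_inner)
    qed
  qed
  have f1: "frechet_derivative q (at x) (axis j \<i>) = \<i> * q' x" if "x \<in> U" for x
  proof -
    have "axis j \<i> = \<i> *s axis j (1::complex)" by (simp add: vec_eq_iff axis_def)
    then show ?thesis using holo_onD(2)[OF q(1) that, of \<i> "axis j 1"] by (simp add: q'_def)
  qed
  \<comment> \<open>\<open>q' / q\<close> is holomorphic, so its derivative is complex linear; this
    makes it drop out of the sum of the two second derivatives below.\<close>
  obtain E where E: "((\<lambda>x. q' x / q x) has_derivative E) (at z)" "E (axis j \<i>) = \<i> * E (axis j 1)"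
  proof -
    have hq': "holo_on U q'" unfolding q'_def by (rule holo_on_partial[OF U(1) q(1)])
    have "((\<lambda>x. q' x / q x) has_derivative (\<lambda>h. - q' z * (inverse (q z) * frechet_derivative q (at z) h * inverse (q z)) + frechet_derivative q' (at z) h / q z)) (at z)"
      by (rule has_derivative_divide[OF holo_onD(1)[OF hq' U(2)] holo_onD(1)[OF q(1) U(2)] q(2)])
    moreover have ax: "axis j \<i> = \<i> *s axis j (1::complex)" by (simp add: vec_eq_iff axis_def)
    moreover have "- q' z * (inverse (q z) * frechet_derivative q (at z) (axis j \<i>) * inverse (q z)) + frechet_derivative q' (at z) (axis j \<i>) / q z =
      \<i> * (- q' z * (inverse (q z) * frechet_derivative q (at z) (axis j 1) * inverse (q z)) + frechet_derivative q' (at z) (axis j 1) / q z)"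
      unfolding ax holo_onD(2)[OF hq' U(2)] holo_onD(2)[OF q(1) U(2)] by (simp add: divide_inverse algebra_simps)
    ultimately show thesis using that by blast
  qed
  obtain G where G: "((\<lambda>w. del_matrix j H w ** matrix_inv (H w)) has_derivative G) (at z)"
    using chern_curvA(2)[OF U H inv(1)[OF U(2)]] unfolding differentiable_def by blast
  have dT: "(T has_derivative (\<lambda>v. trace (G v))) (at z)"
    unfolding T_def[abs_def] by (rule bounded_linear.has_derivative[OF bounded_linear_trace G])
  have dQ: "(Q has_derivative (\<lambda>v. E v + of_nat m * trace (G v))) (at z)"
    unfolding Q_def[abs_def] by (intro has_derivative_add E(1) bounded_linear.has_derivative[OF bounded_linear_mult_right dT])
  \<comment> \<open>The one-variable test along the real line through \<open>z\<close> in the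
    direction \<open>v\<close>; \<open>g\<close> selects twice the real or minus twice the imaginary
    part of \<open>Q\<close>.\<close>
  have main: "g (E v + of_nat m * trace (G v)) \<le> 0"
    if g: "bounded_linear g" and gQ: "\<And>x. x \<in> V \<Longrightarrow> 2 * Re (frechet_derivative q (at x) v / q x) +
      real m * Re (trace (deriv_dir v H x ** matrix_inv (H x))) = g (Q x)" for g and v :: "complex^'n"
  proof -
    have line: "((\<lambda>s. F (z + s *\<^sub>R v)) has_real_derivative F' v) (at s)" if "(F has_derivative F') (at (z + s *\<^sub>R v))" for F :: "complex^'n \<Rightarrow> real" and F' s
    proof -
      have "F differentiable (at (z + s *\<^sub>R v))" using that by (auto simp: differentiable_def)
      from has_derivative_line[OF this] show ?thesis
        using frechet_derivative_at[OF that] by (simp add: has_real_derivative_iff_has_vector_derivative)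
    qed
    have "open ((\<lambda>s::real. z + s *\<^sub>R v) -` V)"
      by (intro open_vimage V(1) continuous_intros)
    then obtain e where e: "e > 0" "ball 0 e \<subseteq> (\<lambda>s::real. z + s *\<^sub>R v) -` V"
      using V(2) unfolding open_contains_ball by force
    then have eV: "z + s *\<^sub>R v \<in> V" if "\<bar>s\<bar> < e" for s using that by (auto simp: subset_iff dist_real_def)
    show ?thesis
    proof (rule second_derivative_test[OF e(1)])
      fix s :: real assume s: "\<bar>s\<bar> < e"
      show "((\<lambda>s. f (z + s *\<^sub>R v)) has_real_derivative g (Q (z + s *\<^sub>R v))) (at s)"
        using line[OF df[OF eV[OF s]]] gQ[OF eV[OF s]] by simp
      have "z + s *\<^sub>R v \<in> U" "z + s *\<^sub>R v \<in> V" using eV[OF s] V by auto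
      then show "f (z + s *\<^sub>R v) \<le> f (z + 0 *\<^sub>R v)"
        using max[of "z + s *\<^sub>R v"] qV[of "z + s *\<^sub>R v"] inv(3)[of "z + s *\<^sub>R v"] inv(3)[OF U(2)] q(2)
        by (simp add: f_def)
    next
      show "((\<lambda>s. g (Q (z + s *\<^sub>R v))) has_real_derivative g (E v + of_nat m * trace (G v))) (at 0)"
        by (rule line) (use bounded_linear.has_derivative[OF g dQ] in simp)
    qed
  qed
  have 1: "2 * Re (E (axis j 1) + of_nat m * trace (G (axis j 1))) \<le> 0"
  proof (rule main[where g="\<lambda>x. 2 * Re x"])
    show "bounded_linear (\<lambda>x. 2 * Re x)" by (intro bounded_linear_const_mult bounded_linear_Re)
    fix x assume "x \<in> V"
    then have "x \<in> U" using V by blast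
    then show "2 * Re (frechet_derivative q (at x) (axis j 1) / q x) + real m * Re (trace (deriv_dir (axis j 1) H x ** matrix_inv (H x))) = 2 * Re (Q x)"
      by (simp add: T Q_def q'_def)
  qed
  have 2: "- 2 * Im (E (axis j \<i>) + of_nat m * trace (G (axis j \<i>))) \<le> 0"
  proof (rule main[where g="\<lambda>x. - 2 * Im x"])
    show "bounded_linear (\<lambda>x. - 2 * Im x)" by (intro bounded_linear_const_mult bounded_linear_Im)
    fix x assume "x \<in> V"
    then have "x \<in> U" using V by blast
    then show "2 * Re (frechet_derivative q (at x) (axis j \<i>) / q x) + real m * Re (trace (deriv_dir (axis j \<i>) H x ** matrix_inv (H x))) = - 2 * Im (Q x)"
      unfolding f1[OF \<open>x \<in> U\<close>] T(2)[OF \<open>x \<in> U\<close>] times_divide_eq_right[symmetric] Q_def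
      by (simp add: algebra_simps del: times_divide_eq_right)
  qed
  \<comment> \<open>Adding the two inequalities amounts to the Laplacian in the j-th complex line,
    where the harmonic contribution of \<open>q\<close> cancels and the curvature remains.\<close>
  define a b where "a = trace (G (axis j 1))" and "b = trace (G (axis j \<i>))"
  have "trace (- M) = - trace M" for M :: "complex^'r^'r" by (simp add: trace_def sum_negf)
  then have "trace_form (chern H z) $ j $ j = - ((1 / 2) * (a + \<i> * b))"
    unfolding trace_form_def vec_lambda_beta chern_ldbar[OF G] a_def b_def
    by (simp only: ldbar_def trace_cs trace_add)
  then have "real m * Re (trace_form (chern H z) $ j $ j) = - (real m * Re a - real m * Im b) / 2"
    by simp argo
  moreover have "2 * (Re (E (axis j 1)) + real m * Re a) \<le> 0" "- 2 * (Re (E (axis j 1)) + real m * Im b) \<le> 0"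
    using 1 2 by (simp_all add: E(2) a_def b_def)
  ultimately have "real m * Re (trace_form (chern H z) $ j $ j) \<ge> 0" by (simp add: field_simps)
  then show ?thesis using m by (simp add: zero_le_mult_iff)
qed

context hbundle
begin

text \<open>Sections of a power of det E have no common zero, so one of them is nonzero at
  \<open>x0\<close> and its norm has a positive maximum on the compact base; there it does not
  vanish and \<open>trace_chern_at_max\<close> applies.\<close>

lemma twist_bound:
  assumes cpt: "compact_space (base B)" and x0: "x0 \<in> topspace (base B)" and am: "ample_det B"
    and h: "C2_metric B h" and pos: "positive_metric B P t h"
  shows "1 + real CARD('r) * t > 0"
proof -
  obtain m N s f where m: "m \<ge> 1" and s: "\<forall>i\<le>N. holo_section_det_power B m (s i)"
    and sf: "\<forall>\<tau>\<in>trivs B. \<forall>x\<in>fst \<tau>. same_point N (\<lambda>i. s i \<tau> x) (f x)"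
    and f: "projective_embedding (base B) (atlas B) N f"
    using am[unfolded ample_det_def] by (elim exE conjE) (rule that)
  have "\<exists>i\<le>N. f x0 i \<noteq> 0" by (rule f[unfolded projective_embedding_def, THEN conjunct1, rule_format, OF x0])
  then obtain i where i: "i \<le> N" "f x0 i \<noteq> 0" by blast
  define q where "q = s i"
  have q: "\<And>\<tau>. \<tau> \<in> trivs B \<Longrightarrow> holo_fun (atlas B) (fst \<tau>) (q \<tau>)"
    "\<And>\<tau> \<tau>' x. \<tau> \<in> trivs B \<Longrightarrow> \<tau>' \<in> trivs B \<Longrightarrow> x \<in> fst \<tau> \<inter> fst \<tau>' \<Longrightarrow> q \<tau>' x = det (transition B \<tau> \<tau>' x) ^ m * q \<tau> x"
    by (rule s[rule_format, OF i(1), unfolded holo_section_det_power_def q_def[symmetric], THEN conjunct1, rule_format],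
      assumption)
      (rule s[rule_format, OF i(1), unfolded holo_section_det_power_def q_def[symmetric], THEN conjunct2, rule_format])
  have hs: "hermitian_form_section B (Ck_on 2) h" using h by (simp add: hermitian_metric_def)
  \<comment> \<open>The squared norm of the section for the metric induced on the power of det E,
    first computed in one trivialization.\<close>
  define u where "u \<tau> x = (cmod (q \<tau> x))\<^sup>2 * Re (det (\<chi> l m. h (frame B \<tau> x l) (frame B \<tau> x m))) ^ m" for \<tau> x
  have uu: "u \<tau>' x = u \<tau> x" if that: "\<tau> \<in> trivs B" "\<tau>' \<in> trivs B" "x \<in> fst \<tau>" "x \<in> fst \<tau>'" and x: "x \<in> topspace (base B)" for \<tau> \<tau>' x
  proof -
    obtain c \<tau>2 where c: "c \<in> atlas B" "x \<in> fst c" using covers[OF x] by blast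
    define d where "d = det (transition B \<tau>' \<tau> x)"
    have "det (gram B h c \<tau>' (snd c x)) = d * cnj d * det (gram B h c \<tau> (snd c x))"
      unfolding gram_change[OF hs c(1) c(1) that(1,2) c(2) c(2) that(3,4)] det_mul det_ctranspose tmat_def det_transpose d_def by simp
    then have "Re (det (gram B h c \<tau>' (snd c x))) = (cmod d)\<^sup>2 * Re (det (gram B h c \<tau> (snd c x)))"
      by (simp add: complex_norm_square[symmetric] del: of_real_power)
    moreover have "q \<tau> x = d ^ m * q \<tau>' x" using q(2)[OF that(2,1)] that(3,4) by (simp add: d_def)
    ultimately show ?thesis
      unfolding u_def gram_at[OF c, symmetric] by (simp add: norm_mult norm_power power_mult_distrib power_mult[symmetric] mult.commute)
  qed
  \<comment> \<open>A trivialization picked at each point turns the norm into a function on the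
    base; by \<open>uu\<close> the choice has no influence.\<close>
  define tr where "tr x = (SOME \<tau>. \<tau> \<in> trivs B \<and> x \<in> fst \<tau>)" for x
  have tr: "tr x \<in> trivs B" "x \<in> fst (tr x)" if "x \<in> topspace (base B)" for x
  proof -
    have "\<exists>\<tau>. \<tau> \<in> trivs B \<and> x \<in> fst \<tau>" using covers[OF that] by blast
    from someI_ex[OF this] show "tr x \<in> trivs B" "x \<in> fst (tr x)" by (simp_all add: tr_def)
  qed
  have uc: "u (tr x) x = (cmod (q \<tau> (inv_into (fst c) (snd c) (snd c x))))\<^sup>2 * Re (det (gram B h c \<tau> (snd c x))) ^ m"
    if "c \<in> atlas B" "\<tau> \<in> trivs B" "x \<in> fst c \<inter> fst \<tau>" for c \<tau> x
  proof -
    have x: "x \<in> topspace (base B)" using in_topspace that by auto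
    have "u (tr x) x = u \<tau> x" by (rule uu) (use that tr x in auto)
    then show ?thesis using that by (simp add: u_def gram_at inv_chart)
  qed
  have hq: "holo_on (cdom c \<tau>) (\<lambda>z. q \<tau> (inv_into (fst c) (snd c) z))" if "c \<in> atlas B" "\<tau> \<in> trivs B" for c \<tau>
    using bspec[OF q(1)[OF that(2), unfolded holo_fun_def] that(1)] by (simp add: case_prod_beta cdom_def)
  have "continuous_map (base B) euclideanreal (\<lambda>x. u (tr x) x)"
  proof (rule continuous_map_charts)
    fix c \<tau> assume c: "c \<in> atlas B" "\<tau> \<in> trivs B"
    have "continuous_on (cdom c \<tau>) (\<lambda>z. (cmod (q \<tau> (inv_into (fst c) (snd c) z)))\<^sup>2 * Re (det (gram B h c \<tau> z)) ^ m)"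
      by (intro continuous_intros holo_on_continuous[OF hq[OF c]] continuous_on_jets(1)[OF metric(1)[OF h c]])
    then show "\<exists>g. continuous_on (cdom c \<tau>) g \<and> (\<forall>x\<in>fst c \<inter> fst \<tau>. u (tr x) x = g (snd c x))"
      by (intro exI[of _ "\<lambda>z. (cmod (q \<tau> (inv_into (fst c) (snd c) z)))\<^sup>2 * Re (det (gram B h c \<tau> z)) ^ m"] conjI ballI uc[OF c])
  qed
  then have "compactin euclideanreal ((\<lambda>x. u (tr x) x) ` topspace (base B))"
    using cpt image_compactin unfolding compact_space_def by blast
  then have "compact ((\<lambda>x. u (tr x) x) ` topspace (base B))" by simp
  then obtain x where x: "x \<in> topspace (base B)" and max: "\<And>y. y \<in> topspace (base B) \<Longrightarrow> u (tr y) y \<le> u (tr x) x"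
    using compact_attains_sup[of "(\<lambda>x. u (tr x) x) ` topspace (base B)"] x0 by blast
  obtain c \<tau> where c: "c \<in> atlas B" "\<tau> \<in> trivs B" "x \<in> fst c \<inter> fst \<tau>" using covers[OF x] .
  \<comment> \<open>Homogeneous coordinates of the embedding are the values of the sections up to a
    nonzero factor.\<close>
  have "q (tr x0) x0 \<noteq> 0"
    using sf[rule_format, OF tr[OF x0]] i by (auto simp: same_point_def q_def)
  moreover obtain c0 \<tau>0 where c0: "c0 \<in> atlas B" "x0 \<in> fst c0" using covers[OF x0] by blast
  have "Re (det (\<chi> l m. h (frame B (tr x0) x0 l) (frame B (tr x0) x0 m))) > 0"
    unfolding gram_at[OF c0, symmetric] by (rule pos_def_det(1)[OF metric(2)[OF h c0(1) tr(1)[OF x0]]]) (use tr[OF x0] c0 in \<open>auto simp: cdom_def\<close>)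
  ultimately have "u (tr x0) x0 > 0" by (simp add: u_def)
  then have ux: "u (tr x) x > 0" using max[OF x0] by linarith
  \<comment> \<open>Any single coordinate direction will do, since only the sign of a number is to
    be decided.\<close>
  obtain j :: 'n where True by blast
  have z: "snd c x \<in> cdom c \<tau>" using c by (auto simp: cdom_def)
  have "Re (trace_form (chern (gram B h c \<tau>) (snd c x)) $ j $ j) \<ge> 0"
  proof (rule trace_chern_at_max[OF open_cdom[OF c(1,2)] z metric(1)[OF h c(1,2)] metric(2)[OF h c(1,2)] hq[OF c(1,2)] _ m])
    show "q \<tau> (inv_into (fst c) (snd c) (snd c x)) \<noteq> 0" using ux m unfolding uc[OF c] by auto
    fix w assume "w \<in> cdom c \<tau>"
    then obtain y where y: "y \<in> fst c \<inter> fst \<tau>" "w = snd c y" by (auto simp: cdom_def)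
    have "u (tr y) y \<le> u (tr x) x" by (rule max) (use y in_topspace c in auto)
    then show "(cmod (q \<tau> (inv_into (fst c) (snd c) w)))\<^sup>2 * Re (det (gram B h c \<tau> w)) ^ m
      \<le> (cmod (q \<tau> (inv_into (fst c) (snd c) (snd c x))))\<^sup>2 * Re (det (gram B h c \<tau> (snd c x))) ^ m"
      unfolding uc[OF c(1,2) y(1)] uc[OF c] y(2) .
  qed
  moreover have "(1 + real CARD('r) * t) * Re (qform (trace_form (chern (gram B h c \<tau>) (snd c x))) (axis j 1)) > 0"
  proof (rule trace_form_neg[OF metric(2)[OF h c(1,2) z]])
    show "posp P t (gram B h c \<tau> (snd c x)) (chern (gram B h c \<tau>) (snd c x))"
      by (rule positive_metric_iff[THEN iffD1, OF pos, rule_format, OF c(1,2) z])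
    show "axis j (1::complex) \<noteq> 0" by (simp add: axis_eq_0_iff)
  qed
  moreover have "qform M (axis j 1) = M $ j $ j" for M :: "complex^'n^'n"
  proof -
    have "M $ l $ m * axis j 1 $ l * cnj (axis j 1 $ m) = (if m = j then if l = j then M $ l $ m else 0 else 0)" for l m
      by (simp add: axis_def)
    then show ?thesis by (simp add: qform_def)
  qed
  ultimately show ?thesis by (simp add: zero_less_mult_iff)
qed

end

section \<open>Perturbations of metrics\<close>

lemma qform_scaleR_right: "qform M (r *\<^sub>R v) = r\<^sup>2 *\<^sub>R qform M v"
  by (simp add: qform_def scaleR_sum_right power2_eq_square)

lemma pos_def_sphere: "pos_def (M :: complex^'k^'k) \<longleftrightarrow> hermitian M \<and> (\<forall>v\<in>sphere 0 1. Re (qform M v) > 0)"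
proof -
  have "Re (qform M v) > 0" if *: "\<forall>v\<in>sphere 0 1. Re (qform M v) > 0" and v: "v \<noteq> 0" for v
  proof -
    have "Re (qform M ((1 / norm v) *\<^sub>R v)) > 0" using * v by simp
    then show ?thesis using v by (simp add: qform_scaleR_right zero_less_mult_iff)
  qed
  moreover have "v \<noteq> 0" if "v \<in> sphere 0 1" for v :: "complex^'k" using that by auto
  ultimately show ?thesis unfolding pos_def_qform by blast
qed

lemma continuous_on_qform [continuous_intros]:
  "continuous_on S f \<Longrightarrow> continuous_on S g \<Longrightarrow> continuous_on S (\<lambda>x. qform (f x) (g x))"
  unfolding qform_def by (intro continuous_intros)

text \<open>Positivity on the unit sphere defines an open set of matrices containing the compact
  image of \<open>H\<close>, hence also a uniform neighbourhood of it; a bound on \<open>N\<close>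
  converts its radius into a range for \<open>\<epsilon>\<close>.\<close>

lemma pos_def_perturb:
  fixes H N :: "'a::euclidean_space \<Rightarrow> complex^'r^'r"
  assumes K: "compact K" and H: "continuous_on K H" "\<And>z. z \<in> K \<Longrightarrow> pos_def (H z)"
    and N: "continuous_on K N" "\<And>z. z \<in> K \<Longrightarrow> hermitian (N z)"
  obtains \<delta> where "\<delta> > 0" "\<And>\<epsilon> z. \<bar>\<epsilon>\<bar> < \<delta> \<Longrightarrow> z \<in> K \<Longrightarrow> pos_def (H z + \<epsilon> *\<^sub>R N z)"
proof -
  define W where "W = {M :: complex^'r^'r. \<forall>v\<in>sphere 0 1. Re (qform M v) > 0}"
  have "continuous_on UNIV (\<lambda>p :: (complex^'r^'r) \<times> (complex^'r). Re (qform (fst p) (snd p)))" by (intro continuous_intros)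
  then have W: "open W"
    unfolding W_def by (intro open_forall_compact compact_sphere) (simp add: case_prod_beta)
  have "H ` K \<subseteq> W" using H(2) by (auto simp: W_def pos_def_sphere)
  then obtain e where e: "e > 0" "(\<Union>x\<in>H ` K. ball x e) \<subseteq> W"
    using compact_subset_open_imp_ball_epsilon_subset[OF compact_continuous_image[OF H(1) K] W] by blast
  obtain b where b: "b > 0" "\<And>z. z \<in> K \<Longrightarrow> norm (N z) \<le> b"
    using compact_imp_bounded[OF compact_continuous_image[OF N(1) K]] unfolding bounded_pos by blast
  show thesis
  proof (rule that)
    show "e / b > 0" using e b by simp
    fix \<epsilon> z assume \<epsilon>: "\<bar>\<epsilon>\<bar> < e / b" and z: "z \<in> K"
    have "\<bar>\<epsilon>\<bar> * norm (N z) \<le> \<bar>\<epsilon>\<bar> * b" using b(2)[OF z] by (simp add: mult_left_mono)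
    also have "\<dots> < e" using \<epsilon> b(1) by (simp add: field_simps)
    finally have "H z + \<epsilon> *\<^sub>R N z \<in> ball (H z) e" by (simp add: dist_norm)
    then have "H z + \<epsilon> *\<^sub>R N z \<in> W" using e z by blast
    moreover have "hermitian (H z + \<epsilon> *\<^sub>R N z)"
      using H(2)[OF z] N(2)[OF z] by (simp add: pos_def_def hermitian_def ctranspose_add ctranspose_scaleR)
    ultimately show "pos_def (H z + \<epsilon> *\<^sub>R N z)" by (simp add: pos_def_sphere W_def)
  qed
qed

lemma finite_uniform_eps:
  assumes "finite S" and ex: "\<And>q. q \<in> S \<Longrightarrow> \<exists>e>0. R q e" and mono: "\<And>q e e'. R q e \<Longrightarrow> 0 < e' \<Longrightarrow> e' \<le> e \<Longrightarrow> R q e'"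
  obtains e :: real where "e > 0" "\<And>q. q \<in> S \<Longrightarrow> R q e"
proof -
  obtain f where f: "\<And>q. q \<in> S \<Longrightarrow> f q > 0 \<and> R q (f q)" using ex by metis
  \<comment> \<open>Inserting 1 keeps the minimum meaningful when \<open>S\<close> is empty.\<close>
  define e where "e = Min (insert 1 (f ` S))"
  have "e > 0" using assms(1) f by (auto simp: e_def)
  moreover have "R q e" if "q \<in> S" for q
    using mono[of q "f q" e] f[OF that] \<open>e > 0\<close> that assms(1) by (simp add: e_def)
  ultimately show thesis using that by blast
qed

context hbundle
begin

lemma gram_add: "gram B (\<lambda>e e'. h e e' + of_real \<epsilon> * \<eta> e e') c \<tau> = (\<lambda>z. gram B h c \<tau> z + \<epsilon> *\<^sub>R gram B \<eta> c \<tau> z)"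
  by (simp add: gram_def Let_def fun_eq_iff vec_eq_iff scaleR_conv_of_real[where 'a=complex])

lemma form_section_add:
  assumes h: "hermitian_form_section B (Ck_on 2) h" and \<eta>: "hermitian_form_section B smooth_on \<eta>"
  shows "hermitian_form_section B (Ck_on 2) (\<lambda>e e'. h e e' + of_real \<epsilon> * \<eta> e e')"
  unfolding hermitian_form_section_def
proof (intro conjI ballI)
  fix c \<tau> assume c: "c \<in> atlas B" "\<tau> \<in> trivs B"
  show "Ck_on 2 (cdom c \<tau>) (gram B (\<lambda>e e'. h e e' + of_real \<epsilon> * \<eta> e e') c \<tau>)"
    unfolding gram_add by (rule Ck2_on_add_scaleR(1)[OF open_cdom[OF c] form_section(1)[OF h c] smooth_form_Ck[OF \<eta> c]])
next
  fix x e e' assume x: "x \<in> topspace (base B)" "e \<in> fibre B x" "e' \<in> fibre B x"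
  show "h e' e + of_real \<epsilon> * \<eta> e' e = cnj (h e e' + of_real \<epsilon> * \<eta> e e')"
    unfolding form_section(2)[OF h x] form_section(2)[OF \<eta> x] by simp
next
  fix \<tau> x e e' assume x: "\<tau> \<in> trivs B" "x \<in> fst \<tau>" "e \<in> fibre B x" "e' \<in> fibre B x"
  show "h e e' + of_real \<epsilon> * \<eta> e e' = (\<Sum>l\<in>UNIV. \<Sum>m\<in>UNIV.
      (h (frame B \<tau> x l) (frame B \<tau> x m) + of_real \<epsilon> * \<eta> (frame B \<tau> x l) (frame B \<tau> x m)) * snd \<tau> e $ l * cnj (snd \<tau> e' $ m))"
    unfolding form_section(3)[OF h x] form_section(3)[OF \<eta> x]
    by (simp add: distrib_right sum.distrib sum_distrib_left mult.assoc)
qed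

lemma pos_def_change:
  assumes h: "hermitian_form_section B reg h"
    and c: "c \<in> atlas B" "c' \<in> atlas B" and \<tau>: "\<tau> \<in> trivs B" "\<tau>' \<in> trivs B"
    and x: "x \<in> fst c" "x \<in> fst c'" "x \<in> fst \<tau>" "x \<in> fst \<tau>'" and pd: "pos_def (gram B h c \<tau> (snd c x))"
  shows "pos_def (gram B h c' \<tau>' (snd c' x))"
  unfolding gram_change[OF h c \<tau> x] by (rule pos_def_congruence[OF pd tmat_inverse[OF \<tau> x(3,4)]])

text \<open>The local formulas for the right-hand sides are guaranteed for metrics only, so a
  variation has to be a metric on the whole base before it may be inserted; compactness makes one
  \<open>\<delta>\<close> serve everywhere.\<close>

lemma metric_perturb:
  assumes cpt: "compact_space (base B)" and h: "C2_metric B h" and \<eta>: "hermitian_form_section B smooth_on \<eta>"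
  obtains \<delta> where "\<delta> > 0" "\<And>\<epsilon>. \<bar>\<epsilon>\<bar> < \<delta> \<Longrightarrow> C2_metric B (\<lambda>e e'. h e e' + of_real \<epsilon> * \<eta> e e')"
proof -
  have hs: "hermitian_form_section B (Ck_on 2) h" using h by (simp add: hermitian_metric_def)
  obtain \<K> where \<K>: "finite \<K>" "\<forall>(c, \<tau>, K)\<in>\<K>. c \<in> atlas B \<and> \<tau> \<in> trivs B \<and> compact K \<and> K \<subseteq> cdom c \<tau>"
    "\<And>x. x \<in> topspace (base B) \<Longrightarrow> \<exists>(c, \<tau>, K)\<in>\<K>. x \<in> fst c \<inter> fst \<tau> \<and> snd c x \<in> K"
    by (rule compact_chart_cover[OF cpt]) (rule that; (assumption | blast))
  define R where "R q \<delta> \<longleftrightarrow> (\<forall>\<epsilon>. \<bar>\<epsilon>\<bar> < \<delta> \<longrightarrow> (\<forall>z\<in>snd (snd q). pos_def (gram B h (fst q) (fst (snd q)) z + \<epsilon> *\<^sub>R gram B \<eta> (fst q) (fst (snd q)) z)))"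
    for q :: "('x, 'n) chart \<times> ('e, 'x, 'r) triv \<times> (complex^'n) set" and \<delta>
  have ex: "\<exists>\<delta>>0. R q \<delta>" if "q \<in> \<K>" for q
  proof -
    obtain c \<tau> K where q: "q = (c, \<tau>, K)" by (cases q) auto
    have c: "c \<in> atlas B" "\<tau> \<in> trivs B" and K: "compact K" "K \<subseteq> cdom c \<tau>" using \<K>(2) that unfolding q by auto
    have cH: "continuous_on K (gram B h c \<tau>)" by (rule continuous_on_subset[OF continuous_on_jets(1)[OF metric(1)[OF h c]] K(2)])
    have cN: "continuous_on K (gram B \<eta> c \<tau>)" by (rule continuous_on_subset[OF continuous_on_jets(1)[OF smooth_form_Ck[OF \<eta> c]] K(2)])
    obtain \<delta> where "\<delta> > 0" "\<And>\<epsilon> z. \<bar>\<epsilon>\<bar> < \<delta> \<Longrightarrow> z \<in> K \<Longrightarrow> pos_def (gram B h c \<tau> z + \<epsilon> *\<^sub>R gram B \<eta> c \<tau> z)"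
      by (rule pos_def_perturb[OF K(1) cH metric(2)[OF h c subsetD[OF K(2)]] cN gram_hermitian[OF \<eta> c subsetD[OF K(2)]]]) (assumption+, (rule that; (assumption | blast)))
    then show ?thesis unfolding R_def q by auto
  qed
  have mono: "R q e'" if "R q e" "0 < e'" "e' \<le> e" for q e e' using that by (simp add: R_def)
  obtain \<delta> where \<delta>: "\<delta> > 0" "\<And>q. q \<in> \<K> \<Longrightarrow> R q \<delta>"
    by (rule finite_uniform_eps[of \<K> R, OF \<K>(1)]) (erule ex, erule (2) mono, (rule that; (assumption | blast)))
  show thesis
  proof (rule that[OF \<delta>(1)])
    fix \<epsilon> :: real assume \<epsilon>: "\<bar>\<epsilon>\<bar> < \<delta>"
    note fs = form_section_add[OF hs \<eta>, of \<epsilon>]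
    have "pos_def (gram B (\<lambda>e e'. h e e' + of_real \<epsilon> * \<eta> e e') c \<tau> z)" if c: "c \<in> atlas B" "\<tau> \<in> trivs B" "z \<in> cdom c \<tau>" for c \<tau> z
    proof -
      obtain x where x: "x \<in> fst c" "x \<in> fst \<tau>" "z = snd c x" using c by (auto simp: cdom_def)
      obtain c' \<tau>' K where q: "(c', \<tau>', K) \<in> \<K>" "x \<in> fst c' \<inter> fst \<tau>'" "snd c' x \<in> K" using \<K>(3)[OF in_topspace[OF c(1) x(1)]] by auto
      have c': "c' \<in> atlas B" "\<tau>' \<in> trivs B" using \<K>(2) q(1) by auto
      have "pos_def (gram B (\<lambda>e e'. h e e' + of_real \<epsilon> * \<eta> e e') c' \<tau>' (snd c' x))"
        using \<delta>(2)[OF q(1)] q(3) \<epsilon> by (simp add: R_def gram_add)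
      then show ?thesis unfolding x(3) by (intro pos_def_change[OF fs c'(1) c(1) c'(2) c(2)]) (use x q in auto)
    qed
    then show "C2_metric B (\<lambda>e e'. h e e' + of_real \<epsilon> * \<eta> e e')" using fs by (simp add: hermitian_metric_def)
  qed
qed

end

section \<open>The distortion function and neighbourhoods of a metric\<close>

lemma posp_distp_open:
  fixes c0 :: "('n::finite, 'r::finite) curv"
  assumes us: "unitary_invariant_sphere_measure \<sigma>" and rt: "1 + real CARD('r) * t > 0"
    and adm: "pos_def H0" "hermH H0 c0" and p: "posp P t H0 c0" and b: "distp P s \<sigma> t H0 c0 < b"
  obtains W where "open W" "(H0, c0) \<in> W"
    "\<And>H c. (H, c) \<in> W \<Longrightarrow> pos_def H \<Longrightarrow> hermH H c \<Longrightarrow> posp P t H c \<and> distp P s \<sigma> t H c < b"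
proof -
  define A where "A = {p :: (complex^'r^'r) \<times> ('n, 'r) curv. pos_def (fst p) \<and> hermH (fst p) (snd p)}"
  \<comment> \<open>Neighbourhoods relative to the admissible pairs. The open set extracted from
    this filter may contain inadmissible pairs, about which nothing is claimed.\<close>
  define F where "F = inf (nhds (H0, c0)) (principal A)"
  have "filterlim (\<lambda>x. x) (nhds (H0, c0)) F"
    unfolding filterlim_def F_def by simp
  then have lim: "(fst \<longlongrightarrow> H0) F" "(snd \<longlongrightarrow> c0) F" using tendsto_fst tendsto_snd by fastforce+
  have "eventually (\<lambda>p. pos_def (fst p) \<and> hermH (fst p) (snd p)) F"
    by (simp add: F_def eventually_inf_principal A_def)
  note * = posp_distp_tendsto[OF us rt lim this adm p]
  have "eventually (\<lambda>p. posp P t (fst p) (snd p) \<and> distp P s \<sigma> t (fst p) (snd p) < b) F"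
    by (intro eventually_conj *(1) order_tendstoD(2)[OF *(2) b])
  then have "eventually (\<lambda>p. p \<in> A \<longrightarrow> posp P t (fst p) (snd p) \<and> distp P s \<sigma> t (fst p) (snd p) < b) (nhds (H0, c0))"
    by (simp add: F_def eventually_inf_principal)
  then obtain W where "open W" "(H0, c0) \<in> W" "\<And>p. p \<in> W \<Longrightarrow> p \<in> A \<longrightarrow> posp P t (fst p) (snd p) \<and> distp P s \<sigma> t (fst p) (snd p) < b"
    unfolding eventually_nhds by blast
  then show thesis using that[of W] by (fastforce simp: A_def)
qed

lemma norm_vec_le_sum: "norm (x :: 'a::real_normed_vector^'k) \<le> real CARD('k) * e" if "\<And>i. norm (x $ i) \<le> e"
proof -
  have "norm x \<le> (\<Sum>i\<in>UNIV. norm (x $ i))" unfolding norm_vec_def by (rule L2_set_le_sum) simp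
  also have "\<dots> \<le> (\<Sum>i\<in>(UNIV::'k set). e)" by (rule sum_mono) (rule that)
  finally show ?thesis by simp
qed

lemma norm_jets_le:
  fixes d :: "complex^'n::finite \<Rightarrow> complex^'r::finite^'r"
  assumes e: "e \<ge> 0" and d1: "\<And>b. b \<in> Basis \<Longrightarrow> norm (deriv_dir b d z) \<le> e"
    and d2: "\<And>b b'. b \<in> Basis \<Longrightarrow> b' \<in> Basis \<Longrightarrow> norm (deriv_dir b (deriv_dir b' d) z) \<le> e"
  defines "k \<equiv> real (card (Basis :: (complex^'n) set))" and "n \<equiv> real CARD('n)"
  shows "norm (jetP d z) \<le> n * (k * e)" "norm (jetQ d z) \<le> n * (k * e)" "norm (jetR d z) \<le> n * (n * (k * (k * e)))"
proof -
  have b1: "cmod (b $ j) \<le> 1" if "b \<in> Basis" for b :: "complex^'n" and j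
    using Finite_Cartesian_Product.norm_nth_le[of b j] that by simp
  have pq: "cmod (pc j b) \<le> 1" "cmod (qc j b) \<le> 1" if "b \<in> Basis" for b :: "complex^'n" and j
    using b1[OF that, of j] by (simp_all add: pc_def qc_def norm_divide)
  have cs: "norm (cs a M) \<le> e" if "cmod a \<le> 1" "norm M \<le> e" for a and M :: "complex^'r^'r"
    using mult_mono[OF that] e by (simp add: norm_cs)
  have sm: "norm (sum f Basis) \<le> k * e'" if "\<And>b. b \<in> Basis \<Longrightarrow> norm (f b) \<le> e'" for f :: "complex^'n \<Rightarrow> complex^'r^'r" and e'
    unfolding k_def by (rule sum_norm_bound[OF that])
  show "norm (jetP d z) \<le> n * (k * e)" unfolding jetP_def n_def
    by (intro norm_vec_le_sum) (simp only: vec_lambda_beta, intro sm cs pq d1)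
  show "norm (jetQ d z) \<le> n * (k * e)" unfolding jetQ_def n_def
    by (intro norm_vec_le_sum) (simp only: vec_lambda_beta, intro sm cs pq d1)
  have cc: "norm (cs (qc l b * pc j b') M) \<le> e" if "b \<in> Basis" "b' \<in> Basis" "norm M \<le> e" for l j and b b' :: "complex^'n" and M :: "complex^'r^'r"
    using pq(2)[OF that(1), of l] pq(1)[OF that(2), of j] that(3) by (intro cs) (simp_all add: norm_mult mult_le_one)
  show "norm (jetR d z) \<le> n * (n * (k * (k * e)))" unfolding jetR_def n_def
    by (intro norm_vec_le_sum) (simp only: vec_lambda_beta, intro sm cc d2)
qed

lemma C2_close_mono: "C2_close e' K H H' \<Longrightarrow> e' \<le> e \<Longrightarrow> C2_close e K H H'"
  unfolding C2_close_def Let_def by (meson less_le_trans)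

lemma C2_close_jets:
  fixes H :: "complex^'n::finite \<Rightarrow> complex^'r::finite^'r"
  assumes U: "open U" "K \<subseteq> U" and K: "compact K" and H: "Ck_on 2 U H"
    and W: "open W" "\<And>z. z \<in> K \<Longrightarrow> (H z, jetP H z, jetQ H z, jetR H z) \<in> W"
  obtains e where "e > 0" "\<And>H' z. Ck_on 2 U H' \<Longrightarrow> C2_close e K H H' \<Longrightarrow> z \<in> K \<Longrightarrow> (H' z, jetP H' z, jetQ H' z, jetR H' z) \<in> W"
proof -
  define J where "J H z = (H z, jetP H z, jetQ H z, jetR H z)" for H :: "complex^'n \<Rightarrow> complex^'r^'r" and z
  have "continuous_on U (J H)" unfolding J_def by (intro continuous_intros continuous_on_jets[OF H])
  then have "compact (J H ` K)" by (intro compact_continuous_image[OF _ K] continuous_on_subset[OF _ U(2)])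
  moreover have "J H ` K \<subseteq> W" using W(2) by (auto simp: J_def)
  ultimately obtain \<delta> where \<delta>: "\<delta> > 0" "(\<Union>x\<in>J H ` K. ball x \<delta>) \<subseteq> W"
    using compact_subset_open_imp_ball_epsilon_subset[OF _ W(1)] by blast
  define k n where "k = real (card (Basis :: (complex^'n) set))" and "n = real CARD('n)"
  \<comment> \<open>Counts the terms of the jet in units of \<open>e\<close>: 1 for the value,
    \<open>n * k\<close> for each first order array and \<open>n * n * k * k\<close> for the second
    order one, with \<open>k\<close> the number of real basis vectors.\<close>
  define C where "C = 1 + n * k + n * k + n * n * k * k"
  have C: "C \<ge> 1" unfolding C_def n_def k_def by simp
  show thesis
  proof (rule that)
    define e where "e = \<delta> / (C + 1)"
    show e: "\<delta> / (C + 1) > 0" using C \<delta> by simp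
    fix H' z assume H': "Ck_on 2 U H'" and cl: "C2_close (\<delta> / (C + 1)) K H H'" and z: "z \<in> K"
    have zU: "z \<in> U" using z U by blast
    define d where "d = (\<lambda>w. H' w - H w)"
    have cl: "norm (d z) \<le> e" "\<And>b. b \<in> Basis \<Longrightarrow> norm (deriv_dir b d z) \<le> e"
      "\<And>b b'. b \<in> Basis \<Longrightarrow> b' \<in> Basis \<Longrightarrow> norm (deriv_dir b (deriv_dir b' d) z) \<le> e"
      using cl z unfolding C2_close_def Let_def d_def[symmetric] e_def by (auto intro: less_imp_le)
    have d: "d = (\<lambda>w. H' w + (- 1) *\<^sub>R H w)" by (simp add: d_def)
    have e0: "e \<ge> 0" using e by (simp add: e_def)
    note jets = jets_add_scaleR[OF U(1) zU H' H, of "- 1", folded d]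
    have "J H' z - J H z = (d z, jetP d z, jetQ d z, jetR d z)"
      unfolding jets by (simp add: J_def d_def)
    then have "norm (J H' z - J H z) \<le> norm (d z) + (norm (jetP d z) + (norm (jetQ d z) + norm (jetR d z)))"
      by (simp only:) (rule order_trans[OF norm_Pair_le add_left_mono[OF order_trans[OF norm_Pair_le add_left_mono[OF norm_Pair_le]]]])
    also have "\<dots> \<le> e + (n * (k * e) + (n * (k * e) + n * (n * (k * (k * e)))))"
      unfolding k_def n_def by (intro add_mono norm_jets_le[OF e0] cl)
    also have "\<dots> = C * e" by (simp add: C_def algebra_simps)
    also have "\<dots> < \<delta>" using C \<delta> by (simp add: e_def field_simps)
    finally have "J H' z \<in> ball (J H z) \<delta>" by (simp add: dist_norm norm_minus_commute)
    then have "J H' z \<in> (\<Union>x\<in>J H ` K. ball x \<delta>)" using z by blast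
    then show "(H' z, jetP H' z, jetQ H' z, jetR H' z) \<in> W" using \<delta>(2) unfolding J_def[of H'] by blast
  qed
qed

context hbundle
begin

text \<open>The global function on the base; chart and trivialization are chosen at each point,
  harmlessly by \<open>posp_distp_change\<close>.\<close>

definition dist_fun :: "pos_type \<Rightarrow> real \<Rightarrow> (complex^'r) measure \<Rightarrow> real \<Rightarrow> 'e form \<Rightarrow> 'x \<Rightarrow> real" where
  "dist_fun P s \<sigma> t h x = (let (c, \<tau>) = (SOME (c, \<tau>). c \<in> atlas B \<and> \<tau> \<in> trivs B \<and> x \<in> fst c \<inter> fst \<tau>)
     in distp P s \<sigma> t (gram B h c \<tau> (snd c x)) (chern (gram B h c \<tau>) (snd c x)))"

lemma dist_fun:
  assumes us: "unitary_invariant_sphere_measure \<sigma>" and rt: "1 + real CARD('r) * t > 0"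
    and h: "C2_metric B h" and pos: "positive_metric B P t h"
  shows "c \<in> atlas B \<Longrightarrow> \<tau> \<in> trivs B \<Longrightarrow> x \<in> fst c \<inter> fst \<tau> \<Longrightarrow>
      dist_fun P s \<sigma> t h x = distp P s \<sigma> t (gram B h c \<tau> (snd c x)) (chern (gram B h c \<tau>) (snd c x))"
    and "c \<in> atlas B \<Longrightarrow> \<tau> \<in> trivs B \<Longrightarrow> x \<in> fst c \<inter> fst \<tau> \<Longrightarrow>
      dist_fun P s \<sigma> t h x = distortion P s \<sigma> t (gram B h c \<tau>) (snd c x)"
    and "x \<in> topspace (base B) \<Longrightarrow> dist_fun P s \<sigma> t h x \<ge> 0"
    and "continuous_map (base B) euclideanreal (dist_fun P s \<sigma> t h)"
proof -
  have p: "posp P t (gram B h c \<tau> z) (chern (gram B h c \<tau>) z)" if "c \<in> atlas B" "\<tau> \<in> trivs B" "z \<in> cdom c \<tau>" for c \<tau> z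
    by (rule positive_metric_iff[THEN iffD1, OF pos, rule_format, OF that])
  have zd: "snd c x \<in> cdom c \<tau>" if "x \<in> fst c \<inter> fst \<tau>" for c :: "('x, 'n) chart" and \<tau> :: "('e, 'x, 'r) triv" and x
    using that by (auto simp: cdom_def)
  show 1: "dist_fun P s \<sigma> t h x = distp P s \<sigma> t (gram B h c \<tau> (snd c x)) (chern (gram B h c \<tau>) (snd c x))"
    if c: "c \<in> atlas B" "\<tau> \<in> trivs B" "x \<in> fst c \<inter> fst \<tau>" for c \<tau> x
  proof -
    define Q where "Q = (\<lambda>(c, \<tau>). c \<in> atlas B \<and> \<tau> \<in> trivs B \<and> x \<in> fst c \<inter> fst \<tau>)"
    obtain c' \<tau>' where ct: "(SOME q. Q q) = (c', \<tau>')" by (cases "SOME q. Q q")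
    have "Q (c, \<tau>)" using c by (simp add: Q_def)
    then have "Q (c', \<tau>')" unfolding ct[symmetric] by (rule someI)
    then have c': "c' \<in> atlas B" "\<tau>' \<in> trivs B" "x \<in> fst c'" "x \<in> fst \<tau>'" by (simp_all add: Q_def)
    have "dist_fun P s \<sigma> t h x = distp P s \<sigma> t (gram B h c' \<tau>' (snd c' x)) (chern (gram B h c' \<tau>') (snd c' x))"
      unfolding dist_fun_def Q_def[symmetric] ct by simp
    also have "\<dots> = distp P s \<sigma> t (gram B h c \<tau> (snd c x)) (chern (gram B h c \<tau>) (snd c x))"
      by (rule posp_distp_change(2)[OF h c(1) c'(1) c(2) c'(2) _ c'(3) _ c'(4) p[OF c(1,2) zd[OF c(3)]] us rt]) (use c(3) in auto)
    finally show ?thesis .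
  qed
  show "dist_fun P s \<sigma> t h x = distortion P s \<sigma> t (gram B h c \<tau>) (snd c x)"
    if c: "c \<in> atlas B" "\<tau> \<in> trivs B" "x \<in> fst c \<inter> fst \<tau>" for c \<tau> x
  proof -
    note z = zd[OF c(3)]
    show ?thesis unfolding 1[OF c]
      by (rule distortion_eq_distp[symmetric, OF posp_pos_def_trace_form[OF metric(2)[OF h c(1,2) z] metric_hermH[OF h c(1,2) z] rt p[OF c(1,2) z]]])
  qed
  show "dist_fun P s \<sigma> t h x \<ge> 0" if x: "x \<in> topspace (base B)" for x
  proof -
    obtain c \<tau> where c: "c \<in> atlas B" "\<tau> \<in> trivs B" "x \<in> fst c \<inter> fst \<tau>" using covers[OF x] .
    note z = zd[OF c(3)]
    show ?thesis unfolding 1[OF c] by (rule distp_nonneg[OF us metric(2)[OF h c(1,2) z] metric_hermH[OF h c(1,2) z] rt p[OF c(1,2) z]])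
  qed
  show "continuous_map (base B) euclideanreal (dist_fun P s \<sigma> t h)"
  proof (rule continuous_map_charts)
    fix c \<tau> assume c: "c \<in> atlas B" "\<tau> \<in> trivs B"
    have "continuous_on (cdom c \<tau>) (\<lambda>z. distp P s \<sigma> t (gram B h c \<tau> z) (chern (gram B h c \<tau>) z))"
      unfolding continuous_on_def
    proof
      fix z assume z: "z \<in> cdom c \<tau>"
      have lim: "(gram B h c \<tau> \<longlongrightarrow> gram B h c \<tau> z) (at z within cdom c \<tau>)" "(chern (gram B h c \<tau>) \<longlongrightarrow> chern (gram B h c \<tau>) z) (at z within cdom c \<tau>)"
        using continuous_on_jets(1)[OF metric(1)[OF h c]] continuous_on_chern[OF h c] z by (simp_all add: continuous_on_def)
      have "eventually (\<lambda>z. pos_def (gram B h c \<tau> z) \<and> hermH (gram B h c \<tau> z) (chern (gram B h c \<tau>) z)) (at z within cdom c \<tau>)"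
        unfolding eventually_at_filter by (rule always_eventually) (auto intro: metric(2)[OF h c] metric_hermH[OF h c])
      from posp_distp_tendsto(2)[OF us rt lim this metric(2)[OF h c z] metric_hermH[OF h c z] p[OF c z]]
      show "((\<lambda>z. distp P s \<sigma> t (gram B h c \<tau> z) (chern (gram B h c \<tau>) z)) \<longlongrightarrow> distp P s \<sigma> t (gram B h c \<tau> z) (chern (gram B h c \<tau>) z)) (at z within cdom c \<tau>)" .
    qed
    then show "\<exists>g. continuous_on (cdom c \<tau>) g \<and> (\<forall>x\<in>fst c \<inter> fst \<tau>. dist_fun P s \<sigma> t h x = g (snd c x))"
      by (intro exI[of _ "\<lambda>z. distp P s \<sigma> t (gram B h c \<tau> z) (chern (gram B h c \<tau>) z)"] conjI ballI 1[OF c])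
  qed
qed

text \<open>A continuous function on a compact space is bounded above, which is what gives the real
  supremum its meaning.\<close>

lemma dist_fun_le_SUP:
  assumes cpt: "compact_space (base B)" and us: "unitary_invariant_sphere_measure \<sigma>" and rt: "1 + real CARD('r) * t > 0"
    and h: "C2_metric B h" and pos: "positive_metric B P t h" and x: "x \<in> topspace (base B)"
  shows "dist_fun P s \<sigma> t h x \<le> (SUP x\<in>topspace (base B). dist_fun P s \<sigma> t h x)"
proof (rule cSUP_upper[OF x])
  have "compactin euclideanreal (dist_fun P s \<sigma> t h ` topspace (base B))"
    using cpt image_compactin dist_fun(4)[OF us rt h pos] unfolding compact_space_def by blast
  then show "bdd_above (dist_fun P s \<sigma> t h ` topspace (base B))"
    by (simp add: compact_imp_bounded bounded_imp_bdd_above)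
qed

text \<open>Positivity and the strict bound are open in the pair of metric and curvature, and that
  pair depends continuously on the 2-jet through \<open>curvA\<close>. Hence the 2-jets of
  \<open>h\<close> over each compact piece lie in an open set, and finitely many pieces yield a
  common \<open>\<epsilon>\<close>.\<close>

lemma C2_neighbourhood:
  assumes cpt: "compact_space (base B)" and us: "unitary_invariant_sphere_measure \<sigma>" and rt: "1 + real CARD('r) * t > 0"
    and h: "C2_metric B h"
    and hp: "\<And>c \<tau> z. c \<in> atlas B \<Longrightarrow> \<tau> \<in> trivs B \<Longrightarrow> z \<in> cdom c \<tau> \<Longrightarrow>
      posp P t (gram B h c \<tau> z) (chern (gram B h c \<tau>) z) \<and> distp P s \<sigma> t (gram B h c \<tau> z) (chern (gram B h c \<tau>) z) < b"
  shows "holds_C2_near B h (\<lambda>h. C2_metric B h \<and> (\<forall>c\<in>atlas B. \<forall>\<tau>\<in>trivs B. \<forall>z\<in>cdom c \<tau>.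
      posp P t (gram B h c \<tau> z) (chern (gram B h c \<tau>) z) \<and> distp P s \<sigma> t (gram B h c \<tau> z) (chern (gram B h c \<tau>) z) < b))"
proof -
  define good where "good p \<longleftrightarrow> posp P t (fst p) (snd p) \<and> distp P s \<sigma> t (fst p) (snd p) < b" for p :: "(complex^'r^'r) \<times> ('n, 'r) curv"
  \<comment> \<open>The union of all such open sets is used, so that no neighbourhood has to be
    selected point by point.\<close>
  define Ws where "Ws = {W. open W \<and> (\<forall>p\<in>W. pos_def (fst p) \<longrightarrow> hermH (fst p) (snd p) \<longrightarrow> good p)}"
  define V where "V = {p :: (complex^'r^'r) \<times> (complex^'r^'r^'n) \<times> (complex^'r^'r^'n) \<times> ('n, 'r) curv. invertible (fst p)} \<inter>
    (\<lambda>p. (fst p, curvA (fst p) (fst (snd p)) (fst (snd (snd p))) (snd (snd (snd p))))) -` \<Union>Ws"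
  have "open V" unfolding V_def
  proof (rule continuous_open_preimage)
    show "open {p :: (complex^'r^'r) \<times> (complex^'r^'r^'n) \<times> (complex^'r^'r^'n) \<times> ('n, 'r) curv. invertible (fst p)}"
      using open_vimage[OF open_invertible continuous_on_fst[OF continuous_on_id]] by (simp add: vimage_def)
    show "open (\<Union>Ws)" by (auto simp: Ws_def)
  qed (intro continuous_intros continuous_on_curvA, auto)
  obtain \<K> where \<K>: "finite \<K>" "\<forall>(c, \<tau>, K)\<in>\<K>. c \<in> atlas B \<and> \<tau> \<in> trivs B \<and> compact K \<and> K \<subseteq> cdom c \<tau>"
    "\<And>x. x \<in> topspace (base B) \<Longrightarrow> \<exists>(c, \<tau>, K)\<in>\<K>. x \<in> fst c \<inter> fst \<tau> \<and> snd c x \<in> K"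
    by (rule compact_chart_cover[OF cpt]) (rule that; (assumption | blast))
  define R where "R q e \<longleftrightarrow> (case q of (c, \<tau>, K) \<Rightarrow> \<forall>h'. C2_metric B h' \<longrightarrow> C2_close e K (gram B h c \<tau>) (gram B h' c \<tau>) \<longrightarrow>
      (\<forall>z\<in>K. good (gram B h' c \<tau> z, chern (gram B h' c \<tau>) z)))" for q e
  have ex: "\<exists>e>0. R q e" if "q \<in> \<K>" for q
  proof -
    obtain c \<tau> K where q: "q = (c, \<tau>, K)" by (cases q) auto
    have c: "c \<in> atlas B" "\<tau> \<in> trivs B" and K: "compact K" "K \<subseteq> cdom c \<tau>" using \<K>(2) that unfolding q by auto
    have inV: "(gram B h c \<tau> z, jetP (gram B h c \<tau>) z, jetQ (gram B h c \<tau>) z, jetR (gram B h c \<tau>) z) \<in> V" if "z \<in> K" for z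
    proof -
      have z: "z \<in> cdom c \<tau>" using that K by blast
      obtain W where W: "open W" "(gram B h c \<tau> z, chern (gram B h c \<tau>) z) \<in> W"
        "\<And>H c. (H, c) \<in> W \<Longrightarrow> pos_def H \<Longrightarrow> hermH H c \<Longrightarrow> posp P t H c \<and> distp P s \<sigma> t H c < b"
        by (rule posp_distp_open[OF us rt metric(2)[OF h c z] metric_hermH[OF h c z] conjunct1[OF hp[OF c z]] conjunct2[OF hp[OF c z]]])
          (rule that; (assumption | blast))
      have "W \<in> Ws" using W(1,3) by (auto simp: Ws_def good_def)
      then show ?thesis using W(2) metric(3)[OF h c z] by (auto simp: V_def metric_chern[OF h c z])
    qed
    obtain e where e: "e > 0" "\<And>H' z. Ck_on 2 (cdom c \<tau>) H' \<Longrightarrow> C2_close e K (gram B h c \<tau>) H' \<Longrightarrow> z \<in> K \<Longrightarrow> (H' z, jetP H' z, jetQ H' z, jetR H' z) \<in> V"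
      using C2_close_jets[OF open_cdom[OF c] K(2,1) metric(1)[OF h c] \<open>open V\<close> inV] by blast
    have "R q e" unfolding R_def q
    proof (simp only: prod.case, intro allI impI ballI)
      fix h' z assume h': "C2_metric B h'" "C2_close e K (gram B h c \<tau>) (gram B h' c \<tau>)" and zK: "z \<in> K"
      have z: "z \<in> cdom c \<tau>" using zK K by blast
      have "(gram B h' c \<tau> z, chern (gram B h' c \<tau>) z) \<in> \<Union>Ws"
        using e(2)[OF metric(1)[OF h'(1) c] h'(2) zK] by (simp add: V_def metric_chern[OF h'(1) c z])
      then show "good (gram B h' c \<tau> z, chern (gram B h' c \<tau>) z)"
        using metric(2)[OF h'(1) c z] metric_hermH[OF h'(1) c z] by (auto simp: Ws_def)
    qed
    then show ?thesis using e(1) by blast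
  qed
  have mono: "R q e'" if "R q e" "0 < e'" "e' \<le> e" for q e e'
  proof -
    obtain c \<tau> K where q: "q = (c, \<tau>, K)" by (cases q) auto
    show ?thesis using that unfolding R_def q prod.case by (blast intro: C2_close_mono)
  qed
  obtain \<epsilon> where \<epsilon>: "\<epsilon> > 0" "\<And>q. q \<in> \<K> \<Longrightarrow> R q \<epsilon>"
    by (rule finite_uniform_eps[of \<K> R, OF \<K>(1)]) (erule ex, erule (2) mono, (rule that; (assumption | blast)))
  show ?thesis unfolding holds_C2_near_def
  proof (intro exI conjI allI impI)
    show "finite \<K>" "\<epsilon> > 0" by fact+
    show "\<forall>(c, \<tau>, K)\<in>\<K>. c \<in> atlas B \<and> \<tau> \<in> trivs B \<and> compact K \<and> K \<subseteq> cdom c \<tau>" by fact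
    fix h' assume h': "C2_metric B h' \<and> (\<forall>(c, \<tau>, K)\<in>\<K>. C2_close \<epsilon> K (gram B h c \<tau>) (gram B h' c \<tau>))"
    then show C2: "C2_metric B h'" by blast
    show "\<forall>c\<in>atlas B. \<forall>\<tau>\<in>trivs B. \<forall>z\<in>cdom c \<tau>.
      posp P t (gram B h' c \<tau> z) (chern (gram B h' c \<tau>) z) \<and> distp P s \<sigma> t (gram B h' c \<tau> z) (chern (gram B h' c \<tau>) z) < b"
    proof (intro ballI)
      fix c \<tau> z assume c: "c \<in> atlas B" "\<tau> \<in> trivs B" "z \<in> cdom c \<tau>"
      obtain x where x: "x \<in> fst c" "x \<in> fst \<tau>" "z = snd c x" using c by (auto simp: cdom_def)
      \<comment> \<open>The point lies over one of the finitely many compact pieces; the property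
        holds there and is carried back to the given chart.\<close>
      obtain c' \<tau>' K where q: "(c', \<tau>', K) \<in> \<K>" "x \<in> fst c' \<inter> fst \<tau>'" "snd c' x \<in> K" using \<K>(3)[OF in_topspace[OF c(1) x(1)]] by auto
      have c': "c' \<in> atlas B" "\<tau>' \<in> trivs B" using \<K>(2) q(1) by auto
      have cl: "C2_close \<epsilon> K (gram B h c' \<tau>') (gram B h' c' \<tau>')" using h' q(1) by auto
      have g: "good (gram B h' c' \<tau>' (snd c' x), chern (gram B h' c' \<tau>') (snd c' x))"
        using \<epsilon>(2)[OF q(1)] C2 cl q(3) by (simp add: R_def)
      then have p: "posp P t (gram B h' c' \<tau>' (snd c' x)) (chern (gram B h' c' \<tau>') (snd c' x))" by (simp add: good_def)
      have x': "x \<in> fst c'" "x \<in> fst \<tau>'" using q(2) by auto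
      note * = posp_distp_change[OF C2 c'(1) c(1) c'(2) c(2) x'(1) x(1) x'(2) x(2) p]
      show "posp P t (gram B h' c \<tau> z) (chern (gram B h' c \<tau>) z) \<and> distp P s \<sigma> t (gram B h' c \<tau> z) (chern (gram B h' c \<tau>) z) < b"
        using *(1) *(2)[OF us rt] g unfolding x(3) by (simp add: good_def)
    qed
  qed
qed

end

section \<open>The linearized system\<close>

lemma linear_pc: "linear (pc j)" and linear_qc: "linear (qc j)"
  by (rule linearI; simp add: pc_def qc_def add_divide_distrib scaleR_conv_of_real[where 'a=complex])+

lemma linear_frame_var: "linear (\<lambda>N. frame_var S N C)"
proof (rule linearI)
  have eq: "frame_var S N C $ j $ k = (1 / 2) *\<^sub>R (C $ j $ k ** (S ** N ** ctranspose S) - (S ** N ** ctranspose S) ** C $ j $ k)" for N j k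
    by (simp add: frame_var_def scaleR_diff_right bounded_bilinear.scaleR_left[OF bounded_bilinear_matrix_mul]
      bounded_bilinear.scaleR_right[OF bounded_bilinear_matrix_mul] bounded_bilinear.minus_left[OF bounded_bilinear_matrix_mul]
      bounded_bilinear.minus_right[OF bounded_bilinear_matrix_mul])
  have vec: "X = Y" if "\<And>j k. X $ j $ k = Y $ j $ k" for X Y :: "('n::finite, 'r::finite) curv"
    using that by (simp add: vec_eq_iff)
  show "frame_var S (M + N) C = frame_var S M C + frame_var S N C" for M N
    by (rule vec) (simp only: eq vector_add_component bounded_bilinear.add_left[OF bounded_bilinear_matrix_mul]
      bounded_bilinear.add_right[OF bounded_bilinear_matrix_mul] scaleR_add_right[symmetric] add_diff_add)
  show "frame_var S (x *\<^sub>R N) C = x *\<^sub>R frame_var S N C" for x N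
    by (rule vec) (simp only: eq vector_scaleR_component bounded_bilinear.scaleR_left[OF bounded_bilinear_matrix_mul]
      bounded_bilinear.scaleR_right[OF bounded_bilinear_matrix_mul] scaleR_diff_right[symmetric] scaleR_left_commute)
qed

text \<open>Differential of the second order part of the system for a variation \<open>N\<close> of
  the Gram matrix and \<open>c'\<close> of the curvature, taken as independent. \<open>A\<close>
  stands for the value of the scalar left-hand side, which factors out by logarithmic
  differentiation.\<close>

definition lin_sys :: "pos_type \<Rightarrow> real \<Rightarrow> (complex^'r) measure \<Rightarrow> real \<Rightarrow> real \<Rightarrow> real \<Rightarrow> complex^'r^'r \<Rightarrow>
    ('n::finite, 'r::finite) curv \<Rightarrow> complex^'r^'r \<Rightarrow> ('n, 'r) curv \<Rightarrow> real \<times> (complex^'r^'r)" where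
  "lin_sys P s \<sigma> t b A H c N c' = (let w = trace_form c; C = in_frame (on_basis H) (tw t c) in
     (A * (dlog P s \<sigma> C (in_frame (on_basis H) (tw t c') + frame_var (on_basis H) N C) +
        b * (Re (Ddet w (trace_form c')) / Re (det w))),
      (1 / real CARD('n)) *\<^sub>R (ctr (matrix_inv w) (tf c') -
        ctr (matrix_inv w ** trace_form c' ** matrix_inv w) (tf c))))"

lemma linear_lin_sys:
  fixes c :: "('n::finite, 'r::finite) curv"
  assumes g: "good P (in_frame (on_basis H) (tw t c))" and s: "s > 0" and us: "unitary_invariant_sphere_measure \<sigma>"
  shows "linear (\<lambda>(N, c'). lin_sys P s \<sigma> t b A H c N c')"
proof -
  define w C S where "w = trace_form c" and "C = in_frame (on_basis H) (tw t c)" and "S = on_basis H"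
  have dl: "linear (dlog P s \<sigma> C)" unfolding C_def by (rule dlog_linear[OF us g s])
  note lins = linear_add[OF dl] linear_scale[OF dl] linear_add[OF linear_frame_var] linear_scale[OF linear_frame_var]
    linear_add[OF linear_in_frame] linear_scale[OF linear_in_frame] linear_add[OF linear_tw] linear_scale[OF linear_tw]
    linear_add[OF linear_tf] linear_scale[OF linear_tf] linear_add[OF linear_trace_form] linear_scale[OF linear_trace_form]
    Ddet_add Ddet_scaleR bounded_bilinear.add_left[OF bounded_bilinear_matrix_mul] bounded_bilinear.scaleR_left[OF bounded_bilinear_matrix_mul]
    bounded_bilinear.add_right[OF bounded_bilinear_matrix_mul] bounded_bilinear.scaleR_right[OF bounded_bilinear_matrix_mul]
    bounded_bilinear.add_right[OF bounded_bilinear_ctr] bounded_bilinear.scaleR_right[OF bounded_bilinear_ctr]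
    bounded_bilinear.add_left[OF bounded_bilinear_ctr] bounded_bilinear.scaleR_left[OF bounded_bilinear_ctr]
  have eq: "lin_sys P s \<sigma> t b A H c N c' = (A * (dlog P s \<sigma> C (in_frame S (tw t c')) + dlog P s \<sigma> C (frame_var S N C) + b * (Re (Ddet w (trace_form c')) / Re (det w))),
      (1 / real CARD('n)) *\<^sub>R (ctr (matrix_inv w) (tf c') - ctr (matrix_inv w ** trace_form c' ** matrix_inv w) (tf c)))" for N c'
    unfolding lin_sys_def Let_def C_def[symmetric] unfolding w_def[symmetric] S_def[symmetric] linear_add[OF dl] by (rule refl)
  show ?thesis
  proof (rule linearI)
    fix p q :: "(complex^'r^'r) \<times> ('n, 'r) curv" and r :: real
    show "(\<lambda>(N, c'). lin_sys P s \<sigma> t b A H c N c') (p + q) = (\<lambda>(N, c'). lin_sys P s \<sigma> t b A H c N c') p + (\<lambda>(N, c'). lin_sys P s \<sigma> t b A H c N c') q"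
      by (simp add: case_prod_beta eq lins add_divide_distrib algebra_simps)
    show "(\<lambda>(N, c'). lin_sys P s \<sigma> t b A H c N c') (r *\<^sub>R p) = r *\<^sub>R (\<lambda>(N, c'). lin_sys P s \<sigma> t b A H c N c') p"
      by (simp add: case_prod_beta eq lins algebra_simps)
  qed
qed

text \<open>Logarithmic differentiation of the scalar left-hand side: its derivative is its value
  \<open>A\<close> times the sum of \<open>dlog\<close> and \<open>b\<close> times the relative
  variation of \<open>det \<omega>\<close>. The constant n! and the density \<open>V\<close> cancel
  in the relative variation.\<close>

lemma lin_sys_line:
  fixes c :: "real \<Rightarrow> ('n::finite, 'r::finite) curv" and b :: real
  assumes us: "unitary_invariant_sphere_measure \<sigma>" and s: "s > 0"
    and H: "pos_def H" and N: "hermitian N" and c: "(c has_vector_derivative c') (at 0)"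
    and g: "good P (in_frame (on_basis H) (tw t (c 0)))" and w: "pos_def (trace_form (c 0))" and V: "V > 0"
  defines "A \<equiv> Phi P s \<sigma> (in_frame (on_basis H) (tw t (c 0))) / V * (Re (top_power (trace_form (c 0))) / V) powr b"
  shows "((\<lambda>\<epsilon>. (Phi P s \<sigma> (in_frame (on_basis (H + \<epsilon> *\<^sub>R N)) (tw t (c \<epsilon>))) / V * (Re (top_power (trace_form (c \<epsilon>))) / V) powr b,
      \<chi> l m. pow_wedge (trace_form (c \<epsilon>)) (\<chi> j k. tf (c \<epsilon>) $ j $ k $ l $ m) / top_power (trace_form (c \<epsilon>))))
    has_vector_derivative lin_sys P s \<sigma> t b A H (c 0) N c') (at 0)"
proof -
  define C where "C = in_frame (on_basis H) (tw t (c 0))"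
  define w where "w = trace_form (c 0)"
  define u where "u \<epsilon> = Re (top_power (trace_form (c \<epsilon>)))" for \<epsilon>
  define u' where "u' = fact CARD('n) * Re (Ddet w (trace_form c'))"
  have dw: "Re (det w) > 0" "invertible w" using pos_def_det[OF w] by (simp_all add: w_def)
  have u0: "u 0 = fact CARD('n) * Re (det w)" "u 0 > 0" using dw by (simp_all add: u_def top_power_det w_def)
  have "((\<lambda>\<epsilon>. det (trace_form (c \<epsilon>))) has_vector_derivative Ddet w (trace_form c')) (at 0)"
    using has_derivative_compose[OF has_vector_derivative_linear[OF linear_trace_form c, unfolded has_vector_derivative_def] has_derivative_det]
    unfolding has_vector_derivative_def w_def Ddet_scaleR .
  then have "((\<lambda>\<epsilon>. fact CARD('n) * Re (det (trace_form (c \<epsilon>)))) has_vector_derivative u') (at 0)"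
    unfolding u'_def by (intro has_vector_derivative_mult_right has_vector_derivative_linear[where L=Re] bounded_linear.linear[OF bounded_linear_Re])
  then have du: "(u has_real_derivative u') (at 0)"
    by (simp add: u_def[abs_def] top_power_det has_real_derivative_iff_has_vector_derivative)
  have dPhi: "((\<lambda>\<epsilon>. Phi P s \<sigma> (in_frame (on_basis (H + \<epsilon> *\<^sub>R N)) (tw t (c \<epsilon>)))) has_real_derivative
    Phi P s \<sigma> C * dlog P s \<sigma> C (in_frame (on_basis H) (tw t c') + frame_var (on_basis H) N C)) (at 0)"
    unfolding has_real_derivative_iff_has_vector_derivative by (rule Phi_line[OF us s H N c C_def g[folded C_def]])
  have uV: "u 0 / V > 0" using u0 V by simp
  have dp: "((\<lambda>\<epsilon>. (u \<epsilon> / V) powr b) has_real_derivative b * (u 0 / V) powr (b - 1) * (u' / V)) (at 0)"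
    by (rule DERIV_cong[OF DERIV_fun_powr[OF DERIV_cdivide[OF du] uV]]) simp
  have pw: "b * (u 0 / V) powr (b - 1) * (u' / V) = (u 0 / V) powr b * (b * (Re (Ddet w (trace_form c')) / Re (det w)))"
  proof -
    have 1: "(u 0 / V) powr (b - 1) = (u 0 / V) powr b / (u 0 / V)"
      by (simp only: powr_diff powr_one[OF less_imp_le[OF uV]])
    have 2: "Re (Ddet w (trace_form c')) / Re (det w) = u' / u 0" by (simp add: u'_def u0)
    show ?thesis unfolding 1 2 using V u0(2) by simp
  qed
  have "((\<lambda>\<epsilon>. Phi P s \<sigma> (in_frame (on_basis (H + \<epsilon> *\<^sub>R N)) (tw t (c \<epsilon>))) / V * (u \<epsilon> / V) powr b) has_real_derivative
    A * (dlog P s \<sigma> C (in_frame (on_basis H) (tw t c') + frame_var (on_basis H) N C) + b * (Re (Ddet w (trace_form c')) / Re (det w)))) (at 0)"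
    by (rule DERIV_cong[OF DERIV_mult[OF DERIV_cdivide[OF dPhi] dp]],
      unfold pw A_def u_def[symmetric]) (simp add: C_def add_divide_distrib distrib_left mult_ac)
  from has_vector_derivative_Pair[OF this[unfolded has_real_derivative_iff_has_vector_derivative] endo_line[OF c w_def dw(2)]]
  show ?thesis by (simp add: u_def lin_sys_def Let_def C_def w_def)
qed

text \<open>Weighting by the components of \<open>\<zeta>\<close> and summing over the basis
  evaluates the linear functions \<open>pc j\<close> and \<open>qc k\<close> at
  \<open>\<zeta>\<close> itself.\<close>

lemma dcurvA_symb:
  fixes P Q :: "complex^'r::finite^'r^'n::finite"
  shows "dcurvA H P Q R 0 0 0 (\<Sum>b\<in>Basis. \<Sum>b'\<in>Basis. ((\<zeta> \<bullet> b) * (\<zeta> \<bullet> b')) *\<^sub>R (\<chi> j k. cs (qc k b * pc j b') M)) = symb \<zeta> H M"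
proof -
  have rep: "(\<Sum>b\<in>Basis. of_real (\<zeta> \<bullet> b) * pc j b) = pc j \<zeta>" "(\<Sum>b\<in>Basis. of_real (\<zeta> \<bullet> b) * qc j b) = qc j \<zeta>" for j
    using linear_sum[OF linear_pc[of j], of "\<lambda>b. (\<zeta> \<bullet> b) *\<^sub>R b" Basis] linear_sum[OF linear_qc[of j], of "\<lambda>b. (\<zeta> \<bullet> b) *\<^sub>R b" Basis]
    by (simp_all add: euclidean_representation linear_scale[OF linear_pc] linear_scale[OF linear_qc] scaleR_conv_of_real[where 'a=complex])
  have R: "(\<Sum>b\<in>Basis. \<Sum>b'\<in>Basis. ((\<zeta> \<bullet> b) * (\<zeta> \<bullet> b')) *\<^sub>R (\<chi> j k. cs (qc k b * pc j b') M)) $ j $ k = cs (qc k \<zeta> * pc j \<zeta>) M" for j k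
  proof -
    have "(\<Sum>b\<in>Basis. \<Sum>b'\<in>Basis. ((\<zeta> \<bullet> b) * (\<zeta> \<bullet> b')) *\<^sub>R (\<chi> j k. cs (qc k b * pc j b') M)) $ j $ k =
      (\<Sum>b\<in>Basis. \<Sum>b'\<in>Basis. cs ((of_real (\<zeta> \<bullet> b) * qc k b) * (of_real (\<zeta> \<bullet> b') * pc j b')) M)"
      by (simp add: cs_of_real[symmetric] cs_cs mult_ac)
    also have "\<dots> = cs ((\<Sum>b\<in>Basis. of_real (\<zeta> \<bullet> b) * qc k b) * (\<Sum>b'\<in>Basis. of_real (\<zeta> \<bullet> b') * pc j b')) M"
      by (simp add: vec_eq_iff sum_product) (simp add: sum_distrib_right)
    finally show ?thesis by (simp only: rep)
  qed
  show ?thesis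
    unfolding dcurvA_second_order R symb_def rank1_def
    by (simp add: vec_eq_iff cs_mul_left pc_def qc_def scaleR_conv_of_real[where 'a=complex])
qed

context hbundle
begin

text \<open>The linearization is one linear map \<open>L\<close> on the jet of the variation;
  \<open>A0\<close>, \<open>A1\<close>, \<open>A2\<close> are its restrictions to jets of pure
  order. The right-hand sides involve the metric and first derivatives only, so they leave
  \<open>A2\<close> untouched.\<close>

lemma elliptic:
  assumes cpt: "compact_space (base B)" and us: "unitary_invariant_sphere_measure \<sigma>" and s: "s > 0"
    and rt: "1 + real CARD('r) * t > 0" and V: "volume_form B \<Omega>"
    and h: "C2_metric B h"
    and hp: "\<And>c \<tau> z. c \<in> atlas B \<Longrightarrow> \<tau> \<in> trivs B \<Longrightarrow> z \<in> cdom c \<tau> \<Longrightarrow>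
      posp P t (gram B h c \<tau> z) (chern (gram B h c \<tau>) z) \<and> distp P s \<sigma> t (gram B h c \<tau> z) (chern (gram B h c \<tau>) z) < b"
    and F: "first_order_rhs_scalar B F" and G: "first_order_rhs_endo B G"
  shows "system_elliptic B P s \<sigma> t \<Omega> b F G h"
  unfolding system_elliptic_def
proof (intro ballI)
  fix c \<tau> x assume c: "c \<in> atlas B" "\<tau> \<in> trivs B" and x: "x \<in> fst c \<inter> fst \<tau>"
  define z where "z = snd c x"
  define U where "U = cdom c \<tau>"
  have zU: "z \<in> U" using x by (auto simp: z_def U_def cdom_def)
  have oU: "open U" unfolding U_def by (rule open_cdom[OF c])
  define H where "H = gram B h c \<tau>"
  note m = metric[OF h c, folded U_def H_def]
  define c0 where "c0 = chern H z"
  define P0 Q0 R0 where "P0 = jetP H z" and "Q0 = jetQ H z" and "R0 = jetR H z"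
  have c0: "c0 = curvA (H z) P0 Q0 R0"
    unfolding c0_def P0_def Q0_def R0_def by (rule metric_chern[OF h c, folded U_def H_def, OF zU])
  have p: "posp P t (H z) c0" and db: "distp P s \<sigma> t (H z) c0 < b"
    using hp[OF c, folded U_def H_def, OF zU] by (simp_all add: c0_def)
  have hH: "hermH (H z) c0" unfolding c0_def by (rule metric_hermH[OF h c, folded U_def H_def, OF zU])
  note pd = m(2)[OF zU]
  have w: "pos_def (trace_form c0)" by (rule posp_pos_def_trace_form[OF pd hH rt p])
  define C where "C = in_frame (on_basis (H z)) (tw t c0)"
  have i1: "invertible (mat 1 :: complex^'n^'n)" by (rule invertible_leftI[of "mat 1"]) simp
  have g: "good P C" unfolding C_def
    by (rule positive_imp_good) (rule frame_coords(3,4)[OF pd on_basis[OF pd] hH p i1])+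
  have "snd c x \<in> snd c ` fst c" using x by blast
  then have Vp: "\<Omega> c z > 0" unfolding z_def by (rule V[unfolded volume_form_def, THEN conjunct1, rule_format, OF c(1), THEN conjunct2, rule_format])
  define A where "A = Phi P s \<sigma> C / \<Omega> c z * (Re (top_power (trace_form c0)) / \<Omega> c z) powr b"
  have A: "A > 0"
    using Phi_pos[OF us g, of s] Vp pos_def_det[OF w] by (simp add: A_def top_power_det)
  have jetH: "jet K z = (z, K z, jetP K z)" if "K differentiable (at z)" for K :: "complex^'n \<Rightarrow> complex^'r^'r"
    by (simp add: jet_def jetP_del_matrix[OF that])
  have Hd: "H differentiable (at z)" using m(1) zU by (auto simp: Ck2_on)
  have J0: "(z, K, D) \<in> jets c \<tau>" if "pos_def K" for K :: "complex^'r^'r" and D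
    using zU that by (simp add: jets_def U_def)
  obtain f where f: "smooth_on (jets c \<tau>) f" "\<And>h. C2_metric B h \<Longrightarrow> F h x = f (jet (gram B h c \<tau>) z)"
    using bspec[OF bspec[OF F[unfolded first_order_rhs_scalar_def] c(1)] c(2)] x unfolding z_def by blast
  obtain k where k: "smooth_on (jets c \<tau>) k" "\<And>h e. C2_metric B h \<Longrightarrow> e \<in> fibre B x \<Longrightarrow> snd \<tau> (G h e) = snd \<tau> e v* k (jet (gram B h c \<tau>) z)"
    using bspec[OF bspec[OF G[unfolded first_order_rhs_endo_def] c(1)] c(2)] x unfolding z_def by blast
  \<comment> \<open>\<open>jets\<close> is not open, so the derivative is taken of a smooth
    extension, which agrees with \<open>f\<close> on the jets of actual metrics.\<close>
  obtain f2 Wf where "open Wf" "jets c \<tau> \<subseteq> Wf" and f2: "\<And>y. y \<in> jets c \<tau> \<Longrightarrow> f2 y = f y" "f2 differentiable (at (z, H z, P0))"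
    by (rule smooth_on_imp_differentiable[OF f(1) J0[OF pd, of P0]]) (rule that; (assumption | blast))
  obtain k2 Wk where "open Wk" "jets c \<tau> \<subseteq> Wk" and k2: "\<And>y. y \<in> jets c \<tau> \<Longrightarrow> k2 y = k y" "k2 differentiable (at (z, H z, P0))"
    by (rule smooth_on_imp_differentiable[OF k(1) J0[OF pd, of P0]]) (rule that; (assumption | blast))
  define Df Dk where "Df = frechet_derivative f2 (at (z, H z, P0))" and "Dk = frechet_derivative k2 (at (z, H z, P0))"
  have Df: "(f2 has_derivative Df) (at (z, H z, P0))" "linear Df" and Dk: "(k2 has_derivative Dk) (at (z, H z, P0))" "linear Dk"
    using differentiable_has_derivative[OF f2(2)] differentiable_has_derivative[OF k2(2)] has_derivative_linear by (auto simp: Df_def Dk_def)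
  \<comment> \<open>The base point does not move along a variation, hence the 0 in the first slot of
    \<open>Df\<close> and \<open>Dk\<close>.\<close>
  define L where "L = (\<lambda>(N, PN, QN, RN). lin_sys P s \<sigma> t b A (H z) c0 N (dcurvA (H z) P0 Q0 R0 N PN QN RN) - (Df (0, N, PN), Dk (0, N, PN)))"
  have linL: "linear L"
  proof -
    have 1: "linear (\<lambda>p. (fst p, (\<lambda>(N, PN, QN, RN). dcurvA (H z) P0 Q0 R0 N PN QN RN) p))"
    proof (rule linearI)
      fix p q :: "(complex^'r^'r) \<times> (complex^'r^'r^'n) \<times> (complex^'r^'r^'n) \<times> ('n, 'r) curv" and r :: real
      show "(fst (p + q), (\<lambda>(N, PN, QN, RN). dcurvA (H z) P0 Q0 R0 N PN QN RN) (p + q)) =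
        (fst p, (\<lambda>(N, PN, QN, RN). dcurvA (H z) P0 Q0 R0 N PN QN RN) p) + (fst q, (\<lambda>(N, PN, QN, RN). dcurvA (H z) P0 Q0 R0 N PN QN RN) q)"
        unfolding linear_add[OF linear_dcurvA] by simp
      show "(fst (r *\<^sub>R p), (\<lambda>(N, PN, QN, RN). dcurvA (H z) P0 Q0 R0 N PN QN RN) (r *\<^sub>R p)) =
        r *\<^sub>R (fst p, (\<lambda>(N, PN, QN, RN). dcurvA (H z) P0 Q0 R0 N PN QN RN) p)"
        unfolding linear_scale[OF linear_dcurvA] by simp
    qed
    have 2: "linear (\<lambda>p :: (complex^'r^'r) \<times> (complex^'r^'r^'n) \<times> (complex^'r^'r^'n) \<times> ('n, 'r) curv. (Df (0, fst p, fst (snd p)), Dk (0, fst p, fst (snd p))))"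
    proof (rule linearI)
      have "Df (0, a + a', d + d') = Df (0, a, d) + Df (0, a', d')" "Dk (0, a + a', d + d') = Dk (0, a, d) + Dk (0, a', d')"
        "Df (0, r *\<^sub>R a, r *\<^sub>R d) = r * Df (0, a, d)" "Dk (0, r *\<^sub>R a, r *\<^sub>R d) = r *\<^sub>R Dk (0, a, d)" for a a' d d' r
        using linear_add[OF Df(2), of "(0, a, d)" "(0, a', d')"] linear_add[OF Dk(2), of "(0, a, d)" "(0, a', d')"]
          linear_scale[OF Df(2), of r "(0, a, d)"] linear_scale[OF Dk(2), of r "(0, a, d)"] by simp_all
      then show "(Df (0, fst (p + q), fst (snd (p + q))), Dk (0, fst (p + q), fst (snd (p + q)))) =
          (Df (0, fst p, fst (snd p)), Dk (0, fst p, fst (snd p))) + (Df (0, fst q, fst (snd q)), Dk (0, fst q, fst (snd q)))"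
        "(Df (0, fst (r *\<^sub>R p), fst (snd (r *\<^sub>R p))), Dk (0, fst (r *\<^sub>R p), fst (snd (r *\<^sub>R p)))) =
          r *\<^sub>R (Df (0, fst p, fst (snd p)), Dk (0, fst p, fst (snd p)))"
        for p q :: "(complex^'r^'r) \<times> (complex^'r^'r^'n) \<times> (complex^'r^'r^'n) \<times> ('n, 'r) curv" and r
        by simp_all
    qed
    have "linear (\<lambda>p. (\<lambda>(N, c'). lin_sys P s \<sigma> t b A (H z) c0 N c') (fst p, (\<lambda>(N, PN, QN, RN). dcurvA (H z) P0 Q0 R0 N PN QN RN) p))"
      using linear_compose[OF 1 linear_lin_sys[OF g[unfolded C_def] s us]] by (simp add: o_def)
    from linear_compose_sub[OF this 2] show ?thesis by (simp add: L_def case_prod_unfold)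
  qed
  have line: "((\<lambda>\<epsilon>. (scalar_operator B P s \<sigma> t \<Omega> b F c \<tau> x (\<lambda>e e'. h e e' + of_real \<epsilon> * \<eta> e e'),
      endo_operator B G c \<tau> x (\<lambda>e e'. h e e' + of_real \<epsilon> * \<eta> e e'))) has_vector_derivative
      L (N z, jetP N z, jetQ N z, jetR N z)) (at 0)"
    if \<eta>: "hermitian_form_section B smooth_on \<eta>" and N: "N = gram B \<eta> c \<tau>" for \<eta> N
  proof -
    \<comment> \<open>Only for these parameters is the perturbed form a metric, and only then do the
      explicit curve and the operators of the system coincide; a neighbourhood of 0 is enough for
      the derivative.\<close>
    obtain \<delta> where \<delta>: "\<delta> > 0" "\<And>\<epsilon>. \<bar>\<epsilon>\<bar> < \<delta> \<Longrightarrow> C2_metric B (\<lambda>e e'. h e e' + of_real \<epsilon> * \<eta> e e')"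
      by (rule metric_perturb[OF cpt h \<eta>]) (rule that; (assumption | blast))
    have N2: "Ck_on 2 U N" unfolding N U_def by (rule smooth_form_Ck[OF \<eta> c])
    have Nh: "hermitian (N z)" unfolding N by (rule gram_hermitian[OF \<eta> c zU[unfolded U_def]])
    define ce where "ce \<epsilon> = curvA (H z + \<epsilon> *\<^sub>R N z) (P0 + \<epsilon> *\<^sub>R jetP N z) (Q0 + \<epsilon> *\<^sub>R jetQ N z) (R0 + \<epsilon> *\<^sub>R jetR N z)" for \<epsilon>
    define c' where "c' = dcurvA (H z) P0 Q0 R0 (N z) (jetP N z) (jetQ N z) (jetR N z)"
    have dce: "(ce has_vector_derivative c') (at 0)"
      unfolding ce_def[abs_def] c'_def by (rule curvA_line[OF m(3)[OF zU]])
    have ce0: "ce 0 = c0" by (simp add: ce_def c0)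
    define Je where "Je \<epsilon> = (z, H z + \<epsilon> *\<^sub>R N z, P0 + \<epsilon> *\<^sub>R jetP N z)" for \<epsilon> :: real
    have "(Je has_vector_derivative (0, N z, jetP N z)) (at 0)"
      unfolding Je_def[abs_def] by (auto intro!: derivative_eq_intros has_vector_derivative_Pair)
    then have dJ: "(Je has_derivative (\<lambda>r. r *\<^sub>R (0, N z, jetP N z))) (at 0)" by (simp add: has_vector_derivative_def)
    have J00: "Je 0 = (z, H z, P0)" by (simp add: Je_def)
    have "((\<lambda>\<epsilon>. (f2 (Je \<epsilon>), k2 (Je \<epsilon>))) has_vector_derivative (Df (0, N z, jetP N z), Dk (0, N z, jetP N z))) (at 0)"
      using has_derivative_compose[OF dJ, of f2 Df] has_derivative_compose[OF dJ, of k2 Dk] Df Dk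
      by (intro has_vector_derivative_Pair) (simp_all only: J00 has_vector_derivative_def linear_scale)
    note sub = has_vector_derivative_diff[OF lin_sys_line[where b=b, OF us s pd Nh dce, unfolded ce0, OF g[unfolded C_def] w Vp] this]
    have "L (N z, jetP N z, jetQ N z, jetR N z) = lin_sys P s \<sigma> t b (Phi P s \<sigma> (in_frame (on_basis (H z)) (tw t c0)) / \<Omega> c z * (Re (top_power (trace_form c0)) / \<Omega> c z) powr b) (H z) c0 (N z) c'
       - (Df (0, N z, jetP N z), Dk (0, N z, jetP N z))"
      by (simp add: L_def c'_def A_def C_def)
    note sub = sub[folded this]
    show ?thesis
    proof (rule has_vector_derivative_transform_within_open[OF sub, of "{-\<delta><..<\<delta>}"])
      show "open {- \<delta><..<\<delta>}" "0 \<in> {- \<delta><..<\<delta>}" using \<delta>(1) by auto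
      fix \<epsilon> assume "\<epsilon> \<in> {- \<delta><..<\<delta>}"
      then have \<epsilon>: "\<bar>\<epsilon>\<bar> < \<delta>" by auto
      define he where "he = (\<lambda>e e'. h e e' + of_real \<epsilon> * \<eta> e e')"
      have C2: "C2_metric B he" unfolding he_def by (rule \<delta>(2)[OF \<epsilon>])
      have gr: "gram B he c \<tau> = (\<lambda>z. H z + \<epsilon> *\<^sub>R N z)" unfolding he_def gram_add H_def N ..
      note me = metric[OF C2 c, folded U_def]
      note js = jets_add_scaleR[OF oU zU m(1) N2, of \<epsilon>]
      have ch: "chern (gram B he c \<tau>) z = ce \<epsilon>"
        unfolding metric_chern[OF C2 c, folded U_def, OF zU] unfolding gr js by (simp add: ce_def P0_def Q0_def R0_def)
      have "gram B he c \<tau> differentiable (at z)" using me(1) zU by (auto simp: Ck2_on)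
      then have J: "jet (gram B he c \<tau>) z = Je \<epsilon>" by (simp only: jetH) (simp only: gr js Je_def P0_def)
      have Jj: "Je \<epsilon> \<in> jets c \<tau>" unfolding Je_def by (rule J0) (use me(2)[OF zU] in \<open>simp add: gr\<close>)
      have endo: "endo_matrix B \<tau> x (G he) = k2 (Je \<epsilon>)"
      proof -
        have "snd \<tau> (G he (frame B \<tau> x l)) $ i = k (Je \<epsilon>) $ l $ i" for l i
        proof -
          have "snd \<tau> (G he (frame B \<tau> x l)) = axis l 1 v* k (Je \<epsilon>)"
            using k(2)[OF C2 frame(1)[OF c(2)], of l] frame(2)[OF c(2), of x l] x by (simp add: J)
          then show ?thesis by (simp add: vector_matrix_mult_def axis_def if_distrib if_distribR cong: if_cong)
        qed
        then show ?thesis by (simp add: endo_matrix_def vec_eq_iff k2(1)[OF Jj])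
      qed
      have "scalar_operator B P s \<sigma> t \<Omega> b F c \<tau> x he = Phi P s \<sigma> (in_frame (on_basis (H z + \<epsilon> *\<^sub>R N z)) (tw t (ce \<epsilon>))) / \<Omega> c z *
          (Re (top_power (trace_form (ce \<epsilon>))) / \<Omega> c z) powr b - f2 (Je \<epsilon>)"
        unfolding scalar_operator_def Let_def z_def[symmetric] twisted_curv_tw det_curv_def ch f(2)[OF C2] J f2(1)[OF Jj] by (simp add: gr)
      moreover have "endo_operator B G c \<tau> x he = (\<chi> l m. pow_wedge (trace_form (ce \<epsilon>)) (\<chi> j k. tf (ce \<epsilon>) $ j $ k $ l $ m) / top_power (trace_form (ce \<epsilon>))) - k2 (Je \<epsilon>)"
        unfolding endo_operator_def Let_def z_def[symmetric] tracefree_curv_tf det_curv_def ch endo ..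
      ultimately show "(Phi P s \<sigma> (in_frame (on_basis (H z + \<epsilon> *\<^sub>R N z)) (tw t (ce \<epsilon>))) / \<Omega> c z * (Re (top_power (trace_form (ce \<epsilon>))) / \<Omega> c z) powr b,
          \<chi> l m. pow_wedge (trace_form (ce \<epsilon>)) (\<chi> j k. tf (ce \<epsilon>) $ j $ k $ l $ m) / top_power (trace_form (ce \<epsilon>))) - (f2 (Je \<epsilon>), k2 (Je \<epsilon>)) =
        (scalar_operator B P s \<sigma> t \<Omega> b F c \<tau> x (\<lambda>e e'. h e e' + of_real \<epsilon> * \<eta> e e'), endo_operator B G c \<tau> x (\<lambda>e e'. h e e' + of_real \<epsilon> * \<eta> e e'))"
        unfolding he_def[symmetric] by simp
    qed
  qed
  define A0 where "A0 M = L (M, 0, 0, 0)" for M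
  define A1 where "A1 b M = L (0, (\<chi> j. cs (pc j b) M), (\<chi> k. cs (qc k b) M), 0)" for b M
  define A2 where "A2 b b' M = L (0, 0, 0, (\<chi> j k. cs (qc k b * pc j b') M))" for b b' M
  show "elliptic_linearization_at B c \<tau> x (\<lambda>h'. (scalar_operator B P s \<sigma> t \<Omega> b F c \<tau> x h', endo_operator B G c \<tau> x h')) h"
    unfolding elliptic_linearization_at_def
  proof (rule exI[of _ A2], rule exI[of _ A1], rule exI[of _ A0], intro conjI ballI allI impI)
    have vl: "(\<chi> i. f i + g i) = (\<chi> i. f i) + (\<chi> i. g i)" "(\<chi> i. r *\<^sub>R f i) = r *\<^sub>R (\<chi> i. f i)" for f g :: "'k::finite \<Rightarrow> 'v::real_vector" and r
      by (simp_all add: vec_eq_iff)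
    show "linear A0" unfolding A0_def
      by (rule linearI) (simp_all add: linear_add[OF linL, symmetric] linear_scale[OF linL, symmetric])
    show "linear (A1 b)" for b unfolding A1_def
      by (rule linearI) (simp_all add: linear_add[OF linL, symmetric] linear_scale[OF linL, symmetric] cs_add cs_scaleR vl)
    show "linear (A2 b b')" for b b' unfolding A2_def
      by (rule linearI) (simp_all add: linear_add[OF linL, symmetric] linear_scale[OF linL, symmetric] cs_add cs_scaleR vl)
    fix \<eta> assume \<eta>: "hermitian_form_section B smooth_on \<eta>"
    define N where "N = gram B \<eta> c \<tau>"
    \<comment> \<open>Splits the jet by order of differentiation, which is the shape demanded by the
      definition of the linearization.\<close>
    have "(N z, jetP N z, jetQ N z, jetR N z) = (\<Sum>b\<in>Basis. \<Sum>b'\<in>Basis. (0, 0, 0, (\<chi> j k. cs (qc k b * pc j b') (deriv_dir b (deriv_dir b' N) z)))) +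
      (\<Sum>b\<in>Basis. (0, (\<chi> j. cs (pc j b) (deriv_dir b N z)), (\<chi> k. cs (qc k b) (deriv_dir b N z)), 0)) + (N z, 0, 0, 0)"
      by (simp add: prod_eq_iff fst_sum snd_sum jetP_def jetQ_def jetR_def vec_eq_iff)
    then have "L (N z, jetP N z, jetQ N z, jetR N z) = (\<Sum>b\<in>Basis. \<Sum>b'\<in>Basis. A2 b b' (deriv_dir b (deriv_dir b' N) z)) +
      (\<Sum>b\<in>Basis. A1 b (deriv_dir b N z)) + A0 (N z)"
      by (simp only: linear_add[OF linL] linear_sum[OF linL] A0_def A1_def A2_def)
    with line[OF \<eta> N_def] show "let N = gram B \<eta> c \<tau>; z = snd c x in
      ((\<lambda>\<epsilon>. (scalar_operator B P s \<sigma> t \<Omega> b F c \<tau> x (\<lambda>e e'. h e e' + of_real \<epsilon> * \<eta> e e'),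
        endo_operator B G c \<tau> x (\<lambda>e e'. h e e' + of_real \<epsilon> * \<eta> e e'))) has_vector_derivative
       ((\<Sum>b\<in>Basis. \<Sum>b'\<in>Basis. A2 b b' (deriv_dir b (deriv_dir b' N) z)) + (\<Sum>b\<in>Basis. A1 b (deriv_dir b N z)) + A0 (N z))) (at 0)"
      by (simp only: Let_def N_def[symmetric] z_def[symmetric])
  next
    fix \<zeta> :: "complex^'n" assume \<zeta>: "\<zeta> \<noteq> 0"
    \<comment> \<open>A jet of pure second order has vanishing value and first derivatives, so the
      frame variation and the derivatives of the right-hand sides drop out of the symbol.\<close>
    have "(\<Sum>b\<in>Basis. \<Sum>b'\<in>Basis. ((\<zeta> \<bullet> b) * (\<zeta> \<bullet> b')) *\<^sub>R A2 b b' M) = lin_sys P s \<sigma> t b A (H z) c0 0 (symb \<zeta> (H z) M)" for M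
    proof -
      have "(\<Sum>b\<in>Basis. \<Sum>b'\<in>Basis. ((\<zeta> \<bullet> b) * (\<zeta> \<bullet> b')) *\<^sub>R A2 b b' M) =
        L (\<Sum>b\<in>Basis. \<Sum>b'\<in>Basis. ((\<zeta> \<bullet> b) * (\<zeta> \<bullet> b')) *\<^sub>R (0, 0, 0, (\<chi> j k. cs (qc k b * pc j b') M)))"
        by (simp only: linear_sum[OF linL] linear_scale[OF linL] A2_def)
      also have "(\<Sum>b\<in>Basis. \<Sum>b'\<in>Basis. ((\<zeta> \<bullet> b) * (\<zeta> \<bullet> b')) *\<^sub>R (0, 0, 0, (\<chi> j k. cs (qc k b * pc j b') M))) =
        (0 :: complex^'r^'r, 0 :: complex^'r^'r^'n, 0 :: complex^'r^'r^'n, \<Sum>b\<in>Basis. \<Sum>b'\<in>Basis. ((\<zeta> \<bullet> b) * (\<zeta> \<bullet> b')) *\<^sub>R (\<chi> j k. cs (qc k b * pc j b') M))"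
        by (simp add: prod_eq_iff fst_sum snd_sum)
      finally show ?thesis
        by (simp add: L_def dcurvA_symb linear_0[OF Df(2)] linear_0[OF Dk(2)] zero_prod_def[symmetric])
    qed
    moreover have "bij_betw (\<lambda>M. lin_sys P s \<sigma> t b A (H z) c0 0 (symb \<zeta> (H z) M)) {M. hermitian M} (UNIV \<times> Herm0 (H z))"
      using symbol_bij_betw[OF us s pd hH rt p db \<zeta> A] by (simp add: lin_sys_def Let_def linear_0[OF linear_frame_var])
    ultimately show "bij_betw (\<lambda>M. \<Sum>b\<in>Basis. \<Sum>b'\<in>Basis. ((\<zeta> \<bullet> b) * (\<zeta> \<bullet> b')) *\<^sub>R A2 b b' M) {M. hermitian M} (UNIV \<times> Herm0 (gram B h c \<tau> (snd c x)))"
      by (simp only: H_def[symmetric] z_def[symmetric])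
  qed
qed

end

theorem theorem3p8:
  fixes B :: "('x, 'n::finite, 'e, 'r::finite) hvb"
    and P :: pos_type and s t :: real
    and \<sigma> :: "(complex^'r) measure"
    and \<Omega> :: "('x, 'n) chart \<Rightarrow> complex^'n \<Rightarrow> real"
  assumes "projective_manifold (base B) (atlas B)"
    and "holomorphic_vector_bundle B"
    and "ample_det B"
    and "\<exists>h. smooth_metric B h \<and> positive_metric B P t h"
    and "volume_form B \<Omega>"
    and "s > 0" and "s \<ge> real CARD('r) - 1"
    and "unitary_invariant_sphere_measure \<sigma>"
  shows "\<exists>\<beta> :: 'e form \<Rightarrow> 'x \<Rightarrow> real.
    (\<forall>h. smooth_metric B h \<and> positive_metric B P t h \<longrightarrow>
       continuous_map (base B) euclideanreal (\<beta> h) \<and>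
       (\<forall>x\<in>topspace (base B). \<beta> h x \<ge> 0) \<and>
       (\<forall>c\<in>atlas B. \<forall>\<tau>\<in>trivs B. \<forall>x \<in> fst c \<inter> fst \<tau>.
          \<beta> h x = distortion P s \<sigma> t (gram B h c \<tau>) (snd c x))) \<and>
    (\<forall>h\<^sub>t b. smooth_metric B h\<^sub>t \<and> positive_metric B P t h\<^sub>t \<and>
       b > (SUP x\<in>topspace (base B). \<beta> h\<^sub>t x) \<longrightarrow>
       holds_C2_near B h\<^sub>t (\<lambda>h. positive_metric B P t h \<and>
         (\<forall>F G. first_order_rhs_scalar B F \<and> first_order_rhs_endo B G \<longrightarrow>
            system_elliptic B P s \<sigma> t \<Omega> b F G h)))"
proof (cases "topspace (base B) = {}")
  \<comment> \<open>The base may be empty, and then there is no point at which a section could be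
    nonzero; all pointwise claims are vacuous and the empty family of compact sets describes the
    neighbourhood.\<close>
  case True
  interpret hbundle B by unfold_locales fact
  have e: "fst c = {}" if "c \<in> atlas B" for c using in_topspace[OF that] True by auto
  have "continuous_map (base B) euclideanreal (\<lambda>x. 0)" by simp
  moreover have "positive_metric B P t h" for h by (auto simp: positive_metric_def cdom_def e)
  moreover have "system_elliptic B P s \<sigma> t \<Omega> b F G h" for b F G h by (auto simp: system_elliptic_def e)
  ultimately show ?thesis
    using True e by (intro exI[of _ "\<lambda>_ _. 0"]) (auto simp: holds_C2_near_def intro!: exI[of _ "{}"] exI[of _ 1])
next
  case False
  interpret hbundle B by unfold_locales fact
  note us = assms(8)
  have cpt: "compact_space (base B)" using assms(1) by (simp add: projective_manifold_def)
  \<comment> \<open>The inequality does not mention the metric, so the one metric assumed to exist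
    settles it for all others.\<close>
  have rt: "1 + real CARD('r) * t > 0"
    using twist_bound[OF cpt _ assms(3)] smooth_imp_C2 assms(4) False by blast
  show ?thesis
  proof (intro exI[of _ "dist_fun P s \<sigma> t"] conjI allI impI ballI; (elim conjE)?)
    fix h assume h: "smooth_metric B h" "positive_metric B P t h"
    note * = dist_fun[OF us rt smooth_imp_C2[OF h(1)] h(2), where s=s]
    show "continuous_map (base B) euclideanreal (dist_fun P s \<sigma> t h)" by (rule *(4))
    show "dist_fun P s \<sigma> t h x \<ge> 0" if "x \<in> topspace (base B)" for x by (rule *(3)[OF that])
    show "dist_fun P s \<sigma> t h x = distortion P s \<sigma> t (gram B h c \<tau>) (snd c x)"
      if "c \<in> atlas B" "\<tau> \<in> trivs B" "x \<in> fst c \<inter> fst \<tau>" for c \<tau> x by (rule *(2)[OF that])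
  next
    fix h b assume h: "smooth_metric B h" "positive_metric B P t h" and b: "b > (SUP x\<in>topspace (base B). dist_fun P s \<sigma> t h x)"
    note C2 = smooth_imp_C2[OF h(1)]
    have near: "posp P t (gram B h c \<tau> z) (chern (gram B h c \<tau>) z) \<and> distp P s \<sigma> t (gram B h c \<tau> z) (chern (gram B h c \<tau>) z) < b"
      if c: "c \<in> atlas B" "\<tau> \<in> trivs B" "z \<in> cdom c \<tau>" for c \<tau> z
    proof -
      obtain x where x: "x \<in> fst c \<inter> fst \<tau>" "z = snd c x" using c(3) by (auto simp: cdom_def)
      have "dist_fun P s \<sigma> t h x \<le> (SUP x\<in>topspace (base B). dist_fun P s \<sigma> t h x)"
        by (rule dist_fun_le_SUP[OF cpt us rt C2 h(2)]) (use in_topspace[OF c(1)] x in auto)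
      then have "distp P s \<sigma> t (gram B h c \<tau> z) (chern (gram B h c \<tau>) z) < b"
        using b unfolding x(2) dist_fun(1)[OF us rt C2 h(2) c(1,2) x(1)] by linarith
      then show ?thesis using positive_metric_iff[THEN iffD1, OF h(2), rule_format, OF c] by blast
    qed
    have mono: "holds_C2_near B h Q'" if "holds_C2_near B h Q" "\<And>h'. Q h' \<Longrightarrow> Q' h'" for Q Q'
      using that unfolding holds_C2_near_def by meson
    show "holds_C2_near B h (\<lambda>h. positive_metric B P t h \<and>
         (\<forall>F G. first_order_rhs_scalar B F \<and> first_order_rhs_endo B G \<longrightarrow> system_elliptic B P s \<sigma> t \<Omega> b F G h))"
    proof (rule mono[OF C2_neighbourhood[OF cpt us rt C2 near]], assumption+, elim conjE, intro conjI allI impI; (elim conjE)?)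
      fix h' assume h': "C2_metric B h'" "\<forall>c\<in>atlas B. \<forall>\<tau>\<in>trivs B. \<forall>z\<in>cdom c \<tau>.
        posp P t (gram B h' c \<tau> z) (chern (gram B h' c \<tau>) z) \<and> distp P s \<sigma> t (gram B h' c \<tau> z) (chern (gram B h' c \<tau>) z) < b"
      show "positive_metric B P t h'" unfolding positive_metric_iff using h'(2) by blast
      fix F G assume "first_order_rhs_scalar B F" "first_order_rhs_endo B G"
      then show "system_elliptic B P s \<sigma> t \<Omega> b F G h'"
        by (intro elliptic[OF cpt us assms(6) rt assms(5) h'(1) h'(2)[rule_format]])
    qed
  qed
qed

end
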